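(* Assume $a>0$ is a given constant such that $a<1/\lambda_{max}$, where $\lambda_{max}$ is the maximal eigenvalue of $\boldsymbol{Q}_{33}^{-1}\boldsymbol{A}_{33}$. Consider the half-space system $$\boldsymbol{A}\frac{\mathrm{d}W}{\mathrm{d}y}=-\boldsymbol{Q}W+h,\quad W=W(y),\ y\in[0,+\infty),\qquad W(+\infty)=0,$$ with the boundary condition $$\boldsymbol{B}\boldsymbol{V}_3^TW(0)=g,$$ where $\boldsymbol{B}\in\mathbb{R}^{n_+\times(n_++n_0+n_-)}$ and $g\in\mathbb{R}^{n_+}$ are given, with constant coefficients. For any $h$ with $\|h\|_a<+\infty$ and $g$ with $\|g\|<+\infty$, the system has a unique solution and there exists a positive constant $C_{a,M}$ independent of the non-homogeneous term $h$ such that the estimate $$\|W\|_a\le C_{a,M}\left(\|h\|_a+\|g\|\right)$$ holds, if and only if the boundary condition satisfies the following conditions: 1. $\mathrm{rank}(\boldsymbol{B}\boldsymbol{T}_+)=n_+$. 2. $\boldsymbol{B}\boldsymbol{T}_0=\boldsymbol{0}$. What's more, the analytical expressions of the solution are given as follows. The value of $\boldsymbol{V}_2^TW$ is uniquely determined by $$\boldsymbol{G}^T\boldsymbol{A}W(y)=-\int_y^{+\infty}\boldsymbol{G}^Th(s)\,\mathrm{d}s .$$ The component $\boldsymbol{V}_3^TW$ is $$\boldsymbol{V}_3^TW=\boldsymbol{T}_+z_++\boldsymbol{T}_0z_0+\boldsymbol{T}_-z_-,$$ where, with $$h_3=\boldsymbol{Q}_{33}^{-1}\Big(\boldsymbol{V}_3^Th-\boldsymbol{Q}_{32}\boldsymbol{V}_2^TW-\boldsymbol{A}_{32}\frac{\mathrm{d}\boldsymbol{V}_2^TW}{\mathrm{d}y}\Big)$$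 and $\boldsymbol{T}^{-1}h_3=[h_+^T,h_0^T,h_-^T]^T$ (blocks with $n_+,n_0,n_-$ rows), $$z_0(y)=h_0(y),\qquad z_-(y)=-\boldsymbol{\Lambda}_-^{-1}\int_y^{+\infty}\exp(\boldsymbol{\Lambda}_-^{-1}(s-y))h_-(s)\,\mathrm{d}s,$$ $$z_+(y)=\exp(-\boldsymbol{\Lambda}_+^{-1}y)z_+(0)+\boldsymbol{\Lambda}_+^{-1}\int_0^y\exp(\boldsymbol{\Lambda}_+^{-1}(s-y))h_+(s)\,\mathrm{d}s,$$ with $z_+(0)\in\mathbb{R}^{n_+}$ prescribed by the boundary condition through $\boldsymbol{B}\boldsymbol{T}_+z_+(0)=g-\boldsymbol{B}(\boldsymbol{T}_0z_0(0)+\boldsymbol{T}_-z_-(0))$. The component $\boldsymbol{V}_1^TW$ is $$\boldsymbol{V}_1^TW(y)=-\boldsymbol{A}_{21}^{-1}\left(\boldsymbol{A}_{22}\boldsymbol{V}_2^TW(y)+\boldsymbol{A}_{23}\boldsymbol{V}_3^TW(y)\right)+\int_y^{+\infty}\boldsymbol{A}_{21}^{-1}\left(\boldsymbol{Q}_{22}\boldsymbol{V}_2^TW(s)+\boldsymbol{Q}_{23}\boldsymbol{V}_3^TW(s)-\boldsymbol{U}_2^Th(s)\right)\mathrm{d}s .$$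
   Context: Let $M\ge2$ be an integer and $N=\#\{\boldsymbol{\alpha}\in\mathbb{N}^3:\ |\boldsymbol{\alpha}|\le M\}$ (with $0\in\mathbb{N}$). The matrices $\boldsymbol{A},\boldsymbol{Q}\in\mathbb{R}^{N\times N}$ are constant, $\boldsymbol{A}$ is symmetric, $\boldsymbol{Q}$ is symmetric positive semi-definite, and it is assumed that $\mathrm{Null}(\boldsymbol{A})\cap\mathrm{Null}(\boldsymbol{Q})=\{0\}$; the half-space system is the abstract form of the $M$-th order linear steady Grad moment equations, with unknown $W(y)\in\mathbb{R}^N$ and given non-homogeneous term $h=h(y)\in\mathbb{R}^N$. Throughout, $e^{ay}W(y)$ and $e^{ay}h(y)$ are assumed to be square integrable on $[0,+\infty)$. Let $p=\dim\mathrm{Null}(\boldsymbol{Q})$ and let $\boldsymbol{G}\in\mathbb{R}^{N\times p}$ be an orthonormal basis matrix of $\mathrm{Null}(\boldsymbol{Q})$. Let $r=\dim\mathrm{Null}(\boldsymbol{G}^T\boldsymbol{A}\boldsymbol{G})$ and let $\boldsymbol{X}\in\mathbb{R}^{p\times r}$ be an orthonormal basis matrix of $\mathrm{Null}(\boldsymbol{G}^T\boldsymbol{A}\boldsymbol{G})$. Put $\boldsymbol{V}_1=\boldsymbol{G}\boldsymbol{X}\in\mathbb{R}^{N\times r}$; let $\boldsymbol{V}_2\in\mathbb{R}^{N\times p}$ be obtained by Gram-Schmidt orthogonalization of $\boldsymbol{A}\boldsymbol{G}$ (which has rank $p$), so its orthonormal columns span the column space of $\boldsymbol{A}\boldsymbol{G}$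 and $\boldsymbol{V}_2^T\boldsymbol{V}_1=\boldsymbol{0}$; let $\boldsymbol{V}_3\in\mathbb{R}^{N\times(N-p-r)}$ be the orthogonal complement of $[\boldsymbol{V}_1,\boldsymbol{V}_2]$, so that $\boldsymbol{V}=[\boldsymbol{V}_1,\boldsymbol{V}_2,\boldsymbol{V}_3]$ is orthogonal. Put $\boldsymbol{U}_1=\boldsymbol{G}$, $\boldsymbol{U}_2=\boldsymbol{A}\boldsymbol{G}\boldsymbol{X}$, $\boldsymbol{U}_3=\boldsymbol{V}_3$, and $\boldsymbol{A}_{ij}=\boldsymbol{U}_i^T\boldsymbol{A}\boldsymbol{V}_j$, $\boldsymbol{Q}_{ij}=\boldsymbol{U}_i^T\boldsymbol{Q}\boldsymbol{V}_j$. Then $\boldsymbol{A}_{33}$ is symmetric, $\boldsymbol{Q}_{33}$ is symmetric positive definite and $\boldsymbol{A}_{21}$ is invertible. Let $\boldsymbol{Q}_{33}=\boldsymbol{L}\boldsymbol{L}^T$ be the Cholesky decomposition and $\boldsymbol{L}^{-1}\boldsymbol{A}_{33}\boldsymbol{L}^{-T}\boldsymbol{R}=\boldsymbol{R}\boldsymbol{\Lambda}$ an orthogonal eigenvalue decomposition, with $\boldsymbol{R}$ orthogonal and $\boldsymbol{\Lambda}=\mathrm{diag}(\boldsymbol{\Lambda}_+,\boldsymbol{0},\boldsymbol{\Lambda}_-)$ diagonal, where $\boldsymbol{\Lambda}_+\in\mathbb{R}^{n_+\times n_+}$ has positive diagonal entries, the zero block is $n_0\times n_0$, and $\boldsymbol{\Lambda}_-\in\mathbb{R}^{n_-\times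 n_-}$ has negative diagonal entries; $n_+,n_0,n_-$ are the numbers of positive, zero and negative eigenvalues of $\boldsymbol{A}_{33}$. Put $\boldsymbol{T}=\boldsymbol{L}^{-T}\boldsymbol{R}=[\boldsymbol{T}_+,\boldsymbol{T}_0,\boldsymbol{T}_-]$ (column blocks with $n_+,n_0,n_-$ columns); $\boldsymbol{T}$ is invertible and $\boldsymbol{Q}_{33}^{-1}\boldsymbol{A}_{33}\boldsymbol{T}=\boldsymbol{T}\boldsymbol{\Lambda}$. Norms: $\|h\|_a=\left(\int_0^{+\infty}e^{2ay}h^T(y)h(y)\,\mathrm{d}y\right)^{1/2}$ for vector-valued functions on $[0,+\infty)$, and $\|g\|=\sqrt{g^Tg}$ for vectors.
   Formalization: As h with finite norm need not be smooth or decay, solutions are weak: AW is absolutely continuous with derivative A dW/dy, the equation holds at every y, and W(+∞)=0 is read as AW(y)→0, with W(y)→0 in full whenever h(y)→0. *)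

theory Defs
  imports
    "HOL-Analysis.Equivalence_Lebesgue_Henstock_Integration"
    "Jordan_Normal_Form.Matrix_Kernel"
    "Jordan_Normal_Form.Gauss_Jordan_Elimination"
    "Jordan_Normal_Form.DL_Rank"
    "Jordan_Normal_Form.Char_Poly"
begin

no_notation inner (infix \<open>\<bullet>\<close> 70)
no_notation Finite_Cartesian_Product.vec_nth (infixl \<open>$\<close> 90)

text \<open>Matrices are those of Jordan_Normal_Form, whose dimensions are natural numbers that may be
  zero: every block below (a null space, a spectral part) is allowed to be empty.\<close>

definition symmetric_real_mat :: "nat \<Rightarrow> real mat \<Rightarrow> bool" where
  "symmetric_real_mat n A \<longleftrightarrow> A \<in> carrier_mat n n \<and> transpose_mat A = A"

definition pos_semidef_mat :: "nat \<Rightarrow> real mat \<Rightarrow> bool" where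
  "pos_semidef_mat n A \<longleftrightarrow>
     symmetric_real_mat n A \<and> (\<forall>v\<in>carrier_vec n. 0 \<le> v \<bullet> (A *\<^sub>v v))"

text \<open>The library's \<open>orthogonal_mat\<close> only asks for pairwise orthogonal nonzero columns.\<close>

definition orthonormal_mat :: "nat \<Rightarrow> real mat \<Rightarrow> bool" where
  "orthonormal_mat n A \<longleftrightarrow> A \<in> carrier_mat n n \<and> transpose_mat A * A = 1\<^sub>m n"

definition orthonormal_basis_mat :: "nat \<Rightarrow> nat \<Rightarrow> real Matrix.vec set \<Rightarrow> real mat \<Rightarrow> bool" where
  "orthonormal_basis_mat n k S A \<longleftrightarrow>
     A \<in> carrier_mat n k \<and> transpose_mat A * A = 1\<^sub>m k \<and> vec_space.col_space n A = S"

definition append_cols :: "real mat \<Rightarrow> real mat \<Rightarrow> real mat" (infixr \<open>@\<^sub>c\<close> 65) where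
  "A @\<^sub>c B = mat (dim_row A) (dim_col A + dim_col B)
     (\<lambda>(i, j). if j < dim_col A then A $$ (i, j) else B $$ (i, j - dim_col A))"

text \<open>\<open>mat_inv A\<close> is the inverse of an invertible square matrix, and unspecified otherwise.\<close>

definition mat_inv :: "real mat \<Rightarrow> real mat" where
  "mat_inv A = the (mat_inverse A)"

definition mat_exp :: "real mat \<Rightarrow> real mat" where
  "mat_exp A = mat (dim_row A) (dim_row A) (\<lambda>(i, j). \<Sum>k. (A ^\<^sub>m k) $$ (i, j) / fact k)"

definition cholesky :: "nat \<Rightarrow> real mat \<Rightarrow> real mat \<Rightarrow> bool" where
  "cholesky n A L \<longleftrightarrow>
     L \<in> carrier_mat n n \<and> upper_triangular (transpose_mat L) \<and> (\<forall>i<n. 0 < L $$ (i, i)) \<and>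
     A = L * transpose_mat L"

definition is_max_eigenvalue :: "real mat \<Rightarrow> real \<Rightarrow> bool" where
  "is_max_eigenvalue A l \<longleftrightarrow> eigenvalue A l \<and> (\<forall>k. eigenvalue A k \<longrightarrow> k \<le> l)"

definition vec_norm2 :: "real Matrix.vec \<Rightarrow> real" where
  "vec_norm2 v = sqrt (v \<bullet> v)"

definition vec_integrable :: "nat \<Rightarrow> real set \<Rightarrow> (real \<Rightarrow> real Matrix.vec) \<Rightarrow> bool" where
  "vec_integrable n S f \<longleftrightarrow> (\<forall>i<n. integrable (lebesgue_on S) (\<lambda>s. f s $ i))"

definition vec_integral :: "nat \<Rightarrow> real set \<Rightarrow> (real \<Rightarrow> real Matrix.vec) \<Rightarrow> real Matrix.vec" where
  "vec_integral n S f = Matrix.vec n (\<lambda>i. \<integral>s. f s $ i \<partial>lebesgue_on S)"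

definition weighted_L2 :: "real \<Rightarrow> nat \<Rightarrow> (real \<Rightarrow> real Matrix.vec) \<Rightarrow> bool" where
  "weighted_L2 a n f \<longleftrightarrow>
     (\<forall>y\<ge>0. f y \<in> carrier_vec n) \<and>
     (\<forall>i<n. (\<lambda>y. f y $ i) \<in> borel_measurable (lebesgue_on {0..})) \<and>
     integrable (lebesgue_on {0..}) (\<lambda>y. exp (2 * a * y) * (f y \<bullet> f y))"

definition weighted_norm :: "real \<Rightarrow> (real \<Rightarrow> real Matrix.vec) \<Rightarrow> real" where
  "weighted_norm a f = sqrt (\<integral>y. exp (2 * a * y) * (f y \<bullet> f y) \<partial>lebesgue_on {0..})"

definition tends_to_zero :: "nat \<Rightarrow> (real \<Rightarrow> real Matrix.vec) \<Rightarrow> bool" where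
  "tends_to_zero n f \<longleftrightarrow> (\<forall>i<n. ((\<lambda>y. f y $ i) \<longlongrightarrow> 0) at_top)"

text \<open>\<open>D\<close> is a (locally integrable) derivative of the absolutely continuous function \<open>F\<close>
  on \<open>[0, \<infinity>)\<close>.\<close>

definition has_weak_derivative ::
    "nat \<Rightarrow> (real \<Rightarrow> real Matrix.vec) \<Rightarrow> (real \<Rightarrow> real Matrix.vec) \<Rightarrow> bool" where
  "has_weak_derivative n F D \<longleftrightarrow>
     (\<forall>y\<ge>0. F y \<in> carrier_vec n \<and> D y \<in> carrier_vec n \<and>
        vec_integrable n {0..y} D \<and> F y = F 0 + vec_integral n {0..y} D)"

text \<open>The equation \<open>A W' = - Q W + h\<close> with \<open>W(+\<infinity>) = 0\<close>, for merely square integrable \<open>h\<close> and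
  possibly singular \<open>A\<close>. Here \<open>D\<close> plays the role of \<open>W'\<close>. Only the part of \<open>W\<close> seen through \<open>A\<close>
  carries a derivative, so \<open>D\<close> is tied to \<open>W\<close> by \<open>A D\<close> being the derivative of the absolutely
  continuous function \<open>A W\<close>. The equation holds at every \<open>y \<ge> 0\<close>, not just almost everywhere:
  its components in the null space of \<open>A\<close> are algebraic constraints between \<open>W(y)\<close> and
  \<open>h(y)\<close>, and they give a meaning to the value \<open>W(0)\<close> in the boundary condition.

  The same components make a part of \<open>W(y)\<close> equal to a pointwise function of \<open>h(y)\<close>, and a square
  integrable (even continuous) \<open>h\<close> need not have a limit at infinity. Hence the condition
  \<open>W(+\<infinity>) = 0\<close> is imposed on \<open>A W\<close> in all cases, and on the whole of \<open>W\<close> when \<open>h\<close> itself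
  vanishes at infinity.\<close>

definition half_space_solution ::
    "nat \<Rightarrow> real mat \<Rightarrow> real mat \<Rightarrow> (real \<Rightarrow> real Matrix.vec) \<Rightarrow>
     (real \<Rightarrow> real Matrix.vec) \<Rightarrow> (real \<Rightarrow> real Matrix.vec) \<Rightarrow> bool" where
  "half_space_solution n A Q h W D \<longleftrightarrow>
     (\<forall>y\<ge>0. W y \<in> carrier_vec n \<and> D y \<in> carrier_vec n \<and>
        A *\<^sub>v D y = - (Q *\<^sub>v W y) + h y) \<and>
     has_weak_derivative n (\<lambda>y. A *\<^sub>v W y) (\<lambda>y. A *\<^sub>v D y) \<and>
     tends_to_zero n (\<lambda>y. A *\<^sub>v W y) \<and>
     (tends_to_zero n h \<longrightarrow> tends_to_zero n W)"

text \<open>\<open>C\<close> is the matrix of the boundary condition \<open>C W(0) = g\<close>; square integrability of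
  \<open>exp(a y) W(y)\<close> is part of being a solution.\<close>

definition solves_bvp ::
    "real \<Rightarrow> nat \<Rightarrow> real mat \<Rightarrow> real mat \<Rightarrow> real mat \<Rightarrow> (real \<Rightarrow> real Matrix.vec) \<Rightarrow>
     real Matrix.vec \<Rightarrow> (real \<Rightarrow> real Matrix.vec) \<Rightarrow> (real \<Rightarrow> real Matrix.vec) \<Rightarrow> bool" where
  "solves_bvp a n A Q C h g W D \<longleftrightarrow>
     weighted_L2 a n W \<and> half_space_solution n A Q h W D \<and> C *\<^sub>v W 0 = g"

text \<open>Functions are only relevant on \<open>[0, \<infinity>)\<close>, so uniqueness is equality there. The constant
  is chosen before the data \<open>h\<close> and \<open>g\<close>.\<close>

definition well_posed ::
    "real \<Rightarrow> nat \<Rightarrow> nat \<Rightarrow> real mat \<Rightarrow> real mat \<Rightarrow> real mat \<Rightarrow> bool" where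
  "well_posed a n k A Q C \<longleftrightarrow>
     (\<exists>K>0. \<forall>h g. weighted_L2 a n h \<longrightarrow> g \<in> carrier_vec k \<longrightarrow>
        (\<exists>W. (\<exists>D. solves_bvp a n A Q C h g W D) \<and>
             (\<forall>W' D'. solves_bvp a n A Q C h g W' D' \<longrightarrow> (\<forall>y\<ge>0. W' y = W y)) \<and>
             weighted_norm a W \<le> K * (weighted_norm a h + vec_norm2 g)))"

end

theory Submission
  imports Defs "HOL-Analysis.Set_Integral"
begin

text \<open>Testing \<open>A W' = - Q W + h\<close> with \<open>G\<close>, \<open>U\<^sub>2\<close> and \<open>T\<^sup>T V\<^sub>3\<^sup>T\<close> makes the system triangular
  in \<open>V\<^sub>2\<^sup>T W\<close>, \<open>z = T\<^sup>-\<^sup>1 V\<^sub>3\<^sup>T W\<close>, \<open>V\<^sub>1\<^sup>T W\<close>. The first part is a tail integral of the data, the last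
  one a tail integral plus a linear function of the others, and each component of \<open>z\<close> satisfies a
  scalar equation \<open>\<lambda> z\<^sub>i' = f\<^sub>i - z\<^sub>i\<close>: for \<open>\<lambda> > 0\<close> it is determined by \<open>z\<^sub>i(0)\<close>, for \<open>\<lambda> < 0\<close> by decay,
  and for \<open>\<lambda> = 0\<close> it reads \<open>z\<^sub>i = f\<^sub>i\<close>. The bounds in the weighted norm come from an energy estimate,
  the condition \<open>a < 1 / \<lambda>\<close> giving the damping of the components with \<open>\<lambda> > 0\<close>. The boundary condition
  has to determine exactly \<open>z\<^sub>+(0)\<close>, so \<open>B T\<^sub>+\<close> must be invertible. If \<open>B T\<^sub>0\<close> did not vanish, a change of
  \<open>h\<close> at the single point \<open>0\<close>, invisible in the norm, would change \<open>z\<^sub>+(0)\<close> and violate the estimate.\<close>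

section \<open>Integrals and weak derivatives on the half-line\<close>

text \<open>The obstacle is low regularity: \<open>h\<close> is merely square integrable and
  \<open>A\<close> may be singular, so \<open>W\<close> need not be differentiable and only
  \<open>A W\<close> is absolutely continuous. Every derivative is taken of a linear image of
  \<open>A W\<close>, and components of \<open>W\<close> are recovered afterwards through the
  inverses of \<open>G^T A V2\<close>, of \<open>A21\<close> and of the nonzero eigenvalues.
  Triangularity comes from the choice of blocks: the columns of \<open>A G\<close> lie in the span
  of \<open>V2\<close>, hence are orthogonal to \<open>V3\<close>, while
  \<open>G^T A G X = 0\<close> and \<open>Q G = 0\<close>. The matrix \<open>T = L^(-T) R\<close>
  satisfies \<open>T^T Q33 T = I\<close> and \<open>T^T A33 T = Lam\<close>, so
  \<open>T^(-1) = T^T Q33\<close> and \<open>T^(-1) Q33^(-1) = T^T\<close>; this is why testing with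
  \<open>T^T V3^T\<close> produces \<open>T^(-1) h3\<close>. The weight is absorbed into
  \<open>u = exp(a y) F\<close>, with \<open>u' = k u + v\<close>. For negative eigenvalues and for
  tail integrals \<open>k\<close> is positive; there a pointwise bound on \<open>u\<close>, obtained
  from Young's inequality, takes the place of damping. Integrating factors and squares both need the
  product rule for absolutely continuous functions, which is Fubini's theorem on a square.\<close>

lemma integrable_lebesgue_on_subset:
  fixes f :: "real \<Rightarrow> real"
  assumes "integrable (lebesgue_on S) f" "T \<subseteq> S" "S \<in> sets lebesgue" "T \<in> sets lebesgue"
  shows "integrable (lebesgue_on T) f"
  using assms set_integrable_subset[of lebesgue S f T]
  by (auto simp: set_integrable_def integrable_restrict_space)

text \<open>A negligible overlap is allowed because the closed intervals used later share an
  endpoint.\<close>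

lemma integral_lebesgue_on_Un:
  fixes f :: "real \<Rightarrow> real"
  assumes "integrable (lebesgue_on (S \<union> T)) f" "S \<in> sets lebesgue" "T \<in> sets lebesgue"
    "negligible (S \<inter> T)"
  shows "integral\<^sup>L (lebesgue_on (S \<union> T)) f = integral\<^sup>L (lebesgue_on S) f + integral\<^sup>L (lebesgue_on T) f"
proof -
  have ST: "S \<union> T \<in> sets lebesgue" using assms by auto
  have i: "integrable (lebesgue_on S) f" "integrable (lebesgue_on T) f"
    using integrable_lebesgue_on_subset[OF assms(1) _ ST] assms by auto
  have si: "set_integrable lebesgue S f" "set_integrable lebesgue T f"
    using i assms by (auto simp: set_integrable_def integrable_restrict_space)
  have n: "S \<inter> T \<in> null_sets lebesgue"
    using assms(4) negligible_iff_null_sets by blast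
  have "AE x in lebesgue. \<not> (x \<in> S \<and> x \<in> T)"
    using AE_not_in[OF n] by simp
  then have "(LINT x:S \<union> T|lebesgue. f x) = (LINT x:S|lebesgue. f x) + (LINT x:T|lebesgue. f x)"
    using set_integral_Un_AE[of S T lebesgue f] assms si by simp
  then show ?thesis
    using assms ST by (simp add: set_lebesgue_integral_def integral_restrict_space)
qed

lemma integral_lebesgue_on_split:
  fixes f :: "real \<Rightarrow> real"
  assumes "x \<le> y"
  shows "y \<le> z \<Longrightarrow> integrable (lebesgue_on {x..z}) f \<Longrightarrow>
      (\<integral>s. f s \<partial>lebesgue_on {x..z}) = (\<integral>s. f s \<partial>lebesgue_on {x..y}) + (\<integral>s. f s \<partial>lebesgue_on {y..z})"
    and "integrable (lebesgue_on {x..}) f \<Longrightarrow>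
      (\<integral>s. f s \<partial>lebesgue_on {x..}) = (\<integral>s. f s \<partial>lebesgue_on {x..y}) + (\<integral>s. f s \<partial>lebesgue_on {y..})"
proof -
  have n: "negligible ({x..y} \<inter> {y..z})" for z
    by (rule negligible_subset[of "{y}"]) auto
  have n': "negligible ({x..y} \<inter> {y..})"
    by (rule negligible_subset[of "{y}"]) auto
  have u: "{x..y} \<union> {y..} = {x..}" using assms by auto
  show "y \<le> z \<Longrightarrow> integrable (lebesgue_on {x..z}) f \<Longrightarrow>
      (\<integral>s. f s \<partial>lebesgue_on {x..z}) = (\<integral>s. f s \<partial>lebesgue_on {x..y}) + (\<integral>s. f s \<partial>lebesgue_on {y..z})"
    using integral_lebesgue_on_Un[of "{x..y}" "{y..z}" f] n assms by (simp add: ivl_disj_un)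
  show "integrable (lebesgue_on {x..}) f \<Longrightarrow>
      (\<integral>s. f s \<partial>lebesgue_on {x..}) = (\<integral>s. f s \<partial>lebesgue_on {x..y}) + (\<integral>s. f s \<partial>lebesgue_on {y..})"
    using integral_lebesgue_on_Un[of "{x..y}" "{y..}" f] n' u by simp
qed

text \<open>Dominated convergence, with \<open>f\<close> restricted to the half-line as dominating
  function: at a fixed point the truncated integrand is constant as soon as \<open>y\<close> has
  passed it. The second limit is the complement of the first.\<close>

lemma tendsto_integral_lebesgue_on_at_top:
  fixes f :: "real \<Rightarrow> real"
  assumes "integrable (lebesgue_on {0..}) f"
  shows "((\<lambda>y. \<integral>s. f s \<partial>lebesgue_on {0..y}) \<longlongrightarrow> (\<integral>s. f s \<partial>lebesgue_on {0..})) at_top"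
    and "((\<lambda>y. \<integral>s. f s \<partial>lebesgue_on {y..}) \<longlongrightarrow> 0) at_top"
proof -
  let ?g = "\<lambda>x. indicator {0..} x *\<^sub>R f x"
  have g: "integrable lebesgue ?g"
    using assms by (simp add: integrable_restrict_space)
  have "((\<lambda>y. \<integral>x. indicator {0..y} x *\<^sub>R f x \<partial>lebesgue) \<longlongrightarrow> (\<integral>x. ?g x \<partial>lebesgue)) at_top"
  proof (rule integral_dominated_convergence_at_top)
    show "?g \<in> borel_measurable lebesgue" using g by auto
    show "(\<lambda>x. indicator {0..y} x *\<^sub>R f x) \<in> borel_measurable lebesgue" for y
    proof -
      have "(\<lambda>x. indicator {0..y} x *\<^sub>R f x) = (\<lambda>x. indicator {0..y} x * ?g x)"
        by (auto split: split_indicator)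
      moreover have "?g \<in> borel_measurable lebesgue" using g by auto
      ultimately show ?thesis by (simp only:) (intro borel_measurable_times borel_measurable_indicator; simp)
    qed
    show "integrable lebesgue (\<lambda>x. norm (?g x))" using g by (rule integrable_norm)
    show "\<forall>\<^sub>F i in at_top. AE x in lebesgue. norm (indicator {0..i} x *\<^sub>R f x) \<le> norm (?g x)"
      by (auto split: split_indicator intro!: always_eventually)
    show "AE x in lebesgue. ((\<lambda>i. indicator {0..i} x *\<^sub>R f x) \<longlongrightarrow> ?g x) at_top"
    proof (rule AE_I2)
      fix x :: real
      have "\<forall>\<^sub>F i in at_top. indicator {0..i} x *\<^sub>R f x = ?g x"
        using eventually_ge_at_top[of x] by eventually_elim (auto split: split_indicator)
      then show "((\<lambda>i. indicator {0..i} x *\<^sub>R f x) \<longlongrightarrow> ?g x) at_top"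
        by (rule tendsto_eventually)
    qed
  qed
  then show *: "((\<lambda>y. \<integral>s. f s \<partial>lebesgue_on {0..y}) \<longlongrightarrow> (\<integral>s. f s \<partial>lebesgue_on {0..})) at_top"
    by (simp add: integral_restrict_space)
  have "((\<lambda>y. (\<integral>s. f s \<partial>lebesgue_on {0..}) - (\<integral>s. f s \<partial>lebesgue_on {0..y})) \<longlongrightarrow> 0) at_top"
    using tendsto_diff[OF tendsto_const *, of "\<integral>s. f s \<partial>lebesgue_on {0..}"] by simp
  moreover have "\<forall>\<^sub>F y in at_top. (\<integral>s. f s \<partial>lebesgue_on {0..}) - (\<integral>s. f s \<partial>lebesgue_on {0..y})
      = (\<integral>s. f s \<partial>lebesgue_on {y..})"
    using eventually_ge_at_top[of 0]
    by eventually_elim (use integral_lebesgue_on_split(2)[OF _ assms] in simp)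
  ultimately show "((\<lambda>y. \<integral>s. f s \<partial>lebesgue_on {y..}) \<longlongrightarrow> 0) at_top"
    by (rule Lim_transform_eventually)
qed

text \<open>Monotone convergence along integer endpoints. It turns bounds on \<open>{0..y}\<close>
  that are uniform in \<open>y\<close>, as energy estimates produce them, into integrability on the
  half-line.\<close>

lemma integrable_lebesgue_on_atLeast:
  fixes f :: "real \<Rightarrow> real"
  assumes f: "f \<in> borel_measurable (lebesgue_on {0..})" "\<And>x. 0 \<le> x \<Longrightarrow> 0 \<le> f x"
    and i: "\<And>y. 0 \<le> y \<Longrightarrow> integrable (lebesgue_on {0..y}) f"
    and b: "\<And>y. 0 \<le> y \<Longrightarrow> (\<integral>s. f s \<partial>lebesgue_on {0..y}) \<le> C"
  shows "integrable (lebesgue_on {0..}) f" "(\<integral>s. f s \<partial>lebesgue_on {0..}) \<le> C"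
proof -
  let ?I = "\<lambda>n::nat. LINT x:{0..real n}|lebesgue. f x"
  have eq: "?I n = (\<integral>s. f s \<partial>lebesgue_on {0..real n})" for n
    by (simp add: set_lebesgue_integral_def integral_restrict_space)
  have mono: "incseq ?I"
  proof (rule monoI)
    fix k l :: nat assume "k \<le> l"
    have "0 \<le> (\<integral>s. f s \<partial>lebesgue_on {real k..real l})"
      by (rule integral_nonneg_AE) (auto intro!: AE_I2 f)
    then show "?I k \<le> ?I l"
      unfolding eq using integral_lebesgue_on_split(1)[of 0 "real k" "real l" f] i \<open>k \<le> l\<close> by simp
  qed
  obtain l where l: "?I \<longlonglongrightarrow> l"
  proof (rule incseq_convergent[OF mono])
    show "\<forall>i. ?I i \<le> C" unfolding eq by (auto intro: b)
  qed
  have "set_integrable lebesgue (\<Union>n::nat. {0..real n}) f"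
    using l i by (intro pos_integrable_to_top)
      (auto simp: mono_def f set_integrable_def integrable_restrict_space)
  moreover have "(\<Union>n::nat. {0..real n}) = {0..}"
    by (auto intro: real_arch_simple)
  ultimately show int: "integrable (lebesgue_on {0..}) f"
    by (simp add: set_integrable_def integrable_restrict_space)
  show "(\<integral>s. f s \<partial>lebesgue_on {0..}) \<le> C"
  proof (rule tendsto_upperbound[OF tendsto_integral_lebesgue_on_at_top(1)[OF int]])
    show "\<forall>\<^sub>F y in at_top. (\<integral>s. f s \<partial>lebesgue_on {0..y}) \<le> C"
      using eventually_ge_at_top[of 0] by eventually_elim (rule b)
  qed simp
qed

text \<open>The scalar counterpart of \<open>has_weak_derivative\<close>. Absolute continuity is
  encoded by the integral identity based at 0 and not by differentiability, because \<open>D\<close>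
  is only locally integrable.\<close>

definition weak_deriv :: "(real \<Rightarrow> real) \<Rightarrow> (real \<Rightarrow> real) \<Rightarrow> bool" where
  "weak_deriv F D \<longleftrightarrow> (\<forall>y\<ge>0. integrable (lebesgue_on {0..y}) D \<and>
     F y = F 0 + (\<integral>s. D s \<partial>lebesgue_on {0..y}))"

lemma weak_derivD:
  assumes "weak_deriv F D" "0 \<le> y"
  shows "integrable (lebesgue_on {0..y}) D" "F y = F 0 + (\<integral>s. D s \<partial>lebesgue_on {0..y})"
  using assms unfolding weak_deriv_def by blast+

lemma weak_deriv_cong:
  assumes "\<And>y. 0 \<le> y \<Longrightarrow> F y = F' y" "\<And>y. 0 \<le> y \<Longrightarrow> D y = D' y"
  shows "weak_deriv F D \<longleftrightarrow> weak_deriv F' D'"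
proof -
  have "integrable (lebesgue_on {0..y}) D = integrable (lebesgue_on {0..y}) D'" for y
    by (rule Bochner_Integration.integrable_cong) (auto simp: assms)
  moreover have "(\<integral>s. D s \<partial>lebesgue_on {0..y}) = (\<integral>s. D' s \<partial>lebesgue_on {0..y})" for y
    by (rule Bochner_Integration.integral_cong) (auto simp: assms)
  ultimately show ?thesis unfolding weak_deriv_def by (metis assms(1) order_refl)
qed

lemma weak_deriv_add:
  assumes "weak_deriv F D" "weak_deriv G E"
  shows "weak_deriv (\<lambda>y. F y + G y) (\<lambda>y. D y + E y)"
  unfolding weak_deriv_def
proof (intro allI impI)
  fix y :: real assume y: "0 \<le> y"
  show "integrable (lebesgue_on {0..y}) (\<lambda>y. D y + E y) \<and>
    F y + G y = F 0 + G 0 + (\<integral>s. D s + E s \<partial>lebesgue_on {0..y})"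
    using weak_derivD[OF assms(1) y] weak_derivD[OF assms(2) y] by simp
qed

lemma weak_deriv_cmult:
  assumes "weak_deriv F D"
  shows "weak_deriv (\<lambda>y. c * F y) (\<lambda>y. c * D y)"
  unfolding weak_deriv_def
proof (intro allI impI)
  fix y :: real assume y: "0 \<le> y"
  show "integrable (lebesgue_on {0..y}) (\<lambda>y. c * D y) \<and>
    c * F y = c * F 0 + (\<integral>s. c * D s \<partial>lebesgue_on {0..y})"
    using weak_derivD[OF assms(1) y] by (simp add: algebra_simps)
qed

lemma weak_deriv_const: "weak_deriv (\<lambda>y. c) (\<lambda>y. 0)"
  by (simp add: weak_deriv_def)

lemma weak_deriv_sum:
  assumes "\<And>i. i \<in> I \<Longrightarrow> weak_deriv (F i) (D i)"
  shows "weak_deriv (\<lambda>y. \<Sum>i\<in>I. F i y) (\<lambda>y. \<Sum>i\<in>I. D i y)"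
  using assms
proof (induction I rule: infinite_finite_induct)
  case (insert j J)
  then have "weak_deriv (\<lambda>y. F j y + (\<Sum>i\<in>J. F i y)) (\<lambda>y. D j y + (\<Sum>i\<in>J. D i y))"
    by (intro weak_deriv_add) auto
  with insert show ?case by simp
qed (simp_all add: weak_deriv_const)

lemma weak_deriv_continuous_on:
  assumes "weak_deriv F D"
  shows "continuous_on {0..y} F"
proof (cases "0 \<le> y")
  case True
  have i: "D integrable_on {0..y}"
    using weak_derivD(1)[OF assms True] by (simp add: integrable_on_lebesgue_on)
  have "continuous_on {0..y} (\<lambda>t. F 0 + Henstock_Kurzweil_Integration.integral {0..t} D)"
    by (intro continuous_intros indefinite_integral_continuous_1 i)
  then show ?thesis
  proof (rule continuous_on_eq)
    fix t assume "t \<in> {0..y}"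
    then show "F 0 + Henstock_Kurzweil_Integration.integral {0..t} D = F t"
      using weak_derivD[OF assms, of t] by (simp add: lebesgue_integral_eq_integral)
  qed
qed auto

text \<open>Integration by parts for two primitives vanishing at 0. The two iterated integrals are
  the integrals of \<open>D s * E t\<close> over the triangles below and above the diagonal of the
  square; together they fill the square, and the diagonal is a null set.\<close>

lemma integral_triangle_swap:
  fixes D E :: "real \<Rightarrow> real"
  assumes D: "integrable (lebesgue_on {0..y}) D" and E: "integrable (lebesgue_on {0..y}) E"
  defines "M \<equiv> lebesgue_on {0..y}"
  shows "(\<integral>s. D s * (\<integral>t. E t \<partial>lebesgue_on {0..s}) \<partial>M) + (\<integral>s. E s * (\<integral>t. D t \<partial>lebesgue_on {0..s}) \<partial>M)
    = (\<integral>s. D s \<partial>M) * (\<integral>s. E s \<partial>M)"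
    and "integrable M (\<lambda>s. D s * (\<integral>t. E t \<partial>lebesgue_on {0..s}))"
proof -
  have fin: "finite_measure M"
    unfolding M_def by (rule finite_measure_lebesgue_on) simp
  interpret M: finite_measure M by (rule fin)
  interpret P: pair_sigma_finite M M ..
  have meas: "(\<lambda>x. x) \<in> borel_measurable M"
    using id_borel_measurable_lebesgue_on[of "{0..y}"] by (simp add: M_def id_def)
  have DM: "integrable M D" "integrable M E" using D E by (simp_all add: M_def)
  have le: "(\<lambda>p. indicator {p. snd p \<le> fst p} p :: real) \<in> borel_measurable (M \<Otimes>\<^sub>M M)"
  proof (rule borel_measurable_indicator')
    have f: "fst \<in> borel_measurable (M \<Otimes>\<^sub>M M)"
      using measurable_compose[OF measurable_fst[of M M] meas] by (simp add: comp_def)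
    have s: "snd \<in> borel_measurable (M \<Otimes>\<^sub>M M)"
      using measurable_compose[OF measurable_snd[of M M] meas] by (simp add: comp_def)
    have "{x \<in> space (M \<Otimes>\<^sub>M M). snd x \<le> fst x} \<in> sets (M \<Otimes>\<^sub>M M)"
      by (rule borel_measurable_le[OF s f])
    then show "{x \<in> space (M \<Otimes>\<^sub>M M). x \<in> {p. snd p \<le> fst p}} \<in> sets (M \<Otimes>\<^sub>M M)" by simp
  qed
  \<comment> \<open>Integrability on the product space: the triangular kernel is dominated by the
    product of the absolute values of \<open>F\<close> and \<open>G\<close>, whose inner integral
    does not depend on the outer variable.\<close>
  have int: "integrable (M \<Otimes>\<^sub>M M) (\<lambda>p. F (fst p) * (indicator {p. snd p \<le> fst p} p * G (snd p)))"
    if F: "integrable M F" and G: "integrable M G" for F G :: "real \<Rightarrow> real"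
  proof (rule P.Fubini_integrable)
    have [measurable]: "F \<in> borel_measurable M" "G \<in> borel_measurable M" using F G by auto
    have m[measurable]: "(\<lambda>p. F (fst p) * (indicator {p. snd p \<le> fst p} p * G (snd p))) \<in> borel_measurable (M \<Otimes>\<^sub>M M)"
      using le by simp
    show "(\<lambda>p. F (fst p) * (indicator {p. snd p \<le> fst p} p * G (snd p))) \<in> borel_measurable (M \<Otimes>\<^sub>M M)"
      by (rule m)
    have b: "integrable M (\<lambda>t. F s * (indicator {p. snd p \<le> fst p} (s, t) * G t))" if "s \<in> space M" for s
    proof (rule Bochner_Integration.integrable_bound)
      show "integrable M (\<lambda>t. F s * G t)" using G by simp
      show "(\<lambda>t. F s * (indicator {p. snd p \<le> fst p} (s, t) * G t)) \<in> borel_measurable M"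
        using measurable_compose[OF measurable_Pair1'[OF that, of M] m] by simp
    qed (auto split: split_indicator)
    then show "AE x in M. integrable M (\<lambda>y. F (fst (x, y)) * (indicator {p. snd p \<le> fst p} (x, y) * G (snd (x, y))))"
      by (auto intro: AE_I2)
    show "integrable M (\<lambda>x. \<integral>y. norm (F (fst (x, y)) * (indicator {p. snd p \<le> fst p} (x, y) * G (snd (x, y)))) \<partial>M)"
    proof (rule Bochner_Integration.integrable_bound)
      show "integrable M (\<lambda>x. F x * (\<integral>y. \<bar>G y\<bar> \<partial>M))" using F by simp
      show "(\<lambda>x. \<integral>y. norm (F (fst (x, y)) * (indicator {p. snd p \<le> fst p} (x, y) * G (snd (x, y)))) \<partial>M) \<in> borel_measurable M"
        by (rule M.borel_measurable_lebesgue_integral) (use m in \<open>simp add: case_prod_beta'\<close>)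
      show "AE x in M. norm (\<integral>y. norm (F (fst (x, y)) * (indicator {p. snd p \<le> fst p} (x, y) * G (snd (x, y)))) \<partial>M)
         \<le> norm (F x * (\<integral>y. \<bar>G y\<bar> \<partial>M))"
      proof (rule AE_I2)
        fix s assume s: "s \<in> space M"
        have "(\<integral>y. norm (F s * (indicator {p. snd p \<le> fst p} (s, y) * G y)) \<partial>M) \<le> (\<integral>y. \<bar>F s\<bar> * \<bar>G y\<bar> \<partial>M)"
          by (rule integral_mono[OF integrable_norm[OF b[OF s]]])
            (use G in \<open>auto split: split_indicator simp: abs_mult\<close>)
        moreover have "0 \<le> (\<integral>y. norm (F s * (indicator {p. snd p \<le> fst p} (s, y) * G y)) \<partial>M)"
          by (rule integral_nonneg_AE) auto
        ultimately show "norm (\<integral>y. norm (F (fst (s, y)) * (indicator {p. snd p \<le> fst p} (s, y) * G (snd (s, y)))) \<partial>M)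
         \<le> norm (F s * (\<integral>y. \<bar>G y\<bar> \<partial>M))"
          by (simp add: abs_mult)
      qed
    qed
  qed
  have inner: "(\<integral>t. G t \<partial>lebesgue_on {0..s}) = (\<integral>t. indicator {p. snd p \<le> fst p} (s, t) * G t \<partial>M)"
    if "s \<in> space M" for s and G :: "real \<Rightarrow> real"
  proof -
    have "s \<le> y" "0 \<le> s" using that by (auto simp: M_def)
    then have "(\<lambda>x. indicator {0..s} x *\<^sub>R G x) = (\<lambda>x. indicator {0..y} x *\<^sub>R (indicator {p. snd p \<le> fst p} (s, x) * G x))"
      by (auto split: split_indicator)
    then show ?thesis unfolding M_def by (subst (1 2) integral_restrict_space) (auto simp del: real_scaleR_def)
  qed
  have iter: "(\<integral>s. F s * (\<integral>t. G t \<partial>lebesgue_on {0..s}) \<partial>M)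
    = (\<integral>s. (\<integral>t. F s * (indicator {p. snd p \<le> fst p} (s, t) * G t) \<partial>M) \<partial>M)" for F G :: "real \<Rightarrow> real"
    by (rule Bochner_Integration.integral_cong) (simp_all add: inner)
  show "integrable M (\<lambda>s. D s * (\<integral>t. E t \<partial>lebesgue_on {0..s}))"
  proof -
    have "integrable M (\<lambda>s. \<integral>t. D s * (indicator {p. snd p \<le> fst p} (s, t) * E t) \<partial>M)"
      using P.integrable_fst[of "\<lambda>s t. D s * (indicator {p. snd p \<le> fst p} (s, t) * E t)"] int[OF DM]
      by (simp add: case_prod_beta')
    moreover have "integrable M (\<lambda>s. D s * (\<integral>t. E t \<partial>lebesgue_on {0..s})) \<longleftrightarrow>
        integrable M (\<lambda>s. \<integral>t. D s * (indicator {p. snd p \<le> fst p} (s, t) * E t) \<partial>M)"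
      by (rule Bochner_Integration.integrable_cong) (simp_all add: inner)
    ultimately show ?thesis by simp
  qed
  let ?K = "\<lambda>s t. E s * (indicator {p. snd p \<le> fst p} (s, t) * D t)"
  have K: "integrable (M \<Otimes>\<^sub>M M) (case_prod ?K)"
    using int[OF DM(2,1)] by (simp add: case_prod_beta')
  have "integrable M (\<lambda>t. \<integral>s. ?K s t \<partial>M)"
    by (rule P.integrable_snd[OF K])
  moreover have "(\<integral>s. D s * (\<integral>t. E t \<partial>lebesgue_on {0..s}) \<partial>M) + (\<integral>t. (\<integral>s. ?K s t \<partial>M) \<partial>M) = 
     (\<integral>s. D s * (\<integral>t. E t \<partial>M) \<partial>M)"
  proof -
    \<comment> \<open>After exchanging the order in the second term, the slices at a fixed
      \<open>s\<close> are \<open>{..s}\<close> and \<open>{s..}\<close>, which together cover the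
      whole interval.\<close>
    have pt: "D s * (\<integral>t. E t \<partial>lebesgue_on {0..s}) + (\<integral>t. ?K t s \<partial>M) = D s * (\<integral>t. E t \<partial>M)"
      if s: "s \<in> space M" for s
    proof -
      have i1: "integrable M (\<lambda>t. indicator A t * E t)" if "A \<in> sets borel" for A
      proof (rule Bochner_Integration.integrable_bound[OF DM(2)])
        have "A \<inter> {0..y} \<in> sets M"
          unfolding M_def sets_restrict_space_iff using that by (auto simp: sets_restrict_space)
        then have "indicator A \<in> borel_measurable M"
          by (intro borel_measurable_indicator') (simp add: M_def Int_def conj_commute)
        then show "(\<lambda>t. indicator A t * E t) \<in> borel_measurable M"
          using borel_measurable_integrable[OF DM(2)] by (rule borel_measurable_times)
      qed (auto split: split_indicator)
      have "(\<integral>t. E t \<partial>lebesgue_on {0..s}) = (\<integral>t. indicator {..s} t * E t \<partial>M)"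
        unfolding inner[OF s] by (rule Bochner_Integration.integral_cong) (auto split: split_indicator)
      moreover have "(\<integral>t. ?K t s \<partial>M) = D s * (\<integral>t. indicator {s..} t * E t \<partial>M)"
        by (subst integral_mult_right_zero[symmetric], rule Bochner_Integration.integral_cong) (auto split: split_indicator)
      moreover have "(\<integral>t. indicator {..s} t * E t \<partial>M) + (\<integral>t. indicator {s..} t * E t \<partial>M)
        = (\<integral>t. indicator {..s} t * E t + indicator {s..} t * E t \<partial>M)"
        by (simp add: i1)
      moreover have "\<dots> = (\<integral>t. E t \<partial>M)"
      proof (rule integral_cong_AE)
        \<comment> \<open>The two slices count \<open>t = s\<close> twice, which is harmless almost
          everywhere.\<close>
        have "{s} \<in> null_sets M"
          unfolding M_def using s by (subst null_sets_restrict_space) (auto simp: M_def)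
        then show "AE t in M. indicator {..s} t * E t + indicator {s..} t * E t = E t"
          by (rule AE_I') (auto split: split_indicator)
        show "(\<lambda>t. indicator {..s} t * E t + indicator {s..} t * E t) \<in> borel_measurable M"
          using i1[of "{..s}"] i1[of "{s..}"] by auto
      qed (use DM in auto)
      ultimately show ?thesis by (simp add: distrib_left[symmetric])
    qed
    have "(\<integral>s. D s * (\<integral>t. E t \<partial>lebesgue_on {0..s}) \<partial>M) + (\<integral>t. (\<integral>s. ?K s t \<partial>M) \<partial>M)
      = (\<integral>s. D s * (\<integral>t. E t \<partial>lebesgue_on {0..s}) + (\<integral>t. ?K t s \<partial>M) \<partial>M)"
      by (rule Bochner_Integration.integral_add[symmetric]) (fact)+
    also have "\<dots> = (\<integral>s. D s * (\<integral>t. E t \<partial>M) \<partial>M)"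
      by (rule Bochner_Integration.integral_cong) (simp_all add: pt)
    finally show ?thesis .
  qed
  moreover have "(\<integral>s. E s * (\<integral>t. D t \<partial>lebesgue_on {0..s}) \<partial>M) = (\<integral>t. (\<integral>s. ?K s t \<partial>M) \<partial>M)"
    unfolding iter by (rule P.Fubini_integral[OF K, symmetric])
  ultimately show "(\<integral>s. D s * (\<integral>t. E t \<partial>lebesgue_on {0..s}) \<partial>M) + (\<integral>s. E s * (\<integral>t. D t \<partial>lebesgue_on {0..s}) \<partial>M)
    = (\<integral>s. D s \<partial>M) * (\<integral>s. E s \<partial>M)" by simp
qed

text \<open>Write both factors as initial value plus primitive. All terms of the product but one are
  linear in a primitive; the product of the two primitives is
  \<open>integral_triangle_swap\<close>.\<close>

lemma weak_deriv_mult: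
  assumes F: "weak_deriv F D" and G: "weak_deriv G E"
  shows "weak_deriv (\<lambda>y. F y * G y) (\<lambda>y. D y * G y + F y * E y)"
  unfolding weak_deriv_def
proof (intro allI impI)
  fix y :: real assume y: "0 \<le> y"
  let ?M = "lebesgue_on {0..y}"
  let ?ID = "\<lambda>s. \<integral>t. D t \<partial>lebesgue_on {0..s}" and ?IE = "\<lambda>s. \<integral>t. E t \<partial>lebesgue_on {0..s}"
  note iD = weak_derivD[OF F y] and iE = weak_derivD[OF G y]
  note DE = integral_triangle_swap[OF iD(1) iE(1)] and ED = integral_triangle_swap[OF iE(1) iD(1)]
  have eq: "D s * G s + F s * E s = (G 0 * D s + F 0 * E s) + (D s * ?IE s + E s * ?ID s)"
    if "s \<in> {0..y}" for s
    using weak_derivD(2)[OF F, of s] weak_derivD(2)[OF G, of s] that by (simp add: algebra_simps)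
  have i: "integrable ?M (\<lambda>s. (G 0 * D s + F 0 * E s) + (D s * ?IE s + E s * ?ID s))"
    using iD(1) iE(1) DE(2) ED(2) by simp
  have "integrable ?M (\<lambda>s. D s * G s + F s * E s)"
    using i by (subst Bochner_Integration.integrable_cong[OF refl eq]) auto
  moreover have "(\<integral>s. D s * G s + F s * E s \<partial>?M) = (\<integral>s. (G 0 * D s + F 0 * E s) + (D s * ?IE s + E s * ?ID s) \<partial>?M)"
    by (rule Bochner_Integration.integral_cong[OF refl]) (use eq in auto)
  moreover have "\<dots> = G 0 * ?ID y + F 0 * ?IE y + ?ID y * ?IE y"
    using iD(1) iE(1) DE ED(2) by simp
  ultimately show "integrable ?M (\<lambda>y. D y * G y + F y * E y) \<and>
    F y * G y = F 0 * G 0 + (\<integral>s. D s * G s + F s * E s \<partial>?M)"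
    using iD(2) iE(2) by (simp add: algebra_simps)
qed

lemma weak_deriv_exp: "weak_deriv (\<lambda>y. exp (c * y)) (\<lambda>y. c * exp (c * y))"
  unfolding weak_deriv_def
proof (intro allI impI)
  fix y :: real assume y: "0 \<le> y"
  have i: "integrable (lebesgue_on {0..y}) (\<lambda>y. c * exp (c * y))"
    by (intro continuous_imp_integrable_real continuous_intros)
  have "((\<lambda>y. c * exp (c * y)) has_integral exp (c * y) - exp (c * 0)) {0..y}"
    by (rule fundamental_theorem_of_calculus[OF y])
      (auto intro!: derivative_eq_intros simp flip: has_real_derivative_iff_has_vector_derivative)
  then show "integrable (lebesgue_on {0..y}) (\<lambda>y. c * exp (c * y)) \<and>
    exp (c * y) = exp (c * 0) + (\<integral>s. c * exp (c * s) \<partial>lebesgue_on {0..y})"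
    using i lebesgue_integral_eq_integral[OF i]
    by (simp only: integral_unique) simp
qed

text \<open>The integrating factor: when \<open>D\<close> contains \<open>- c * F\<close>, that term
  cancels. With \<open>c\<close> equal to the weight \<open>a\<close> it gives the equation of
  \<open>exp (a * y) * F y\<close>.\<close>

lemma weak_deriv_exp_mult:
  assumes "weak_deriv F D"
  shows "weak_deriv (\<lambda>y. exp (c * y) * F y) (\<lambda>y. exp (c * y) * (c * F y + D y))"
  using weak_deriv_mult[OF weak_deriv_exp[of c] assms] by (simp add: algebra_simps)

lemma weak_deriv_measurable:
  assumes "weak_deriv F D"
  shows "F \<in> borel_measurable (lebesgue_on {0..})"
proof (rule continuous_imp_measurable_on_sets_lebesgue)
  show "continuous_on {0..} F"
    unfolding continuous_on_eq_continuous_within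
  proof
    fix x :: real assume x: "x \<in> {0..}"
    have "continuous (at x within {0..x+1}) F"
      using weak_deriv_continuous_on[OF assms, of "x+1"] x by (auto simp: continuous_on_eq_continuous_within)
    moreover have "at x within {0..x+1} = at x within {0..}"
      by (rule at_within_nhd[of _ "{..<x+1}"]) (use x in auto)
    ultimately show "continuous (at x within {0..}) F"
      by (simp add: continuous_within)
  qed
qed simp

section \<open>Weighted square integrable functions\<close>

definition wL2 :: "real \<Rightarrow> (real \<Rightarrow> real) \<Rightarrow> bool" where
  "wL2 a f \<longleftrightarrow> f \<in> borel_measurable (lebesgue_on {0..}) \<and>
     integrable (lebesgue_on {0..}) (\<lambda>y. exp (2 * a * y) * (f y)\<^sup>2)"

definition wL2_norm :: "real \<Rightarrow> (real \<Rightarrow> real) \<Rightarrow> real" where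
  "wL2_norm a f = sqrt (\<integral>y. exp (2 * a * y) * (f y)\<^sup>2 \<partial>lebesgue_on {0..})"

lemma wL2_norm_nonneg [simp]: "0 \<le> wL2_norm a f"
  unfolding wL2_norm_def by (intro real_sqrt_ge_zero integral_nonneg_AE AE_I2) simp

lemma wL2_norm_square: "(wL2_norm a f)\<^sup>2 = (\<integral>y. exp (2 * a * y) * (f y)\<^sup>2 \<partial>lebesgue_on {0..})"
  unfolding wL2_norm_def by (intro real_sqrt_pow2 integral_nonneg_AE AE_I2) simp

lemma wL2_cong:
  assumes "\<And>y. 0 \<le> y \<Longrightarrow> f y = g y"
  shows "wL2 a f \<longleftrightarrow> wL2 a g" "wL2_norm a f = wL2_norm a g"
proof -
  have "f \<in> borel_measurable (lebesgue_on {0..}) \<longleftrightarrow> g \<in> borel_measurable (lebesgue_on {0..})"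
    by (rule measurable_cong) (auto simp: assms)
  moreover have "integrable (lebesgue_on {0..}) (\<lambda>y. exp (2 * a * y) * (f y)\<^sup>2) \<longleftrightarrow>
      integrable (lebesgue_on {0..}) (\<lambda>y. exp (2 * a * y) * (g y)\<^sup>2)"
    by (rule Bochner_Integration.integrable_cong) (auto simp: assms)
  ultimately show "wL2 a f \<longleftrightarrow> wL2 a g" unfolding wL2_def by simp
  show "wL2_norm a f = wL2_norm a g"
    unfolding wL2_norm_def by (intro arg_cong[where f = sqrt] Bochner_Integration.integral_cong) (auto simp: assms)
qed

lemma id_measurable_lebesgue_on: "(\<lambda>x. x) \<in> borel_measurable (lebesgue_on (S::real set))"
  using id_borel_measurable_lebesgue_on[of S] by (simp add: id_def)

lemma exp_measurable_lebesgue_on [measurable]: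
  "(\<lambda>y::real. exp (c * y)) \<in> borel_measurable (lebesgue_on S)"
  using id_measurable_lebesgue_on[of S] by measurable

lemma wL2_dominated:
  assumes f: "f \<in> borel_measurable (lebesgue_on {0..})"
    and F: "integrable (lebesgue_on {0..}) F"
    and b: "\<And>y. 0 \<le> y \<Longrightarrow> exp (2 * a * y) * (f y)\<^sup>2 \<le> F y"
  shows "wL2 a f" "(wL2_norm a f)\<^sup>2 \<le> (\<integral>y. F y \<partial>lebesgue_on {0..})"
proof -
  have i: "integrable (lebesgue_on {0..}) (\<lambda>y. exp (2 * a * y) * (f y)\<^sup>2)"
  proof (rule Bochner_Integration.integrable_bound[OF F])
    show "(\<lambda>y. exp (2 * a * y) * (f y)\<^sup>2) \<in> borel_measurable (lebesgue_on {0..})"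
      using f by measurable
    show "AE y in lebesgue_on {0..}. norm (exp (2 * a * y) * (f y)\<^sup>2) \<le> norm (F y)"
    proof (rule AE_I2)
      fix y :: real assume "y \<in> space (lebesgue_on {0..})"
      then show "norm (exp (2 * a * y) * (f y)\<^sup>2) \<le> norm (F y)"
        using b[of y] abs_ge_self[of "F y"] by (simp add: abs_mult)
    qed
  qed
  then show "wL2 a f" using f by (simp add: wL2_def)
  show "(wL2_norm a f)\<^sup>2 \<le> (\<integral>y. F y \<partial>lebesgue_on {0..})"
    unfolding wL2_norm_square by (rule integral_mono[OF i F]) (simp add: b)
qed

text \<open>The factor 2 comes from bounding the square of a sum by twice the sum of squares. Only
  the existence of constants matters later, so this replaces Minkowski's inequality.\<close>

lemma wL2_add:
  assumes f: "wL2 a f" and g: "wL2 a g"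
  shows "wL2 a (\<lambda>y. f y + g y)" "wL2_norm a (\<lambda>y. f y + g y) \<le> 2 * (wL2_norm a f + wL2_norm a g)"
proof -
  have m: "(\<lambda>y. f y + g y) \<in> borel_measurable (lebesgue_on {0..})"
    using f g by (auto simp: wL2_def)
  have i: "integrable (lebesgue_on {0..}) (\<lambda>y. 2 * (exp (2 * a * y) * (f y)\<^sup>2) + 2 * (exp (2 * a * y) * (g y)\<^sup>2))"
    using f g by (auto simp: wL2_def)
  have b: "exp (2 * a * y) * (f y + g y)\<^sup>2 \<le> 2 * (exp (2 * a * y) * (f y)\<^sup>2) + 2 * (exp (2 * a * y) * (g y)\<^sup>2)" for y
  proof -
    have "(f y + g y)\<^sup>2 \<le> 2 * (f y)\<^sup>2 + 2 * (g y)\<^sup>2"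
      using zero_le_power2[of "f y - g y"] by (simp add: power2_eq_square algebra_simps)
    then have "exp (2 * a * y) * (f y + g y)\<^sup>2 \<le> exp (2 * a * y) * (2 * (f y)\<^sup>2 + 2 * (g y)\<^sup>2)"
      by (intro mult_left_mono) auto
    then show ?thesis by (simp add: algebra_simps)
  qed
  show "wL2 a (\<lambda>y. f y + g y)" by (rule wL2_dominated(1)[OF m i b])
  have "(wL2_norm a (\<lambda>y. f y + g y))\<^sup>2 \<le> 2 * (wL2_norm a f)\<^sup>2 + 2 * (wL2_norm a g)\<^sup>2"
    using wL2_dominated(2)[OF m i b] f g by (simp add: wL2_norm_square wL2_def)
  also have "\<dots> \<le> (2 * (wL2_norm a f + wL2_norm a g))\<^sup>2"
    using wL2_norm_nonneg[of a f] wL2_norm_nonneg[of a g]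
    by (simp add: power2_eq_square algebra_simps)
  finally show "wL2_norm a (\<lambda>y. f y + g y) \<le> 2 * (wL2_norm a f + wL2_norm a g)"
    by (rule power2_le_imp_le) simp
qed

lemma wL2_cmult:
  assumes f: "wL2 a f"
  shows "wL2 a (\<lambda>y. c * f y)" "wL2_norm a (\<lambda>y. c * f y) = \<bar>c\<bar> * wL2_norm a f"
proof -
  have eq: "exp (2 * a * y) * (c * f y)\<^sup>2 = c\<^sup>2 * (exp (2 * a * y) * (f y)\<^sup>2)" for y
    by (simp add: power_mult_distrib)
  show "wL2 a (\<lambda>y. c * f y)" "wL2_norm a (\<lambda>y. c * f y) = \<bar>c\<bar> * wL2_norm a f"
    using f unfolding wL2_def wL2_norm_def eq by (auto simp: real_sqrt_mult)
qed

lemma wL2_zero: "wL2 a (\<lambda>y. 0)" "wL2_norm a (\<lambda>y. 0) = 0"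
  by (simp_all add: wL2_def wL2_norm_def)

lemma wL2_sum:
  assumes "\<And>i. i \<in> I \<Longrightarrow> wL2 a (F i)"
  shows "wL2 a (\<lambda>y. \<Sum>i\<in>I. F i y)"
  using assms
proof (induction I rule: infinite_finite_induct)
  case (insert j J)
  then have "wL2 a (\<lambda>y. F j y + (\<Sum>i\<in>J. F i y))"
    by (intro wL2_add) auto
  with insert show ?case by simp
qed (simp_all add: wL2_zero)

section \<open>Exponential tails and weighted energy estimates\<close>

lemma exp_neg_integral:
  fixes c y :: real
  assumes c: "0 < c"
  shows "integrable (lebesgue_on {0..}) (\<lambda>s. exp (- c * s))"
    and "0 \<le> y \<Longrightarrow> (\<integral>s. exp (- c * s) \<partial>lebesgue_on {y..}) = exp (- c * y) / c"
proof -
  note w = weak_deriv_exp[of "- c"]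
  have i: "integrable (lebesgue_on {0..y}) (\<lambda>s. exp (- c * s))" for y
    by (intro continuous_imp_integrable_real continuous_intros)
  have I: "(\<integral>s. exp (- c * s) \<partial>lebesgue_on {0..y}) = (1 - exp (- c * y)) / c" if "0 \<le> y" for y
    using weak_derivD(2)[OF w that] c by (simp add: field_simps)
  show int: "integrable (lebesgue_on {0..}) (\<lambda>s. exp (- c * s))"
  proof (rule integrable_lebesgue_on_atLeast(1)[where C = "1 / c"])
    show "(\<integral>s. exp (- c * s) \<partial>lebesgue_on {0..y}) \<le> 1 / c" if "0 \<le> y" for y
      unfolding I[OF that] using c by (simp add: divide_right_mono)
  qed (use i exp_measurable_lebesgue_on[of "- c"] in auto)
  have "((\<lambda>y. (1 - exp (- c * y)) / c) \<longlongrightarrow> (\<integral>s. exp (- c * s) \<partial>lebesgue_on {0..})) at_top"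
    by (rule Lim_transform_eventually[OF tendsto_integral_lebesgue_on_at_top(1)[OF int]])
      (auto intro!: eventually_mono[OF eventually_ge_at_top[of 0]] simp: I[simplified])
  moreover have "((\<lambda>y. (1 - exp (- c * y)) / c) \<longlongrightarrow> (1 - 0) / c) at_top"
  proof -
    have "filterlim (\<lambda>y. - c * y) at_bot at_top"
      using filterlim_tendsto_neg_mult_at_bot[OF tendsto_const _ filterlim_ident, of "- c"] c by simp
    then show ?thesis
      by (intro tendsto_intros filterlim_compose[OF exp_at_bot]) (use c in auto)
  qed
  ultimately have T: "(\<integral>s. exp (- c * s) \<partial>lebesgue_on {0..}) = 1 / c"
    using tendsto_unique[OF trivial_limit_at_top_linorder] by auto
  show "0 \<le> y \<Longrightarrow> (\<integral>s. exp (- c * s) \<partial>lebesgue_on {y..}) = exp (- c * y) / c"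
    using integral_lebesgue_on_split(2)[OF _ int, of y] I[of y] T by (simp add: diff_divide_distrib)
qed

text \<open>The factor 1/2 (1/(2a) + 1) is what Young's inequality gives for
  \<open>e\<^bsup>ay\<^esup> |f s| = e\<^bsup>a(y - s)\<^esup> (e\<^bsup>as\<^esup> |f s|)\<close>.\<close>

lemma wL2_tail:
  assumes f: "wL2 a f" and a: "0 < a"
  shows "integrable (lebesgue_on {0..}) f"
    and "0 \<le> y \<Longrightarrow> exp (a * y) * (\<integral>s. \<bar>f s\<bar> \<partial>lebesgue_on {y..}) \<le> (1 / (2 * a) + 1) / 2 * wL2_norm a f"
proof -
  have young: "exp (a * y) * \<bar>f s\<bar> \<le> (t * exp (2 * a * y) * exp (- (2 * a) * s) + exp (2 * a * s) * (f s)\<^sup>2 / t) / 2"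
    if "0 < t" for t y s
  proof -
    have "2 * ((t * exp (a * (y - s))) * (exp (a * s) * \<bar>f s\<bar>)) \<le>
        (t * exp (a * (y - s)))\<^sup>2 + (exp (a * s) * \<bar>f s\<bar>)\<^sup>2"
      using zero_le_power2[of "t * exp (a * (y - s)) - exp (a * s) * \<bar>f s\<bar>"]
      by (simp add: power2_eq_square algebra_simps)
    moreover have "(t * exp (a * (y - s))) * (exp (a * s) * \<bar>f s\<bar>) = t * (exp (a * y) * \<bar>f s\<bar>)"
      by (simp add: algebra_simps flip: exp_add)
    moreover have "(t * exp (a * (y - s)))\<^sup>2 = t * (t * exp (2 * a * y) * exp (- (2 * a) * s))"
      by (simp add: power2_eq_square algebra_simps flip: exp_add)
    moreover have "(exp (a * s) * \<bar>f s\<bar>)\<^sup>2 = t * (exp (2 * a * s) * (f s)\<^sup>2 / t)"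
      using that by (simp add: power_mult_distrib power2_eq_square exp_add[symmetric] algebra_simps)
    ultimately have "2 * (t * (exp (a * y) * \<bar>f s\<bar>)) \<le> t * (t * exp (2 * a * y) * exp (- (2 * a) * s)) + t * (exp (2 * a * s) * (f s)\<^sup>2 / t)"
      by linarith
    then have "t * (2 * (exp (a * y) * \<bar>f s\<bar>)) \<le> t * (t * exp (2 * a * y) * exp (- (2 * a) * s) + exp (2 * a * s) * (f s)\<^sup>2 / t)"
      by (simp only: distrib_left mult.left_commute[of t 2])
    then have "2 * (exp (a * y) * \<bar>f s\<bar>) \<le> t * exp (2 * a * y) * exp (- (2 * a) * s) + exp (2 * a * s) * (f s)\<^sup>2 / t"
      by (rule mult_left_le_imp_le) (rule that)
    then show ?thesis by (simp only: pos_le_divide_eq[OF zero_less_numeral] mult.commute[of _ 2])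
  qed
  have ie: "integrable (lebesgue_on {0..}) (\<lambda>s. exp (- (2 * a) * s))"
    by (rule exp_neg_integral) (use a in auto)
  have if2: "integrable (lebesgue_on {0..}) (\<lambda>s. exp (2 * a * s) * (f s)\<^sup>2)" using f by (simp add: wL2_def)
  show i: "integrable (lebesgue_on {0..}) f"
  proof (rule Bochner_Integration.integrable_bound)
    show "integrable (lebesgue_on {0..}) (\<lambda>s. (exp (- (2 * a) * s) + exp (2 * a * s) * (f s)\<^sup>2) / 2)"
      using ie if2 by simp
    show "f \<in> borel_measurable (lebesgue_on {0..})" using f by (simp add: wL2_def)
    show "AE s in lebesgue_on {0..}. norm (f s) \<le> norm ((exp (- (2 * a) * s) + exp (2 * a * s) * (f s)\<^sup>2) / 2)"
      using young[of 1 0] by (intro AE_I2) (auto intro: order_trans[OF _ abs_ge_self])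
  qed
  assume y: "0 \<le> y"
  show "exp (a * y) * (\<integral>s. \<bar>f s\<bar> \<partial>lebesgue_on {y..}) \<le> (1 / (2 * a) + 1) / 2 * wL2_norm a f"
  proof (rule field_le_epsilon)
    \<comment> \<open>The optimal weight in Young's inequality is \<open>t = wL2_norm a f\<close>,
      which may be 0. Adding \<open>e / ?C\<close> makes \<open>t\<close> positive, and since the
      final bound is \<open>?C * t\<close>, it costs exactly \<open>e\<close>.\<close>
    fix e :: real assume e: "0 < e"
    let ?C = "(1 / (2 * a) + 1) / 2"
    have C: "0 < ?C" using a by (simp add: add_pos_pos)
    define t where "t = wL2_norm a f + e / ?C"
    have t: "0 < t" "wL2_norm a f \<le> t"
      using e C wL2_norm_nonneg[of a f] by (auto simp: t_def intro: add_nonneg_pos divide_pos_pos)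
    have sub: "integrable (lebesgue_on {y..}) g" if "integrable (lebesgue_on {0..}) g" for g :: "real \<Rightarrow> real"
      using integrable_lebesgue_on_subset[OF that, of "{y..}"] y by auto
    have "exp (a * y) * (\<integral>s. \<bar>f s\<bar> \<partial>lebesgue_on {y..}) = (\<integral>s. exp (a * y) * \<bar>f s\<bar> \<partial>lebesgue_on {y..})"
      by simp
    also have "\<dots> \<le> (\<integral>s. (t * exp (2 * a * y) * exp (- (2 * a) * s) + exp (2 * a * s) * (f s)\<^sup>2 / t) / 2 \<partial>lebesgue_on {y..})"
      by (rule integral_mono) (use sub[OF i] sub[OF ie] sub[OF if2] young[OF t(1)] in auto)
    also have "\<dots> = (t * exp (2 * a * y) * (\<integral>s. exp (- (2 * a) * s) \<partial>lebesgue_on {y..}) +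
        (\<integral>s. exp (2 * a * s) * (f s)\<^sup>2 \<partial>lebesgue_on {y..}) / t) / 2"
      using sub[OF ie] sub[OF if2] by simp
    also have "(\<integral>s. exp (- (2 * a) * s) \<partial>lebesgue_on {y..}) = exp (- (2 * a) * y) / (2 * a)"
      by (rule exp_neg_integral(2)) (use a y in auto)
    also have "t * exp (2 * a * y) * (exp (- (2 * a) * y) / (2 * a)) = t / (2 * a)"
      by (simp add: exp_minus)
    also have "(\<integral>s. exp (2 * a * s) * (f s)\<^sup>2 \<partial>lebesgue_on {y..}) \<le> t\<^sup>2"
    proof -
      have "0 \<le> (\<integral>s. exp (2 * a * s) * (f s)\<^sup>2 \<partial>lebesgue_on {0..y})"
        by (rule integral_nonneg_AE) auto
      then have "(\<integral>s. exp (2 * a * s) * (f s)\<^sup>2 \<partial>lebesgue_on {y..}) \<le> (wL2_norm a f)\<^sup>2"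
        using integral_lebesgue_on_split(2)[OF y if2] by (simp add: wL2_norm_square)
      also have "\<dots> \<le> t\<^sup>2" using t by (intro power_mono) auto
      finally show ?thesis .
    qed
    finally have "exp (a * y) * (\<integral>s. \<bar>f s\<bar> \<partial>lebesgue_on {y..}) \<le> (t / (2 * a) + t\<^sup>2 / t) / 2"
      using t by (simp add: divide_right_mono)
    also have "\<dots> = ?C * t" using t a by (simp add: power2_eq_square field_simps)
    also have "\<dots> = ?C * wL2_norm a f + e" unfolding t_def distrib_left using C by simp
    finally show "exp (a * y) * (\<integral>s. \<bar>f s\<bar> \<partial>lebesgue_on {y..}) \<le> ?C * wL2_norm a f + e" .
  qed
qed

text \<open>Integrate the derivative \<open>2 * k * u^2 + 2 * u * v\<close> of \<open>u^2\<close>;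
  Young's inequality with weight \<open>\<bar>k\<bar>\<close> spends half of the quadratic term on
  the mixed one. For negative \<open>k\<close> the remaining half is a damping, and the initial
  value controls both the integral and the supremum. For positive \<open>k\<close> the sign is
  reversed, so the integral is controlled by the value of \<open>u^2\<close> at the right end; this
  is why a bound on the supremum is assumed in that case.\<close>

lemma energy_estimate:
  assumes u: "weak_deriv u w" and w: "\<And>y. 0 \<le> y \<Longrightarrow> w y = k * u y + v y"
    and v: "integrable (lebesgue_on {0..}) (\<lambda>y. (v y)\<^sup>2)"
    and k: "k \<noteq> 0" and M: "\<bar>u 0\<bar> \<le> M" "\<And>y. 0 < k \<Longrightarrow> 0 \<le> y \<Longrightarrow> \<bar>u y\<bar> \<le> M"
  shows "integrable (lebesgue_on {0..}) (\<lambda>y. (u y)\<^sup>2)"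
    and "(\<integral>y. (u y)\<^sup>2 \<partial>lebesgue_on {0..}) \<le> M\<^sup>2 / \<bar>k\<bar> + (\<integral>y. (v y)\<^sup>2 \<partial>lebesgue_on {0..}) / k\<^sup>2"
    and "0 \<le> y \<Longrightarrow> (u y)\<^sup>2 \<le> M\<^sup>2 + (\<integral>y. (v y)\<^sup>2 \<partial>lebesgue_on {0..}) / \<bar>k\<bar>"
proof -
  let ?V = "\<integral>y. (v y)\<^sup>2 \<partial>lebesgue_on {0..}"
  have V: "0 \<le> ?V" by (rule integral_nonneg_AE) auto
  note w2 = weak_deriv_mult[OF u u]
  have iu: "integrable (lebesgue_on {0..y}) (\<lambda>y. (u y)\<^sup>2)" for y
    by (intro continuous_imp_integrable_real continuous_intros weak_deriv_continuous_on[OF u])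
  have young: "\<bar>2 * u s * v s\<bar> \<le> \<bar>k\<bar> * (u s)\<^sup>2 + (v s)\<^sup>2 / \<bar>k\<bar>" for s
  proof -
    have "2 * (\<bar>k\<bar> * \<bar>u s\<bar>) * \<bar>v s\<bar> \<le> (\<bar>k\<bar> * \<bar>u s\<bar>)\<^sup>2 + \<bar>v s\<bar>\<^sup>2"
      using zero_le_power2[of "\<bar>k\<bar> * \<bar>u s\<bar> - \<bar>v s\<bar>"] by (simp add: power2_eq_square algebra_simps)
    then show ?thesis
      using k by (simp add: abs_mult field_simps power2_eq_square)
  qed
  have main: "\<bar>k\<bar> * (\<integral>s. (u s)\<^sup>2 \<partial>lebesgue_on {0..y}) \<le> M\<^sup>2 + ?V / \<bar>k\<bar>"
    "(u y)\<^sup>2 \<le> M\<^sup>2 + ?V / \<bar>k\<bar>" if y: "0 \<le> y" for y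
  proof -
    let ?I = "\<integral>s. (u s)\<^sup>2 \<partial>lebesgue_on {0..y}" and ?W = "\<integral>s. w s * u s + u s * w s \<partial>lebesgue_on {0..y}"
    have iv: "integrable (lebesgue_on {0..y}) (\<lambda>y. (v y)\<^sup>2)"
      by (rule integrable_lebesgue_on_subset[OF v]) auto
    have Vy: "(\<integral>s. (v s)\<^sup>2 \<partial>lebesgue_on {0..y}) \<le> ?V"
    proof -
      have "0 \<le> (\<integral>s. (v s)\<^sup>2 \<partial>lebesgue_on {y..})" by (rule integral_nonneg_AE) auto
      then show ?thesis using integral_lebesgue_on_split(2)[OF y v] by simp
    qed
    have I0: "0 \<le> ?I" by (rule integral_nonneg_AE) auto
    note d = weak_derivD[OF w2 y]
    have d': "(u y)\<^sup>2 = (u 0)\<^sup>2 + ?W" using d(2) by (simp only: power2_eq_square)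
    have M0: "(u 0)\<^sup>2 \<le> M\<^sup>2" using M(1) by (simp add: abs_le_square_iff[symmetric] )
    have i2: "integrable (lebesgue_on {0..y}) (\<lambda>s. c * (u s)\<^sup>2 + (v s)\<^sup>2 / \<bar>k\<bar>)"
      "(\<integral>s. c * (u s)\<^sup>2 + (v s)\<^sup>2 / \<bar>k\<bar> \<partial>lebesgue_on {0..y}) \<le> c * ?I + ?V / \<bar>k\<bar>"
      "integrable (lebesgue_on {0..y}) (\<lambda>s. c * (u s)\<^sup>2 - (v s)\<^sup>2 / \<bar>k\<bar>)"
      "c * ?I - ?V / \<bar>k\<bar> \<le> (\<integral>s. c * (u s)\<^sup>2 - (v s)\<^sup>2 / \<bar>k\<bar> \<partial>lebesgue_on {0..y})" for c
      using iu[of y] iv Vy by (auto simp: divide_right_mono)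
    have e: "w s * u s + u s * w s = 2 * k * (u s)\<^sup>2 + 2 * u s * v s" if "s \<in> {0..y}" for s
      using w[of s] that by (simp add: power2_eq_square algebra_simps)
    show "\<bar>k\<bar> * ?I \<le> M\<^sup>2 + ?V / \<bar>k\<bar>"
    proof (cases "0 < k")
      case True
      have "k * ?I - ?V / \<bar>k\<bar> \<le> ?W"
      proof (rule order_trans[OF i2(4) integral_mono[OF i2(3) d(1)]])
        fix s assume "s \<in> space (lebesgue_on {0..y})"
        then show "k * (u s)\<^sup>2 - (v s)\<^sup>2 / \<bar>k\<bar> \<le> w s * u s + u s * w s"
          using e[of s] young[of s] True by (simp add: abs_le_iff algebra_simps)
      qed
      moreover have "(u y)\<^sup>2 \<le> M\<^sup>2" using M(2)[OF True y] by (simp add: abs_le_square_iff[symmetric])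
      ultimately show ?thesis using d' zero_le_power2[of "u 0"] by (simp only: abs_of_pos[OF True])
    next
      case False
      have "?W \<le> k * ?I + ?V / \<bar>k\<bar>"
      proof (rule order_trans[OF integral_mono[OF d(1) i2(1)] i2(2)])
        fix s assume "s \<in> space (lebesgue_on {0..y})"
        then show "w s * u s + u s * w s \<le> k * (u s)\<^sup>2 + (v s)\<^sup>2 / \<bar>k\<bar>"
          using e[of s] young[of s] False by (simp add: abs_le_iff algebra_simps)
      qed
      moreover have "\<bar>k\<bar> * ?I = - (k * ?I)" using False by simp
      ultimately show ?thesis using d' M0 zero_le_power2[of "u y"] by linarith
    qed
    show "(u y)\<^sup>2 \<le> M\<^sup>2 + ?V / \<bar>k\<bar>"
    proof (cases "0 < k")
      case True
      have "(u y)\<^sup>2 \<le> M\<^sup>2" using M(2)[OF True y] by (simp add: abs_le_square_iff[symmetric])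
      moreover have "0 \<le> ?V / \<bar>k\<bar>" using V by simp
      ultimately show ?thesis by linarith
    next
      case False
      have "?W \<le> k * ?I + ?V / \<bar>k\<bar>"
      proof (rule order_trans[OF integral_mono[OF d(1) i2(1)] i2(2)])
        fix s assume "s \<in> space (lebesgue_on {0..y})"
        then show "w s * u s + u s * w s \<le> k * (u s)\<^sup>2 + (v s)\<^sup>2 / \<bar>k\<bar>"
          using e[of s] young[of s] False by (simp add: abs_le_iff algebra_simps)
      qed
      moreover have "k * ?I \<le> 0" using False I0 by (simp add: mult_nonpos_nonneg)
      ultimately show ?thesis using d' M0 by linarith
    qed
  qed
  have b: "(\<integral>s. (u s)\<^sup>2 \<partial>lebesgue_on {0..y}) \<le> M\<^sup>2 / \<bar>k\<bar> + ?V / k\<^sup>2" if "0 \<le> y" for y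
  proof -
    have "(\<integral>s. (u s)\<^sup>2 \<partial>lebesgue_on {0..y}) \<le> (M\<^sup>2 + ?V / \<bar>k\<bar>) / \<bar>k\<bar>"
      using main(1)[OF that] k by (simp add: pos_le_divide_eq mult.commute)
    also have "\<dots> = M\<^sup>2 / \<bar>k\<bar> + ?V / k\<^sup>2"
      by (simp add: add_divide_distrib power2_eq_square)
    finally show ?thesis .
  qed
  have mu: "(\<lambda>y. (u y)\<^sup>2) \<in> borel_measurable (lebesgue_on {0..})"
    using weak_deriv_measurable[OF u] by measurable
  show "integrable (lebesgue_on {0..}) (\<lambda>y. (u y)\<^sup>2)"
    by (rule integrable_lebesgue_on_atLeast(1)[OF mu _ iu b]) auto
  show "(\<integral>y. (u y)\<^sup>2 \<partial>lebesgue_on {0..}) \<le> M\<^sup>2 / \<bar>k\<bar> + ?V / k\<^sup>2"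
    by (rule integrable_lebesgue_on_atLeast(2)[OF mu _ iu b]) auto
  show "0 \<le> y \<Longrightarrow> (u y)\<^sup>2 \<le> M\<^sup>2 + ?V / \<bar>k\<bar>" by (rule main(2))
qed

lemma weak_deriv_congI:
  assumes "weak_deriv F D" "\<And>y. 0 \<le> y \<Longrightarrow> F y = F' y" "\<And>y. 0 \<le> y \<Longrightarrow> D y = D' y"
  shows "weak_deriv F' D'"
  using weak_deriv_cong[of F F' D D'] assms by blast

lemma tendsto_zero_exp_bound:
  fixes F :: "real \<Rightarrow> real"
  assumes a: "0 < a" and b: "\<And>y. 0 \<le> y \<Longrightarrow> exp (a * y) * \<bar>F y\<bar> \<le> M"
  shows "(F \<longlongrightarrow> 0) at_top"
proof (rule Lim_null_comparison)
  show "\<forall>\<^sub>F y in at_top. norm (F y) \<le> exp (- a * y) * M"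
    using eventually_ge_at_top[of 0]
  proof eventually_elim
    case (elim y)
    have "exp (- a * y) * (exp (a * y) * \<bar>F y\<bar>) \<le> exp (- a * y) * M"
      by (intro mult_left_mono b elim) simp
    then show ?case by (simp add: exp_minus field_simps)
  qed
  have "filterlim (\<lambda>y. - a * y) at_bot at_top"
    using filterlim_tendsto_neg_mult_at_bot[OF tendsto_const _ filterlim_ident, of "- a"] a by simp
  then have "((\<lambda>y. exp (- a * y) * M) \<longlongrightarrow> 0 * M) at_top"
    by (intro tendsto_intros filterlim_compose[OF exp_at_bot])
  then show "((\<lambda>y. exp (- a * y) * M) \<longlongrightarrow> 0) at_top" by simp
qed

text \<open>The function \<open>e\<^bsup>ay\<^esup> F y\<close> satisfies a linear equation with coefficient \<open>a + b\<close>.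
  If this is negative, its square integral is controlled by its initial value, and otherwise
  by its supremum.\<close>

lemma weighted_energy_estimate:
  assumes F: "weak_deriv F D" and D: "\<And>y. 0 \<le> y \<Longrightarrow> D y = b * F y + c * f y"
    and f: "wL2 a f" and k: "a + b \<noteq> 0"
    and M: "\<bar>F 0\<bar> \<le> M" "\<And>y. 0 < a + b \<Longrightarrow> 0 \<le> y \<Longrightarrow> exp (a * y) * \<bar>F y\<bar> \<le> M"
  shows "wL2 a F" "wL2_norm a F \<le> M / sqrt \<bar>a + b\<bar> + \<bar>c\<bar> / \<bar>a + b\<bar> * wL2_norm a f"
    and "0 < a \<Longrightarrow> (F \<longlongrightarrow> 0) at_top"
proof -
  define k where "k = a + b"
  let ?u = "\<lambda>y. exp (a * y) * F y" and ?v = "\<lambda>y. c * (exp (a * y) * f y)"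
  have u: "weak_deriv ?u (\<lambda>y. exp (a * y) * (a * F y + D y))"
    by (rule weak_deriv_exp_mult[OF F])
  have w: "exp (a * y) * (a * F y + D y) = k * ?u y + ?v y" if "0 \<le> y" for y
    by (simp add: D[OF that] k_def algebra_simps)
  have sq: "(exp (a * y) * g y)\<^sup>2 = exp (2 * a * y) * (g y)\<^sup>2" for y and g :: "real \<Rightarrow> real"
    by (simp add: power_mult_distrib exp_double[symmetric] mult.assoc)
  have vsq: "(?v y)\<^sup>2 = c\<^sup>2 * (exp (2 * a * y) * (f y)\<^sup>2)" for y
    by (simp only: power_mult_distrib[of c] sq)
  have v: "integrable (lebesgue_on {0..}) (\<lambda>y. (?v y)\<^sup>2)"
    unfolding vsq using f by (simp add: wL2_def)
  have V: "(\<integral>y. (?v y)\<^sup>2 \<partial>lebesgue_on {0..}) = (\<bar>c\<bar> * wL2_norm a f)\<^sup>2"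
    unfolding vsq by (simp add: wL2_norm_square power_mult_distrib)
  have k0: "k \<noteq> 0" and M0: "\<bar>?u 0\<bar> \<le> M" and Mk: "\<And>y. 0 < k \<Longrightarrow> 0 \<le> y \<Longrightarrow> \<bar>?u y\<bar> \<le> M"
    using k M by (auto simp: k_def abs_mult)
  note E = energy_estimate[OF u w v k0 M0 Mk]
  show "wL2 a F"
    using E(1) weak_deriv_measurable[OF F] unfolding sq by (simp add: wL2_def)
  have M': "0 \<le> M" using M(1) by linarith
  have "(wL2_norm a F)\<^sup>2 \<le> M\<^sup>2 / \<bar>k\<bar> + (\<bar>c\<bar> * wL2_norm a f)\<^sup>2 / k\<^sup>2"
    using E(2) unfolding V sq by (simp add: wL2_norm_square)
  also have "\<dots> = (M / sqrt \<bar>k\<bar>)\<^sup>2 + (\<bar>c\<bar> / \<bar>k\<bar> * wL2_norm a f)\<^sup>2"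
    by (simp add: power_divide power_mult_distrib)
  \<comment> \<open>A sum of squares of nonnegative numbers is at most the square of their sum; this
    yields a bound that is linear in \<open>M\<close> and in the norm of \<open>f\<close>.\<close>
  also have "\<dots> \<le> (M / sqrt \<bar>k\<bar> + \<bar>c\<bar> / \<bar>k\<bar> * wL2_norm a f)\<^sup>2"
    unfolding power2_sum using M' by simp
  finally show "wL2_norm a F \<le> M / sqrt \<bar>a + b\<bar> + \<bar>c\<bar> / \<bar>a + b\<bar> * wL2_norm a f"
    unfolding k_def by (rule power2_le_imp_le) (use M' in auto)
  assume a: "0 < a"
  show "(F \<longlongrightarrow> 0) at_top"
  proof (rule tendsto_zero_exp_bound[OF a])
    fix y :: real assume y: "0 \<le> y"
    have "(?u y)\<^sup>2 \<le> M\<^sup>2 + (\<bar>c\<bar> * wL2_norm a f)\<^sup>2 / \<bar>k\<bar>"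
      using E(3)[OF _ _ _ y] unfolding V by simp
    from real_sqrt_le_mono[OF this] show "exp (a * y) * \<bar>F y\<bar> \<le> sqrt (M\<^sup>2 + (\<bar>c\<bar> * wL2_norm a f)\<^sup>2 / \<bar>k\<bar>)"
      by (simp only: real_sqrt_abs abs_mult abs_exp_cancel)
  qed
qed

section \<open>Tail integrals and explicit solutions of the scalar equation\<close>

lemma weak_deriv_indefinite:
  assumes "\<And>y. 0 \<le> y \<Longrightarrow> integrable (lebesgue_on {0..y}) f"
  shows "weak_deriv (\<lambda>y. \<integral>s. f s \<partial>lebesgue_on {0..y}) f"
proof -
  \<comment> \<open>Splitting the degenerate interval at its only point gives
    \<open>I = I + I\<close>.\<close>
  have "(\<integral>s. f s \<partial>lebesgue_on {0..0}) = 0"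
    using integral_lebesgue_on_split(1)[OF order_refl order_refl assms[OF order_refl]] by linarith
  then show ?thesis using assms unfolding weak_deriv_def by (simp del: atLeastAtMost_singleton)
qed

lemma weak_deriv_tail:
  assumes f: "integrable (lebesgue_on {0..}) f"
  shows "weak_deriv (\<lambda>y. \<integral>s. f s \<partial>lebesgue_on {y..}) (\<lambda>y. - f y)"
  unfolding weak_deriv_def
proof (intro allI impI)
  fix y :: real assume y: "0 \<le> y"
  have "integrable (lebesgue_on {0..y}) f"
    by (rule integrable_lebesgue_on_subset[OF f]) auto
  then show "integrable (lebesgue_on {0..y}) (\<lambda>y. - f y) \<and>
      (\<integral>s. f s \<partial>lebesgue_on {y..}) = (\<integral>s. f s \<partial>lebesgue_on {0..}) + (\<integral>s. - f s \<partial>lebesgue_on {0..y})"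
    using integral_lebesgue_on_split(2)[OF y f] by simp
qed

text \<open>Decay at infinity fixes the constant of integration: \<open>F 0\<close> must be minus
  the integral of \<open>D\<close> over the half-line.\<close>

lemma weak_deriv_eq_tail:
  assumes F: "weak_deriv F D" and D: "integrable (lebesgue_on {0..}) D"
    and lim: "(F \<longlongrightarrow> 0) at_top" and y: "0 \<le> y"
  shows "F y = - (\<integral>s. D s \<partial>lebesgue_on {y..})"
proof -
  have "((\<lambda>y. F 0 + (\<integral>s. D s \<partial>lebesgue_on {0..y})) \<longlongrightarrow> F 0 + (\<integral>s. D s \<partial>lebesgue_on {0..})) at_top"
    by (intro tendsto_intros tendsto_integral_lebesgue_on_at_top D)
  moreover have "\<forall>\<^sub>F y in at_top. F 0 + (\<integral>s. D s \<partial>lebesgue_on {0..y}) = F y"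
    using eventually_ge_at_top[of 0] by eventually_elim (rule weak_derivD(2)[OF F, symmetric])
  ultimately have "(F \<longlongrightarrow> F 0 + (\<integral>s. D s \<partial>lebesgue_on {0..})) at_top"
    by (rule Lim_transform_eventually)
  then have "F 0 + (\<integral>s. D s \<partial>lebesgue_on {0..}) = 0"
    using tendsto_unique[OF trivial_limit_at_top_linorder _ lim] by blast
  then show ?thesis
    using weak_derivD(2)[OF F y] integral_lebesgue_on_split(2)[OF y D] by simp
qed

text \<open>The integrand is allowed to be any \<open>g\<close> dominated by \<open>f\<close>, so
  that the same bound serves plain tails and the kernel of \<open>backward_sol\<close>, whose
  exponential factor is at most 1 when \<open>c\<close> is negative.\<close>

lemma abs_integral_tail_le:
  assumes f: "wL2 a f" and a: "0 < a" and y: "0 \<le> y"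
    and g: "integrable (lebesgue_on {y..}) g" "\<And>s. y \<le> s \<Longrightarrow> \<bar>g s\<bar> \<le> \<bar>f s\<bar>"
  shows "exp (a * y) * \<bar>\<integral>s. g s \<partial>lebesgue_on {y..}\<bar> \<le> (1 / (2 * a) + 1) / 2 * wL2_norm a f"
proof -
  have f': "integrable (lebesgue_on {y..}) f"
    by (rule integrable_lebesgue_on_subset[OF wL2_tail(1)[OF f a]]) (use y in auto)
  have "\<bar>\<integral>s. g s \<partial>lebesgue_on {y..}\<bar> \<le> (\<integral>s. \<bar>g s\<bar> \<partial>lebesgue_on {y..})"
    by (rule integral_abs_bound)
  also have "\<dots> \<le> (\<integral>s. \<bar>f s\<bar> \<partial>lebesgue_on {y..})"
    by (rule integral_mono) (use f' g in auto)
  finally have "exp (a * y) * \<bar>\<integral>s. g s \<partial>lebesgue_on {y..}\<bar> \<le> exp (a * y) * (\<integral>s. \<bar>f s\<bar> \<partial>lebesgue_on {y..})"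
    by (intro mult_left_mono) auto
  then show ?thesis using wL2_tail(2)[OF f a y] by linarith
qed

text \<open>The tail \<open>F\<close> of \<open>f\<close> solves
  \<open>F' = 0 * F + (- 1) * f\<close>. The weighted coefficient \<open>a + 0\<close> is positive,
  so the supremum bound needed by the energy estimate comes from
  \<open>abs_integral_tail_le\<close>.\<close>

lemma wL2_tail_op:
  assumes a: "0 < a"
  shows "\<exists>C. \<forall>f. wL2 a f \<longrightarrow> wL2 a (\<lambda>y. \<integral>s. f s \<partial>lebesgue_on {y..}) \<and>
      wL2_norm a (\<lambda>y. \<integral>s. f s \<partial>lebesgue_on {y..}) \<le> C * wL2_norm a f"
proof (intro exI allI impI)
  let ?K = "(1 / (2 * a) + 1) / 2"
  fix f assume f: "wL2 a f"
  note i = wL2_tail(1)[OF f a]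
  have b: "exp (a * y) * \<bar>\<integral>s. f s \<partial>lebesgue_on {y..}\<bar> \<le> ?K * wL2_norm a f" if "0 \<le> y" for y
    by (rule abs_integral_tail_le[OF f a that integrable_lebesgue_on_subset[OF i]]) (use that in auto)
  have e: "- f y = 0 * (\<integral>s. f s \<partial>lebesgue_on {y..}) + (- 1) * f y" for y by simp
  have k: "a + 0 \<noteq> 0" using a by simp
  have b0: "\<bar>\<integral>s. f s \<partial>lebesgue_on {0..}\<bar> \<le> ?K * wL2_norm a f" using b[of 0] by simp
  note E = weighted_energy_estimate[OF weak_deriv_tail[OF i] e f k b0 b]
  show "wL2 a (\<lambda>y. \<integral>s. f s \<partial>lebesgue_on {y..}) \<and>
      wL2_norm a (\<lambda>y. \<integral>s. f s \<partial>lebesgue_on {y..}) \<le> (?K / sqrt \<bar>a + 0\<bar> + \<bar>- 1\<bar> / \<bar>a + 0\<bar>) * wL2_norm a f"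
    using E(1,2) by (simp add: distrib_right)
qed

text \<open>Variation of constants for \<open>F' = c * (f - F)\<close> with initial value
  \<open>x\<close>; here \<open>c\<close> stands for the inverse of an eigenvalue.\<close>

definition forward_sol :: "real \<Rightarrow> real \<Rightarrow> (real \<Rightarrow> real) \<Rightarrow> real \<Rightarrow> real" where
  "forward_sol c x f y = exp (- y * c) * x + c * (\<integral>s. exp ((s - y) * c) * f s \<partial>lebesgue_on {0..y})"

text \<open>The same equation integrated from infinity; for negative \<open>c\<close> this selects
  the decaying solution.\<close>

definition backward_sol :: "real \<Rightarrow> (real \<Rightarrow> real) \<Rightarrow> real \<Rightarrow> real" where
  "backward_sol c f y = - (c * (\<integral>s. exp ((s - y) * c) * f s \<partial>lebesgue_on {y..}))"

lemma exp_shift: "exp ((s - y) * c) * t = exp (- c * y) * (exp (c * s) * t)" for s y c t :: real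
proof -
  have "(s - y) * c = - c * y + c * s" by (simp add: algebra_simps)
  then show ?thesis by (simp only: exp_add mult.assoc)
qed

text \<open>Moving the dependence on \<open>y\<close> out of the integrand leaves a primitive or a
  tail of \<open>exp (c * s) * f s\<close>, which is differentiated by the rules above.\<close>

lemma integral_exp_shift:
  fixes f :: "real \<Rightarrow> real"
  shows "(\<integral>s. exp ((s - y) * c) * f s \<partial>M) = exp (- c * y) * (\<integral>s. exp (c * s) * f s \<partial>M)"
  by (simp only: exp_shift integral_mult_right_zero)

lemma integrable_exp_mult:
  fixes f :: "real \<Rightarrow> real"
  assumes "integrable (lebesgue_on S) f" "\<And>s. s \<in> S \<Longrightarrow> c * s \<le> K"
  shows "integrable (lebesgue_on S) (\<lambda>s. exp (c * s) * f s)"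
proof (rule Bochner_Integration.integrable_bound)
  show "integrable (lebesgue_on S) (\<lambda>s. exp K * f s)" using assms by simp
  show "(\<lambda>s. exp (c * s) * f s) \<in> borel_measurable (lebesgue_on S)"
    by (rule borel_measurable_times[OF exp_measurable_lebesgue_on borel_measurable_integrable[OF assms(1)]])
  show "AE s in lebesgue_on S. norm (exp (c * s) * f s) \<le> norm (exp K * f s)"
    using assms(2) by (intro AE_I2) (simp add: abs_mult mult_right_mono)
qed

lemma integrable_exp_shift:
  fixes f :: "real \<Rightarrow> real"
  assumes "integrable (lebesgue_on S) f" "\<And>s. s \<in> S \<Longrightarrow> c * s \<le> K"
  shows "integrable (lebesgue_on S) (\<lambda>s. exp ((s - y) * c) * f s)"
  unfolding exp_shift by (rule integrable_mult_right) (rule integrable_exp_mult[OF assms])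

lemma integrable_exp_forward:
  fixes f :: "real \<Rightarrow> real"
  assumes "integrable (lebesgue_on {0..y}) f"
  shows "integrable (lebesgue_on {0..y}) (\<lambda>s. exp ((s - t) * c) * f s)"
proof (rule integrable_exp_shift[OF assms])
  show "c * s \<le> \<bar>c\<bar> * y" if "s \<in> {0..y}" for s
    using that by (intro mult_mono) auto
qed

lemma integrable_exp_backward:
  fixes f :: "real \<Rightarrow> real"
  assumes "integrable (lebesgue_on {y..}) f" "c \<le> 0"
  shows "integrable (lebesgue_on {y..}) (\<lambda>s. exp ((s - t) * c) * f s)"
proof (rule integrable_exp_shift[OF assms(1)])
  show "c * s \<le> c * y" if "s \<in> {y..}" for s
    using that assms by (intro mult_left_mono_neg) auto
qed

lemma weak_deriv_forward_sol:
  assumes f: "\<And>y. 0 \<le> y \<Longrightarrow> integrable (lebesgue_on {0..y}) f"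
  shows "weak_deriv (forward_sol c x f) (\<lambda>y. c * (f y - forward_sol c x f y))"
    and "forward_sol c x f 0 = x"
proof -
  have i: "integrable (lebesgue_on {0..y}) (\<lambda>s. exp (c * s) * f s)" if "0 \<le> y" for y
    using integrable_exp_forward[OF f[OF that], of 0 c] by (simp add: mult.commute)
  let ?P = "\<lambda>y. x + c * (\<integral>s. exp (c * s) * f s \<partial>lebesgue_on {0..y})"
  have w: "weak_deriv ?P (\<lambda>y. 0 + c * (exp (c * y) * f y))"
    by (intro weak_deriv_add weak_deriv_const weak_deriv_cmult weak_deriv_indefinite i)
  have eq: "forward_sol c x f y = exp (- c * y) * ?P y" for y
    unfolding forward_sol_def integral_exp_shift by (simp add: algebra_simps)
  have "exp (- c * y) * (- c * ?P y + (0 + c * (exp (c * y) * f y))) = c * (f y - forward_sol c x f y)" for y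
    unfolding eq by (simp add: algebra_simps exp_minus)
  then show "weak_deriv (forward_sol c x f) (\<lambda>y. c * (f y - forward_sol c x f y))"
    by (intro weak_deriv_congI[OF weak_deriv_exp_mult[OF w, of "- c"]]) (simp_all only: eq)
  have "(\<integral>s. exp ((s - 0) * c) * f s \<partial>lebesgue_on {0..0}) = 0"
    using integral_lebesgue_on_split(1)[OF order_refl order_refl integrable_exp_forward[OF f[OF order_refl], of 0 c]]
    by linarith
  then show "forward_sol c x f 0 = x" by (simp add: forward_sol_def del: atLeastAtMost_singleton)
qed

text \<open>After multiplication by \<open>exp (c * y)\<close> the derivative no longer contains
  \<open>F\<close>, so the initial value determines the function.\<close>

lemma forward_sol_unique:
  assumes F: "weak_deriv F D" and D: "\<And>y. 0 \<le> y \<Longrightarrow> D y = c * (f y - F y)" and y: "0 \<le> y"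
  shows "F y = forward_sol c (F 0) f y"
proof -
  have "exp (c * s) * (c * F s + D s) = c * (exp (c * s) * f s)" if "0 \<le> s" for s
    by (simp add: D[OF that] algebra_simps)
  then have w: "weak_deriv (\<lambda>y. exp (c * y) * F y) (\<lambda>s. c * (exp (c * s) * f s))"
    by (intro weak_deriv_congI[OF weak_deriv_exp_mult[OF F, of c]]) simp_all
  have "exp (- c * y) * (exp (c * y) * F y) =
      exp (- c * y) * (F 0 + c * (\<integral>s. exp (c * s) * f s \<partial>lebesgue_on {0..y}))"
    using weak_derivD(2)[OF w y] by simp
  then show ?thesis unfolding forward_sol_def integral_exp_shift by (simp add: algebra_simps exp_minus)
qed

lemma weak_deriv_backward_sol:
  assumes f: "integrable (lebesgue_on {0..}) f" and c: "c \<le> 0"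
  shows "weak_deriv (backward_sol c f) (\<lambda>y. c * (f y - backward_sol c f y))"
proof -
  have i: "integrable (lebesgue_on {0..}) (\<lambda>s. exp (c * s) * f s)"
    using integrable_exp_backward[OF f c, of 0] by (simp add: mult.commute)
  let ?P = "\<lambda>y. - c * (\<integral>s. exp (c * s) * f s \<partial>lebesgue_on {y..})"
  have w: "weak_deriv ?P (\<lambda>y. - c * - (exp (c * y) * f y))"
    by (intro weak_deriv_cmult weak_deriv_tail i)
  have eq: "backward_sol c f y = exp (- c * y) * ?P y" for y
    unfolding backward_sol_def integral_exp_shift by (simp add: algebra_simps)
  have "exp (- c * y) * (- c * ?P y + - c * - (exp (c * y) * f y)) = c * (f y - backward_sol c f y)" for y
    unfolding eq by (simp add: algebra_simps exp_minus)
  then show "weak_deriv (backward_sol c f) (\<lambda>y. c * (f y - backward_sol c f y))"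
    by (intro weak_deriv_congI[OF weak_deriv_exp_mult[OF w, of "- c"]]) (simp_all only: eq)
qed

text \<open>Since \<open>c\<close> is not positive, the factor \<open>exp (c * y)\<close> is at most
  1. The product \<open>exp (c * y) * F y\<close> therefore still decays, and its known derivative
  determines it as a tail integral.\<close>

lemma backward_sol_unique:
  assumes F: "weak_deriv F D" and D: "\<And>y. 0 \<le> y \<Longrightarrow> D y = c * (f y - F y)" and y: "0 \<le> y"
    and f: "integrable (lebesgue_on {0..}) f" and c: "c \<le> 0" and lim: "(F \<longlongrightarrow> 0) at_top"
  shows "F y = backward_sol c f y"
proof -
  have "exp (c * s) * (c * F s + D s) = c * (exp (c * s) * f s)" if "0 \<le> s" for s
    by (simp add: D[OF that] algebra_simps)
  then have w: "weak_deriv (\<lambda>y. exp (c * y) * F y) (\<lambda>s. c * (exp (c * s) * f s))"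
    by (intro weak_deriv_congI[OF weak_deriv_exp_mult[OF F, of c]]) simp_all
  have i: "integrable (lebesgue_on {0..}) (\<lambda>s. exp (c * s) * f s)"
    using integrable_exp_backward[OF f c, of 0] by (simp add: mult.commute)
  have l: "((\<lambda>y. exp (c * y) * F y) \<longlongrightarrow> 0) at_top"
  proof (rule Lim_null_comparison)
    show "\<forall>\<^sub>F y in at_top. norm (exp (c * y) * F y) \<le> \<bar>F y\<bar>"
      using eventually_ge_at_top[of 0]
    proof eventually_elim
      case (elim y)
      then have "exp (c * y) \<le> 1" using c by (simp add: mult_nonpos_nonneg)
      then show ?case using mult_right_mono[of "exp (c * y)" 1 "\<bar>F y\<bar>"] by (simp add: abs_mult)
    qed
    show "((\<lambda>y. \<bar>F y\<bar>) \<longlongrightarrow> 0) at_top" by (rule tendsto_rabs_zero[OF lim])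
  qed
  have "exp (- c * y) * (exp (c * y) * F y) =
      exp (- c * y) * - (c * (\<integral>s. exp (c * s) * f s \<partial>lebesgue_on {y..}))"
    using weak_deriv_eq_tail[OF w _ l y] i by simp
  then show ?thesis unfolding backward_sol_def integral_exp_shift by (simp add: algebra_simps exp_minus)
qed

text \<open>The weighted coefficient is \<open>a - c\<close>, negative exactly because
  \<open>a < c\<close>. The initial value \<open>x\<close> alone then controls the homogeneous part,
  and the supremum hypothesis of the energy estimate is vacuous.\<close>

lemma forward_sol_bound:
  assumes a: "0 < a" "a < c"
  shows "\<exists>C. \<forall>x f. wL2 a f \<longrightarrow> wL2 a (forward_sol c x f) \<and>
      wL2_norm a (forward_sol c x f) \<le> C * (wL2_norm a f + \<bar>x\<bar>)"
    and "wL2 a f \<Longrightarrow> (forward_sol c x f \<longlongrightarrow> 0) at_top"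
proof -
  have *: "wL2 a (forward_sol c x f)" (is ?A)
    "wL2_norm a (forward_sol c x f) \<le> \<bar>x\<bar> / sqrt (c - a) + \<bar>c\<bar> / (c - a) * wL2_norm a f" (is ?B)
    "(forward_sol c x f \<longlongrightarrow> 0) at_top" (is ?C) if f: "wL2 a f" for x f
  proof -
    have i: "integrable (lebesgue_on {0..y}) f" for y
      by (rule integrable_lebesgue_on_subset[OF wL2_tail(1)[OF f a(1)]]) auto
    have e: "c * (f y - forward_sol c x f y) = - c * forward_sol c x f y + c * f y" for y
      by (simp add: algebra_simps)
    have k: "a + - c \<noteq> 0" "\<bar>a + - c\<bar> = c - a" using a by auto
    have x: "\<bar>forward_sol c x f 0\<bar> \<le> \<bar>x\<bar>" by (simp add: weak_deriv_forward_sol(2)[OF i])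
    have M: "exp (a * y) * \<bar>forward_sol c x f y\<bar> \<le> \<bar>x\<bar>" if "0 < a + - c" for y using that a by simp
    note E = weighted_energy_estimate[OF weak_deriv_forward_sol(1)[OF i] e f k(1) x M]
    show ?A by (rule E(1))
    show ?B using E(2) by (simp only: k(2))
    show ?C using E(3) a(1) by blast
  qed
  show "\<exists>C. \<forall>x f. wL2 a f \<longrightarrow> wL2 a (forward_sol c x f) \<and>
      wL2_norm a (forward_sol c x f) \<le> C * (wL2_norm a f + \<bar>x\<bar>)"
  proof (intro exI allI impI conjI)
    fix x f assume f: "wL2 a f"
    show "wL2 a (forward_sol c x f)" by (rule *(1)[OF f])
    have p: "0 \<le> 1 / sqrt (c - a)" "0 \<le> \<bar>c\<bar> / (c - a)" using a by auto
    have "0 \<le> 1 / sqrt (c - a) * wL2_norm a f" "0 \<le> \<bar>c\<bar> / (c - a) * \<bar>x\<bar>"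
      by (intro mult_nonneg_nonneg p; simp)+
    then show "wL2_norm a (forward_sol c x f) \<le> (1 / sqrt (c - a) + \<bar>c\<bar> / (c - a)) * (wL2_norm a f + \<bar>x\<bar>)"
      using *(2)[OF f, of x] by (simp add: distrib_left distrib_right)
  qed
  show "wL2 a f \<Longrightarrow> (forward_sol c x f \<longlongrightarrow> 0) at_top" by (rule *(3))
qed

text \<open>Here the weighted coefficient \<open>a - c\<close> is positive, and the supremum is
  bounded through the tail estimate since the kernel is at most 1. The bound on the value at 0 is
  recorded as well: the boundary condition needs the outgoing data of these modes in terms of the
  norm of \<open>f\<close>.\<close>

lemma backward_sol_bound:
  assumes a: "0 < a" and c: "c < 0"
  shows "\<exists>C. \<forall>f. wL2 a f \<longrightarrow> wL2 a (backward_sol c f) \<and>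
      wL2_norm a (backward_sol c f) \<le> C * wL2_norm a f \<and> \<bar>backward_sol c f 0\<bar> \<le> C * wL2_norm a f"
    and "wL2 a f \<Longrightarrow> (backward_sol c f \<longlongrightarrow> 0) at_top"
proof -
  define K where "K = \<bar>c\<bar> * ((1 / (2 * a) + 1) / 2)"
  have *: "wL2 a (backward_sol c f)" (is ?A)
    "wL2_norm a (backward_sol c f) \<le> K * wL2_norm a f / sqrt (a - c) + \<bar>c\<bar> / (a - c) * wL2_norm a f" (is ?B)
    "(backward_sol c f \<longlongrightarrow> 0) at_top" (is ?C) "\<bar>backward_sol c f 0\<bar> \<le> K * wL2_norm a f" (is ?D)
    if f: "wL2 a f" for f
  proof -
    note i = wL2_tail(1)[OF f a]
    have e: "c * (f y - backward_sol c f y) = - c * backward_sol c f y + c * f y" for y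
      by (simp add: algebra_simps)
    have k: "a + - c \<noteq> 0" "\<bar>a + - c\<bar> = a - c" using a c by auto
    have M: "exp (a * y) * \<bar>backward_sol c f y\<bar> \<le> K * wL2_norm a f" if y: "0 \<le> y" for y
    proof -
      have "exp (a * y) * \<bar>\<integral>s. exp ((s - y) * c) * f s \<partial>lebesgue_on {y..}\<bar> \<le> (1 / (2 * a) + 1) / 2 * wL2_norm a f"
      proof (rule abs_integral_tail_le[OF f a y])
        show "integrable (lebesgue_on {y..}) (\<lambda>s. exp ((s - y) * c) * f s)"
          by (rule integrable_exp_backward[OF integrable_lebesgue_on_subset[OF i]]) (use y c in auto)
        show "\<bar>exp ((s - y) * c) * f s\<bar> \<le> \<bar>f s\<bar>" if "y \<le> s" for s
        proof -
          have "exp ((s - y) * c) \<le> 1" using that c by (simp add: mult_nonneg_nonpos)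
          then show ?thesis
            using mult_right_mono[of "exp ((s - y) * c)" 1 "\<bar>f s\<bar>"] by (simp add: abs_mult)
        qed
      qed
      then have "\<bar>c\<bar> * (exp (a * y) * \<bar>\<integral>s. exp ((s - y) * c) * f s \<partial>lebesgue_on {y..}\<bar>) \<le> \<bar>c\<bar> * ((1 / (2 * a) + 1) / 2 * wL2_norm a f)"
        by (rule mult_left_mono) simp
      then show ?thesis by (simp add: backward_sol_def K_def abs_mult mult_ac)
    qed
    have x: ?D using M[of 0] by simp
    then show ?D .
    note E = weighted_energy_estimate[OF weak_deriv_backward_sol[OF i less_imp_le[OF c]] e f k(1) x M]
    show ?A by (rule E(1))
    show ?B using E(2) by (simp only: k(2))
    show ?C using E(3) a by blast
  qed
  have K: "0 \<le> K" using a by (simp add: K_def)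
  show "\<exists>C. \<forall>f. wL2 a f \<longrightarrow> wL2 a (backward_sol c f) \<and>
      wL2_norm a (backward_sol c f) \<le> C * wL2_norm a f \<and> \<bar>backward_sol c f 0\<bar> \<le> C * wL2_norm a f"
  proof (intro exI allI impI conjI)
    let ?C = "K / sqrt (a - c) + \<bar>c\<bar> / (a - c) + K"
    fix f assume f: "wL2 a f"
    show "wL2 a (backward_sol c f)" by (rule *(1)[OF f])
    have p: "0 \<le> K / sqrt (a - c)" "0 \<le> \<bar>c\<bar> / (a - c)"
      by (rule divide_nonneg_nonneg; use a c K in simp)+
    have q: "0 \<le> K * wL2_norm a f" "0 \<le> K / sqrt (a - c) * wL2_norm a f" "0 \<le> \<bar>c\<bar> / (a - c) * wL2_norm a f"
      by (intro mult_nonneg_nonneg p K; simp)+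
    then show "wL2_norm a (backward_sol c f) \<le> ?C * wL2_norm a f"
      using *(2)[OF f] by (simp add: distrib_right)
    show "\<bar>backward_sol c f 0\<bar> \<le> ?C * wL2_norm a f"
      using *(4)[OF f] q by (simp add: distrib_right)
  qed
  show "wL2 a f \<Longrightarrow> (backward_sol c f \<longlongrightarrow> 0) at_top" by (rule *(3))
qed

text \<open>A nonzero multiple of an exponential vanishes nowhere, so norm 0 would make the
  half-line a null set. This recovers an initial value from a norm, although point values are in
  general invisible to it.\<close>

lemma exp_wL2_norm_zero:
  assumes "wL2_norm a (\<lambda>y. exp (c * y) * x) = 0" "wL2 a (\<lambda>y. exp (c * y) * x)"
  shows "x = 0"
proof (rule ccontr)
  assume x: "x \<noteq> 0"
  have "(\<integral>y. exp (2 * a * y) * (exp (c * y) * x)\<^sup>2 \<partial>lebesgue_on {0..}) = 0"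
    using assms(1) wL2_norm_square[of a "\<lambda>y. exp (c * y) * x"] by simp
  then have "AE y in lebesgue_on {0..}. exp (2 * a * y) * (exp (c * y) * x)\<^sup>2 = 0"
    using assms(2) by (subst (asm) integral_nonneg_eq_0_iff_AE) (auto simp: wL2_def)
  then have "AE y in lebesgue_on {(0::real)..}. y \<notin> {0..}"
    by (rule eventually_mono) (use x in simp)
  then have "{0..} \<in> null_sets (lebesgue_on {(0::real)..})"
    by (subst AE_iff_null_sets) auto
  then have "{(0::real)..} \<in> null_sets lebesgue"
    by (subst (asm) null_sets_restrict_space) auto
  then have "{(0::real)..1} \<in> null_sets lebesgue"
    by (rule null_sets_subset) auto
  then show False by (auto simp: null_sets_def)
qed

section \<open>Vector-valued functions\<close>

lemma wL2_congI:
  assumes "wL2 a f" "\<And>y. 0 \<le> y \<Longrightarrow> f y = g y"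
  shows "wL2 a g"
  using wL2_cong(1)[of f g a] assms by blast

lemma mult_mat_vec_index:
  assumes "A \<in> carrier_mat k n" "v \<in> carrier_vec n" "i < k"
  shows "(A *\<^sub>v v) $ i = (\<Sum>j<n. A $$ (i, j) * v $ j)"
  using assms by (simp add: scalar_prod_def lessThan_atLeast0)

lemma scalar_prod_self:
  fixes v :: "real Matrix.vec"
  assumes "v \<in> carrier_vec n"
  shows "v \<bullet> v = (\<Sum>i<n. (v $ i)\<^sup>2)"
  using assms by (simp add: scalar_prod_def lessThan_atLeast0 power2_eq_square)

lemma weighted_L2_iff:
  "weighted_L2 a n f \<longleftrightarrow> (\<forall>y\<ge>0. f y \<in> carrier_vec n) \<and> (\<forall>i<n. wL2 a (\<lambda>y. f y $ i))"
  (is "?L \<longleftrightarrow> ?c \<and> ?R")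
proof (cases ?c)
  case True
  have eq: "exp (2 * a * y) * (f y \<bullet> f y) = (\<Sum>i<n. exp (2 * a * y) * (f y $ i)\<^sup>2)" if "0 \<le> y" for y
    using True that by (subst scalar_prod_self[of _ n]) (auto simp: sum_distrib_left)
  have int: "integrable (lebesgue_on {0..}) (\<lambda>y. exp (2 * a * y) * (f y \<bullet> f y)) \<longleftrightarrow>
      integrable (lebesgue_on {0..}) (\<lambda>y. \<Sum>i<n. exp (2 * a * y) * (f y $ i)\<^sup>2)"
    by (rule Bochner_Integration.integrable_cong) (auto simp: eq)
  show ?thesis
  proof
    assume L: ?L
    have "wL2 a (\<lambda>y. f y $ i)" if i: "i < n" for i
    proof (rule wL2_dominated(1))
      show "integrable (lebesgue_on {0..}) (\<lambda>y. \<Sum>i<n. exp (2 * a * y) * (f y $ i)\<^sup>2)"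
        using L int by (simp add: weighted_L2_def)
      show "(\<lambda>y. f y $ i) \<in> borel_measurable (lebesgue_on {0..})"
        using L i by (simp add: weighted_L2_def)
      show "exp (2 * a * y) * (f y $ i)\<^sup>2 \<le> (\<Sum>i<n. exp (2 * a * y) * (f y $ i)\<^sup>2)" for y
        using i by (intro member_le_sum) auto
    qed
    with True show "?c \<and> ?R" by simp
  next
    assume "?c \<and> ?R"
    then show ?L using int unfolding weighted_L2_def wL2_def by auto
  qed
next
  case False
  then show ?thesis by (auto simp: weighted_L2_def)
qed

lemma weighted_norm_square:
  assumes "weighted_L2 a n f"
  shows "(weighted_norm a f)\<^sup>2 = (\<Sum>i<n. (wL2_norm a (\<lambda>y. f y $ i))\<^sup>2)"
proof -
  have c: "\<forall>y\<ge>0. f y \<in> carrier_vec n" and w: "\<And>i. i < n \<Longrightarrow> wL2 a (\<lambda>y. f y $ i)"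
    using assms by (auto simp: weighted_L2_iff)
  have nn: "0 \<le> f y \<bullet> f y" if "0 \<le> y" for y
    using c that by (simp add: scalar_prod_self[of _ n] sum_nonneg)
  have "(weighted_norm a f)\<^sup>2 = (\<integral>y. exp (2 * a * y) * (f y \<bullet> f y) \<partial>lebesgue_on {0..})"
    unfolding weighted_norm_def by (intro real_sqrt_pow2 integral_nonneg_AE AE_I2) (simp add: nn)
  also have "\<dots> = (\<integral>y. (\<Sum>i<n. exp (2 * a * y) * (f y $ i)\<^sup>2) \<partial>lebesgue_on {0..})"
    by (rule Bochner_Integration.integral_cong[OF refl]) (use c in \<open>auto simp: scalar_prod_self sum_distrib_left\<close>)
  also have "\<dots> = (\<Sum>i<n. \<integral>y. exp (2 * a * y) * (f y $ i)\<^sup>2 \<partial>lebesgue_on {0..})"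
    by (rule Bochner_Integration.integral_sum) (use w in \<open>auto simp: wL2_def\<close>)
  finally show ?thesis by (simp add: wL2_norm_square)
qed

lemma weighted_norm_nonneg: "weighted_L2 a n f \<Longrightarrow> 0 \<le> weighted_norm a f"
  unfolding weighted_norm_def weighted_L2_def
  by (intro real_sqrt_ge_zero integral_nonneg_AE AE_I2) (auto simp: scalar_prod_self[of _ n] sum_nonneg)

lemma wL2_norm_le_weighted_norm:
  assumes "weighted_L2 a n f" "i < n"
  shows "wL2_norm a (\<lambda>y. f y $ i) \<le> weighted_norm a f"
proof (rule power2_le_imp_le[OF _ weighted_norm_nonneg[OF assms(1)]])
  show "(wL2_norm a (\<lambda>y. f y $ i))\<^sup>2 \<le> (weighted_norm a f)\<^sup>2"
    unfolding weighted_norm_square[OF assms(1)]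
    using assms(2) by (intro member_le_sum[of i "{..<n}" "\<lambda>i. (wL2_norm a (\<lambda>y. f y $ i))\<^sup>2"]) auto
qed

text \<open>The Euclidean norm of the vector of component norms is at most their sum.\<close>

lemma weighted_norm_le_sum:
  assumes "weighted_L2 a n f"
  shows "weighted_norm a f \<le> (\<Sum>i<n. wL2_norm a (\<lambda>y. f y $ i))"
proof (rule power2_le_imp_le)
  have "(\<Sum>i\<in>I. (g i)\<^sup>2) \<le> (\<Sum>i\<in>I. g i)\<^sup>2" if "finite I" "\<And>i. 0 \<le> g i" for I and g :: "nat \<Rightarrow> real"
    using that
  proof (induction I rule: finite_induct)
    case (insert i I)
    then have "0 \<le> g i * sum g I" by (intro mult_nonneg_nonneg sum_nonneg) auto
    with insert show ?case by (simp add: power2_sum)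
  qed simp
  then show "(weighted_norm a f)\<^sup>2 \<le> (\<Sum>i<n. wL2_norm a (\<lambda>y. f y $ i))\<^sup>2"
    unfolding weighted_norm_square[OF assms] by simp
qed (simp add: sum_nonneg)

lemma has_weak_derivative_iff:
  "has_weak_derivative n F D \<longleftrightarrow> (\<forall>y\<ge>0. F y \<in> carrier_vec n \<and> D y \<in> carrier_vec n) \<and>
     (\<forall>i<n. weak_deriv (\<lambda>y. F y $ i) (\<lambda>y. D y $ i))"
proof -
  have "F y = F 0 + vec_integral n {0..y} D \<longleftrightarrow>
      (\<forall>i<n. F y $ i = F 0 $ i + (\<integral>s. D s $ i \<partial>lebesgue_on {0..y}))"
    if "F y \<in> carrier_vec n" "F 0 \<in> carrier_vec n" for y
    using that by (auto simp: vec_integral_def Matrix.vec_eq_iff)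
  note eq = this
  show ?thesis
  proof (cases "\<forall>y\<ge>0. F y \<in> carrier_vec n \<and> D y \<in> carrier_vec n")
    case True
    then have "has_weak_derivative n F D \<longleftrightarrow> (\<forall>y\<ge>0. (\<forall>i<n. integrable (lebesgue_on {0..y}) (\<lambda>s. D s $ i)) \<and>
        F y = F 0 + vec_integral n {0..y} D)"
      unfolding has_weak_derivative_def vec_integrable_def by blast
    also have "\<dots> \<longleftrightarrow> (\<forall>y\<ge>0. \<forall>i<n. integrable (lebesgue_on {0..y}) (\<lambda>s. D s $ i) \<and>
        F y $ i = F 0 $ i + (\<integral>s. D s $ i \<partial>lebesgue_on {0..y}))"
      using True eq[of _] by (metis order_refl)
    also have "\<dots> \<longleftrightarrow> (\<forall>i<n. weak_deriv (\<lambda>y. F y $ i) (\<lambda>y. D y $ i))"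
      unfolding weak_deriv_def by blast
    finally show ?thesis using True by blast
  next
    case False
    then show ?thesis unfolding has_weak_derivative_def by blast
  qed
qed

lemma weighted_L2_mult:
  assumes M: "M \<in> carrier_mat k n" and f: "weighted_L2 a n f"
  shows "weighted_L2 a k (\<lambda>y. M *\<^sub>v f y)"
proof -
  have "wL2 a (\<lambda>y. (M *\<^sub>v f y) $ i)" if i: "i < k" for i
  proof -
    have w: "wL2 a (\<lambda>y. \<Sum>j<n. M $$ (i, j) * f y $ j)"
      using f by (intro wL2_sum wL2_cmult) (auto simp: weighted_L2_iff)
    have c: "f y \<in> carrier_vec n" if "0 \<le> y" for y using f that by (simp add: weighted_L2_iff)
    show ?thesis by (rule wL2_congI[OF w]) (rule mult_mat_vec_index[OF M c i, symmetric])
  qed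
  then show ?thesis using M f by (auto simp: weighted_L2_iff)
qed

lemma weighted_L2_add:
  assumes "weighted_L2 a n f" "weighted_L2 a n g"
  shows "weighted_L2 a n (\<lambda>y. f y + g y)"
proof -
  have "wL2 a (\<lambda>y. (f y + g y) $ i)" if i: "i < n" for i
  proof -
    have w: "wL2 a (\<lambda>y. f y $ i + g y $ i)"
      using assms i by (intro wL2_add) (auto simp: weighted_L2_iff)
    have c: "g y \<in> carrier_vec n" if "0 \<le> y" for y using assms(2) that by (simp add: weighted_L2_iff)
    show ?thesis by (rule wL2_congI[OF w]) (use carrier_vecD[OF c] i in simp)
  qed
  then show ?thesis using assms by (auto simp: weighted_L2_iff)
qed

lemma uminus_vec_conv_mult:
  fixes v :: "real Matrix.vec"
  shows "v \<in> carrier_vec n \<Longrightarrow> - v = (- 1\<^sub>m n) *\<^sub>v v"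
  by (rule eq_vecI) auto

lemma weighted_L2_cong:
  assumes "\<And>y. 0 \<le> y \<Longrightarrow> f y = g y"
  shows "weighted_L2 a n f \<longleftrightarrow> weighted_L2 a n g"
proof -
  have "wL2 a (\<lambda>y. f y $ i) \<longleftrightarrow> wL2 a (\<lambda>y. g y $ i)" for i
    by (rule wL2_cong(1)) (simp add: assms)
  then show ?thesis using assms by (auto simp: weighted_L2_iff)
qed

lemma weighted_L2_uminus:
  assumes "weighted_L2 a n f"
  shows "weighted_L2 a n (\<lambda>y. - f y)"
proof -
  have "weighted_L2 a n (\<lambda>y. (- 1\<^sub>m n) *\<^sub>v f y)"
    by (rule weighted_L2_mult[OF _ assms]) simp
  then show ?thesis
    by (rule weighted_L2_cong[THEN iffD1, rotated]) (use assms in \<open>auto simp: weighted_L2_def uminus_vec_conv_mult\<close>)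
qed

lemma weighted_L2_minus:
  assumes "weighted_L2 a n f" "weighted_L2 a n g"
  shows "weighted_L2 a n (\<lambda>y. f y - g y)"
  by (rule weighted_L2_cong[THEN iffD1, OF _ weighted_L2_add[OF assms(1) weighted_L2_uminus[OF assms(2)]]])
    (use assms in \<open>auto simp: weighted_L2_def\<close>)

lemma has_weak_derivative_cong:
  assumes "has_weak_derivative n F D" "\<And>y. 0 \<le> y \<Longrightarrow> F y = F' y" "\<And>y. 0 \<le> y \<Longrightarrow> D y = D' y"
  shows "has_weak_derivative n F' D'"
proof -
  have "weak_deriv (\<lambda>y. F' y $ i) (\<lambda>y. D' y $ i)" if "i < n" for i
    by (rule weak_deriv_congI[of "\<lambda>y. F y $ i" "\<lambda>y. D y $ i"])
      (use assms that in \<open>simp_all add: has_weak_derivative_iff\<close>)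
  then show ?thesis using assms by (auto simp: has_weak_derivative_iff)
qed

lemma has_weak_derivative_mult:
  assumes M: "M \<in> carrier_mat k n" and F: "has_weak_derivative n F D"
  shows "has_weak_derivative k (\<lambda>y. M *\<^sub>v F y) (\<lambda>y. M *\<^sub>v D y)"
proof -
  have c: "\<And>y. 0 \<le> y \<Longrightarrow> F y \<in> carrier_vec n" "\<And>y. 0 \<le> y \<Longrightarrow> D y \<in> carrier_vec n"
    and w: "\<And>i. i < n \<Longrightarrow> weak_deriv (\<lambda>y. F y $ i) (\<lambda>y. D y $ i)"
    using F by (auto simp: has_weak_derivative_iff)
  have "weak_deriv (\<lambda>y. (M *\<^sub>v F y) $ i) (\<lambda>y. (M *\<^sub>v D y) $ i)" if i: "i < k" for i
  proof (rule weak_deriv_congI)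
    show "weak_deriv (\<lambda>y. \<Sum>j<n. M $$ (i, j) * F y $ j) (\<lambda>y. \<Sum>j<n. M $$ (i, j) * D y $ j)"
      by (intro weak_deriv_sum weak_deriv_cmult w) simp
  qed (simp_all only: mult_mat_vec_index[OF M c(1) i] mult_mat_vec_index[OF M c(2) i])
  then show ?thesis using M c by (auto simp: has_weak_derivative_iff)
qed

lemma has_weak_derivative_add:
  assumes F: "has_weak_derivative n F D" and G: "has_weak_derivative n G E"
  shows "has_weak_derivative n (\<lambda>y. F y + G y) (\<lambda>y. D y + E y)"
proof -
  have "weak_deriv (\<lambda>y. (F y + G y) $ i) (\<lambda>y. (D y + E y) $ i)" if i: "i < n" for i
  proof (rule weak_deriv_congI)
    show "weak_deriv (\<lambda>y. F y $ i + G y $ i) (\<lambda>y. D y $ i + E y $ i)"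
      using F G i by (intro weak_deriv_add) (auto simp: has_weak_derivative_iff)
  qed (use F G i in \<open>auto simp: has_weak_derivative_iff\<close>)
  then show ?thesis using F G by (auto simp: has_weak_derivative_iff)
qed

lemma has_weak_derivative_minus:
  assumes F: "has_weak_derivative n F D" and G: "has_weak_derivative n G E"
  shows "has_weak_derivative n (\<lambda>y. F y - G y) (\<lambda>y. D y - E y)"
proof -
  have "has_weak_derivative n (\<lambda>y. F y + (- 1\<^sub>m n) *\<^sub>v G y) (\<lambda>y. D y + (- 1\<^sub>m n) *\<^sub>v E y)"
    by (intro has_weak_derivative_add[OF F] has_weak_derivative_mult[OF _ G]) simp
  then show ?thesis
    by (rule has_weak_derivative_cong) (use F G in \<open>auto simp: has_weak_derivative_iff uminus_vec_conv_mult[symmetric] minus_add_uminus_vec[of _ n]\<close>)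
qed

lemma tends_to_zero_cong:
  assumes "tends_to_zero n f" "\<And>y. 0 \<le> y \<Longrightarrow> f y = g y"
  shows "tends_to_zero n g"
  unfolding tends_to_zero_def
proof (intro allI impI)
  fix i assume "i < n"
  then have "((\<lambda>y. f y $ i) \<longlongrightarrow> 0) at_top" using assms by (simp add: tends_to_zero_def)
  then show "((\<lambda>y. g y $ i) \<longlongrightarrow> 0) at_top"
    by (rule Lim_transform_eventually)
      (use assms(2) in \<open>auto intro!: eventually_mono[OF eventually_ge_at_top[of 0]]\<close>)
qed

lemma tends_to_zero_mult:
  assumes M: "M \<in> carrier_mat k n" and c: "\<And>y. 0 \<le> y \<Longrightarrow> f y \<in> carrier_vec n" and f: "tends_to_zero n f"
  shows "tends_to_zero k (\<lambda>y. M *\<^sub>v f y)"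
  unfolding tends_to_zero_def
proof (intro allI impI)
  fix i assume i: "i < k"
  have "((\<lambda>y. \<Sum>j<n. M $$ (i, j) * f y $ j) \<longlongrightarrow> (\<Sum>j<n. M $$ (i, j) * 0)) at_top"
    using f by (intro tendsto_sum tendsto_mult tendsto_const) (auto simp: tends_to_zero_def)
  then have "((\<lambda>y. \<Sum>j<n. M $$ (i, j) * f y $ j) \<longlongrightarrow> 0) at_top" by simp
  then show "((\<lambda>y. (M *\<^sub>v f y) $ i) \<longlongrightarrow> 0) at_top"
    by (rule Lim_transform_eventually)
      (auto intro!: eventually_mono[OF eventually_ge_at_top[of 0]] mult_mat_vec_index[OF M c i, symmetric]
        simp del: index_mult_mat_vec)
qed

lemma tends_to_zero_add:
  assumes "tends_to_zero n f" "tends_to_zero n g" "\<And>y. 0 \<le> y \<Longrightarrow> g y \<in> carrier_vec n"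
  shows "tends_to_zero n (\<lambda>y. f y + g y)"
  unfolding tends_to_zero_def
proof (intro allI impI)
  fix i assume i: "i < n"
  have "((\<lambda>y. f y $ i + g y $ i) \<longlongrightarrow> 0) at_top"
    using assms i by (auto simp: tends_to_zero_def intro: tendsto_add_zero)
  moreover have "\<forall>\<^sub>F y in at_top. f y $ i + g y $ i = (f y + g y) $ i"
    using eventually_ge_at_top[of 0] by eventually_elim (use carrier_vecD[OF assms(3)] i in simp)
  ultimately show "((\<lambda>y. (f y + g y) $ i) \<longlongrightarrow> 0) at_top"
    by (rule Lim_transform_eventually)
qed

lemma tends_to_zero_minus:
  assumes "tends_to_zero n f" "tends_to_zero n g" "\<And>y. 0 \<le> y \<Longrightarrow> g y \<in> carrier_vec n"
  shows "tends_to_zero n (\<lambda>y. f y - g y)"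
  unfolding tends_to_zero_def
proof (intro allI impI)
  fix i assume i: "i < n"
  have "((\<lambda>y. f y $ i - g y $ i) \<longlongrightarrow> 0 - 0) at_top"
    using assms i by (intro tendsto_diff) (auto simp: tends_to_zero_def)
  then have "((\<lambda>y. f y $ i - g y $ i) \<longlongrightarrow> 0) at_top" by simp
  moreover have "\<forall>\<^sub>F y in at_top. f y $ i - g y $ i = (f y - g y) $ i"
    using eventually_ge_at_top[of 0] by eventually_elim (use carrier_vecD[OF assms(3)] i in simp)
  ultimately show "((\<lambda>y. (f y - g y) $ i) \<longlongrightarrow> 0) at_top"
    by (rule Lim_transform_eventually)
qed

lemma vec_integral_carrier [simp]: "vec_integral n S f \<in> carrier_vec n"
  by (simp add: vec_integral_def)

lemma vec_integral_mult:
  assumes M: "M \<in> carrier_mat k n" and f: "vec_integrable n S f" "\<And>s. s \<in> S \<Longrightarrow> f s \<in> carrier_vec n"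
  shows "vec_integrable k S (\<lambda>s. M *\<^sub>v f s)"
    and "vec_integral k S (\<lambda>s. M *\<^sub>v f s) = M *\<^sub>v vec_integral n S f"
proof -
  have i: "integrable (lebesgue_on S) (\<lambda>s. (M *\<^sub>v f s) $ i) \<longleftrightarrow>
      integrable (lebesgue_on S) (\<lambda>s. \<Sum>j<n. M $$ (i, j) * f s $ j)" if "i < k" for i
    by (rule Bochner_Integration.integrable_cong) (simp_all only: space_lebesgue_on mult_mat_vec_index[OF M f(2) that])
  have e: "(\<integral>s. (M *\<^sub>v f s) $ i \<partial>lebesgue_on S) =
      (\<integral>s. (\<Sum>j<n. M $$ (i, j) * f s $ j) \<partial>lebesgue_on S)" if "i < k" for i
    by (rule Bochner_Integration.integral_cong) (simp_all only: space_lebesgue_on mult_mat_vec_index[OF M f(2) that])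
  show "vec_integrable k S (\<lambda>s. M *\<^sub>v f s)"
    using f(1) unfolding vec_integrable_def by (auto simp: i simp del: index_mult_mat_vec)
  show "vec_integral k S (\<lambda>s. M *\<^sub>v f s) = M *\<^sub>v vec_integral n S f"
  proof (rule eq_vecI)
    fix j assume "j < dim_vec (M *\<^sub>v vec_integral n S f)"
    then have j: "j < k" using M by simp
    have "vec_integral k S (\<lambda>s. M *\<^sub>v f s) $ j = (\<integral>s. (\<Sum>l<n. M $$ (j, l) * f s $ l) \<partial>lebesgue_on S)"
      using e[OF j] j by (simp add: vec_integral_def del: index_mult_mat_vec)
    also have "\<dots> = (\<Sum>l<n. M $$ (j, l) * (\<integral>s. f s $ l \<partial>lebesgue_on S))"
      using f(1) by (subst Bochner_Integration.integral_sum) (auto simp: vec_integrable_def)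
    also have "\<dots> = (M *\<^sub>v vec_integral n S f) $ j"
      by (subst mult_mat_vec_index[OF M _ j]) (auto simp: vec_integral_def)
    finally show "vec_integral k S (\<lambda>s. M *\<^sub>v f s) $ j = (M *\<^sub>v vec_integral n S f) $ j" .
  qed (use M in \<open>simp add: vec_integral_def\<close>)
qed

lemma vec_integral_cong:
  assumes "\<And>s. s \<in> S \<Longrightarrow> f s = g s"
  shows "vec_integrable n S f \<longleftrightarrow> vec_integrable n S g" "vec_integral n S f = vec_integral n S g"
proof -
  have "integrable (lebesgue_on S) (\<lambda>s. f s $ i) \<longleftrightarrow> integrable (lebesgue_on S) (\<lambda>s. g s $ i)" for i
    by (rule Bochner_Integration.integrable_cong) (auto simp: assms)
  then show "vec_integrable n S f \<longleftrightarrow> vec_integrable n S g" by (simp add: vec_integrable_def)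
  have "(\<integral>s. f s $ i \<partial>lebesgue_on S) = (\<integral>s. g s $ i \<partial>lebesgue_on S)" for i
    by (rule Bochner_Integration.integral_cong) (auto simp: assms)
  then show "vec_integral n S f = vec_integral n S g" by (simp add: vec_integral_def)
qed

lemma vec_integral_uminus:
  "vec_integral n S (\<lambda>s. - f s) = - vec_integral n S f" if "\<And>s. s \<in> S \<Longrightarrow> f s \<in> carrier_vec n"
proof (rule eq_vecI)
  fix i assume "i < dim_vec (- vec_integral n S f)"
  then have i: "i < n" by (simp add: vec_integral_def)
  have "(\<integral>s. (- f s) $ i \<partial>lebesgue_on S) = (\<integral>s. - f s $ i \<partial>lebesgue_on S)"
    by (rule Bochner_Integration.integral_cong) (use carrier_vecD[OF that] i in simp_all)
  then show "vec_integral n S (\<lambda>s. - f s) $ i = (- vec_integral n S f) $ i"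
    using i by (simp add: vec_integral_def)
qed (simp add: vec_integral_def)

lemma weighted_L2_vec_integrable:
  assumes "weighted_L2 a n f" "0 < a" "0 \<le> y"
  shows "vec_integrable n {y..} f"
  unfolding vec_integrable_def
proof (intro allI impI)
  fix i assume "i < n"
  then have "integrable (lebesgue_on {0..}) (\<lambda>s. f s $ i)"
    using assms wL2_tail(1)[OF _ assms(2)] by (simp add: weighted_L2_iff)
  then show "integrable (lebesgue_on {y..}) (\<lambda>s. f s $ i)"
    by (rule integrable_lebesgue_on_subset) (use assms in auto)
qed

lemma vec_tail_weak_derivative:
  assumes f: "weighted_L2 a n f" and a: "0 < a"
  shows "has_weak_derivative n (\<lambda>y. vec_integral n {y..} f) (\<lambda>y. - f y)"
    and "tends_to_zero n (\<lambda>y. vec_integral n {y..} f)"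
proof -
  have i: "integrable (lebesgue_on {0..}) (\<lambda>s. f s $ i)" if "i < n" for i
    using f that wL2_tail(1)[OF _ a] by (simp add: weighted_L2_iff)
  have "weak_deriv (\<lambda>y. vec_integral n {y..} f $ i) (\<lambda>y. (- f y) $ i)" if j: "i < n" for i
    by (rule weak_deriv_congI[OF weak_deriv_tail[OF i[OF j]]])
      (use f j in \<open>auto simp: vec_integral_def weighted_L2_def\<close>)
  then show "has_weak_derivative n (\<lambda>y. vec_integral n {y..} f) (\<lambda>y. - f y)"
    using f by (auto simp: has_weak_derivative_iff weighted_L2_def)
  show "tends_to_zero n (\<lambda>y. vec_integral n {y..} f)"
    unfolding tends_to_zero_def using tendsto_integral_lebesgue_on_at_top(2)[OF i]
    by (auto simp: vec_integral_def)
qed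

lemma has_weak_derivative_eq_tail:
  assumes F: "has_weak_derivative n F D" and D: "weighted_L2 a n D" and a: "0 < a"
    and lim: "tends_to_zero n F" and y: "0 \<le> y"
  shows "F y = - vec_integral n {y..} D"
proof (rule eq_vecI)
  fix i assume "i < dim_vec (- vec_integral n {y..} D)"
  then have i: "i < n" by (simp add: vec_integral_def)
  have "F y $ i = - (\<integral>s. D s $ i \<partial>lebesgue_on {y..})"
    by (rule weak_deriv_eq_tail[OF _ _ _ y])
      (use F D lim i wL2_tail(1)[OF _ a] in \<open>auto simp: has_weak_derivative_iff weighted_L2_iff tends_to_zero_def\<close>)
  then show "F y $ i = (- vec_integral n {y..} D) $ i" using i by (simp add: vec_integral_def)
next
  have "F y \<in> carrier_vec n" using F y by (auto simp: has_weak_derivative_iff)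
  then show "dim_vec (F y) = dim_vec (- vec_integral n {y..} D)" by (simp add: vec_integral_def)
qed

text \<open>Estimates whose constant is chosen before the data \<open>d\<close>: \<open>P\<close> says that \<open>d\<close> is admissible, and
  \<open>\<nu> d\<close> measures its size.\<close>

definition bounded_family ::
    "real \<Rightarrow> nat \<Rightarrow> ('d \<Rightarrow> bool) \<Rightarrow> ('d \<Rightarrow> real) \<Rightarrow> ('d \<Rightarrow> real \<Rightarrow> real Matrix.vec) \<Rightarrow> bool" where
  "bounded_family a n P \<nu> f \<longleftrightarrow> (\<forall>d. P d \<longrightarrow> 0 \<le> \<nu> d) \<and> (\<exists>C. \<forall>d. P d \<longrightarrow>
     weighted_L2 a n (f d) \<and> (\<forall>i<n. wL2_norm a (\<lambda>y. f d y $ i) \<le> C * \<nu> d))"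

text \<open>The constants may be found one component at a time; the sum of their absolute values
  serves all components, because \<open>\<nu>\<close> is nonnegative.\<close>

lemma bounded_familyI:
  assumes "\<And>d y. P d \<Longrightarrow> 0 \<le> y \<Longrightarrow> f d y \<in> carrier_vec n"
    and \<nu>: "\<And>d. P d \<Longrightarrow> 0 \<le> \<nu> d"
    and "\<And>i. i < n \<Longrightarrow> \<exists>C. \<forall>d. P d \<longrightarrow> wL2 a (\<lambda>y. f d y $ i) \<and> wL2_norm a (\<lambda>y. f d y $ i) \<le> C * \<nu> d"
  shows "bounded_family a n P \<nu> f"
proof -
  have "\<forall>i. \<exists>C. i < n \<longrightarrow> (\<forall>d. P d \<longrightarrow> wL2 a (\<lambda>y. f d y $ i) \<and> wL2_norm a (\<lambda>y. f d y $ i) \<le> C * \<nu> d)"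
    using assms(3) by blast
  from choice[OF this] obtain C where
    C: "\<And>i d. i < n \<Longrightarrow> P d \<Longrightarrow> wL2 a (\<lambda>y. f d y $ i) \<and> wL2_norm a (\<lambda>y. f d y $ i) \<le> C i * \<nu> d"
    by blast
  have "wL2_norm a (\<lambda>y. f d y $ i) \<le> (\<Sum>i<n. \<bar>C i\<bar>) * \<nu> d" if "i < n" "P d" for i d
  proof -
    have "C i \<le> \<bar>C i\<bar>" by simp
    also have "\<dots> \<le> (\<Sum>i<n. \<bar>C i\<bar>)" using that by (intro member_le_sum) auto
    finally have "C i * \<nu> d \<le> (\<Sum>i<n. \<bar>C i\<bar>) * \<nu> d" by (rule mult_right_mono[OF _ \<nu>[OF that(2)]])
    then show ?thesis using C[OF that] by linarith
  qed
  then show ?thesis unfolding bounded_family_def weighted_L2_iff using assms(1) C \<nu> by blast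
qed

lemma bounded_familyD:
  assumes "bounded_family a n P \<nu> f"
  shows "P d \<Longrightarrow> weighted_L2 a n (f d)"
    and "\<exists>C. \<forall>d. P d \<longrightarrow> weighted_norm a (f d) \<le> C * \<nu> d"
proof -
  obtain C where C: "\<And>d. P d \<Longrightarrow> weighted_L2 a n (f d)"
    "\<And>d i. P d \<Longrightarrow> i < n \<Longrightarrow> wL2_norm a (\<lambda>y. f d y $ i) \<le> C * \<nu> d"
    using assms unfolding bounded_family_def by blast
  show "P d \<Longrightarrow> weighted_L2 a n (f d)" by (rule C)
  have "weighted_norm a (f d) \<le> (n * C) * \<nu> d" if "P d" for d
  proof -
    have "weighted_norm a (f d) \<le> (\<Sum>i<n. wL2_norm a (\<lambda>y. f d y $ i))"
      by (rule weighted_norm_le_sum[OF C(1)[OF that]])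
    also have "\<dots> \<le> (\<Sum>i<n. C * \<nu> d)"
      by (intro sum_mono C(2)[OF that]) simp
    finally show ?thesis by simp
  qed
  then show "\<exists>C. \<forall>d. P d \<longrightarrow> weighted_norm a (f d) \<le> C * \<nu> d" by blast
qed

lemma bounded_family_cong:
  assumes "bounded_family a n P \<nu> f" "\<And>d y. P d \<Longrightarrow> 0 \<le> y \<Longrightarrow> f d y = g d y"
  shows "bounded_family a n P \<nu> g"
proof -
  have "weighted_L2 a n (f d) \<longleftrightarrow> weighted_L2 a n (g d)"
    "\<And>i. wL2_norm a (\<lambda>y. f d y $ i) = wL2_norm a (\<lambda>y. g d y $ i)" if "P d" for d
    using assms(2)[OF that] by (auto intro!: weighted_L2_cong wL2_cong)
  then show ?thesis using assms(1) unfolding bounded_family_def by auto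
qed

lemma bounded_family_add:
  assumes "bounded_family a n P \<nu> f" "bounded_family a n P \<nu> g"
  shows "bounded_family a n P \<nu> (\<lambda>d y. f d y + g d y)"
proof -
  obtain C where C: "\<And>d. P d \<Longrightarrow> weighted_L2 a n (f d)"
    "\<And>d i. P d \<Longrightarrow> i < n \<Longrightarrow> wL2_norm a (\<lambda>y. f d y $ i) \<le> C * \<nu> d"
    using assms(1) unfolding bounded_family_def by blast
  obtain C' where C': "\<And>d. P d \<Longrightarrow> weighted_L2 a n (g d)"
    "\<And>d i. P d \<Longrightarrow> i < n \<Longrightarrow> wL2_norm a (\<lambda>y. g d y $ i) \<le> C' * \<nu> d"
    using assms(2) unfolding bounded_family_def by blast
  have "wL2_norm a (\<lambda>y. (f d y + g d y) $ i) \<le> (2 * (C + C')) * \<nu> d" if d: "P d" and i: "i < n" for d i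
  proof -
    have "wL2_norm a (\<lambda>y. (f d y + g d y) $ i) = wL2_norm a (\<lambda>y. f d y $ i + g d y $ i)"
      by (rule wL2_cong(2)) (use C(1)[OF d] C'(1)[OF d] i in \<open>auto simp: weighted_L2_def\<close>)
    also have "\<dots> \<le> 2 * (wL2_norm a (\<lambda>y. f d y $ i) + wL2_norm a (\<lambda>y. g d y $ i))"
      by (rule wL2_add) (use C(1)[OF d] C'(1)[OF d] i in \<open>auto simp: weighted_L2_iff\<close>)
    finally show ?thesis using C(2)[OF d i] C'(2)[OF d i] by (simp add: distrib_right)
  qed
  then show ?thesis
    using assms(1) weighted_L2_add[OF C(1) C'(1)] unfolding bounded_family_def by blast
qed

lemma bounded_family_mult:
  assumes M: "M \<in> carrier_mat k n" and f: "bounded_family a n P \<nu> f"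
  shows "bounded_family a k P \<nu> (\<lambda>d y. M *\<^sub>v f d y)"
proof -
  obtain C where C: "\<And>d. P d \<Longrightarrow> weighted_L2 a n (f d)"
    "\<And>d i. P d \<Longrightarrow> i < n \<Longrightarrow> wL2_norm a (\<lambda>y. f d y $ i) \<le> C * \<nu> d"
    using f unfolding bounded_family_def by blast
  \<comment> \<open>Induction on the number of summands, because each use of \<open>wL2_add\<close>
    costs a factor 2. The constant built in this way depends on the coefficients but not on
    \<open>d\<close>.\<close>
  have sum: "\<exists>K. \<forall>d. P d \<longrightarrow> wL2_norm a (\<lambda>y. \<Sum>j<l. c j * f d y $ j) \<le> K * \<nu> d" if "l \<le> n" for l and c :: "nat \<Rightarrow> real"
    using that
  proof (induction l)
    case 0
    show ?case by (intro exI[of _ 0]) (simp add: wL2_zero)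
  next
    case (Suc l)
    then obtain K where K: "\<And>d. P d \<Longrightarrow> wL2_norm a (\<lambda>y. \<Sum>j<l. c j * f d y $ j) \<le> K * \<nu> d" by auto
    have "wL2_norm a (\<lambda>y. \<Sum>j<Suc l. c j * f d y $ j) \<le> (2 * (K + \<bar>c l\<bar> * C)) * \<nu> d" if d: "P d" for d
    proof -
      have w: "wL2 a (\<lambda>y. f d y $ j)" if "j < n" for j using C(1)[OF d] that by (simp add: weighted_L2_iff)
      have wl: "wL2 a (\<lambda>y. f d y $ l)" using Suc.prems by (intro w) simp
      have "wL2_norm a (\<lambda>y. \<Sum>j<Suc l. c j * f d y $ j) \<le>
          2 * (wL2_norm a (\<lambda>y. \<Sum>j<l. c j * f d y $ j) + wL2_norm a (\<lambda>y. c l * f d y $ l))"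
        unfolding sum.lessThan_Suc
        by (rule wL2_add) (use Suc.prems in \<open>auto intro!: wL2_sum wL2_cmult w\<close>)
      also have "wL2_norm a (\<lambda>y. c l * f d y $ l) = \<bar>c l\<bar> * wL2_norm a (\<lambda>y. f d y $ l)"
        by (rule wL2_cmult(2)[OF wl])
      also have "\<dots> \<le> \<bar>c l\<bar> * (C * \<nu> d)"
        using Suc.prems by (intro mult_left_mono C(2)[OF d]) auto
      finally show ?thesis using K[OF d] by (simp add: algebra_simps)
    qed
    then show ?case by blast
  qed
  have "\<exists>K. \<forall>d. P d \<longrightarrow> wL2_norm a (\<lambda>y. (M *\<^sub>v f d y) $ i) \<le> K * \<nu> d" if i: "i < k" for i
  proof -
    have "wL2_norm a (\<lambda>y. (M *\<^sub>v f d y) $ i) = wL2_norm a (\<lambda>y. \<Sum>j<n. M $$ (i, j) * f d y $ j)" if "P d" for d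
      by (rule wL2_cong(2), rule mult_mat_vec_index[OF M _ i]) (use C(1)[OF that] in \<open>auto simp: weighted_L2_def\<close>)
    moreover obtain K where "\<forall>d. P d \<longrightarrow> wL2_norm a (\<lambda>y. \<Sum>j<n. M $$ (i, j) * f d y $ j) \<le> K * \<nu> d"
      using sum[of n "\<lambda>j. M $$ (i, j)"] by blast
    ultimately show ?thesis by (intro exI[of _ K] allI impI) (simp only:)
  qed
  note K = this
  have W: "weighted_L2 a k (\<lambda>y. M *\<^sub>v f d y)" if "P d" for d
    by (rule weighted_L2_mult[OF M C(1)[OF that]])
  show ?thesis
  proof (rule bounded_familyI)
    show "0 \<le> \<nu> d" if "P d" for d using f that by (simp add: bounded_family_def)
    show "M *\<^sub>v f d y \<in> carrier_vec k" if "P d" "0 \<le> y" for d y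
      by (rule carrier_vecI) (use M in simp)
    show "\<exists>C. \<forall>d. P d \<longrightarrow> wL2 a (\<lambda>y. (M *\<^sub>v f d y) $ i) \<and> wL2_norm a (\<lambda>y. (M *\<^sub>v f d y) $ i) \<le> C * \<nu> d"
      if "i < k" for i
      using K[OF that] W that unfolding weighted_L2_iff by blast
  qed
qed

lemma bounded_family_minus:
  assumes f: "bounded_family a n P \<nu> f" and g: "bounded_family a n P \<nu> g"
  shows "bounded_family a n P \<nu> (\<lambda>d y. f d y - g d y)"
proof (rule bounded_family_cong)
  show "bounded_family a n P \<nu> (\<lambda>d y. f d y + (- 1\<^sub>m n) *\<^sub>v g d y)"
    by (intro bounded_family_add[OF f] bounded_family_mult[OF _ g]) simp
  show "f d y + (- 1\<^sub>m n) *\<^sub>v g d y = f d y - g d y" if "P d" "0 \<le> y" for d y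
  proof -
    have "f d y \<in> carrier_vec n" "g d y \<in> carrier_vec n"
      using bounded_familyD(1)[OF f that(1)] bounded_familyD(1)[OF g that(1)] that(2)
      by (auto simp: weighted_L2_def)
    then show ?thesis by (simp add: uminus_vec_conv_mult[symmetric] minus_add_uminus_vec[of _ n])
  qed
qed

lemma bounded_family_tail:
  assumes f: "bounded_family a n P \<nu> f" and a: "0 < a"
  shows "bounded_family a n P \<nu> (\<lambda>d y. vec_integral n {y..} (f d))"
proof (rule bounded_familyI)
  obtain C where C: "\<And>d. P d \<Longrightarrow> weighted_L2 a n (f d)"
    "\<And>d i. P d \<Longrightarrow> i < n \<Longrightarrow> wL2_norm a (\<lambda>y. f d y $ i) \<le> C * \<nu> d"
    using f unfolding bounded_family_def by blast
  from wL2_tail_op[OF a] obtain K where K: "\<forall>g. wL2 a g \<longrightarrow> wL2 a (\<lambda>y. \<integral>s. g s \<partial>lebesgue_on {y..}) \<and>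
      wL2_norm a (\<lambda>y. \<integral>s. g s \<partial>lebesgue_on {y..}) \<le> K * wL2_norm a g" ..
  fix i assume i: "i < n"
  have "wL2 a (\<lambda>y. vec_integral n {y..} (f d) $ i) \<and>
      wL2_norm a (\<lambda>y. vec_integral n {y..} (f d) $ i) \<le> (\<bar>K\<bar> * C) * \<nu> d" if d: "P d" for d
  proof -
    have w: "wL2 a (\<lambda>y. f d y $ i)" using C(1)[OF d] i by (simp add: weighted_L2_iff)
    have "K * wL2_norm a (\<lambda>y. f d y $ i) \<le> \<bar>K\<bar> * wL2_norm a (\<lambda>y. f d y $ i)"
      by (intro mult_right_mono) auto
    also have "\<dots> \<le> \<bar>K\<bar> * (C * \<nu> d)" by (intro mult_left_mono C d i) auto
    finally show ?thesis using K[rule_format, OF w] i by (simp add: vec_integral_def)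
  qed
  then show "\<exists>C. \<forall>d. P d \<longrightarrow> wL2 a (\<lambda>y. vec_integral n {y..} (f d) $ i) \<and>
      wL2_norm a (\<lambda>y. vec_integral n {y..} (f d) $ i) \<le> C * \<nu> d" by (intro exI allI impI)
qed (use f in \<open>auto simp: bounded_family_def\<close>)

section \<open>Matrices\<close>

lemma mat_vec_closed: "M \<in> carrier_mat k n \<Longrightarrow> M *\<^sub>v v \<in> carrier_vec k"
  by (rule carrier_vecI) simp

lemma mult_mat_vec_uminus:
  fixes M :: "real mat"
  assumes "M \<in> carrier_mat k n" "v \<in> carrier_vec n"
  shows "M *\<^sub>v (- v) = - (M *\<^sub>v v)"
  using assms by (intro eq_vecI) auto

lemma minus_cancel_vec:
  fixes u v :: "real Matrix.vec"
  shows "u \<in> carrier_vec n \<Longrightarrow> v \<in> carrier_vec n \<Longrightarrow> u + v - u = v"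
  by (intro eq_vecI) auto

lemma mult_mat_vec_zero:
  fixes M :: "real mat"
  assumes "M \<in> carrier_mat k n"
  shows "M *\<^sub>v 0\<^sub>v n = 0\<^sub>v k"
  using assms by (intro eq_vecI) auto

lemma injective_imp_inverse:
  fixes M :: "real mat"
  assumes M: "M \<in> carrier_mat n n"
    and inj: "\<And>x. x \<in> carrier_vec n \<Longrightarrow> M *\<^sub>v x = 0\<^sub>v n \<Longrightarrow> x = 0\<^sub>v n"
  obtains Mi where "Mi \<in> carrier_mat n n" "M * Mi = 1\<^sub>m n" "Mi * M = 1\<^sub>m n"
proof -
  have "Determinant.det M \<noteq> 0" using det_0_iff_vec_prod_zero_field[OF M] inj by auto
  from det_non_zero_imp_unit[OF M this, of "()"] show thesis
    using that by (auto simp: Units_def ring_mat_simps)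
qed

lemma mult_mat_vec_assoc3:
  assumes "A \<in> carrier_mat k n" "B \<in> carrier_mat n l" "C \<in> carrier_mat l o'" "v \<in> carrier_vec o'"
  shows "(A * B * C) *\<^sub>v v = A *\<^sub>v (B *\<^sub>v (C *\<^sub>v v))"
proof -
  have "(A * B * C) *\<^sub>v v = (A * B) *\<^sub>v (C *\<^sub>v v)"
    by (rule assoc_mult_mat_vec) (use assms in auto)
  also have "\<dots> = A *\<^sub>v (B *\<^sub>v (C *\<^sub>v v))"
    by (rule assoc_mult_mat_vec) (use assms mat_vec_closed in auto)
  finally show ?thesis .
qed

lemma scalar_prod_self_eq_0:
  fixes v :: "real Matrix.vec"
  assumes "v \<in> carrier_vec n" "v \<bullet> v = 0"
  shows "v = 0\<^sub>v n"
proof (rule eq_vecI)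
  fix i assume "i < dim_vec (0\<^sub>v n :: real Matrix.vec)"
  then have i: "i < n" by simp
  have "(\<Sum>i<n. (v $ i)\<^sup>2) = 0" using assms by (simp add: scalar_prod_self)
  then have "(v $ i)\<^sup>2 = 0" using i by (subst (asm) sum_nonneg_eq_0_iff) auto
  then show "v $ i = 0\<^sub>v n $ i" using i by simp
qed (use assms in auto)

lemma orthogonal_imp_zero:
  fixes v :: "real Matrix.vec"
  assumes "v \<in> carrier_vec n" "\<And>u. u \<in> carrier_vec n \<Longrightarrow> u \<bullet> v = 0"
  shows "v = 0\<^sub>v n"
  using scalar_prod_self_eq_0[OF assms(1)] assms by blast

lemma mult_unit_vec_index:
  fixes M :: "real mat"
  assumes "M \<in> carrier_mat k n" "i < k" "j < n"
  shows "(M *\<^sub>v unit_vec n j) $ i = M $$ (i, j)"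
  using assms
  by (subst mult_mat_vec_index[OF assms(1) _ assms(2)])
    (auto simp: unit_vec_def if_distrib[of "\<lambda>x. _ * x"] sum.delta cong: if_cong)

lemma mat_eq_vecI:
  fixes A B :: "real mat"
  assumes A: "A \<in> carrier_mat k n" and B: "B \<in> carrier_mat k n"
    and eq: "\<And>v. v \<in> carrier_vec n \<Longrightarrow> A *\<^sub>v v = B *\<^sub>v v"
  shows "A = B"
proof (rule eq_matI)
  fix i j assume "i < dim_row B" "j < dim_col B"
  then have ij: "i < k" "j < n" using B by auto
  show "A $$ (i, j) = B $$ (i, j)"
    using eq[of "unit_vec n j"] mult_unit_vec_index[OF A ij] mult_unit_vec_index[OF B ij] by simp
qed (use A B in auto)

text \<open>\<open>mat_inv\<close> is defined by Gauss-Jordan elimination. An algebraic left inverse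
  shows that elimination succeeds, and uniqueness of inverses identifies its result, so later
  inverses can be exhibited instead of computed.\<close>

lemma mat_inv_eq:
  assumes M: "M \<in> carrier_mat n n" and Mi: "Mi \<in> carrier_mat n n" and inv: "Mi * M = 1\<^sub>m n"
  shows "mat_inv M = Mi" "M * Mi = 1\<^sub>m n"
proof -
  show MMi: "M * Mi = 1\<^sub>m n" by (rule mat_mult_left_right_inverse[OF Mi M inv])
  have "M \<in> Units (ring_mat TYPE(real) n ())"
    using M Mi inv MMi by (auto simp: Units_def ring_mat_simps)
  then obtain N where N: "mat_inverse M = Some N"
    using mat_inverse(1)[OF M, of "()"] by (cases "mat_inverse M") auto
  note * = mat_inverse(2)[OF M N]
  have "N = Mi * M * N" using * inv left_mult_one_mat[of N n n] by simp
  also have "\<dots> = Mi" using * M Mi assoc_mult_mat[OF Mi M, of N n] by simp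
  finally show "mat_inv M = Mi" by (simp add: mat_inv_def N)
qed

lemma append_cols_carrier:
  "A \<in> carrier_mat n k \<Longrightarrow> B \<in> carrier_mat n l \<Longrightarrow> A @\<^sub>c B \<in> carrier_mat n (k + l)"
  by (auto simp: append_cols_def)

lemma sum_lessThan_add:
  fixes f :: "nat \<Rightarrow> 'a::comm_monoid_add"
  shows "(\<Sum>j<k + l. f j) = (\<Sum>j<k. f j) + (\<Sum>j<l. f (k + j))"
  by (induction l) (simp_all add: add.assoc)

lemma append_cols_mult:
  assumes A: "A \<in> carrier_mat n k" and B: "B \<in> carrier_mat n l"
    and u: "u \<in> carrier_vec k" and w: "w \<in> carrier_vec l"
  shows "(A @\<^sub>c B) *\<^sub>v (u @\<^sub>v w) = A *\<^sub>v u + B *\<^sub>v w"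
proof (rule eq_vecI)
  note AB = append_cols_carrier[OF A B]
  fix i assume "i < dim_vec (A *\<^sub>v u + B *\<^sub>v w)"
  then have i: "i < n" using B by simp
  have "((A @\<^sub>c B) *\<^sub>v (u @\<^sub>v w)) $ i = (\<Sum>j<k + l. (A @\<^sub>c B) $$ (i, j) * (u @\<^sub>v w) $ j)"
    using u w by (intro mult_mat_vec_index[OF AB _ i]) auto
  also have "\<dots> = (\<Sum>j<k. (A @\<^sub>c B) $$ (i, j) * (u @\<^sub>v w) $ j) + (\<Sum>j<l. (A @\<^sub>c B) $$ (i, k + j) * (u @\<^sub>v w) $ (k + j))"
    by (rule sum_lessThan_add)
  also have "(\<Sum>j<k. (A @\<^sub>c B) $$ (i, j) * (u @\<^sub>v w) $ j) = (\<Sum>j<k. A $$ (i, j) * u $ j)"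
    by (rule sum.cong) (use A B u w i in \<open>auto simp: append_cols_def\<close>)
  also have "(\<Sum>j<l. (A @\<^sub>c B) $$ (i, k + j) * (u @\<^sub>v w) $ (k + j)) = (\<Sum>j<l. B $$ (i, j) * w $ j)"
    by (rule sum.cong) (use A B u w i in \<open>auto simp: append_cols_def\<close>)
  finally show "((A @\<^sub>c B) *\<^sub>v (u @\<^sub>v w)) $ i = (A *\<^sub>v u + B *\<^sub>v w) $ i"
    using i B mult_mat_vec_index[OF A u i] mult_mat_vec_index[OF B w i] by (simp del: index_mult_mat_vec)
qed (use A B in \<open>auto simp: append_cols_def\<close>)

lemma append_cols_transpose_mult:
  assumes A: "A \<in> carrier_mat n k" and B: "B \<in> carrier_mat n l" and w: "w \<in> carrier_vec n"
  shows "transpose_mat (A @\<^sub>c B) *\<^sub>v w = transpose_mat A *\<^sub>v w @\<^sub>v transpose_mat B *\<^sub>v w"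
proof (rule eq_vecI)
  fix i assume "i < dim_vec (transpose_mat A *\<^sub>v w @\<^sub>v transpose_mat B *\<^sub>v w)"
  then have i: "i < k + l" using A B by simp
  note AB = append_cols_carrier[OF A B]
  have "(transpose_mat (A @\<^sub>c B) *\<^sub>v w) $ i = (\<Sum>j<n. (A @\<^sub>c B) $$ (j, i) * w $ j)"
    using mult_mat_vec_index[of "transpose_mat (A @\<^sub>c B)" "k + l" n w i] AB w i by simp
  also have "\<dots> = (if i < k then (\<Sum>j<n. A $$ (j, i) * w $ j) else (\<Sum>j<n. B $$ (j, i - k) * w $ j))"
    using A B i by (auto simp: append_cols_def)
  also have "\<dots> = (transpose_mat A *\<^sub>v w @\<^sub>v transpose_mat B *\<^sub>v w) $ i"
    using mult_mat_vec_index[of "transpose_mat A" k n w i] mult_mat_vec_index[of "transpose_mat B" l n w "i - k"] A B w i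
    by auto
  finally show "(transpose_mat (A @\<^sub>c B) *\<^sub>v w) $ i = (transpose_mat A *\<^sub>v w @\<^sub>v transpose_mat B *\<^sub>v w) $ i" .
qed (use A B in \<open>auto simp: append_cols_def\<close>)

lemma append_cols_split:
  assumes "K \<in> carrier_mat n (k + l)"
  obtains A B where "A \<in> carrier_mat n k" "B \<in> carrier_mat n l" "K = A @\<^sub>c B"
proof
  show "mat n k (\<lambda>(i, j). K $$ (i, j)) \<in> carrier_mat n k" "mat n l (\<lambda>(i, j). K $$ (i, j + k)) \<in> carrier_mat n l"
    by simp_all
  show "K = mat n k (\<lambda>(i, j). K $$ (i, j)) @\<^sub>c mat n l (\<lambda>(i, j). K $$ (i, j + k))"
    using assms by (intro eq_matI) (auto simp: append_cols_def)
qed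

lemma adjoint_real:
  fixes M :: "real mat"
  assumes "M \<in> carrier_mat k n" "x \<in> carrier_vec n" "y \<in> carrier_vec k"
  shows "x \<bullet> (transpose_mat M *\<^sub>v y) = (M *\<^sub>v x) \<bullet> y"
  using transpose_vec_mult_scalar[OF assms] assms mat_vec_closed[OF assms(1), of x]
    mat_vec_closed[of "transpose_mat M" n k y]
  by (metis comm_scalar_prod transpose_carrier_mat)

text \<open>The determinant of the Cholesky factor is the product of its positive diagonal
  entries.\<close>

lemma lower_triangular_inverse:
  fixes L :: "real mat"
  assumes L: "L \<in> carrier_mat n n" "upper_triangular (transpose_mat L)" "\<forall>i<n. 0 < L $$ (i, i)"
  shows "mat_inv L \<in> carrier_mat n n" "mat_inv L * L = 1\<^sub>m n" "L * mat_inv L = 1\<^sub>m n"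
proof -
  have "Determinant.det (transpose_mat L) = prod_list (diag_mat (transpose_mat L))"
    using L by (intro det_upper_triangular) auto
  also have "\<dots> \<noteq> 0"
    using L by (auto simp: prod_list_zero_iff diag_mat_def)
  finally have "Determinant.det L \<noteq> 0" using det_transpose[OF L(1)] by simp
  from det_non_zero_imp_unit[OF L(1) this, of "()"] obtain Li where
    Li: "Li \<in> carrier_mat n n" "Li * L = 1\<^sub>m n" by (auto simp: Units_def ring_mat_simps)
  from mat_inv_eq[OF L(1) this] Li
  show "mat_inv L \<in> carrier_mat n n" "mat_inv L * L = 1\<^sub>m n" "L * mat_inv L = 1\<^sub>m n" by auto
qed

lemma diag_block_mat_3:
  fixes A C :: "real mat"
  assumes A: "A \<in> carrier_mat k k" "diagonal_mat A" and C: "C \<in> carrier_mat l l" "diagonal_mat C"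
  shows "diag_block_mat [A, 0\<^sub>m n n, C] = mat (k + n + l) (k + n + l) (\<lambda>(i, j). if i = j then
    (if i < k then A $$ (i, i) else if i < k + n then 0 else C $$ (i - k - n, i - k - n)) else 0)"
  using assms by (intro eq_matI) (auto simp: Let_def diagonal_mat_def)

lemma diagonal_mult_vec:
  fixes v :: "real Matrix.vec"
  assumes "v \<in> carrier_vec n" "i < n"
  shows "(mat n n (\<lambda>(i, j). if i = j then c i else 0) *\<^sub>v v) $ i = c i * v $ i"
  using assms by (subst mult_mat_vec_index[of _ n n]) (auto simp: if_distrib[of "\<lambda>x. x * _"] sum.delta cong: if_cong)

lemma diagonal_mat_inv:
  assumes A: "A \<in> carrier_mat n n" "diagonal_mat A" "\<And>i. i < n \<Longrightarrow> A $$ (i, i) \<noteq> (0 :: real)"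
  shows "mat_inv A = mat n n (\<lambda>(i, j). if i = j then 1 / A $$ (i, i) else 0)"
proof (rule mat_inv_eq(1)[OF A(1)])
  let ?D = "mat n n (\<lambda>(i, j). if i = j then 1 / A $$ (i, i) else 0)"
  show "?D * A = 1\<^sub>m n"
  proof (rule mat_eq_vecI)
    fix v :: "real Matrix.vec" assume v: "v \<in> carrier_vec n"
    have A': "A = mat n n (\<lambda>(i, j). if i = j then A $$ (i, i) else 0)"
      using A by (intro eq_matI) (auto simp: diagonal_mat_def)
    have "(?D *\<^sub>v (A *\<^sub>v v)) $ i = v $ i" if i: "i < n" for i
    proof -
      have "(?D *\<^sub>v (A *\<^sub>v v)) $ i = 1 / A $$ (i, i) * (A *\<^sub>v v) $ i"
        by (rule diagonal_mult_vec[OF mat_vec_closed[OF A(1)] i])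
      also have "(A *\<^sub>v v) $ i = A $$ (i, i) * v $ i"
        by (subst A') (rule diagonal_mult_vec[OF v i])
      finally show ?thesis using A(3)[OF i] by simp
    qed
    then have "?D *\<^sub>v (A *\<^sub>v v) = v" using v by (intro eq_vecI) auto
    then show "(?D * A) *\<^sub>v v = 1\<^sub>m n *\<^sub>v v"
      using v assoc_mult_mat_vec[of ?D n n A n v] A(1) by simp
  qed (use A in auto)
qed simp

lemma mat_exp_diagonal:
  "mat_exp (mat n n (\<lambda>(i, j). if i = j then c i else 0)) = mat n n (\<lambda>(i, j). if i = j then exp (c i) else 0)"
proof -
  let ?D = "mat n n (\<lambda>(i, j). if i = j then c i else 0)"
  have pow: "?D ^\<^sub>m k = mat n n (\<lambda>(i, j). if i = j then c i ^ k else 0)" for k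
  proof (induction k)
    case 0
    show ?case by (intro eq_matI) auto
  next
    case (Suc k)
    have "mat n n (\<lambda>(i, j). if i = j then c i ^ k else 0) * ?D = mat n n (\<lambda>(i, j). if i = j then c i ^ Suc k else 0)"
    proof (rule eq_matI)
      fix i j assume "i < dim_row (mat n n (\<lambda>(i, j). if i = j then c i ^ Suc k else 0))"
        "j < dim_col (mat n n (\<lambda>(i, j). if i = j then c i ^ Suc k else 0))"
      then have ij: "i < n" "j < n" by auto
      then have "(mat n n (\<lambda>(i, j). if i = j then c i ^ k else 0) * ?D) $$ (i, j) =
          (\<Sum>l\<in>{0..<n}. (if i = l then c i ^ k else 0) * (if l = j then c l else 0))"
        by (simp add: scalar_prod_def)
      also have "\<dots> = (\<Sum>l\<in>{0..<n}. if i = l then c i ^ k * (if l = j then c l else 0) else 0)"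
        by (rule sum.cong) auto
      also have "\<dots> = c i ^ k * (if i = j then c i else 0)" using ij by (simp add: sum.delta')
      finally show "(mat n n (\<lambda>(i, j). if i = j then c i ^ k else 0) * ?D) $$ (i, j) =
          mat n n (\<lambda>(i, j). if i = j then c i ^ Suc k else 0) $$ (i, j)" using ij by simp
    qed auto
    then show ?case using Suc by simp
  qed
  have "(\<Sum>k. c i ^ k / fact k) = exp (c i)" for i
    by (simp add: exp_def divide_inverse mult.commute)
  then show ?thesis unfolding mat_exp_def pow by (intro eq_matI) auto
qed

section \<open>The reduced system\<close>

text \<open>The system after the change of variables: \<open>S\<^sub>i\<close>, \<open>P\<^sub>i\<close> are the column blocks of a
  basis and the row blocks of its inverse, and the \<open>R\<^sub>i\<close> are the row blocks of an invertible
  matrix with left inverse \<open>[K\<^sub>1, K\<^sub>2, K\<^sub>3]\<close>, so that the equation may be tested with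
  each \<open>R\<^sub>i\<close> separately.\<close>

locale reduced_system =
  fixes a :: real and N p r m :: nat and A Q :: "real mat"
    and S1 S2 S3 P1 P2 P3 R1 R2 R3 K1 K2 K3 E Ei F Fi A22 A23 Q22 Q23 A32 Q32 Lam :: "real mat"
    and lam :: "nat \<Rightarrow> real"
  assumes carr [simp]: "A \<in> carrier_mat N N" "Q \<in> carrier_mat N N"
      "S1 \<in> carrier_mat N r" "S2 \<in> carrier_mat N p" "S3 \<in> carrier_mat N m"
      "P1 \<in> carrier_mat r N" "P2 \<in> carrier_mat p N" "P3 \<in> carrier_mat m N"
      "R1 \<in> carrier_mat p N" "R2 \<in> carrier_mat r N" "R3 \<in> carrier_mat m N"
      "K1 \<in> carrier_mat N p" "K2 \<in> carrier_mat N r" "K3 \<in> carrier_mat N m"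
      "E \<in> carrier_mat p p" "Ei \<in> carrier_mat p p" "F \<in> carrier_mat r r" "Fi \<in> carrier_mat r r"
      "A22 \<in> carrier_mat r p" "A23 \<in> carrier_mat r m" "Q22 \<in> carrier_mat r p" "Q23 \<in> carrier_mat r m"
      "A32 \<in> carrier_mat m p" "Q32 \<in> carrier_mat m p"
    and SP: "\<And>w. w \<in> carrier_vec N \<Longrightarrow> w = S1 *\<^sub>v (P1 *\<^sub>v w) + S2 *\<^sub>v (P2 *\<^sub>v w) + S3 *\<^sub>v (P3 *\<^sub>v w)"
    and PS: "\<And>u v w. u \<in> carrier_vec r \<Longrightarrow> v \<in> carrier_vec p \<Longrightarrow> w \<in> carrier_vec m \<Longrightarrow>
        P1 *\<^sub>v (S1 *\<^sub>v u + S2 *\<^sub>v v + S3 *\<^sub>v w) = u \<and>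
        P2 *\<^sub>v (S1 *\<^sub>v u + S2 *\<^sub>v v + S3 *\<^sub>v w) = v \<and>
        P3 *\<^sub>v (S1 *\<^sub>v u + S2 *\<^sub>v v + S3 *\<^sub>v w) = w"
    and KR: "\<And>w. w \<in> carrier_vec N \<Longrightarrow> w = K1 *\<^sub>v (R1 *\<^sub>v w) + K2 *\<^sub>v (R2 *\<^sub>v w) + K3 *\<^sub>v (R3 *\<^sub>v w)"
    and E: "\<And>v. v \<in> carrier_vec p \<Longrightarrow> Ei *\<^sub>v (E *\<^sub>v v) = v" "\<And>v. v \<in> carrier_vec p \<Longrightarrow> E *\<^sub>v (Ei *\<^sub>v v) = v"
    and F: "\<And>v. v \<in> carrier_vec r \<Longrightarrow> Fi *\<^sub>v (F *\<^sub>v v) = v" "\<And>v. v \<in> carrier_vec r \<Longrightarrow> F *\<^sub>v (Fi *\<^sub>v v) = v"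
    and R1A: "\<And>w. w \<in> carrier_vec N \<Longrightarrow> R1 *\<^sub>v (A *\<^sub>v w) = E *\<^sub>v (P2 *\<^sub>v w)"
    and R2A: "\<And>w. w \<in> carrier_vec N \<Longrightarrow>
        R2 *\<^sub>v (A *\<^sub>v w) = F *\<^sub>v (P1 *\<^sub>v w) + A22 *\<^sub>v (P2 *\<^sub>v w) + A23 *\<^sub>v (P3 *\<^sub>v w)"
    and R3A: "\<And>w. w \<in> carrier_vec N \<Longrightarrow> R3 *\<^sub>v (A *\<^sub>v w) = A32 *\<^sub>v (P2 *\<^sub>v w) + Lam *\<^sub>v (P3 *\<^sub>v w)"
    and R1Q: "\<And>w. w \<in> carrier_vec N \<Longrightarrow> R1 *\<^sub>v (Q *\<^sub>v w) = 0\<^sub>v p"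
    and R2Q: "\<And>w. w \<in> carrier_vec N \<Longrightarrow> R2 *\<^sub>v (Q *\<^sub>v w) = Q22 *\<^sub>v (P2 *\<^sub>v w) + Q23 *\<^sub>v (P3 *\<^sub>v w)"
    and R3Q: "\<And>w. w \<in> carrier_vec N \<Longrightarrow> R3 *\<^sub>v (Q *\<^sub>v w) = Q32 *\<^sub>v (P2 *\<^sub>v w) + P3 *\<^sub>v w"
    and Lam: "Lam = mat m m (\<lambda>(i, j). if i = j then lam i else 0)"
    and a: "0 < a" and lam: "\<And>i. i < m \<Longrightarrow> 0 < lam i \<Longrightarrow> a < 1 / lam i"
begin

lemma Lam_carrier [simp]: "Lam \<in> carrier_mat m m"
  by (simp add: Lam)

lemma Lam_index [simp]: "v \<in> carrier_vec m \<Longrightarrow> i < m \<Longrightarrow> (Lam *\<^sub>v v) $ i = lam i * v $ i"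
  by (subst mult_mat_vec_index[of _ m m]) (auto simp: Lam if_distrib[of "\<lambda>x. x * _"] sum.delta cong: if_cong)

lemma mult_closed [simp]:
  "A *\<^sub>v w \<in> carrier_vec N" "Q *\<^sub>v w \<in> carrier_vec N" "P1 *\<^sub>v w \<in> carrier_vec r" "P2 *\<^sub>v w \<in> carrier_vec p"
  "P3 *\<^sub>v w \<in> carrier_vec m" "R1 *\<^sub>v w \<in> carrier_vec p" "R2 *\<^sub>v w \<in> carrier_vec r" "R3 *\<^sub>v w \<in> carrier_vec m"
  "E *\<^sub>v w \<in> carrier_vec p" "Ei *\<^sub>v w \<in> carrier_vec p" "F *\<^sub>v w \<in> carrier_vec r" "Fi *\<^sub>v w \<in> carrier_vec r"
  "A22 *\<^sub>v w \<in> carrier_vec r" "A23 *\<^sub>v w \<in> carrier_vec r" "Q22 *\<^sub>v w \<in> carrier_vec r" "Q23 *\<^sub>v w \<in> carrier_vec r"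
  "A32 *\<^sub>v w \<in> carrier_vec m" "Q32 *\<^sub>v w \<in> carrier_vec m" "Lam *\<^sub>v w \<in> carrier_vec m"
  "S1 *\<^sub>v w \<in> carrier_vec N" "S2 *\<^sub>v w \<in> carrier_vec N" "S3 *\<^sub>v w \<in> carrier_vec N"
  "K1 *\<^sub>v w \<in> carrier_vec N" "K2 *\<^sub>v w \<in> carrier_vec N" "K3 *\<^sub>v w \<in> carrier_vec N"
  by (rule mat_vec_closed, rule carr Lam_carrier)+

lemma R_eqI:
  assumes "v \<in> carrier_vec N" "w \<in> carrier_vec N"
    and "R1 *\<^sub>v v = R1 *\<^sub>v w" "R2 *\<^sub>v v = R2 *\<^sub>v w" "R3 *\<^sub>v v = R3 *\<^sub>v w"
  shows "v = w"
  using KR[OF assms(1)] KR[OF assms(2)] assms(3-5) by simp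

text \<open>The third row with the known second component moved to the data: \<open>w\<close> stands
  for \<open>V2^T W\<close> and \<open>d\<close> for its derivative. In the moment system this is
  \<open>T^(-1) h3\<close>.\<close>

definition source :: "(real \<Rightarrow> real Matrix.vec) \<Rightarrow> (real \<Rightarrow> real Matrix.vec) \<Rightarrow> (real \<Rightarrow> real Matrix.vec) \<Rightarrow> real \<Rightarrow> real Matrix.vec" where
  "source h w d y = R3 *\<^sub>v h y - Q32 *\<^sub>v w y - A32 *\<^sub>v d y"

text \<open>Minus the derivative of \<open>R2 (A W)\<close>, with \<open>w\<close> and
  \<open>z\<close> standing for the second and third coordinates of \<open>W\<close>.\<close>

definition drift :: "(real \<Rightarrow> real Matrix.vec) \<Rightarrow> (real \<Rightarrow> real Matrix.vec) \<Rightarrow> (real \<Rightarrow> real Matrix.vec) \<Rightarrow> real \<Rightarrow> real Matrix.vec" where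
  "drift h w z y = Q22 *\<^sub>v w y + Q23 *\<^sub>v z y - R2 *\<^sub>v h y"

text \<open>An initial value can be prescribed only for positive eigenvalues: for negative ones
  decay selects the solution, and for eigenvalue 0 the equation degenerates to the algebraic
  relation \<open>z = f\<close>.\<close>

definition coord_sol :: "nat \<Rightarrow> real \<Rightarrow> (real \<Rightarrow> real) \<Rightarrow> real \<Rightarrow> real" where
  "coord_sol i x f = (if 0 < lam i then forward_sol (1 / lam i) x f
     else if lam i < 0 then backward_sol (1 / lam i) f else f)"

text \<open>The rows \<open>R1\<close>, \<open>R2\<close>, \<open>R3\<close> together have a left
  inverse, so testing loses nothing. One direction extracts the formulas from a solution, the other
  certifies the constructed one.\<close>

lemma equation_rows:
  assumes W: "W \<in> carrier_vec N" and D: "D \<in> carrier_vec N" and h: "h \<in> carrier_vec N"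
  shows "A *\<^sub>v D = - (Q *\<^sub>v W) + h \<longleftrightarrow>
    E *\<^sub>v (P2 *\<^sub>v D) = R1 *\<^sub>v h \<and>
    F *\<^sub>v (P1 *\<^sub>v D) + A22 *\<^sub>v (P2 *\<^sub>v D) + A23 *\<^sub>v (P3 *\<^sub>v D) = - (Q22 *\<^sub>v (P2 *\<^sub>v W) + Q23 *\<^sub>v (P3 *\<^sub>v W) - R2 *\<^sub>v h) \<and>
    A32 *\<^sub>v (P2 *\<^sub>v D) + Lam *\<^sub>v (P3 *\<^sub>v D) = - (Q32 *\<^sub>v (P2 *\<^sub>v W) + P3 *\<^sub>v W) + R3 *\<^sub>v h"
    (is "?L \<longleftrightarrow> ?R1 \<and> ?R2 \<and> ?R3")
proof -
  have lin: "R *\<^sub>v (- (Q *\<^sub>v W) + h) = - (R *\<^sub>v (Q *\<^sub>v W)) + R *\<^sub>v h" if "R \<in> carrier_mat k N" for R k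
  proof -
    have "R *\<^sub>v (- (Q *\<^sub>v W) + h) = R *\<^sub>v (- (Q *\<^sub>v W)) + R *\<^sub>v h"
      by (rule mult_add_distrib_mat_vec[OF that]) (use h in auto)
    also have "R *\<^sub>v (- (Q *\<^sub>v W)) = - (R *\<^sub>v (Q *\<^sub>v W))"
      by (rule mult_mat_vec_uminus[OF that]) simp
    finally show ?thesis .
  qed
  have c: "- (Q *\<^sub>v W) + h \<in> carrier_vec N" using h by simp
  have "?L \<longleftrightarrow> R1 *\<^sub>v (A *\<^sub>v D) = R1 *\<^sub>v (- (Q *\<^sub>v W) + h) \<and>
      R2 *\<^sub>v (A *\<^sub>v D) = R2 *\<^sub>v (- (Q *\<^sub>v W) + h) \<and> R3 *\<^sub>v (A *\<^sub>v D) = R3 *\<^sub>v (- (Q *\<^sub>v W) + h)"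
    using R_eqI[of "A *\<^sub>v D" "- (Q *\<^sub>v W) + h"] c by auto
  also have "R1 *\<^sub>v (A *\<^sub>v D) = R1 *\<^sub>v (- (Q *\<^sub>v W) + h) \<longleftrightarrow> ?R1"
    unfolding lin[OF carr(9)] R1A[OF D] R1Q[OF W] by simp
  also have "R2 *\<^sub>v (A *\<^sub>v D) = R2 *\<^sub>v (- (Q *\<^sub>v W) + h) \<longleftrightarrow> ?R2"
  proof -
    have "- (u + v) + w = - (u + v - w)" if "u \<in> carrier_vec r" "v \<in> carrier_vec r" "w \<in> carrier_vec r"
      for u v w :: "real Matrix.vec"
      using that by (intro eq_vecI) auto
    then show ?thesis unfolding lin[OF carr(10)] R2A[OF D] R2Q[OF W] by simp
  qed
  also have "R3 *\<^sub>v (A *\<^sub>v D) = R3 *\<^sub>v (- (Q *\<^sub>v W) + h) \<longleftrightarrow> ?R3"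
    unfolding lin[OF carr(11)] R3A[OF D] R3Q[OF W] by simp
  finally show ?thesis .
qed

section \<open>Coordinates of an arbitrary decaying solution\<close>

context
  fixes h W D
  assumes h: "weighted_L2 a N h" and W: "weighted_L2 a N W" and sol: "half_space_solution N A Q h W D"
begin

lemma sol_carrier:
  assumes "0 \<le> y" shows "h y \<in> carrier_vec N" "W y \<in> carrier_vec N" "D y \<in> carrier_vec N"
  using assms h sol by (auto simp: weighted_L2_def half_space_solution_def)

lemma sol_eqs:
  assumes y: "0 \<le> y"
  shows "P2 *\<^sub>v D y = Ei *\<^sub>v (R1 *\<^sub>v h y)" "R1 *\<^sub>v (A *\<^sub>v D y) = R1 *\<^sub>v h y"
    "R2 *\<^sub>v (A *\<^sub>v D y) = - drift h (\<lambda>y. P2 *\<^sub>v W y) (\<lambda>y. P3 *\<^sub>v W y) y"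
    "Lam *\<^sub>v (P3 *\<^sub>v D y) = source h (\<lambda>y. P2 *\<^sub>v W y) (\<lambda>y. P2 *\<^sub>v D y) y - P3 *\<^sub>v W y"
proof -
  note c = sol_carrier[OF y]
  have "A *\<^sub>v D y = - (Q *\<^sub>v W y) + h y" using sol y by (simp add: half_space_solution_def)
  note eqs = this[unfolded equation_rows[OF c(2,3,1)]]
  show "P2 *\<^sub>v D y = Ei *\<^sub>v (R1 *\<^sub>v h y)"
    using eqs E(1)[of "P2 *\<^sub>v D y"] by simp
  show "R1 *\<^sub>v (A *\<^sub>v D y) = R1 *\<^sub>v h y" unfolding R1A[OF c(3)] using eqs by simp
  show "R2 *\<^sub>v (A *\<^sub>v D y) = - drift h (\<lambda>y. P2 *\<^sub>v W y) (\<lambda>y. P3 *\<^sub>v W y) y"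
    unfolding R2A[OF c(3)] drift_def using eqs by simp
  have "u = w - q - v - z" if "v + u = - (q + z) + w" and
    "u \<in> carrier_vec m" "v \<in> carrier_vec m" "w \<in> carrier_vec m" "q \<in> carrier_vec m" "z \<in> carrier_vec m"
    for u v w q z :: "real Matrix.vec"
  proof (rule eq_vecI)
    fix i assume "i < dim_vec (w - q - v - z)"
    then have i: "i < m" using that by simp
    have "(v + u) $ i = (- (q + z) + w) $ i" by (simp only: that(1))
    with \<open>i < m\<close> show "u $ i = (w - q - v - z) $ i" using that(2-) by simp
  qed (use that in auto)
  then show "Lam *\<^sub>v (P3 *\<^sub>v D y) = source h (\<lambda>y. P2 *\<^sub>v W y) (\<lambda>y. P2 *\<^sub>v D y) y - P3 *\<^sub>v W y"
    unfolding source_def using eqs by simp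
qed

lemma sol_AW: "has_weak_derivative N (\<lambda>y. A *\<^sub>v W y) (\<lambda>y. A *\<^sub>v D y)" "tends_to_zero N (\<lambda>y. A *\<^sub>v W y)"
  using sol by (auto simp: half_space_solution_def)

lemma sol_R1h: "weighted_L2 a p (\<lambda>y. R1 *\<^sub>v h y)"
  by (rule weighted_L2_mult[OF carr(9) h])

text \<open>\<open>R1\<close> annihilates the range of \<open>Q\<close>, so the derivative of
  \<open>R1 (A W)\<close> is the datum \<open>R1 h\<close> itself; decay of \<open>A W\<close> then
  makes it a tail integral.\<close>

lemma sol_R1:
  assumes y: "0 \<le> y"
  shows "R1 *\<^sub>v (A *\<^sub>v W y) = - vec_integral p {y..} (\<lambda>s. R1 *\<^sub>v h s)"
proof (rule has_weak_derivative_eq_tail[OF _ sol_R1h a _ y])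
  show "has_weak_derivative p (\<lambda>y. R1 *\<^sub>v (A *\<^sub>v W y)) (\<lambda>s. R1 *\<^sub>v h s)"
    by (rule has_weak_derivative_cong[OF has_weak_derivative_mult[OF carr(9) sol_AW(1)] refl sol_eqs(2)])
  show "tends_to_zero p (\<lambda>y. R1 *\<^sub>v (A *\<^sub>v W y))"
    by (rule tends_to_zero_mult[OF carr(9) _ sol_AW(2)]) simp
qed

text \<open>The second coordinate is the linear image \<open>Ei (R1 (A W))\<close> of
  \<open>A W\<close> and inherits its regularity.\<close>

lemma sol_P2: "has_weak_derivative p (\<lambda>y. P2 *\<^sub>v W y) (\<lambda>y. P2 *\<^sub>v D y)"
proof (rule has_weak_derivative_cong)
  show "has_weak_derivative p (\<lambda>y. Ei *\<^sub>v (R1 *\<^sub>v (A *\<^sub>v W y))) (\<lambda>y. Ei *\<^sub>v (R1 *\<^sub>v (A *\<^sub>v D y)))"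
    by (intro has_weak_derivative_mult[of _ _ p] has_weak_derivative_mult[of _ _ N] sol_AW) auto
  show "Ei *\<^sub>v (R1 *\<^sub>v (A *\<^sub>v W y)) = P2 *\<^sub>v W y" "Ei *\<^sub>v (R1 *\<^sub>v (A *\<^sub>v D y)) = P2 *\<^sub>v D y" if "0 \<le> y" for y
    using sol_carrier[OF that] by (simp_all add: R1A E(1))
qed

lemma sol_P2_tail:
  assumes y: "0 \<le> y"
  shows "P2 *\<^sub>v W y = Ei *\<^sub>v (- vec_integral p {y..} (\<lambda>s. R1 *\<^sub>v h s))"
  using sol_R1[OF y] sol_carrier(2)[OF y] E(1)[of "P2 *\<^sub>v W y"] by (simp add: R1A)

lemma sol_source: "weighted_L2 a m (source h (\<lambda>y. P2 *\<^sub>v W y) (\<lambda>y. P2 *\<^sub>v D y))"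
proof -
  have d: "weighted_L2 a p (\<lambda>y. P2 *\<^sub>v D y)"
    by (rule weighted_L2_cong[THEN iffD2, OF sol_eqs(1)]) (simp_all add: weighted_L2_mult[OF _ sol_R1h])
  show ?thesis unfolding source_def
    by (intro weighted_L2_minus weighted_L2_mult[OF carr(11) h] weighted_L2_mult[OF carr(24) weighted_L2_mult[OF carr(7) W]]
        weighted_L2_mult[OF carr(23) d])
qed

text \<open>What is differentiable and decays is \<open>Lam (P3 W) = R3 (A W) - A32 (P2 W)\<close>,
  so each coordinate arrives multiplied by its eigenvalue. If that is nonzero, division gives a
  scalar equation whose solution is unique; if it is 0, the row is already a pointwise
  formula.\<close>

lemma sol_P3:
  assumes i: "i < m" and y: "0 \<le> y"
  shows "(P3 *\<^sub>v W y) $ i = coord_sol i ((P3 *\<^sub>v W 0) $ i)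
    (\<lambda>y. source h (\<lambda>y. P2 *\<^sub>v W y) (\<lambda>y. P2 *\<^sub>v D y) y $ i) y"
proof -
  define f where "f = (\<lambda>y. source h (\<lambda>y. P2 *\<^sub>v W y) (\<lambda>y. P2 *\<^sub>v D y) y $ i)"
  define z where "z = (\<lambda>y. (P3 *\<^sub>v W y) $ i)"
  define \<delta> where "\<delta> = (\<lambda>y. (P3 *\<^sub>v D y) $ i)"
  have f: "wL2 a f" using sol_source i by (simp add: weighted_L2_iff f_def)
  have lz: "weak_deriv (\<lambda>y. lam i * z y) (\<lambda>y. lam i * \<delta> y)" and lim: "((\<lambda>y. lam i * z y) \<longlongrightarrow> 0) at_top"
  proof -
    have eq: "Lam *\<^sub>v (P3 *\<^sub>v v) = R3 *\<^sub>v (A *\<^sub>v v) - A32 *\<^sub>v (P2 *\<^sub>v v)" if "v \<in> carrier_vec N" for v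
      unfolding R3A[OF that] by (rule minus_cancel_vec[of _ m, symmetric]) simp_all
    have "has_weak_derivative m (\<lambda>y. Lam *\<^sub>v (P3 *\<^sub>v W y)) (\<lambda>y. Lam *\<^sub>v (P3 *\<^sub>v D y))"
    proof (rule has_weak_derivative_cong)
      show "has_weak_derivative m (\<lambda>y. R3 *\<^sub>v (A *\<^sub>v W y) - A32 *\<^sub>v (P2 *\<^sub>v W y)) (\<lambda>y. R3 *\<^sub>v (A *\<^sub>v D y) - A32 *\<^sub>v (P2 *\<^sub>v D y))"
        by (intro has_weak_derivative_minus has_weak_derivative_mult[OF carr(11) sol_AW(1)] has_weak_derivative_mult[OF carr(23) sol_P2])
    qed (simp_all add: eq sol_carrier)
    then show "weak_deriv (\<lambda>y. lam i * z y) (\<lambda>y. lam i * \<delta> y)"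
      using i by (simp add: has_weak_derivative_iff z_def \<delta>_def del: index_mult_mat_vec)
    have P2AW: "tends_to_zero p (\<lambda>y. P2 *\<^sub>v W y)"
    proof (rule tends_to_zero_cong)
      show "tends_to_zero p (\<lambda>y. Ei *\<^sub>v (R1 *\<^sub>v (A *\<^sub>v W y)))"
        by (intro tends_to_zero_mult[of _ _ p] tends_to_zero_mult[of _ _ N] sol_AW) auto
      show "Ei *\<^sub>v (R1 *\<^sub>v (A *\<^sub>v W y)) = P2 *\<^sub>v W y" if "0 \<le> y" for y
        using sol_carrier[OF that] by (simp_all add: R1A E(1))
    qed
    have "tends_to_zero m (\<lambda>y. Lam *\<^sub>v (P3 *\<^sub>v W y))"
    proof (rule tends_to_zero_cong)
      show "tends_to_zero m (\<lambda>y. R3 *\<^sub>v (A *\<^sub>v W y) - A32 *\<^sub>v (P2 *\<^sub>v W y))"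
        by (intro tends_to_zero_minus tends_to_zero_mult[OF carr(11) _ sol_AW(2)] tends_to_zero_mult[OF carr(23) _ P2AW]) auto
    qed (simp add: eq sol_carrier)
    then show "((\<lambda>y. lam i * z y) \<longlongrightarrow> 0) at_top"
      using i by (simp add: tends_to_zero_def z_def del: index_mult_mat_vec)
  qed
  have eq: "lam i * \<delta> y = f y - z y" if "0 \<le> y" for y
    using arg_cong[OF sol_eqs(4)[OF that], of "\<lambda>v. v $ i"] i carrier_vecD[OF mult_closed(5), of "W y"]
    by (simp add: f_def z_def \<delta>_def del: index_mult_mat_vec dim_mult_mat_vec)
  show ?thesis
  proof (cases "lam i = 0")
    case True
    then show ?thesis using eq[OF y] by (simp add: coord_sol_def z_def f_def del: index_mult_mat_vec)
  next
    case False
    have w: "weak_deriv z \<delta>"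
      using weak_deriv_cmult[OF lz, of "1 / lam i"] False by simp
    have d: "\<delta> y = 1 / lam i * (f y - z y)" if "0 \<le> y" for y
      using eq[OF that] False by (simp add: field_simps)
    have l: "(z \<longlongrightarrow> 0) at_top"
      using tendsto_mult[OF tendsto_const[of "1 / lam i"] lim] False by simp
    have "z y = coord_sol i (z 0) f y"
      using forward_sol_unique[OF w d y] backward_sol_unique[OF w d y wL2_tail(1)[OF f a] _ l] False
      by (simp add: coord_sol_def)
    then show ?thesis by (simp add: z_def f_def del: index_mult_mat_vec)
  qed
qed

text \<open>The first coordinate need not be differentiable, since \<open>A23\<close> may feed zero
  modes into it. The combination \<open>R2 (A W)\<close> is differentiable and decays; it is
  integrated from infinity and then solved for \<open>P1 W\<close> by means of
  \<open>Fi\<close>.\<close>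

lemma sol_P1:
  assumes y: "0 \<le> y"
  shows "P1 *\<^sub>v W y = - (Fi *\<^sub>v (A22 *\<^sub>v (P2 *\<^sub>v W y) + A23 *\<^sub>v (P3 *\<^sub>v W y))) +
      vec_integral r {y..} (\<lambda>s. Fi *\<^sub>v (drift h (\<lambda>y. P2 *\<^sub>v W y) (\<lambda>y. P3 *\<^sub>v W y) s))"
    and "vec_integrable r {y..} (\<lambda>s. Fi *\<^sub>v (drift h (\<lambda>y. P2 *\<^sub>v W y) (\<lambda>y. P3 *\<^sub>v W y) s))"
proof -
  let ?q = "drift h (\<lambda>y. P2 *\<^sub>v W y) (\<lambda>y. P3 *\<^sub>v W y)"
  have q: "weighted_L2 a r ?q" unfolding drift_def
    by (intro weighted_L2_minus weighted_L2_add weighted_L2_mult[OF carr(10) h]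
        weighted_L2_mult[OF carr(21) weighted_L2_mult[OF carr(7) W]] weighted_L2_mult[OF carr(22) weighted_L2_mult[OF carr(8) W]])
  have qc: "?q s \<in> carrier_vec r" for s by (simp add: drift_def)
  have "R2 *\<^sub>v (A *\<^sub>v W y) = - vec_integral r {y..} (\<lambda>s. - ?q s)"
  proof (rule has_weak_derivative_eq_tail[OF _ weighted_L2_uminus[OF q] a _ y])
    show "has_weak_derivative r (\<lambda>y. R2 *\<^sub>v (A *\<^sub>v W y)) (\<lambda>s. - ?q s)"
      by (rule has_weak_derivative_cong[OF has_weak_derivative_mult[OF carr(10) sol_AW(1)] refl sol_eqs(3)])
    show "tends_to_zero r (\<lambda>y. R2 *\<^sub>v (A *\<^sub>v W y))"
      by (rule tends_to_zero_mult[OF carr(10) _ sol_AW(2)]) simp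
  qed
  then have R2: "R2 *\<^sub>v (A *\<^sub>v W y) = vec_integral r {y..} ?q"
    using qc by (simp add: vec_integral_uminus)
  note int = vec_integral_mult[OF carr(18) weighted_L2_vec_integrable[OF q a y] qc]
  show "vec_integrable r {y..} (\<lambda>s. Fi *\<^sub>v ?q s)" by (rule int(1))
  let ?u = "A22 *\<^sub>v (P2 *\<^sub>v W y) + A23 *\<^sub>v (P3 *\<^sub>v W y)"
  have "F *\<^sub>v (P1 *\<^sub>v W y) + ?u = vec_integral r {y..} ?q"
    using R2 unfolding R2A[OF sol_carrier(2)[OF y]] by (simp add: assoc_add_vec[of _ r])
  then have "Fi *\<^sub>v (F *\<^sub>v (P1 *\<^sub>v W y) + ?u) = vec_integral r {y..} (\<lambda>s. Fi *\<^sub>v ?q s)"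
    using int(2) by simp
  moreover have "Fi *\<^sub>v (F *\<^sub>v (P1 *\<^sub>v W y) + ?u) = P1 *\<^sub>v W y + Fi *\<^sub>v ?u"
    by (subst mult_add_distrib_mat_vec[OF carr(18)]) (simp_all add: F(1))
  ultimately have "P1 *\<^sub>v W y + Fi *\<^sub>v ?u = vec_integral r {y..} (\<lambda>s. Fi *\<^sub>v ?q s)" by simp
  then have "- (Fi *\<^sub>v ?u) + vec_integral r {y..} (\<lambda>s. Fi *\<^sub>v ?q s) = - (Fi *\<^sub>v ?u) + (P1 *\<^sub>v W y + Fi *\<^sub>v ?u)" by simp
  also have "\<dots> = P1 *\<^sub>v W y"
  proof -
    have "- u + (v + u) = v" if "u \<in> carrier_vec r" "v \<in> carrier_vec r" for u v :: "real Matrix.vec"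
      using that by (intro eq_vecI) auto
    then show ?thesis by simp
  qed
  finally show "P1 *\<^sub>v W y = - (Fi *\<^sub>v ?u) + vec_integral r {y..} (\<lambda>s. Fi *\<^sub>v ?q s)" by simp
qed

end

end

lemma abs_index_le_vec_norm2:
  assumes "x \<in> carrier_vec n" "i < n"
  shows "\<bar>x $ i\<bar> \<le> vec_norm2 x"
proof -
  have "(x $ i)\<^sup>2 \<le> x \<bullet> x"
    unfolding scalar_prod_self[OF assms(1)]
    using assms(2) by (intro member_le_sum[of i "{..<n}" "\<lambda>i. (x $ i)\<^sup>2"]) auto
  from real_sqrt_le_mono[OF this] show ?thesis by (simp add: vec_norm2_def)
qed

lemma vec_norm2_nonneg: "0 \<le> vec_norm2 x"
proof -
  have "0 \<le> x \<bullet> x" by (simp add: scalar_prod_self[of _ "dim_vec x"] sum_nonneg)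
  then show ?thesis by (simp add: vec_norm2_def)
qed

lemma forward_sol_cong:
  assumes "\<And>y. 0 \<le> y \<Longrightarrow> f y = g y"
  shows "forward_sol c x f y = forward_sol c x g y"
  unfolding forward_sol_def
  by (intro arg_cong2[where f = "(+)"] arg_cong2[where f = "(*)"] Bochner_Integration.integral_cong refl)
    (simp add: assms)

lemma backward_sol_cong:
  assumes "\<And>y. 0 \<le> y \<Longrightarrow> f y = g y" "0 \<le> y"
  shows "backward_sol c f y = backward_sol c g y"
  unfolding backward_sol_def
  by (intro arg_cong[where f = uminus] arg_cong2[where f = "(*)"] Bochner_Integration.integral_cong refl)
    (use assms in simp)

section \<open>Construction of the solution from its coordinates, with bounds\<close>

context reduced_system
begin

lemma coord_sol_cong:
  assumes "\<And>y. 0 \<le> y \<Longrightarrow> f y = g y" "0 \<le> y"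
  shows "coord_sol i x f y = coord_sol i x g y"
  unfolding coord_sol_def using forward_sol_cong[OF assms(1)] backward_sol_cong[OF assms] assms by simp

lemma coord_sol_bound:
  assumes i: "i < m"
  shows "\<exists>C. \<forall>x f. wL2 a f \<longrightarrow> wL2 a (coord_sol i x f) \<and> wL2_norm a (coord_sol i x f) \<le> C * (wL2_norm a f + \<bar>x\<bar>)"
proof -
  consider "0 < lam i" | "lam i < 0" | "lam i = 0" by linarith
  then show ?thesis
  proof cases
    case 1
    then have "coord_sol i = forward_sol (1 / lam i)" by (simp add: coord_sol_def fun_eq_iff)
    then show ?thesis using forward_sol_bound(1)[OF a lam[OF i 1]] by simp
  next
    case 2
    then have c: "coord_sol i x = backward_sol (1 / lam i)" for x by (simp add: coord_sol_def fun_eq_iff)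
    obtain C where C: "\<And>f. wL2 a f \<Longrightarrow> wL2 a (backward_sol (1 / lam i) f) \<and>
        wL2_norm a (backward_sol (1 / lam i) f) \<le> C * wL2_norm a f"
      using backward_sol_bound(1)[OF a, of "1 / lam i"] 2 by auto
    have "wL2_norm a (backward_sol (1 / lam i) f) \<le> \<bar>C\<bar> * (wL2_norm a f + \<bar>x\<bar>)" if "wL2 a f" for f x
    proof -
      have "C * wL2_norm a f \<le> \<bar>C\<bar> * (wL2_norm a f + \<bar>x\<bar>)"
        by (intro mult_mono) auto
      then show ?thesis using C[OF that] by linarith
    qed
    then show ?thesis using C unfolding c by blast
  next
    case 3
    then show ?thesis by (intro exI[of _ 1]) (simp add: coord_sol_def)
  qed
qed

lemma coord_sol_deriv:
  assumes i: "i < m" and l: "lam i \<noteq> 0" and f: "wL2 a f"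
  shows "weak_deriv (coord_sol i x f) (\<lambda>y. 1 / lam i * (f y - coord_sol i x f y))"
    and "(coord_sol i x f \<longlongrightarrow> 0) at_top"
proof -
  have int: "integrable (lebesgue_on {0..y}) f" for y
    by (rule integrable_lebesgue_on_subset[OF wL2_tail(1)[OF f a]]) auto
  have c: "coord_sol i x f = forward_sol (1 / lam i) x f" if "0 < lam i"
    using that by (simp add: coord_sol_def)
  have c': "coord_sol i x f = backward_sol (1 / lam i) f" "1 / lam i < 0" if "\<not> 0 < lam i"
    using that l by (simp_all add: coord_sol_def)
  show "weak_deriv (coord_sol i x f) (\<lambda>y. 1 / lam i * (f y - coord_sol i x f y))"
    using weak_deriv_forward_sol(1)[OF int, of "1 / lam i" x]
      weak_deriv_backward_sol[OF wL2_tail(1)[OF f a], of "1 / lam i"] c c'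
    by (cases "0 < lam i") auto
  show "(coord_sol i x f \<longlongrightarrow> 0) at_top"
    using forward_sol_bound(2)[OF a lam[OF i] f] backward_sol_bound(2)[OF a c'(2) f] c c'
    by (cases "0 < lam i") auto
qed

lemma coord_sol_0:
  assumes f: "wL2 a f" and l: "0 < lam i"
  shows "coord_sol i x f 0 = x"
  using weak_deriv_forward_sol(2)[of f "1 / lam i" x] integrable_lebesgue_on_subset[OF wL2_tail(1)[OF f a]] l
  by (simp add: coord_sol_def)

text \<open>The candidates \<open>w1\<close>, \<open>w2\<close>, \<open>z3\<close> below are the
  coordinates of \<open>W\<close>, and \<open>d1\<close>, \<open>d2\<close>, \<open>d3\<close> those
  of \<open>D\<close>. They depend only on \<open>h\<close> and on an initial vector
  \<open>x\<close>, which makes existence and uniqueness statements about the same function.\<close>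

definition w2 :: "(real \<Rightarrow> real Matrix.vec) \<Rightarrow> real \<Rightarrow> real Matrix.vec" where
  "w2 h y = Ei *\<^sub>v (- vec_integral p {y..} (\<lambda>s. R1 *\<^sub>v h s))"

definition d2 :: "(real \<Rightarrow> real Matrix.vec) \<Rightarrow> real \<Rightarrow> real Matrix.vec" where
  "d2 h y = Ei *\<^sub>v (R1 *\<^sub>v h y)"

definition f3 :: "(real \<Rightarrow> real Matrix.vec) \<Rightarrow> real \<Rightarrow> real Matrix.vec" where
  "f3 h = source h (w2 h) (d2 h)"

definition z3 :: "(real \<Rightarrow> real Matrix.vec) \<Rightarrow> real Matrix.vec \<Rightarrow> real \<Rightarrow> real Matrix.vec" where
  "z3 h x y = Matrix.vec m (\<lambda>i. coord_sol i (x $ i) (\<lambda>y. f3 h y $ i) y)"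

text \<open>For \<open>lam i = 0\<close> the entry is a default: \<open>Lam\<close> multiplies it by
  0, and no derivative of that coordinate is claimed.\<close>

definition d3 :: "(real \<Rightarrow> real Matrix.vec) \<Rightarrow> real Matrix.vec \<Rightarrow> real \<Rightarrow> real Matrix.vec" where
  "d3 h x y = Matrix.vec m (\<lambda>i. if lam i = 0 then 0 else 1 / lam i * (f3 h y $ i - z3 h x y $ i))"

definition q1 :: "(real \<Rightarrow> real Matrix.vec) \<Rightarrow> real Matrix.vec \<Rightarrow> real \<Rightarrow> real Matrix.vec" where
  "q1 h x = drift h (w2 h) (z3 h x)"

definition w1 :: "(real \<Rightarrow> real Matrix.vec) \<Rightarrow> real Matrix.vec \<Rightarrow> real \<Rightarrow> real Matrix.vec" where
  "w1 h x y = - (Fi *\<^sub>v (A22 *\<^sub>v w2 h y + A23 *\<^sub>v z3 h x y)) + vec_integral r {y..} (\<lambda>s. Fi *\<^sub>v q1 h x s)"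

text \<open>Obtained by solving the second row for the first coordinate of \<open>D\<close>, with
  \<open>- q1\<close> as the derivative of \<open>R2 (A W)\<close>. It is not claimed to be the
  derivative of \<open>w1\<close> itself.\<close>

definition d1 :: "(real \<Rightarrow> real Matrix.vec) \<Rightarrow> real Matrix.vec \<Rightarrow> real \<Rightarrow> real Matrix.vec" where
  "d1 h x y = - (Fi *\<^sub>v (A22 *\<^sub>v d2 h y + A23 *\<^sub>v d3 h x y)) - Fi *\<^sub>v q1 h x y"

definition Wsol :: "(real \<Rightarrow> real Matrix.vec) \<Rightarrow> real Matrix.vec \<Rightarrow> real \<Rightarrow> real Matrix.vec" where
  "Wsol h x y = S1 *\<^sub>v w1 h x y + S2 *\<^sub>v w2 h y + S3 *\<^sub>v z3 h x y"

definition Dsol :: "(real \<Rightarrow> real Matrix.vec) \<Rightarrow> real Matrix.vec \<Rightarrow> real \<Rightarrow> real Matrix.vec" where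
  "Dsol h x y = S1 *\<^sub>v d1 h x y + S2 *\<^sub>v d2 h y + S3 *\<^sub>v d3 h x y"

lemma sol_carriers [simp]:
  "w2 h y \<in> carrier_vec p" "d2 h y \<in> carrier_vec p" "f3 h y \<in> carrier_vec m" "z3 h x y \<in> carrier_vec m"
  "d3 h x y \<in> carrier_vec m" "q1 h x y \<in> carrier_vec r" "w1 h x y \<in> carrier_vec r" "d1 h x y \<in> carrier_vec r"
  "Wsol h x y \<in> carrier_vec N" "Dsol h x y \<in> carrier_vec N"
  by (simp_all add: w2_def d2_def f3_def source_def z3_def d3_def q1_def drift_def w1_def d1_def Wsol_def Dsol_def)

lemma Wsol_coords:
  "P1 *\<^sub>v Wsol h x y = w1 h x y" "P2 *\<^sub>v Wsol h x y = w2 h y" "P3 *\<^sub>v Wsol h x y = z3 h x y"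
  "P1 *\<^sub>v Dsol h x y = d1 h x y" "P2 *\<^sub>v Dsol h x y = d2 h y" "P3 *\<^sub>v Dsol h x y = d3 h x y"
  unfolding Wsol_def Dsol_def using PS by simp_all

text \<open>Only the components of \<open>P\<^sub>3 (W 0)\<close> belonging to positive \<open>lam i\<close> enter the right-hand side.\<close>

lemma solution_eq_Wsol:
  assumes h: "weighted_L2 a N h" and W: "weighted_L2 a N W" and sol: "half_space_solution N A Q h W D"
    and y: "0 \<le> y"
  shows "W y = Wsol h (P3 *\<^sub>v W 0) y"
proof -
  have p2: "P2 *\<^sub>v W y = w2 h y" if "0 \<le> y" for y
    using sol_P2_tail[OF h W sol that] by (simp add: w2_def)
  have src: "source h (\<lambda>y. P2 *\<^sub>v W y) (\<lambda>y. P2 *\<^sub>v D y) y = f3 h y" if "0 \<le> y" for y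
    unfolding f3_def source_def using p2[OF that] sol_eqs(1)[OF h W sol that] by (simp add: d2_def)
  have p3: "P3 *\<^sub>v W y = z3 h (P3 *\<^sub>v W 0) y" if y: "0 \<le> y" for y
  proof (rule eq_vecI)
    fix i assume "i < dim_vec (z3 h (P3 *\<^sub>v W 0) y)"
    then have i: "i < m" by (simp add: z3_def)
    have "(P3 *\<^sub>v W y) $ i = coord_sol i ((P3 *\<^sub>v W 0) $ i) (\<lambda>y. f3 h y $ i) y"
      unfolding sol_P3[OF h W sol i y] by (rule coord_sol_cong[OF _ y]) (simp add: src)
    then show "(P3 *\<^sub>v W y) $ i = z3 h (P3 *\<^sub>v W 0) y $ i" using i by (simp add: z3_def)
  qed (simp add: z3_def carrier_matD[OF carr(8)])
  have dr: "drift h (\<lambda>y. P2 *\<^sub>v W y) (\<lambda>y. P3 *\<^sub>v W y) s = q1 h (P3 *\<^sub>v W 0) s" if "0 \<le> s" for s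
    unfolding q1_def drift_def using p2[OF that] p3[OF that] by simp
  have "P1 *\<^sub>v W y = w1 h (P3 *\<^sub>v W 0) y"
  proof -
    have "vec_integral r {y..} (\<lambda>s. Fi *\<^sub>v (drift h (\<lambda>y. P2 *\<^sub>v W y) (\<lambda>y. P3 *\<^sub>v W y) s)) =
        vec_integral r {y..} (\<lambda>s. Fi *\<^sub>v q1 h (P3 *\<^sub>v W 0) s)"
      by (rule vec_integral_cong) (use dr y in simp)
    then show ?thesis unfolding w1_def sol_P1(1)[OF h W sol y] using p2[OF y] p3[OF y] by simp
  qed
  moreover have "W y \<in> carrier_vec N" using W y by (simp add: weighted_L2_def)
  ultimately show ?thesis
    unfolding Wsol_def using SP[of "W y"] p2[OF y] p3[OF y] by simp
qed

text \<open>Data are pairs of a source and an initial vector, so that the constants of a bounded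
  family are uniform in both.\<close>

definition admissible :: "(real \<Rightarrow> real Matrix.vec) \<times> real Matrix.vec \<Rightarrow> bool" where
  "admissible d \<longleftrightarrow> weighted_L2 a N (fst d) \<and> snd d \<in> carrier_vec m"

definition data_norm :: "(real \<Rightarrow> real Matrix.vec) \<times> real Matrix.vec \<Rightarrow> real" where
  "data_norm d = weighted_norm a (fst d) + vec_norm2 (snd d)"

abbreviation "bfam n \<equiv> bounded_family a n admissible data_norm"

lemma data_norm_nonneg: "admissible d \<Longrightarrow> 0 \<le> data_norm d"
  using weighted_norm_nonneg vec_norm2_nonneg by (fastforce simp: admissible_def data_norm_def)

lemma bfam_h: "bfam N fst"
proof -
  have "wL2_norm a (\<lambda>y. fst d y $ i) \<le> 1 * data_norm d" if "admissible d" "i < N" for d i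
    using wL2_norm_le_weighted_norm[of a N "fst d" i] vec_norm2_nonneg[of "snd d"] that
    by (simp add: admissible_def data_norm_def)
  then show ?thesis unfolding bounded_family_def using data_norm_nonneg
    by (intro conjI exI[of _ 1]) (auto simp: admissible_def)
qed

lemma bfam_R1h: "bfam p (\<lambda>d y. R1 *\<^sub>v fst d y)"
  by (rule bounded_family_mult[OF carr(9) bfam_h])

lemma bfam_w2: "bfam p (\<lambda>d. w2 (fst d))"
proof (rule bounded_family_cong)
  show "bfam p (\<lambda>d y. (- Ei) *\<^sub>v vec_integral p {y..} (\<lambda>s. R1 *\<^sub>v fst d s))"
    by (rule bounded_family_mult[OF _ bounded_family_tail[OF bfam_R1h a]]) simp
  show "(- Ei) *\<^sub>v vec_integral p {y..} (\<lambda>s. R1 *\<^sub>v fst d s) = w2 (fst d) y" for d y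
    unfolding w2_def by (rule eq_vecI) (auto simp: carrier_matD[OF carr(16)] vec_integral_def)
qed

lemma bfam_d2: "bfam p (\<lambda>d. d2 (fst d))"
  using bounded_family_mult[OF carr(16) bfam_R1h] by (simp add: d2_def[abs_def])

lemma bfam_f3: "bfam m (\<lambda>d. f3 (fst d))"
  unfolding f3_def source_def[abs_def]
  by (intro bounded_family_minus bounded_family_mult[OF carr(11) bfam_h]
      bounded_family_mult[OF carr(24) bfam_w2] bounded_family_mult[OF carr(23) bfam_d2])

lemma f3_wL2:
  assumes "weighted_L2 a N h" "i < m"
  shows "wL2 a (\<lambda>y. f3 h y $ i)"
proof -
  have "admissible (h, 0\<^sub>v m)" using assms by (simp add: admissible_def)
  from bounded_familyD(1)[OF bfam_f3 this] show ?thesis using assms(2) by (simp add: weighted_L2_iff)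
qed

lemma f3_bound: "\<exists>C. \<forall>d i. admissible d \<longrightarrow> i < m \<longrightarrow> wL2_norm a (\<lambda>y. f3 (fst d) y $ i) \<le> C * data_norm d"
  using bfam_f3 unfolding bounded_family_def by blast

lemma bfam_z3: "bfam m (\<lambda>d. z3 (fst d) (snd d))"
proof (rule bounded_familyI)
  fix i assume i: "i < m"
  obtain C where C: "\<forall>x f. wL2 a f \<longrightarrow> wL2 a (coord_sol i x f) \<and> wL2_norm a (coord_sol i x f) \<le> C * (wL2_norm a f + \<bar>x\<bar>)"
    using coord_sol_bound[OF i] ..
  obtain K where K: "\<forall>d i. admissible d \<longrightarrow> i < m \<longrightarrow> wL2_norm a (\<lambda>y. f3 (fst d) y $ i) \<le> K * data_norm d"
    using f3_bound ..
  have "wL2 a (\<lambda>y. z3 (fst d) (snd d) y $ i) \<and> wL2_norm a (\<lambda>y. z3 (fst d) (snd d) y $ i) \<le> (\<bar>C\<bar> * (K + 1)) * data_norm d"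
    if d: "admissible d" for d
  proof -
    have f: "wL2 a (\<lambda>y. f3 (fst d) y $ i)" using f3_wL2 d i by (simp add: admissible_def)
    note c = C[rule_format, OF f, of "snd d $ i"]
    have "\<bar>snd d $ i\<bar> \<le> data_norm d"
      using abs_index_le_vec_norm2[of "snd d" m i] d i weighted_norm_nonneg[of a N "fst d"]
      by (simp add: admissible_def data_norm_def)
    then have "wL2_norm a (\<lambda>y. f3 (fst d) y $ i) + \<bar>snd d $ i\<bar> \<le> (K + 1) * data_norm d"
      using K[rule_format, OF d i] by (simp add: distrib_right)
    then have "\<bar>C\<bar> * (wL2_norm a (\<lambda>y. f3 (fst d) y $ i) + \<bar>snd d $ i\<bar>) \<le> \<bar>C\<bar> * ((K + 1) * data_norm d)"
      by (intro mult_left_mono) auto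
    moreover have "C * (wL2_norm a (\<lambda>y. f3 (fst d) y $ i) + \<bar>snd d $ i\<bar>) \<le> \<bar>C\<bar> * (wL2_norm a (\<lambda>y. f3 (fst d) y $ i) + \<bar>snd d $ i\<bar>)"
      by (intro mult_right_mono) auto
    ultimately have "wL2_norm a (coord_sol i (snd d $ i) (\<lambda>y. f3 (fst d) y $ i)) \<le> (\<bar>C\<bar> * (K + 1)) * data_norm d"
      using c by (simp add: mult.assoc)
    moreover have "(\<lambda>y. z3 (fst d) (snd d) y $ i) = coord_sol i (snd d $ i) (\<lambda>y. f3 (fst d) y $ i)"
      using i by (simp add: z3_def)
    ultimately show ?thesis using c by simp
  qed
  then show "\<exists>C. \<forall>d. admissible d \<longrightarrow> wL2 a (\<lambda>y. z3 (fst d) (snd d) y $ i) \<and>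
      wL2_norm a (\<lambda>y. z3 (fst d) (snd d) y $ i) \<le> C * data_norm d" by (intro exI allI impI)
qed (simp_all add: data_norm_nonneg)

lemma bfam_q1: "bfam r (\<lambda>d. q1 (fst d) (snd d))"
  unfolding q1_def drift_def[abs_def]
  by (intro bounded_family_minus bounded_family_add bounded_family_mult[OF carr(10) bfam_h]
      bounded_family_mult[OF carr(21) bfam_w2] bounded_family_mult[OF carr(22) bfam_z3])

lemma bfam_w1: "bfam r (\<lambda>d. w1 (fst d) (snd d))"
proof (rule bounded_family_cong)
  show "bfam r (\<lambda>d y. (- Fi) *\<^sub>v (A22 *\<^sub>v w2 (fst d) y + A23 *\<^sub>v z3 (fst d) (snd d) y) +
      vec_integral r {y..} (\<lambda>s. Fi *\<^sub>v q1 (fst d) (snd d) s))"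
    by (intro bounded_family_add bounded_family_mult[of "- Fi" r r] bounded_family_mult[OF carr(19) bfam_w2]
        bounded_family_mult[OF carr(20) bfam_z3] bounded_family_tail[OF _ a] bounded_family_mult[OF carr(18) bfam_q1]) simp
  show "(- Fi) *\<^sub>v (A22 *\<^sub>v w2 (fst d) y + A23 *\<^sub>v z3 (fst d) (snd d) y) +
      vec_integral r {y..} (\<lambda>s. Fi *\<^sub>v q1 (fst d) (snd d) s) = w1 (fst d) (snd d) y" for d y
  proof -
    have "A22 *\<^sub>v w2 (fst d) y + A23 *\<^sub>v z3 (fst d) (snd d) y \<in> carrier_vec r" by simp
    then have "(- Fi) *\<^sub>v (A22 *\<^sub>v w2 (fst d) y + A23 *\<^sub>v z3 (fst d) (snd d) y) =
        - (Fi *\<^sub>v (A22 *\<^sub>v w2 (fst d) y + A23 *\<^sub>v z3 (fst d) (snd d) y))"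
      by (intro eq_vecI) (auto simp: carrier_matD[OF carr(18)] carrier_matD[OF carr(20)])
    then show ?thesis by (simp add: w1_def)
  qed
qed

text \<open>The a priori estimate: its constant depends neither on \<open>h\<close> nor on the
  initial vector.\<close>

lemma bfam_Wsol: "bfam N (\<lambda>d. Wsol (fst d) (snd d))"
  unfolding Wsol_def[abs_def]
  by (intro bounded_family_add bounded_family_mult[OF carr(3) bfam_w1] bounded_family_mult[OF carr(4) bfam_w2]
      bounded_family_mult[OF carr(5) bfam_z3])

text \<open>Values at 0 of modes with negative eigenvalue are determined by \<open>h\<close> alone,
  hence the bound does not involve \<open>x\<close>.\<close>

lemma backward_0_bound:
  assumes i: "i < m" "lam i < 0"
  shows "\<exists>C. \<forall>h x. weighted_L2 a N h \<longrightarrow> \<bar>z3 h x 0 $ i\<bar> \<le> C * weighted_norm a h"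
proof -
  obtain C where C: "\<forall>f. wL2 a f \<longrightarrow> wL2 a (backward_sol (1 / lam i) f) \<and>
      wL2_norm a (backward_sol (1 / lam i) f) \<le> C * wL2_norm a f \<and> \<bar>backward_sol (1 / lam i) f 0\<bar> \<le> C * wL2_norm a f"
    using backward_sol_bound(1)[OF a, of "1 / lam i"] i by auto
  obtain K where K: "\<forall>d i. admissible d \<longrightarrow> i < m \<longrightarrow> wL2_norm a (\<lambda>y. f3 (fst d) y $ i) \<le> K * data_norm d"
    using f3_bound ..
  have "\<bar>z3 h x 0 $ i\<bar> \<le> (\<bar>C\<bar> * K) * weighted_norm a h" if h: "weighted_L2 a N h" for h x
  proof -
    \<comment> \<open>Taking the initial vector 0 makes the data norm equal to the norm of
      \<open>h\<close>.\<close>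
    have "wL2_norm a (\<lambda>y. f3 h y $ i) \<le> K * weighted_norm a h"
      using K[rule_format, of "(h, 0\<^sub>v m)" i] i h by (simp add: admissible_def data_norm_def vec_norm2_def)
    then have "\<bar>C\<bar> * wL2_norm a (\<lambda>y. f3 h y $ i) \<le> \<bar>C\<bar> * (K * weighted_norm a h)"
      by (intro mult_left_mono) auto
    moreover have "C * wL2_norm a (\<lambda>y. f3 h y $ i) \<le> \<bar>C\<bar> * wL2_norm a (\<lambda>y. f3 h y $ i)"
      by (intro mult_right_mono) auto
    moreover have "\<bar>z3 h x 0 $ i\<bar> \<le> C * wL2_norm a (\<lambda>y. f3 h y $ i)"
      using C[rule_format, OF f3_wL2[OF h i(1)]] i by (simp add: z3_def coord_sol_def)
    ultimately show ?thesis by (simp add: mult.assoc)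
  qed
  then show ?thesis by (intro exI allI impI)
qed

lemma z3_0:
  assumes "weighted_L2 a N h" "i < m"
  shows "0 < lam i \<Longrightarrow> z3 h x 0 $ i = x $ i" "lam i = 0 \<Longrightarrow> z3 h x y $ i = f3 h y $ i"
  using assms coord_sol_0[OF f3_wL2[OF assms]] by (simp_all add: z3_def coord_sol_def[of _ _ _])

text \<open>Weak differentiability and decay are proved for the three row images of
  \<open>A W\<close>, each of which is a tail integral or a combination of explicit coordinates; the
  left inverse \<open>K1\<close>, \<open>K2\<close>, \<open>K3\<close> then reassembles
  \<open>A W\<close>.\<close>

lemma Wsol_solution:
  assumes h: "weighted_L2 a N h" and x: "x \<in> carrier_vec m"
  shows "half_space_solution N A Q h (Wsol h x) (Dsol h x)" "weighted_L2 a N (Wsol h x)"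
proof -
  have adm: "admissible (h, x)" using h x by (simp add: admissible_def)
  have hc: "h y \<in> carrier_vec N" if "0 \<le> y" for y using h that by (simp add: weighted_L2_def)
  have R1h: "weighted_L2 a p (\<lambda>y. R1 *\<^sub>v h y)" by (rule weighted_L2_mult[OF carr(9) h])
  have q1: "weighted_L2 a r (q1 h x)" using bounded_familyD(1)[OF bfam_q1 adm] by simp
  show W: "weighted_L2 a N (Wsol h x)" using bounded_familyD(1)[OF bfam_Wsol adm] by simp
  have Ew2: "E *\<^sub>v w2 h y = - vec_integral p {y..} (\<lambda>s. R1 *\<^sub>v h s)" for y
    unfolding w2_def by (rule E(2)) simp
  have Ed2: "E *\<^sub>v d2 h y = R1 *\<^sub>v h y" for y unfolding d2_def by (rule E(2)) simp
  have Ld3: "Lam *\<^sub>v d3 h x y = f3 h y - z3 h x y" for y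
  proof (rule eq_vecI)
    fix i assume "i < dim_vec (f3 h y - z3 h x y)"
    then have i: "i < m" by (simp add: z3_def)
    have "lam i = 0 \<Longrightarrow> z3 h x y $ i = f3 h y $ i" by (rule z3_0(2)[OF h i])
    then show "(Lam *\<^sub>v d3 h x y) $ i = (f3 h y - z3 h x y) $ i"
      using i by (simp add: d3_def carrier_vecD[OF sol_carriers(4)] del: index_mult_mat_vec)
  qed (simp add: Lam z3_def)
  have Fd1: "F *\<^sub>v d1 h x y + A22 *\<^sub>v d2 h y + A23 *\<^sub>v d3 h x y = - q1 h x y" for y
  proof -
    let ?u = "A22 *\<^sub>v d2 h y + A23 *\<^sub>v d3 h x y"
    have "d1 h x y = Fi *\<^sub>v (- ?u - q1 h x y)"
      unfolding d1_def by (subst mult_minus_distrib_mat_vec[OF carr(18)]) (simp_all add: mult_mat_vec_uminus[OF carr(18)])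
    then have "F *\<^sub>v d1 h x y = - ?u - q1 h x y" by (simp add: F(2))
    moreover have "- (u + v) - w + u + v = - w"
      if "u \<in> carrier_vec r" "v \<in> carrier_vec r" "w \<in> carrier_vec r" for u v w :: "real Matrix.vec"
      using that by (intro eq_vecI) auto
    ultimately show ?thesis by simp
  qed
  have Fw1: "F *\<^sub>v w1 h x y + A22 *\<^sub>v w2 h y + A23 *\<^sub>v z3 h x y = vec_integral r {y..} (q1 h x)" if y: "0 \<le> y" for y
  proof -
    let ?u = "A22 *\<^sub>v w2 h y + A23 *\<^sub>v z3 h x y"
    have "w1 h x y = Fi *\<^sub>v (- ?u + vec_integral r {y..} (q1 h x))"
      unfolding w1_def
      by (subst mult_add_distrib_mat_vec[OF carr(18)])
        (simp_all add: mult_mat_vec_uminus[OF carr(18)] vec_integral_mult(2)[OF carr(18) weighted_L2_vec_integrable[OF q1 a y]])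
    then have "F *\<^sub>v w1 h x y = - ?u + vec_integral r {y..} (q1 h x)" by (simp add: F(2))
    moreover have "- (u + v) + w + u + v = w"
      if "u \<in> carrier_vec r" "v \<in> carrier_vec r" "w \<in> carrier_vec r" for u v w :: "real Matrix.vec"
      using that by (intro eq_vecI) auto
    ultimately show ?thesis by simp
  qed
  have eq: "A *\<^sub>v Dsol h x y = - (Q *\<^sub>v Wsol h x y) + h y" if y: "0 \<le> y" for y
  proof -
    have "A32 *\<^sub>v d2 h y + Lam *\<^sub>v d3 h x y = - (Q32 *\<^sub>v w2 h y + z3 h x y) + R3 *\<^sub>v h y"
      unfolding Ld3 f3_def source_def
    proof -
      have "v + (w - q - v - z) = - (q + z) + w"
        if "v \<in> carrier_vec m" "w \<in> carrier_vec m" "q \<in> carrier_vec m" "z \<in> carrier_vec m" for v w q z :: "real Matrix.vec"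
        using that by (intro eq_vecI) auto
      then show "A32 *\<^sub>v d2 h y + (R3 *\<^sub>v h y - Q32 *\<^sub>v w2 h y - A32 *\<^sub>v d2 h y - z3 h x y) =
          - (Q32 *\<^sub>v w2 h y + z3 h x y) + R3 *\<^sub>v h y" by simp
    qed
    then show ?thesis
      using equation_rows[OF sol_carriers(9) sol_carriers(10) hc[OF y], of h x y h x y] Ed2 Fd1[of y]
      by (simp add: Wsol_coords q1_def drift_def)
  qed
  have wd1: "has_weak_derivative p (\<lambda>y. E *\<^sub>v w2 h y) (\<lambda>y. E *\<^sub>v d2 h y)" and t1: "tends_to_zero p (\<lambda>y. E *\<^sub>v w2 h y)"
  proof -
    note vt = vec_tail_weak_derivative[OF R1h a]
    have m1: "- 1\<^sub>m p \<in> carrier_mat p p" by simp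
    show "has_weak_derivative p (\<lambda>y. E *\<^sub>v w2 h y) (\<lambda>y. E *\<^sub>v d2 h y)"
      by (rule has_weak_derivative_cong[OF has_weak_derivative_mult[OF m1 vt(1)]])
        (simp_all add: Ew2 Ed2 uminus_vec_conv_mult[of _ p, symmetric])
    show "tends_to_zero p (\<lambda>y. E *\<^sub>v w2 h y)"
      by (rule tends_to_zero_cong[OF tends_to_zero_mult[OF m1 _ vt(2)]])
        (simp_all add: Ew2 uminus_vec_conv_mult[of _ p, symmetric])
  qed
  have Eiw: "Ei *\<^sub>v (E *\<^sub>v w2 h y) = w2 h y" "Ei *\<^sub>v (E *\<^sub>v d2 h y) = d2 h y" for y by (simp_all add: E(1))
  have wd2: "has_weak_derivative p (w2 h) (d2 h)"
    by (rule has_weak_derivative_cong[OF has_weak_derivative_mult[OF carr(16) wd1]]) (simp_all add: Eiw)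
  have t2: "tends_to_zero p (w2 h)"
    by (rule tends_to_zero_cong[OF tends_to_zero_mult[OF carr(16) _ t1]]) (simp_all add: Eiw)
  have wd3: "has_weak_derivative m (\<lambda>y. Lam *\<^sub>v z3 h x y) (\<lambda>y. Lam *\<^sub>v d3 h x y)"
    and t3: "tends_to_zero m (\<lambda>y. Lam *\<^sub>v z3 h x y)"
  proof -
    have "weak_deriv (\<lambda>y. (Lam *\<^sub>v z3 h x y) $ i) (\<lambda>y. (Lam *\<^sub>v d3 h x y) $ i) \<and>
        ((\<lambda>y. (Lam *\<^sub>v z3 h x y) $ i) \<longlongrightarrow> 0) at_top" if i: "i < m" for i
    proof (cases "lam i = 0")
      case True
      then show ?thesis using i weak_deriv_const[of 0] by (simp del: index_mult_mat_vec)
    next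
      case False
      note c = coord_sol_deriv[OF i False f3_wL2[OF h i], of "x $ i"]
      show ?thesis
        using weak_deriv_cmult[OF c(1), of "lam i"] tendsto_mult[OF tendsto_const[of "lam i"] c(2)] i False
        by (simp add: z3_def d3_def del: index_mult_mat_vec)
    qed
    then show "has_weak_derivative m (\<lambda>y. Lam *\<^sub>v z3 h x y) (\<lambda>y. Lam *\<^sub>v d3 h x y)"
      "tends_to_zero m (\<lambda>y. Lam *\<^sub>v z3 h x y)"
      by (simp_all add: has_weak_derivative_iff tends_to_zero_def del: index_mult_mat_vec)
  qed
  have R1: "R1 *\<^sub>v (A *\<^sub>v Wsol h x y) = E *\<^sub>v w2 h y" "R1 *\<^sub>v (A *\<^sub>v Dsol h x y) = E *\<^sub>v d2 h y" for y
    by (simp_all add: R1A Wsol_coords)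
  have R3: "R3 *\<^sub>v (A *\<^sub>v Wsol h x y) = A32 *\<^sub>v w2 h y + Lam *\<^sub>v z3 h x y"
    "R3 *\<^sub>v (A *\<^sub>v Dsol h x y) = A32 *\<^sub>v d2 h y + Lam *\<^sub>v d3 h x y" for y
    by (simp_all add: R3A Wsol_coords)
  have R2: "R2 *\<^sub>v (A *\<^sub>v Dsol h x y) = - q1 h x y" for y
    by (simp add: R2A Wsol_coords Fd1)
  have R2': "R2 *\<^sub>v (A *\<^sub>v Wsol h x y) = vec_integral r {y..} (q1 h x)" if "0 \<le> y" for y
    by (simp add: R2A Wsol_coords Fw1[OF that])
  note vt = vec_tail_weak_derivative[OF q1 a]
  have wd: "has_weak_derivative N (\<lambda>y. A *\<^sub>v Wsol h x y) (\<lambda>y. A *\<^sub>v Dsol h x y)"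
  proof (rule has_weak_derivative_cong)
    show "has_weak_derivative N
       (\<lambda>y. K1 *\<^sub>v (E *\<^sub>v w2 h y) + K2 *\<^sub>v vec_integral r {y..} (q1 h x) + K3 *\<^sub>v (A32 *\<^sub>v w2 h y + Lam *\<^sub>v z3 h x y))
       (\<lambda>y. K1 *\<^sub>v (E *\<^sub>v d2 h y) + K2 *\<^sub>v (- q1 h x y) + K3 *\<^sub>v (A32 *\<^sub>v d2 h y + Lam *\<^sub>v d3 h x y))"
      by (intro has_weak_derivative_add has_weak_derivative_mult[OF carr(12) wd1] has_weak_derivative_mult[OF carr(13) vt(1)]
          has_weak_derivative_mult[OF carr(14)] has_weak_derivative_mult[OF carr(23) wd2] wd3)
    show "K1 *\<^sub>v (E *\<^sub>v w2 h y) + K2 *\<^sub>v vec_integral r {y..} (q1 h x) + K3 *\<^sub>v (A32 *\<^sub>v w2 h y + Lam *\<^sub>v z3 h x y) = A *\<^sub>v Wsol h x y"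
      if "0 \<le> y" for y
      using KR[of "A *\<^sub>v Wsol h x y"] R1(1) R2'[OF that] R3(1) by simp
    show "K1 *\<^sub>v (E *\<^sub>v d2 h y) + K2 *\<^sub>v (- q1 h x y) + K3 *\<^sub>v (A32 *\<^sub>v d2 h y + Lam *\<^sub>v d3 h x y) = A *\<^sub>v Dsol h x y"
      if "0 \<le> y" for y
      using KR[of "A *\<^sub>v Dsol h x y"] R1(2) R2 R3(2) by simp
  qed
  have tz: "tends_to_zero N (\<lambda>y. A *\<^sub>v Wsol h x y)"
  proof (rule tends_to_zero_cong)
    show "tends_to_zero N
       (\<lambda>y. K1 *\<^sub>v (E *\<^sub>v w2 h y) + K2 *\<^sub>v vec_integral r {y..} (q1 h x) + K3 *\<^sub>v (A32 *\<^sub>v w2 h y + Lam *\<^sub>v z3 h x y))"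
      by (intro tends_to_zero_add tends_to_zero_mult[OF carr(12) _ t1] tends_to_zero_mult[OF carr(13) _ vt(2)]
          tends_to_zero_mult[OF carr(14)] tends_to_zero_mult[OF carr(23) _ t2] t3) auto
    show "K1 *\<^sub>v (E *\<^sub>v w2 h y) + K2 *\<^sub>v vec_integral r {y..} (q1 h x) + K3 *\<^sub>v (A32 *\<^sub>v w2 h y + Lam *\<^sub>v z3 h x y) = A *\<^sub>v Wsol h x y"
      if "0 \<le> y" for y
      using KR[of "A *\<^sub>v Wsol h x y"] R1(1) R2'[OF that] R3(1) by simp
  qed
  \<comment> \<open>For eigenvalue 0 the coordinate equals \<open>f3\<close>, a pointwise function
    of \<open>h\<close> and its tail integral, so its decay has to be taken from that of
    \<open>h\<close>.\<close>
  have "tends_to_zero N (Wsol h x)" if th: "tends_to_zero N h"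
  proof -
    have tR: "tends_to_zero k (\<lambda>y. R *\<^sub>v h y)" if "R \<in> carrier_mat k N" for R k
      by (rule tends_to_zero_mult[OF that hc th])
    have td2: "tends_to_zero p (d2 h)"
      unfolding d2_def by (rule tends_to_zero_mult[OF carr(16) _ tR[OF carr(9)]]) simp
    have tf3: "tends_to_zero m (f3 h)"
      unfolding f3_def source_def[abs_def]
      by (intro tends_to_zero_minus tR[OF carr(11)] tends_to_zero_mult[OF carr(24) _ t2] tends_to_zero_mult[OF carr(23) _ td2]) auto
    have tz3: "tends_to_zero m (z3 h x)"
      unfolding tends_to_zero_def
    proof (intro allI impI)
      fix i assume i: "i < m"
      show "((\<lambda>y. z3 h x y $ i) \<longlongrightarrow> 0) at_top"
      proof (cases "lam i = 0")
        case True
        have "(\<lambda>y. z3 h x y $ i) = (\<lambda>y. f3 h y $ i)" using z3_0(2)[OF h i True] by simp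
        then show ?thesis using tf3 i by (simp add: tends_to_zero_def)
      next
        case False
        show ?thesis using coord_sol_deriv(2)[OF i False f3_wL2[OF h i], of "x $ i"] i by (simp add: z3_def)
      qed
    qed
    have "tends_to_zero r (w1 h x)"
    proof (rule tends_to_zero_cong)
      have m1: "- 1\<^sub>m r \<in> carrier_mat r r" by simp
      show "tends_to_zero r (\<lambda>y. Fi *\<^sub>v (vec_integral r {y..} (q1 h x) - (A22 *\<^sub>v w2 h y + A23 *\<^sub>v z3 h x y)))"
        by (intro tends_to_zero_mult[OF carr(18)] tends_to_zero_minus vt(2) tends_to_zero_add
            tends_to_zero_mult[OF carr(19) _ t2] tends_to_zero_mult[OF carr(20) _ tz3]) auto
      show "Fi *\<^sub>v (vec_integral r {y..} (q1 h x) - (A22 *\<^sub>v w2 h y + A23 *\<^sub>v z3 h x y)) = w1 h x y" if "0 \<le> y" for y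
      proof -
        have "u + v + w - (v + w) = u"
          if "u \<in> carrier_vec r" "v \<in> carrier_vec r" "w \<in> carrier_vec r" for u v w :: "real Matrix.vec"
          using that by (intro eq_vecI) auto
        then have "vec_integral r {y..} (q1 h x) - (A22 *\<^sub>v w2 h y + A23 *\<^sub>v z3 h x y) = F *\<^sub>v w1 h x y"
          unfolding Fw1[OF that, symmetric] by this simp_all
        then show ?thesis by (simp add: F(1))
      qed
    qed
    then show ?thesis
      unfolding Wsol_def[abs_def]
      by (intro tends_to_zero_add tends_to_zero_mult[OF carr(3)] tends_to_zero_mult[OF carr(4) _ t2]
          tends_to_zero_mult[OF carr(5) _ tz3]) auto
  qed
  then show "half_space_solution N A Q h (Wsol h x) (Dsol h x)"
    unfolding half_space_solution_def using eq wd tz by simp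
qed

end

section \<open>Boundary conditions\<close>

lemma wL2_norm_eq_0_iff:
  assumes "wL2 a f"
  shows "wL2_norm a f = 0 \<longleftrightarrow> (AE y in lebesgue_on {0..}. f y = 0)"
proof -
  have "wL2_norm a f = 0 \<longleftrightarrow> (\<integral>y. exp (2 * a * y) * (f y)\<^sup>2 \<partial>lebesgue_on {0..}) = 0"
    by (simp add: wL2_norm_def)
  also have "\<dots> \<longleftrightarrow> (AE y in lebesgue_on {0..}. exp (2 * a * y) * (f y)\<^sup>2 = 0)"
    using assms by (intro integral_nonneg_eq_0_iff_AE) (auto simp: wL2_def)
  finally show ?thesis by simp
qed

lemma AE_lebesgue_on_nonzero: "AE y in lebesgue_on {0..}. y \<noteq> (0::real)"
proof -
  have "{0::real} \<in> null_sets (lebesgue_on {0..})"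
    by (subst null_sets_restrict_space) auto
  from AE_not_in[OF this] show ?thesis by simp
qed

text \<open>A function of norm 0 with a nonzero value at 0. Since the equation holds at every point,
  such a source can still act on the boundary value.\<close>

lemma wL2_point_mass: "wL2 a (\<lambda>y. if y = 0 then c else 0)" "wL2_norm a (\<lambda>y. if y = 0 then c else 0) = 0"
proof -
  let ?f = "\<lambda>y::real. if y = 0 then c else 0"
  have m: "?f \<in> borel_measurable (lebesgue_on {0..})"
  proof -
    have "{0::real} \<in> sets (lebesgue_on {0..})" by (simp add: sets_restrict_space_iff)
    then have "indicator {0} \<in> borel_measurable (lebesgue_on {0::real..})"
      by (intro borel_measurable_indicator)
    then have "(\<lambda>y. c * indicator {0} y) \<in> borel_measurable (lebesgue_on {0::real..})"
      by (rule borel_measurable_times[OF borel_measurable_const])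
    moreover have "(\<lambda>y. c * indicator {0} y) = ?f" by (auto simp: indicator_def)
    ultimately show ?thesis by simp
  qed
  have "integrable (lebesgue_on {0..}) (\<lambda>y. exp (2 * a * y) * (?f y)\<^sup>2) \<longleftrightarrow> integrable (lebesgue_on {0..}) (\<lambda>y::real. 0::real)"
  proof (rule integrable_cong_AE)
    show "(\<lambda>y. exp (2 * a * y) * (?f y)\<^sup>2) \<in> borel_measurable (lebesgue_on {0..})"
      using m by measurable
    show "AE y in lebesgue_on {0..}. exp (2 * a * y) * (?f y)\<^sup>2 = 0"
      using AE_lebesgue_on_nonzero by eventually_elim simp
  qed simp
  then show w: "wL2 a ?f" using m by (simp add: wL2_def)
  show "wL2_norm a ?f = 0"
    unfolding wL2_norm_eq_0_iff[OF w] using AE_lebesgue_on_nonzero by eventually_elim simp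
qed

lemma mult_mat_vec_sup_bound:
  fixes M :: "real mat"
  assumes M: "M \<in> carrier_mat k n"
  obtains C where "0 \<le> C"
    "\<And>v t i. v \<in> carrier_vec n \<Longrightarrow> (\<And>j. j < n \<Longrightarrow> \<bar>v $ j\<bar> \<le> t) \<Longrightarrow> 0 \<le> t \<Longrightarrow> i < k \<Longrightarrow> \<bar>(M *\<^sub>v v) $ i\<bar> \<le> C * t"
proof
  let ?C = "\<Sum>i<k. \<Sum>j<n. \<bar>M $$ (i, j)\<bar>"
  show "0 \<le> ?C" by (intro sum_nonneg) auto
  fix v :: "real Matrix.vec" and t i
  assume v: "v \<in> carrier_vec n" "\<And>j. j < n \<Longrightarrow> \<bar>v $ j\<bar> \<le> t" and t: "0 \<le> t" and i: "i < k"
  have "\<bar>(M *\<^sub>v v) $ i\<bar> \<le> (\<Sum>j<n. \<bar>M $$ (i, j) * v $ j\<bar>)"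
    unfolding mult_mat_vec_index[OF M v(1) i] by (rule sum_abs)
  also have "\<dots> \<le> (\<Sum>j<n. \<bar>M $$ (i, j)\<bar> * t)"
    by (intro sum_mono) (auto simp: abs_mult intro!: mult_left_mono v)
  also have "\<dots> = (\<Sum>j<n. \<bar>M $$ (i, j)\<bar>) * t" by (simp add: sum_distrib_right)
  also have "\<dots> \<le> ?C * t"
    using i t by (intro mult_right_mono member_le_sum[of i "{..<k}" "\<lambda>i. \<Sum>j<n. \<bar>M $$ (i, j)\<bar>"]) (auto intro: sum_nonneg)
  finally show "\<bar>(M *\<^sub>v v) $ i\<bar> \<le> ?C * t" .
qed

lemma vec_norm2_le:
  assumes "v \<in> carrier_vec n" "\<And>i. i < n \<Longrightarrow> \<bar>v $ i\<bar> \<le> t" "0 \<le> t"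
  shows "vec_norm2 v \<le> real n * t"
proof -
  have "v \<bullet> v \<le> (\<Sum>i<n. t\<^sup>2)"
    unfolding scalar_prod_self[OF assms(1)]
    by (intro sum_mono) (use assms(2,3) in \<open>simp add: abs_le_square_iff[symmetric]\<close>)
  also have "\<dots> \<le> (real n * t)\<^sup>2"
  proof -
    have "real n \<le> real n * real n" by (cases n) auto
    then have "real n * t\<^sup>2 \<le> real n * real n * t\<^sup>2" by (intro mult_right_mono) auto
    then show ?thesis by (simp add: power2_eq_square mult_ac)
  qed
  finally have "sqrt (v \<bullet> v) \<le> sqrt ((real n * t)\<^sup>2)" by (rule real_sqrt_le_mono)
  then show ?thesis using assms(3) by (simp add: vec_norm2_def)
qed

lemma forward_sol_zero: "(\<And>y. 0 \<le> y \<Longrightarrow> f y = 0) \<Longrightarrow> forward_sol c x f y = exp (- c * y) * x"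
  using forward_sol_cong[of f "\<lambda>_. 0" c x y] by (simp add: forward_sol_def mult.commute)

lemma backward_sol_zero: "(\<And>y. 0 \<le> y \<Longrightarrow> f y = 0) \<Longrightarrow> 0 \<le> y \<Longrightarrow> backward_sol c f y = 0"
  using backward_sol_cong[of f "\<lambda>_. 0" y c] by (simp add: backward_sol_def)

text \<open>\<open>Bz\<close> is the boundary matrix in the eigencoordinates (\<open>B * T\<close>
  in the moment system) and \<open>C\<close> the one acting on \<open>W\<close>. The eigenvalues are
  sorted into \<open>np\<close> positive, \<open>n0\<close> zero and \<open>nm\<close> negative
  ones.\<close>

locale boundary_system = reduced_system +
  fixes np n0 nm :: nat and Bz C :: "real mat"
  assumes m: "m = np + n0 + nm"
    and lam_pos: "\<And>i. i < np \<Longrightarrow> 0 < lam i"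
    and lam_0: "\<And>i. np \<le> i \<Longrightarrow> i < np + n0 \<Longrightarrow> lam i = 0"
    and lam_neg: "\<And>i. np + n0 \<le> i \<Longrightarrow> i < m \<Longrightarrow> lam i < 0"
    and Bz [simp]: "Bz \<in> carrier_mat np m" and C: "\<And>w. w \<in> carrier_vec N \<Longrightarrow> C *\<^sub>v w = Bz *\<^sub>v (P3 *\<^sub>v w)"
begin

lemma less_m: "i < np \<Longrightarrow> i < m" "i < np + n0 \<Longrightarrow> i < m" "np \<le> m"
  by (simp_all add: m)

definition Bp :: "real mat" where
  "Bp = mat np np (\<lambda>(i, j). Bz $$ (i, j))"

definition pos_part :: "real Matrix.vec \<Rightarrow> real Matrix.vec" where
  "pos_part z = Matrix.vec np (\<lambda>i. z $ i)"

text \<open>Kept at full length \<open>m\<close>, with zeros elsewhere, so that \<open>Bz\<close>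
  can be applied to it directly.\<close>

definition neg_part :: "real Matrix.vec \<Rightarrow> real Matrix.vec" where
  "neg_part z = Matrix.vec m (\<lambda>i. if i < np + n0 then 0 else z $ i)"

definition pad :: "real Matrix.vec \<Rightarrow> real Matrix.vec" where
  "pad x = Matrix.vec m (\<lambda>i. if i < np then x $ i else 0)"

lemma part_carriers [simp]:
  "Bp \<in> carrier_mat np np" "pos_part z \<in> carrier_vec np" "neg_part z \<in> carrier_vec m" "pad x \<in> carrier_vec m"
  by (simp_all add: Bp_def pos_part_def neg_part_def pad_def)

text \<open>Only the products of entries belonging to zero modes are assumed to vanish. This covers
  both uses: a matrix whose columns there are 0, and a vector whose entries there are 0.\<close>

lemma Bz_split:
  assumes z: "z \<in> carrier_vec m"
    and zero: "\<And>i j. i < np \<Longrightarrow> np \<le> j \<Longrightarrow> j < np + n0 \<Longrightarrow> Bz $$ (i, j) * z $ j = 0"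
  shows "Bz *\<^sub>v z = Bp *\<^sub>v pos_part z + Bz *\<^sub>v neg_part z"
proof (rule eq_vecI)
  fix i assume "i < dim_vec (Bp *\<^sub>v pos_part z + Bz *\<^sub>v neg_part z)"
  then have i: "i < np" using carrier_matD[OF Bz] by simp
  have "(Bz *\<^sub>v z) $ i = (\<Sum>j<m. Bz $$ (i, j) * z $ j)"
    by (rule mult_mat_vec_index[OF Bz z i])
  also have "\<dots> = (\<Sum>j<m. (if j < np then Bz $$ (i, j) * z $ j else 0) + Bz $$ (i, j) * neg_part z $ j)"
    by (rule sum.cong) (use zero[OF i] in \<open>auto simp: neg_part_def not_less\<close>)
  also have "\<dots> = (\<Sum>j<m. if j < np then Bz $$ (i, j) * z $ j else 0) + (\<Sum>j<m. Bz $$ (i, j) * neg_part z $ j)"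
    by (rule sum.distrib)
  also have "(\<Sum>j<m. if j < np then Bz $$ (i, j) * z $ j else 0) = (\<Sum>j<np. Bz $$ (i, j) * z $ j)"
    by (rule sum.mono_neutral_cong_right) (auto intro: less_m)
  also have "\<dots> = (Bp *\<^sub>v pos_part z) $ i"
    by (subst mult_mat_vec_index[OF _ _ i]) (auto simp: Bp_def pos_part_def i)
  also have "(\<Sum>j<m. Bz $$ (i, j) * neg_part z $ j) = (Bz *\<^sub>v neg_part z) $ i"
    by (subst mult_mat_vec_index[OF Bz _ i]) auto
  finally show "(Bz *\<^sub>v z) $ i = (Bp *\<^sub>v pos_part z + Bz *\<^sub>v neg_part z) $ i"
    using i carrier_matD[OF Bz] by (simp del: index_mult_mat_vec)
qed (use carrier_matD[OF Bz] in simp)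

lemma z3_pos_part_cong:
  assumes "pos_part x = pos_part x'"
  shows "z3 h x y = z3 h x' y"
proof -
  have "coord_sol i (x $ i) f y = coord_sol i (x' $ i) f y" if "i < m" for i f
  proof (cases "i < np")
    case True
    then have "x $ i = x' $ i" using arg_cong[OF assms, of "\<lambda>v. v $ i"] by (simp add: pos_part_def)
    then show ?thesis by simp
  next
    case False
    then have "\<not> 0 < lam i" using lam_0[of i] lam_neg[of i] that by (cases "i < np + n0") (auto simp: not_less)
    then show ?thesis by (simp add: coord_sol_def)
  qed
  then show ?thesis by (simp add: z3_def Matrix.vec_eq_iff)
qed

lemma Wsol_pos_part_cong:
  assumes "pos_part x = pos_part x'"
  shows "Wsol h x y = Wsol h x' y"
proof -
  have "z3 h x = z3 h x'" using z3_pos_part_cong[OF assms] by blast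
  then show ?thesis by (simp add: Wsol_def w1_def q1_def)
qed

lemma z3_0_parts:
  assumes h: "weighted_L2 a N h"
  shows "pos_part (z3 h x 0) = pos_part x" "neg_part (z3 h x 0) = neg_part (z3 h x' 0)"
proof -
  show "pos_part (z3 h x 0) = pos_part x"
    using z3_0(1)[OF h less_m(1) lam_pos] by (intro eq_vecI) (simp_all add: pos_part_def)
  have "z3 h x 0 $ i = z3 h x' 0 $ i" if "i < m" "np + n0 \<le> i" for i
    using lam_neg[OF that(2,1)] that by (simp add: z3_def coord_sol_def)
  then show "neg_part (z3 h x 0) = neg_part (z3 h x' 0)"
    by (simp add: neg_part_def Matrix.vec_eq_iff)
qed

lemma neg_part_bound:
  obtains K where "0 \<le> K" "\<And>h x i. weighted_L2 a N h \<Longrightarrow> i < m \<Longrightarrow> \<bar>neg_part (z3 h x 0) $ i\<bar> \<le> K * weighted_norm a h"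
proof -
  have "\<forall>i. \<exists>K. i < m \<longrightarrow> np + n0 \<le> i \<longrightarrow> (\<forall>h x. weighted_L2 a N h \<longrightarrow> \<bar>z3 h x 0 $ i\<bar> \<le> K * weighted_norm a h)"
    using backward_0_bound lam_neg by blast
  from choice[OF this] obtain K where
    K: "\<And>i h x. i < m \<Longrightarrow> np + n0 \<le> i \<Longrightarrow> weighted_L2 a N h \<Longrightarrow> \<bar>z3 h x 0 $ i\<bar> \<le> K i * weighted_norm a h"
    by blast
  show thesis
  proof
    show "0 \<le> (\<Sum>i<m. \<bar>K i\<bar>)" by (intro sum_nonneg) auto
    fix h x i assume h: "weighted_L2 a N h" and i: "i < m"
    note wn = weighted_norm_nonneg[OF h]
    have "\<bar>neg_part (z3 h x 0) $ i\<bar> \<le> \<bar>K i\<bar> * weighted_norm a h"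
    proof (cases "i < np + n0")
      case True
      then show ?thesis using i wn by (simp add: neg_part_def)
    next
      case False
      have "K i * weighted_norm a h \<le> \<bar>K i\<bar> * weighted_norm a h" by (intro mult_right_mono wn) simp
      then show ?thesis using False K[OF i _ h, of x] i by (simp add: neg_part_def)
    qed
    also have "\<dots> \<le> (\<Sum>i<m. \<bar>K i\<bar>) * weighted_norm a h"
      using i by (intro mult_right_mono wn member_le_sum) auto
    finally show "\<bar>neg_part (z3 h x 0) $ i\<bar> \<le> (\<Sum>i<m. \<bar>K i\<bar>) * weighted_norm a h" .
  qed
qed

section \<open>Well-posedness in terms of the boundary matrix\<close>

lemma boundary_value:
  assumes sol: "solves_bvp a N A Q C h g W D" and h: "weighted_L2 a N h"
  shows "Bz *\<^sub>v (P3 *\<^sub>v W 0) = g" "\<And>y. 0 \<le> y \<Longrightarrow> W y = Wsol h (P3 *\<^sub>v W 0) y"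
    "\<And>y. 0 \<le> y \<Longrightarrow> P3 *\<^sub>v W y = z3 h (P3 *\<^sub>v W 0) y"
proof -
  have "W 0 \<in> carrier_vec N" using sol by (simp add: solves_bvp_def weighted_L2_def)
  then show "Bz *\<^sub>v (P3 *\<^sub>v W 0) = g" using sol C by (simp add: solves_bvp_def)
  show "\<And>y. 0 \<le> y \<Longrightarrow> W y = Wsol h (P3 *\<^sub>v W 0) y"
    using solution_eq_Wsol[OF h] sol unfolding solves_bvp_def by blast
  then have P3: "P3 *\<^sub>v W y = P3 *\<^sub>v Wsol h (P3 *\<^sub>v W 0) y" if "0 \<le> y" for y
    by (rule arg_cong) (rule that)
  show "\<And>y. 0 \<le> y \<Longrightarrow> P3 *\<^sub>v W y = z3 h (P3 *\<^sub>v W 0) y"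
    by (rule P3[unfolded Wsol_coords(3)])
qed

text \<open>With vanishing columns at the zero modes, the boundary condition is a linear equation
  \<open>Bp x = g - Bz n\<close>, where \<open>n\<close> holds the values at 0 of the negative modes
  and is determined by \<open>h\<close>. Invertibility of \<open>Bp\<close> gives existence,
  uniqueness and a bound for \<open>x\<close>, and \<open>Wsol\<close> carries these over to
  \<open>W\<close>.\<close>

lemma well_posed_if:
  assumes inj: "\<And>x. x \<in> carrier_vec np \<Longrightarrow> Bp *\<^sub>v x = 0\<^sub>v np \<Longrightarrow> x = 0\<^sub>v np"
    and zero: "\<And>i j. i < np \<Longrightarrow> np \<le> j \<Longrightarrow> j < np + n0 \<Longrightarrow> Bz $$ (i, j) = 0"
  shows "well_posed a N np A Q C"
proof -
  obtain Bi where Bi: "Bi \<in> carrier_mat np np" "Bp * Bi = 1\<^sub>m np"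
    using injective_imp_inverse[OF part_carriers(1) inj] by blast
  have BBi: "Bp *\<^sub>v (Bi *\<^sub>v v) = v" if "v \<in> carrier_vec np" for v
    using assoc_mult_mat_vec[OF part_carriers(1) Bi(1) that, symmetric] Bi(2) that by simp
  have Bpinj: "u = v" if "u \<in> carrier_vec np" "v \<in> carrier_vec np" "Bp *\<^sub>v u = Bp *\<^sub>v v" for u v
  proof -
    have "Bp *\<^sub>v (u - v) = Bp *\<^sub>v v - Bp *\<^sub>v v"
      using mult_minus_distrib_mat_vec[OF part_carriers(1) that(1,2)] that(3) by simp
    also have "\<dots> = 0\<^sub>v np" by (intro eq_vecI) (auto simp: Bp_def)
    finally have "Bp *\<^sub>v (u - v) = 0\<^sub>v np" .
    from inj[OF minus_carrier_vec[OF that(1,2)] this] have uv: "u - v = 0\<^sub>v np" .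
    show ?thesis
    proof (rule eq_vecI)
      fix i assume "i < dim_vec v"
      then have i: "i < np" using that by simp
      have "(u - v) $ i = 0" unfolding uv using i by simp
      then show "u $ i = v $ i" using i that(1,2) by simp
    qed (use that(1,2) in simp)
  qed
  \<comment> \<open>The initial vector 0 serves as a representative, because
    \<open>neg_part (z3 h x 0)\<close> is the same for every \<open>x\<close>.\<close>
  define bx where "bx h g = Bi *\<^sub>v (g - Bz *\<^sub>v neg_part (z3 h (0\<^sub>v m) 0))" for h g
  have bxc: "bx h g \<in> carrier_vec np" for h g unfolding bx_def by (rule mat_vec_closed[OF Bi(1)])
  have pp: "pos_part (pad x) = x" if "x \<in> carrier_vec np" for x
    using that by (auto simp: pos_part_def pad_def less_m)
  have split: "Bz *\<^sub>v z = Bp *\<^sub>v pos_part z + Bz *\<^sub>v neg_part z" if "z \<in> carrier_vec m" for z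
    by (rule Bz_split[OF that]) (simp add: zero)
  have Bpbx: "Bp *\<^sub>v bx h g = g - Bz *\<^sub>v neg_part (z3 h (0\<^sub>v m) 0)" if "g \<in> carrier_vec np" for h g
    unfolding bx_def by (rule BBi) (use that mat_vec_closed[OF Bz] in simp)
  have ex: "solves_bvp a N A Q C h g (Wsol h (pad (bx h g))) (Dsol h (pad (bx h g)))"
    if h: "weighted_L2 a N h" and g: "g \<in> carrier_vec np" for h g
  proof -
    let ?z = "z3 h (pad (bx h g)) 0"
    have "C *\<^sub>v Wsol h (pad (bx h g)) 0 = Bz *\<^sub>v ?z" by (simp add: C Wsol_coords)
    also have "\<dots> = Bp *\<^sub>v pos_part ?z + Bz *\<^sub>v neg_part ?z" by (rule split) simp
    also have "pos_part ?z = bx h g" using z3_0_parts(1)[OF h] pp[OF bxc] by simp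
    also have "neg_part ?z = neg_part (z3 h (0\<^sub>v m) 0)" by (rule z3_0_parts(2)[OF h])
    also have "Bp *\<^sub>v bx h g + Bz *\<^sub>v neg_part (z3 h (0\<^sub>v m) 0) = g"
      unfolding Bpbx[OF g] by (intro eq_vecI) (use g carrier_matD[OF Bz] in auto)
    finally show ?thesis
      using Wsol_solution[OF h part_carriers(4)] by (simp add: solves_bvp_def)
  qed
  have uniq: "W' y = Wsol h (pad (bx h g)) y"
    if h: "weighted_L2 a N h" and g: "g \<in> carrier_vec np" and s: "solves_bvp a N A Q C h g W' D'" and y: "0 \<le> y"
    for h g W' D' y
  proof -
    let ?x = "P3 *\<^sub>v W' 0"
    have x: "?x = z3 h ?x 0" by (rule boundary_value(3)[OF s h order_refl])
    have "g = Bp *\<^sub>v pos_part ?x + Bz *\<^sub>v neg_part ?x"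
      using trans[OF boundary_value(1)[OF s h, symmetric] split[of ?x]] by simp
    also have "neg_part ?x = neg_part (z3 h (0\<^sub>v m) 0)"
      by (subst x) (rule z3_0_parts(2)[OF h])
    finally have e: "g = Bp *\<^sub>v pos_part ?x + Bz *\<^sub>v neg_part (z3 h (0\<^sub>v m) 0)" .
    have "Bp *\<^sub>v pos_part ?x = Bp *\<^sub>v bx h g"
      unfolding Bpbx[OF g]
    proof -
      have "u = u + v - v" if "u \<in> carrier_vec np" "v \<in> carrier_vec np" for u v :: "real Matrix.vec"
        using that by (intro eq_vecI) auto
      from this[OF mat_vec_closed[OF part_carriers(1)] mat_vec_closed[OF Bz]]
      have "Bp *\<^sub>v pos_part ?x = Bp *\<^sub>v pos_part ?x + Bz *\<^sub>v neg_part (z3 h (0\<^sub>v m) 0) - Bz *\<^sub>v neg_part (z3 h (0\<^sub>v m) 0)"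
        by this
      also have "\<dots> = g - Bz *\<^sub>v neg_part (z3 h (0\<^sub>v m) 0)" by (simp only: e[symmetric])
      finally show "Bp *\<^sub>v pos_part ?x = g - Bz *\<^sub>v neg_part (z3 h (0\<^sub>v m) 0)" .
    qed
    then have "pos_part ?x = pos_part (pad (bx h g))"
      using Bpinj[of "pos_part ?x" "bx h g"] bxc pp by simp
    from trans[OF boundary_value(2)[OF s h y] Wsol_pos_part_cong[OF this]] show ?thesis .
  qed
  obtain K1 where K1: "0 \<le> K1" "\<And>h x i. weighted_L2 a N h \<Longrightarrow> i < m \<Longrightarrow> \<bar>neg_part (z3 h x 0) $ i\<bar> \<le> K1 * weighted_norm a h"
    by (rule neg_part_bound) blast
  obtain K2 where K2: "0 \<le> K2"
    "\<And>v t i. v \<in> carrier_vec m \<Longrightarrow> (\<And>j. j < m \<Longrightarrow> \<bar>v $ j\<bar> \<le> t) \<Longrightarrow> 0 \<le> t \<Longrightarrow> i < np \<Longrightarrow> \<bar>(Bz *\<^sub>v v) $ i\<bar> \<le> K2 * t"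
    by (rule mult_mat_vec_sup_bound[OF Bz]) blast
  obtain K3 where K3: "0 \<le> K3"
    "\<And>v t i. v \<in> carrier_vec np \<Longrightarrow> (\<And>j. j < np \<Longrightarrow> \<bar>v $ j\<bar> \<le> t) \<Longrightarrow> 0 \<le> t \<Longrightarrow> i < np \<Longrightarrow> \<bar>(Bi *\<^sub>v v) $ i\<bar> \<le> K3 * t"
    by (rule mult_mat_vec_sup_bound[OF Bi(1)]) blast
  obtain K4 where K4: "\<forall>d. admissible d \<longrightarrow> weighted_norm a (Wsol (fst d) (snd d)) \<le> K4 * data_norm d"
    using bounded_familyD(2)[OF bfam_Wsol] ..
  \<comment> \<open>\<open>K1\<close> bounds the negative modes at 0, \<open>K2\<close> and
    \<open>K3\<close> the action of \<open>Bz\<close> and \<open>Bi\<close>, and \<open>K4\<close>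
    the solution operator; \<open>real m\<close> passes from entries to the Euclidean norm of the
    initial vector. The summand 1 makes the constant positive.\<close>
  define K where "K = 1 + \<bar>K4\<bar> * (1 + real m * K3 * (1 + K2 * K1))"
  have K0: "0 < K" unfolding K_def using K1(1) K2(1) K3(1) by (intro add_pos_nonneg mult_nonneg_nonneg add_nonneg_nonneg) auto
  have bound: "weighted_norm a (Wsol h (pad (bx h g))) \<le> K * (weighted_norm a h + vec_norm2 g)"
    if h: "weighted_L2 a N h" and g: "g \<in> carrier_vec np" for h g
  proof -
    let ?n = "weighted_norm a h + vec_norm2 g" and ?nz = "neg_part (z3 h (0\<^sub>v m) 0)"
    have nn: "0 \<le> weighted_norm a h" "0 \<le> vec_norm2 g" using weighted_norm_nonneg[OF h] vec_norm2_nonneg by auto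
    have b1: "\<bar>(Bz *\<^sub>v ?nz) $ i\<bar> \<le> K2 * (K1 * weighted_norm a h)" if "i < np" for i
      by (rule K2(2)) (use K1 h that nn in auto)
    have b2: "\<bar>(g - Bz *\<^sub>v ?nz) $ i\<bar> \<le> (1 + K2 * K1) * ?n" if i: "i < np" for i
    proof -
      have "\<bar>(g - Bz *\<^sub>v ?nz) $ i\<bar> \<le> \<bar>g $ i\<bar> + \<bar>(Bz *\<^sub>v ?nz) $ i\<bar>"
        using i carrier_matD[OF Bz] by (simp del: index_mult_mat_vec)
      also have "\<dots> \<le> vec_norm2 g + K2 * K1 * weighted_norm a h"
        using abs_index_le_vec_norm2[OF g i] b1[OF i] by (simp add: mult.assoc)
      also have "\<dots> \<le> (1 + K2 * K1) * ?n"
      proof -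
        have "0 \<le> K2 * K1 * vec_norm2 g" using nn K1(1) K2(1) by (intro mult_nonneg_nonneg)
        then show ?thesis using nn by (simp add: algebra_simps)
      qed
      finally show ?thesis .
    qed
    have n: "0 \<le> (1 + K2 * K1) * ?n" using nn K1(1) K2(1) by (intro mult_nonneg_nonneg add_nonneg_nonneg) auto
    have b3: "\<bar>bx h g $ i\<bar> \<le> K3 * ((1 + K2 * K1) * ?n)" if "i < np" for i
      unfolding bx_def by (rule K3(2)[OF _ b2 n that]) (use g mat_vec_closed[OF Bz] in simp)
    have "vec_norm2 (pad (bx h g)) \<le> real m * (K3 * ((1 + K2 * K1) * ?n))"
      by (rule vec_norm2_le) (use b3 K3(1) n in \<open>auto simp: pad_def\<close>)
    then have "data_norm (h, pad (bx h g)) \<le> (1 + real m * K3 * (1 + K2 * K1)) * ?n"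
      using nn by (simp add: data_norm_def algebra_simps)
    then have "\<bar>K4\<bar> * data_norm (h, pad (bx h g)) \<le> \<bar>K4\<bar> * ((1 + real m * K3 * (1 + K2 * K1)) * ?n)"
      by (intro mult_left_mono) auto
    moreover have adm: "admissible (h, pad (bx h g))" using h by (simp add: admissible_def)
    moreover have "K4 * data_norm (h, pad (bx h g)) \<le> \<bar>K4\<bar> * data_norm (h, pad (bx h g))"
      by (intro mult_right_mono data_norm_nonneg adm) simp
    moreover have "weighted_norm a (Wsol h (pad (bx h g))) \<le> K4 * data_norm (h, pad (bx h g))"
      using K4[rule_format, OF adm] by simp
    ultimately have "weighted_norm a (Wsol h (pad (bx h g))) \<le> \<bar>K4\<bar> * (1 + real m * K3 * (1 + K2 * K1)) * ?n"
      by (simp only: mult.assoc)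
    also have "\<dots> \<le> K * ?n" using nn by (simp add: K_def distrib_right)
    finally show ?thesis .
  qed
  show ?thesis unfolding well_posed_def
  proof (intro exI[of _ K] conjI allI impI K0)
    fix h and g :: "real Matrix.vec" assume "weighted_L2 a N h" "g \<in> carrier_vec np"
    then show "\<exists>W. (\<exists>D. solves_bvp a N A Q C h g W D) \<and>
        (\<forall>W' D'. solves_bvp a N A Q C h g W' D' \<longrightarrow> (\<forall>y\<ge>0. W' y = W y)) \<and>
        weighted_norm a W \<le> K * (weighted_norm a h + vec_norm2 g)"
      using ex uniq bound by (intro exI[of _ "Wsol h (pad (bx h g))"]) blast
  qed
qed

text \<open>Without a component seen by \<open>R1\<close> the second coordinate and its derivative
  vanish, so nothing is subtracted from the third row.\<close>

lemma f3_no_R1: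
  assumes "\<And>y. 0 \<le> y \<Longrightarrow> R1 *\<^sub>v h y = 0\<^sub>v p" "0 \<le> y"
  shows "f3 h y = R3 *\<^sub>v h y"
proof -
  have z: "M *\<^sub>v (0\<^sub>v p) = 0\<^sub>v k" if "M \<in> carrier_mat k p" for M :: "real mat" and k
    using that by (intro eq_vecI) auto
  have "vec_integral p {y..} (\<lambda>s. R1 *\<^sub>v h s) = vec_integral p {y..} (\<lambda>s. 0\<^sub>v p)"
    by (rule vec_integral_cong) (use assms in simp)
  also have "\<dots> = 0\<^sub>v p" by (intro eq_vecI) (auto simp: vec_integral_def)
  finally have "w2 h y = 0\<^sub>v p" by (simp add: w2_def z[OF carr(16)])
  moreover have "d2 h y = 0\<^sub>v p" using assms by (simp add: d2_def z[OF carr(16)])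
  ultimately show ?thesis
    by (simp add: f3_def source_def z[OF carr(24)] z[OF carr(23)])
qed

text \<open>For \<open>h = 0\<close> and \<open>g = 0\<close>, each kernel vector of
  \<open>Bp\<close> is the initial value of a decaying solution whose zero and negative modes
  vanish. Uniqueness leaves only the kernel vector 0.\<close>

lemma well_posed_imp_inj:
  assumes wp: "well_posed a N np A Q C" and x: "x \<in> carrier_vec np" "Bp *\<^sub>v x = 0\<^sub>v np"
  shows "x = 0\<^sub>v np"
proof -
  let ?h = "\<lambda>y::real. 0\<^sub>v N :: real Matrix.vec"
  have h: "weighted_L2 a N ?h" by (simp add: weighted_L2_iff wL2_zero)
  have z: "R *\<^sub>v 0\<^sub>v N = 0\<^sub>v k" if "R \<in> carrier_mat k N" for R :: "real mat" and k
    using that by (intro eq_vecI) auto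
  have f3: "f3 ?h y = 0\<^sub>v m" if "0 \<le> y" for y
    using f3_no_R1[of ?h y] that z[OF carr(9)] z[OF carr(11)] by simp
  have z3: "z3 ?h (pad v) 0 = pad v" if v: "v \<in> carrier_vec np" for v
  proof (rule eq_vecI)
    fix i assume "i < dim_vec (pad v)"
    then have i: "i < m" by (simp add: pad_def)
    consider "i < np" | "np \<le> i" "i < np + n0" | "np + n0 \<le> i" by linarith
    then show "z3 ?h (pad v) 0 $ i = pad v $ i"
    proof cases
      case 1
      then show ?thesis using z3_0(1)[OF h i lam_pos] by simp
    next
      case 2
      then show ?thesis using z3_0(2)[OF h i lam_0] f3[of 0] i by (simp add: pad_def)
    next
      case 3
      then show ?thesis using lam_neg[OF 3 i] backward_sol_zero[of "\<lambda>y. f3 ?h y $ i" 0] f3 i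
        by (simp add: z3_def coord_sol_def pad_def)
    qed
  qed (simp add: z3_def pad_def)
  have sol: "solves_bvp a N A Q C ?h (0\<^sub>v np) (Wsol ?h (pad v)) (Dsol ?h (pad v))"
    if v: "v \<in> carrier_vec np" "Bp *\<^sub>v v = 0\<^sub>v np" for v
  proof -
    have "C *\<^sub>v Wsol ?h (pad v) 0 = Bz *\<^sub>v pad v" by (simp add: C Wsol_coords z3[OF v(1)])
    also have "\<dots> = Bp *\<^sub>v pos_part (pad v) + Bz *\<^sub>v neg_part (pad v)"
      by (rule Bz_split) (auto simp: pad_def less_m)
    also have "pos_part (pad v) = v" using v by (auto simp: pos_part_def pad_def less_m)
    also have "neg_part (pad v) = 0\<^sub>v m" by (auto simp: neg_part_def pad_def)
    also have "Bz *\<^sub>v 0\<^sub>v m = 0\<^sub>v np" by (rule mult_mat_vec_zero) simp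
    finally show ?thesis using Wsol_solution[OF h part_carriers(4)] v by (simp add: solves_bvp_def)
  qed
  from wp obtain K where K: "\<forall>h g. weighted_L2 a N h \<longrightarrow> g \<in> carrier_vec np \<longrightarrow>
      (\<exists>W. (\<exists>D. solves_bvp a N A Q C h g W D) \<and>
             (\<forall>W' D'. solves_bvp a N A Q C h g W' D' \<longrightarrow> (\<forall>y\<ge>0. W' y = W y)) \<and>
             weighted_norm a W \<le> K * (weighted_norm a h + vec_norm2 g))"
    unfolding well_posed_def by blast
  from K[rule_format, OF h zero_carrier_vec] obtain W where
    W: "\<And>W' D'. solves_bvp a N A Q C ?h (0\<^sub>v np) W' D' \<Longrightarrow> \<forall>y\<ge>0. W' y = W y" by blast
  have zero: "Bp *\<^sub>v 0\<^sub>v np = 0\<^sub>v np" by (rule mult_mat_vec_zero) simp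
  have "Wsol ?h (pad x) 0 = W 0" "Wsol ?h (pad (0\<^sub>v np)) 0 = W 0"
    by (rule W[OF sol, rule_format]; use x zero in simp)+
  then have "Wsol ?h (pad x) 0 = Wsol ?h (pad (0\<^sub>v np)) 0" by (rule trans[OF _ sym])
  from arg_cong[OF this, of "\<lambda>w. P3 *\<^sub>v w"] have "pad x = pad (0\<^sub>v np)"
    unfolding Wsol_coords(3) z3[OF x(1)] z3[OF zero_carrier_vec] .
  note pad_eq = this
  have "x $ i = 0" if "i < np" for i
    using arg_cong[OF pad_eq, of "\<lambda>v. v $ i"] that less_m(1)[OF that] by (simp add: pad_def)
  then show ?thesis using x by (intro eq_vecI) auto
qed

text \<open>Perturbing \<open>h\<close> at the single point \<open>y = 0\<close> by a vector of the form \<open>Q v\<close> does not change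
  its norm, but it moves the boundary value in the directions of the zero eigenvalues.\<close>

lemma well_posed_imp_zero:
  assumes wp: "well_posed a N np A Q C" and j: "np \<le> j" "j < np + n0"
  shows "Bz *\<^sub>v unit_vec m j = 0\<^sub>v np"
proof -
  \<comment> \<open>The vector whose third coordinate is the eigendirection \<open>j\<close> and
    whose other coordinates vanish. As \<open>R1\<close> annihilates \<open>Q v\<close> and
    \<open>R3\<close> maps it to that unit vector, the perturbation reaches mode \<open>j\<close>
    alone.\<close>
  define v where "v = S1 *\<^sub>v 0\<^sub>v r + S2 *\<^sub>v 0\<^sub>v p + S3 *\<^sub>v unit_vec m j"
  define h :: "real \<Rightarrow> real Matrix.vec" where "h y = (if y = 0 then Q *\<^sub>v v else 0\<^sub>v N)" for y
  have vc: "v \<in> carrier_vec N" by (simp add: v_def)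
  have Pv: "P2 *\<^sub>v v = 0\<^sub>v p" "P3 *\<^sub>v v = unit_vec m j" unfolding v_def using PS by simp_all
  have hi: "h y $ i = (if y = 0 then (Q *\<^sub>v v) $ i else 0)" if "i < N" for y i
    using that by (simp add: h_def del: index_mult_mat_vec)
  have w: "wL2 a (\<lambda>y. h y $ i)" "wL2_norm a (\<lambda>y. h y $ i) = 0" if "i < N" for i
    unfolding hi[OF that] by (rule wL2_point_mass)+
  have h: "weighted_L2 a N h" using w(1) by (auto simp: weighted_L2_iff h_def)
  have h0: "weighted_norm a h = 0"
    using weighted_norm_le_sum[OF h] w(2) weighted_norm_nonneg[OF h] by simp
  have z: "R *\<^sub>v 0\<^sub>v n = 0\<^sub>v k" if "R \<in> carrier_mat k n" for R :: "real mat" and k n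
    using that by (intro eq_vecI) auto
  have R1h: "R1 *\<^sub>v h y = 0\<^sub>v p" for y by (simp add: h_def R1Q[OF vc] z[OF carr(9)])
  have f3: "f3 h y = (if y = 0 then unit_vec m j else 0\<^sub>v m)" if "0 \<le> y" for y
    using f3_no_R1[where h = h, OF R1h that] by (simp add: h_def R3Q[OF vc] Pv z[OF carr(11)] z[OF carr(24)])
  obtain K where K: "\<forall>h g. weighted_L2 a N h \<longrightarrow> g \<in> carrier_vec np \<longrightarrow>
      (\<exists>W. (\<exists>D. solves_bvp a N A Q C h g W D) \<and>
             (\<forall>W' D'. solves_bvp a N A Q C h g W' D' \<longrightarrow> (\<forall>y\<ge>0. W' y = W y)) \<and>
             weighted_norm a W \<le> K * (weighted_norm a h + vec_norm2 g))"
    using wp unfolding well_posed_def by blast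
  from K[rule_format, OF h zero_carrier_vec] obtain W where
    "\<exists>D. solves_bvp a N A Q C h (0\<^sub>v np) W D"
    and Wn: "weighted_norm a W \<le> K * (weighted_norm a h + vec_norm2 (0\<^sub>v np))" by blast
  from this(1) obtain D where W: "solves_bvp a N A Q C h (0\<^sub>v np) W D" ..
  let ?x = "P3 *\<^sub>v W 0"
  have WL: "weighted_L2 a N W" using W by (simp add: solves_bvp_def)
  have "vec_norm2 (0\<^sub>v np) = 0" by (simp add: vec_norm2_def)
  \<comment> \<open>All data have norm 0, so the estimate forces the weighted norm of
    \<open>W\<close> to be 0, whatever the constant is. The value \<open>W 0\<close> is still
    free.\<close>
  then have W0: "weighted_norm a W = 0" using Wn h0 weighted_norm_nonneg[OF WL] by simp
  have "wL2_norm a (\<lambda>y. W y $ i) = 0" if "i < N" for i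
    using wL2_norm_le_weighted_norm[OF WL that] W0 wL2_norm_nonneg[of a "\<lambda>y. W y $ i"] by linarith
  then have "AE y in lebesgue_on {0..}. W y $ i = 0" if "i < N" for i
    using wL2_norm_eq_0_iff[of a "\<lambda>y. W y $ i"] WL that by (simp add: weighted_L2_iff)
  then have "AE y in lebesgue_on {0..}. \<forall>i\<in>{..<N}. W y $ i = 0"
    by (intro AE_finite_allI) auto
  then have AE0: "AE y in lebesgue_on {0..}. (P3 *\<^sub>v W y) $ i = 0" if i: "i < m" for i
    \<comment> \<open>This supplies \<open>y\<close> in the half-line, where \<open>W y\<close> is
      known to have dimension \<open>N\<close>.\<close>
    using AE_space
  proof eventually_elim
    case (elim y)
    then have "W y \<in> carrier_vec N" using WL by (simp add: weighted_L2_def)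
    then show ?case using elim by (subst mult_mat_vec_index[OF carr(8) _ i]) auto
  qed
  have Weq: "P3 *\<^sub>v W y = z3 h ?x y" if "0 \<le> y" for y
    by (rule boundary_value(3)[OF W h that])
  \<comment> \<open>Positive modes receive no source and are exact exponentials on the half-line; a
    vanishing norm therefore forces their initial values to be 0.\<close>
  have xpos: "?x $ i = 0" if i: "i < np" for i
  proof -
    have im: "i < m" and ij: "i \<noteq> j" using i j by (auto simp: less_m)
    have e: "(P3 *\<^sub>v W y) $ i = exp (- (1 / lam i) * y) * ?x $ i" if "0 \<le> y" for y
    proof -
      have "(P3 *\<^sub>v W y) $ i = forward_sol (1 / lam i) (?x $ i) (\<lambda>y. f3 h y $ i) y"
        unfolding Weq[OF that] using lam_pos[OF i] im by (simp add: z3_def coord_sol_def del: index_mult_mat_vec)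
      also have "\<dots> = exp (- (1 / lam i) * y) * ?x $ i"
        by (rule forward_sol_zero) (use im ij j less_m(2)[OF j(2)] in \<open>auto simp: f3\<close>)
      finally show ?thesis .
    qed
    have L: "wL2 a (\<lambda>y. (P3 *\<^sub>v W y) $ i)"
      using weighted_L2_mult[OF carr(8) WL] im by (simp add: weighted_L2_iff del: index_mult_mat_vec)
    have "wL2 a (\<lambda>y. exp (- (1 / lam i) * y) * ?x $ i)"
      by (rule wL2_congI[OF L e])
    moreover have "wL2_norm a (\<lambda>y. exp (- (1 / lam i) * y) * ?x $ i) = 0"
      using wL2_cong(2)[OF e, where a = a] wL2_norm_eq_0_iff[OF L] AE0[OF im] by simp
    ultimately show ?thesis by (rule exp_wL2_norm_zero[rotated])
  qed
  have "?x = unit_vec m j"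
  proof (rule eq_vecI)
    fix i assume "i < dim_vec (unit_vec m j)"
    then have i: "i < m" by simp
    consider "i < np" | "np \<le> i" "i < np + n0" | "np + n0 \<le> i" by linarith
    then show "?x $ i = unit_vec m j $ i"
    proof cases
      case 1
      then show ?thesis using xpos[OF 1] j i less_m(2)[OF j(2)] by simp
    next
      case 2
      have "?x $ i = z3 h ?x 0 $ i" by (rule arg_cong[OF Weq]) simp
      also have "\<dots> = f3 h 0 $ i" by (rule z3_0(2)[OF h i lam_0[OF 2]])
      finally show ?thesis using f3[of 0] by (simp del: index_mult_mat_vec)
    next
      case 3
      have "?x $ i = z3 h ?x 0 $ i" by (rule arg_cong[OF Weq]) simp
      also have "\<dots> = backward_sol (1 / lam i) (\<lambda>y. f3 h y $ i) 0"
        using lam_neg[OF 3 i] i by (simp add: z3_def coord_sol_def)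
      also have "\<dots> = 0" by (rule backward_sol_zero) (use f3 3 j i less_m(2)[OF j(2)] in auto)
      finally show ?thesis using 3 j i less_m(2)[OF j(2)] by (simp del: index_mult_mat_vec)
    qed
  qed (simp add: carrier_matD[OF carr(8)])
  \<comment> \<open>The boundary value is the unit vector \<open>j\<close> while the prescribed one
    is 0, hence column \<open>j\<close> of \<open>Bz\<close> vanishes.\<close>
  with boundary_value(1)[OF W h] show ?thesis by (simp only:)
qed

end

section \<open>Reduction of the moment system\<close>

lemma mult_mat_vec_inverse:
  fixes M M' :: "real mat"
  assumes "M \<in> carrier_mat n k" "M' \<in> carrier_mat k n" "M * M' = 1\<^sub>m n" "v \<in> carrier_vec n"
  shows "M *\<^sub>v (M' *\<^sub>v v) = v"
proof -
  have "M *\<^sub>v (M' *\<^sub>v v) = (M * M') *\<^sub>v v" by (rule assoc_mult_mat_vec[OF assms(1,2,4), symmetric])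
  also have "\<dots> = v" using assms(3,4) by simp
  finally show ?thesis .
qed

lemma col_space_iff:
  fixes M :: "real mat"
  assumes "M \<in> carrier_mat n k"
  shows "y \<in> vec_space.col_space n M \<longleftrightarrow> (\<exists>x\<in>carrier_vec k. M *\<^sub>v x = y)"
proof -
  have "M *\<^sub>v x \<in> carrier_vec n" for x by (rule mat_vec_closed[OF assms])
  then show ?thesis
    using vec_space.col_space_eq[OF assms] assms by auto
qed

text \<open>The setting of the theorem with \<open>U1\<close> and \<open>U3\<close> already replaced
  by \<open>G\<close> and \<open>V3\<close>.\<close>

locale half_space_moment_system =
  fixes N p r m np n0 nm :: nat
    and A Q G X V1 V2 V3 U2 A21 A22 A23 A32 A33 Q22 Q23 Q32 Q33 L R Lam Lp Lm T Tp T0 Tm :: "real mat"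
    and a lam_max :: real
  assumes A: "symmetric_real_mat N A"
    and Q: "pos_semidef_mat N Q"
    and null: "mat_kernel A \<inter> mat_kernel Q = {0\<^sub>v N}"
    and G: "orthonormal_basis_mat N p (mat_kernel Q) G"
    and X: "orthonormal_basis_mat p r (mat_kernel (transpose_mat G * A * G)) X"
    and V1: "V1 = G * X"
    and V2: "orthonormal_basis_mat N p (vec_space.col_space N (A * G)) V2"
    and V3: "V3 \<in> carrier_mat N m"
    and V: "orthonormal_mat N (V1 @\<^sub>c V2 @\<^sub>c V3)"
    and U2: "U2 = A * G * X"
    and A_blocks:
      "A21 = transpose_mat U2 * A * V1" "A22 = transpose_mat U2 * A * V2"
      "A23 = transpose_mat U2 * A * V3" "A32 = transpose_mat V3 * A * V2"
      "A33 = transpose_mat V3 * A * V3"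
    and Q_blocks:
      "Q22 = transpose_mat U2 * Q * V2" "Q23 = transpose_mat U2 * Q * V3"
      "Q32 = transpose_mat V3 * Q * V2" "Q33 = transpose_mat V3 * Q * V3"
    and L: "cholesky m Q33 L"
    and R: "orthonormal_mat m R"
    and eig: "mat_inv L * A33 * transpose_mat (mat_inv L) * R = R * Lam"
    and Lam: "Lam = diag_block_mat [Lp, 0\<^sub>m n0 n0, Lm]" "m = np + n0 + nm"
    and Lp: "Lp \<in> carrier_mat np np" "diagonal_mat Lp" "\<forall>i<np. 0 < Lp $$ (i, i)"
    and Lm: "Lm \<in> carrier_mat nm nm" "diagonal_mat Lm" "\<forall>i<nm. Lm $$ (i, i) < 0"
    and T: "T = transpose_mat (mat_inv L) * R" "T = Tp @\<^sub>c T0 @\<^sub>c Tm"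
    and T_blocks: "Tp \<in> carrier_mat m np" "T0 \<in> carrier_mat m n0" "Tm \<in> carrier_mat m nm"
    and lam_max: "is_max_eigenvalue (mat_inv Q33 * A33) lam_max"
    and a: "0 < a" "a < 1 / lam_max"
begin

lemma A_carrier: "A \<in> carrier_mat N N" and A_sym: "transpose_mat A = A"
  using A by (auto simp: symmetric_real_mat_def)

lemma Q_carrier: "Q \<in> carrier_mat N N" and Q_sym: "transpose_mat Q = Q"
  using Q by (auto simp: pos_semidef_mat_def symmetric_real_mat_def)

lemma G_carrier: "G \<in> carrier_mat N p" and G_orth: "transpose_mat G * G = 1\<^sub>m p"
  using G by (auto simp: orthonormal_basis_mat_def)

lemma X_carrier: "X \<in> carrier_mat p r" and X_orth: "transpose_mat X * X = 1\<^sub>m r"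
  using X by (auto simp: orthonormal_basis_mat_def)

lemma V1_carrier: "V1 \<in> carrier_mat N r"
  unfolding V1 using G_carrier X_carrier by simp

lemma V2_carrier: "V2 \<in> carrier_mat N p"
  using V2 by (auto simp: orthonormal_basis_mat_def)

lemma U2_carrier: "U2 \<in> carrier_mat N r"
  unfolding U2 using A_carrier G_carrier X_carrier by simp

lemmas carriers = A_carrier Q_carrier G_carrier X_carrier V1_carrier V2_carrier V3 U2_carrier

text \<open>An orthogonal matrix is square, so counting the columns of the three blocks gives the
  dimension.\<close>

lemma N_eq: "N = r + (p + m)"
proof -
  have "V1 @\<^sub>c V2 @\<^sub>c V3 \<in> carrier_mat N (r + (p + m))"
    by (intro append_cols_carrier V1_carrier V2_carrier V3)
  with V show ?thesis by (auto simp: orthonormal_mat_def)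
qed

lemma V_carrier: "V1 @\<^sub>c V2 @\<^sub>c V3 \<in> carrier_mat N N"
  using V by (simp add: orthonormal_mat_def)

lemma VT_mult:
  assumes "w \<in> carrier_vec N"
  shows "transpose_mat (V1 @\<^sub>c V2 @\<^sub>c V3) *\<^sub>v w =
    transpose_mat V1 *\<^sub>v w @\<^sub>v transpose_mat V2 *\<^sub>v w @\<^sub>v transpose_mat V3 *\<^sub>v w"
  unfolding append_cols_transpose_mult[OF V1_carrier append_cols_carrier[OF V2_carrier V3] assms]
    append_cols_transpose_mult[OF V2_carrier V3 assms] ..

lemma V_mult:
  assumes "u \<in> carrier_vec r" "v \<in> carrier_vec p" "w \<in> carrier_vec m"
  shows "(V1 @\<^sub>c V2 @\<^sub>c V3) *\<^sub>v (u @\<^sub>v v @\<^sub>v w) = V1 *\<^sub>v u + V2 *\<^sub>v v + V3 *\<^sub>v w"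
proof -
  have "(V1 @\<^sub>c V2 @\<^sub>c V3) *\<^sub>v (u @\<^sub>v v @\<^sub>v w) = V1 *\<^sub>v u + (V2 *\<^sub>v v + V3 *\<^sub>v w)"
    using append_cols_mult[OF V1_carrier append_cols_carrier[OF V2_carrier V3] assms(1), of "v @\<^sub>v w"]
      append_cols_mult[OF V2_carrier V3 assms(2,3)] assms by simp
  also have "\<dots> = V1 *\<^sub>v u + V2 *\<^sub>v v + V3 *\<^sub>v w"
    by (rule assoc_add_vec[symmetric]) (rule mat_vec_closed, rule carriers)+
  finally show ?thesis .
qed

text \<open>Orthonormality of the columns of a square matrix also gives \<open>V V^T = I\<close>, of
  which this is the block form.\<close>

lemma V_decomposition:
  assumes w: "w \<in> carrier_vec N"
  shows "w = V1 *\<^sub>v (transpose_mat V1 *\<^sub>v w) + V2 *\<^sub>v (transpose_mat V2 *\<^sub>v w) + V3 *\<^sub>v (transpose_mat V3 *\<^sub>v w)"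
proof -
  let ?V = "V1 @\<^sub>c V2 @\<^sub>c V3"
  have "?V * transpose_mat ?V = 1\<^sub>m N"
    using mat_mult_left_right_inverse[of "transpose_mat ?V" N ?V] V by (simp add: orthonormal_mat_def)
  then have "w = ?V *\<^sub>v (transpose_mat ?V *\<^sub>v w)"
    using mult_mat_vec_inverse[OF V_carrier, of "transpose_mat ?V" w] V_carrier w by simp
  also have "\<dots> = V1 *\<^sub>v (transpose_mat V1 *\<^sub>v w) + V2 *\<^sub>v (transpose_mat V2 *\<^sub>v w) + V3 *\<^sub>v (transpose_mat V3 *\<^sub>v w)"
    unfolding VT_mult[OF w]
    by (rule V_mult) (rule mat_vec_closed, rule transpose_carrier_mat[THEN iffD2], rule carriers)+
  finally show ?thesis .
qed

lemma V_coords: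
  assumes "u \<in> carrier_vec r" "v \<in> carrier_vec p" "w \<in> carrier_vec m"
  shows "transpose_mat V1 *\<^sub>v (V1 *\<^sub>v u + V2 *\<^sub>v v + V3 *\<^sub>v w) = u"
    "transpose_mat V2 *\<^sub>v (V1 *\<^sub>v u + V2 *\<^sub>v v + V3 *\<^sub>v w) = v"
    "transpose_mat V3 *\<^sub>v (V1 *\<^sub>v u + V2 *\<^sub>v v + V3 *\<^sub>v w) = w"
proof -
  let ?V = "V1 @\<^sub>c V2 @\<^sub>c V3" and ?w = "V1 *\<^sub>v u + V2 *\<^sub>v v + V3 *\<^sub>v w"
  have c: "?w \<in> carrier_vec N"
    by (intro add_carrier_vec mat_vec_closed[OF V1_carrier] mat_vec_closed[OF V2_carrier] mat_vec_closed[OF V3])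
  have uvw: "u @\<^sub>v v @\<^sub>v w \<in> carrier_vec N" using assms by (simp add: N_eq)
  have "transpose_mat ?V *\<^sub>v (?V *\<^sub>v (u @\<^sub>v v @\<^sub>v w)) = u @\<^sub>v v @\<^sub>v w"
    by (rule mult_mat_vec_inverse[of _ N N]) (use V uvw in \<open>auto simp: orthonormal_mat_def\<close>)
  then have e: "transpose_mat V1 *\<^sub>v ?w @\<^sub>v transpose_mat V2 *\<^sub>v ?w @\<^sub>v transpose_mat V3 *\<^sub>v ?w = u @\<^sub>v v @\<^sub>v w"
    unfolding V_mult[OF assms] VT_mult[OF c] .
  have t: "transpose_mat V1 *\<^sub>v ?w \<in> carrier_vec r" "transpose_mat V2 *\<^sub>v ?w \<in> carrier_vec p"
    by (rule mat_vec_closed, rule transpose_carrier_mat[THEN iffD2], rule carriers)+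
  show "transpose_mat V1 *\<^sub>v ?w = u" using e append_vec_eq[OF t(1) assms(1)] by blast
  have e': "transpose_mat V2 *\<^sub>v ?w @\<^sub>v transpose_mat V3 *\<^sub>v ?w = v @\<^sub>v w" using e append_vec_eq[OF t(1) assms(1)] by blast
  show "transpose_mat V2 *\<^sub>v ?w = v" "transpose_mat V3 *\<^sub>v ?w = w" using e' append_vec_eq[OF t(2) assms(2)] by blast+
qed

lemma mult_zeros: "V1 *\<^sub>v 0\<^sub>v r = 0\<^sub>v N" "V2 *\<^sub>v 0\<^sub>v p = 0\<^sub>v N" "V3 *\<^sub>v 0\<^sub>v m = 0\<^sub>v N"
  by (rule mult_mat_vec_zero, rule carriers)+

lemma V_orthogonality:
  shows "u \<in> carrier_vec r \<Longrightarrow> transpose_mat V1 *\<^sub>v (V1 *\<^sub>v u) = u"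
    and "v \<in> carrier_vec p \<Longrightarrow> transpose_mat V2 *\<^sub>v (V2 *\<^sub>v v) = v"
    and "v \<in> carrier_vec p \<Longrightarrow> transpose_mat V3 *\<^sub>v (V2 *\<^sub>v v) = 0\<^sub>v m"
    and "w \<in> carrier_vec m \<Longrightarrow> transpose_mat V2 *\<^sub>v (V3 *\<^sub>v w) = 0\<^sub>v p"
proof -
  have c: "V1 *\<^sub>v u \<in> carrier_vec N" "V2 *\<^sub>v v \<in> carrier_vec N" "V3 *\<^sub>v w \<in> carrier_vec N" for u v w
    by (rule mat_vec_closed, rule carriers)+
  show "u \<in> carrier_vec r \<Longrightarrow> transpose_mat V1 *\<^sub>v (V1 *\<^sub>v u) = u"
    using V_coords(1)[of u "0\<^sub>v p" "0\<^sub>v m"] c by (simp add: mult_zeros)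
  show "v \<in> carrier_vec p \<Longrightarrow> transpose_mat V2 *\<^sub>v (V2 *\<^sub>v v) = v"
    using V_coords(2)[of "0\<^sub>v r" v "0\<^sub>v m"] c by (simp add: mult_zeros)
  show "v \<in> carrier_vec p \<Longrightarrow> transpose_mat V3 *\<^sub>v (V2 *\<^sub>v v) = 0\<^sub>v m"
    using V_coords(3)[of "0\<^sub>v r" v "0\<^sub>v m"] c by (simp add: mult_zeros)
  show "w \<in> carrier_vec m \<Longrightarrow> transpose_mat V2 *\<^sub>v (V3 *\<^sub>v w) = 0\<^sub>v p"
    using V_coords(2)[of "0\<^sub>v r" "0\<^sub>v p" w] c by (simp add: mult_zeros)
qed

lemma closed [simp]:
  "A *\<^sub>v w \<in> carrier_vec N" "Q *\<^sub>v w \<in> carrier_vec N" "G *\<^sub>v w \<in> carrier_vec N" "X *\<^sub>v w \<in> carrier_vec p"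
  "V1 *\<^sub>v w \<in> carrier_vec N" "V2 *\<^sub>v w \<in> carrier_vec N" "V3 *\<^sub>v w \<in> carrier_vec N" "U2 *\<^sub>v w \<in> carrier_vec N"
  by (rule mat_vec_closed, rule carriers)+

lemma closedT [simp]:
  "transpose_mat G *\<^sub>v w \<in> carrier_vec p" "transpose_mat X *\<^sub>v w \<in> carrier_vec r"
  "transpose_mat V1 *\<^sub>v w \<in> carrier_vec r" "transpose_mat V2 *\<^sub>v w \<in> carrier_vec p"
  "transpose_mat V3 *\<^sub>v w \<in> carrier_vec m" "transpose_mat U2 *\<^sub>v w \<in> carrier_vec r"
  by (rule mat_vec_closed, rule transpose_carrier_mat[THEN iffD2], rule carriers)+

section \<open>Blocks of \<open>A\<close> and \<open>Q\<close> that vanish or are invertible\<close>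

lemma V1_mult: "u \<in> carrier_vec r \<Longrightarrow> V1 *\<^sub>v u = G *\<^sub>v (X *\<^sub>v u)"
  unfolding V1 by (rule assoc_mult_mat_vec[OF G_carrier X_carrier])

lemma U2_mult: "u \<in> carrier_vec r \<Longrightarrow> U2 *\<^sub>v u = A *\<^sub>v (V1 *\<^sub>v u)"
  unfolding U2 using mult_mat_vec_assoc3[OF A_carrier G_carrier X_carrier] by (simp add: V1_mult)

lemma QG: "u \<in> carrier_vec p \<Longrightarrow> Q *\<^sub>v (G *\<^sub>v u) = 0\<^sub>v N"
proof -
  assume u: "u \<in> carrier_vec p"
  have "G *\<^sub>v u \<in> mat_kernel Q"
    using G u col_space_iff[OF G_carrier] unfolding orthonormal_basis_mat_def by blast
  then show ?thesis using mat_kernelD[OF Q_carrier] by blast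
qed

lemma ker_GAG:
  assumes s: "s \<in> carrier_vec p"
  shows "transpose_mat G *\<^sub>v (A *\<^sub>v (G *\<^sub>v s)) = 0\<^sub>v p \<longleftrightarrow> (\<exists>t\<in>carrier_vec r. X *\<^sub>v t = s)"
proof -
  have GAG: "transpose_mat G * A * G \<in> carrier_mat p p"
    using G_carrier A_carrier by simp
  have "(\<exists>t\<in>carrier_vec r. X *\<^sub>v t = s) \<longleftrightarrow> s \<in> mat_kernel (transpose_mat G * A * G)"
    using X col_space_iff[OF X_carrier] unfolding orthonormal_basis_mat_def by blast
  also have "\<dots> \<longleftrightarrow> (transpose_mat G * A * G) *\<^sub>v s = 0\<^sub>v p"
    unfolding mat_kernel[OF GAG] using s by simp
  also have "(transpose_mat G * A * G) *\<^sub>v s = transpose_mat G *\<^sub>v (A *\<^sub>v (G *\<^sub>v s))"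
    by (rule mult_mat_vec_assoc3[OF _ A_carrier G_carrier s]) (use G_carrier in simp)
  finally show ?thesis by simp
qed

lemma AG_V2:
  shows "s \<in> carrier_vec p \<Longrightarrow> \<exists>t\<in>carrier_vec p. A *\<^sub>v (G *\<^sub>v s) = V2 *\<^sub>v t"
    and "t \<in> carrier_vec p \<Longrightarrow> \<exists>s\<in>carrier_vec p. V2 *\<^sub>v t = A *\<^sub>v (G *\<^sub>v s)"
proof -
  have AG: "A * G \<in> carrier_mat N p" using A_carrier G_carrier by simp
  have m: "s \<in> carrier_vec p \<Longrightarrow> (A * G) *\<^sub>v s = A *\<^sub>v (G *\<^sub>v s)" for s
    by (rule assoc_mult_mat_vec[OF A_carrier G_carrier])
  have e: "(\<exists>x\<in>carrier_vec p. V2 *\<^sub>v x = y) \<longleftrightarrow> (\<exists>x\<in>carrier_vec p. (A * G) *\<^sub>v x = y)" for y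
    using V2 col_space_iff[OF V2_carrier] col_space_iff[OF AG] unfolding orthonormal_basis_mat_def by blast
  show "s \<in> carrier_vec p \<Longrightarrow> \<exists>t\<in>carrier_vec p. A *\<^sub>v (G *\<^sub>v s) = V2 *\<^sub>v t" using e m by metis
  show "t \<in> carrier_vec p \<Longrightarrow> \<exists>s\<in>carrier_vec p. V2 *\<^sub>v t = A *\<^sub>v (G *\<^sub>v s)" using e m by metis
qed

lemma A_adjoint: "v \<in> carrier_vec N \<Longrightarrow> w \<in> carrier_vec N \<Longrightarrow> v \<bullet> (A *\<^sub>v w) = (A *\<^sub>v v) \<bullet> w"
  using adjoint_real[OF A_carrier] A_sym by simp

lemma Q_adjoint: "v \<in> carrier_vec N \<Longrightarrow> w \<in> carrier_vec N \<Longrightarrow> v \<bullet> (Q *\<^sub>v w) = (Q *\<^sub>v v) \<bullet> w"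
  using adjoint_real[OF Q_carrier] Q_sym by simp

text \<open>By symmetry of \<open>Q\<close> this is the transpose of \<open>Q G = 0\<close>.\<close>

lemma GQ: "w \<in> carrier_vec N \<Longrightarrow> transpose_mat G *\<^sub>v (Q *\<^sub>v w) = 0\<^sub>v p"
  by (rule orthogonal_imp_zero) (simp_all add: adjoint_real[OF G_carrier] Q_adjoint QG)

text \<open>By symmetry of \<open>A\<close> it suffices that the columns of \<open>A G\<close> lie
  in the span of \<open>V2\<close>, which is orthogonal to \<open>V3\<close>.\<close>

lemma GAV3: "w \<in> carrier_vec m \<Longrightarrow> transpose_mat G *\<^sub>v (A *\<^sub>v (V3 *\<^sub>v w)) = 0\<^sub>v p"
proof (rule orthogonal_imp_zero)
  fix u :: "real Matrix.vec" assume w: "w \<in> carrier_vec m" and u: "u \<in> carrier_vec p"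
  obtain t where t: "t \<in> carrier_vec p" "A *\<^sub>v (G *\<^sub>v u) = V2 *\<^sub>v t" using AG_V2(1)[OF u] by blast
  have "u \<bullet> (transpose_mat G *\<^sub>v (A *\<^sub>v (V3 *\<^sub>v w))) = (V2 *\<^sub>v t) \<bullet> (V3 *\<^sub>v w)"
    by (simp add: adjoint_real[OF G_carrier u] A_adjoint t)
  also have "\<dots> = t \<bullet> (transpose_mat V2 *\<^sub>v (V3 *\<^sub>v w))"
    by (simp add: adjoint_real[OF V2_carrier t(1)])
  also have "\<dots> = 0" using V_orthogonality(4)[OF w] t by simp
  finally show "u \<bullet> (transpose_mat G *\<^sub>v (A *\<^sub>v (V3 *\<^sub>v w))) = 0" .
qed simp

lemma GAV1: "u \<in> carrier_vec r \<Longrightarrow> transpose_mat G *\<^sub>v (A *\<^sub>v (V1 *\<^sub>v u)) = 0\<^sub>v p"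
  unfolding V1_mult using ker_GAG[of "X *\<^sub>v u"] by auto

text \<open>\<open>A V1 = A G X\<close> lies in the column space of \<open>A G\<close>, that is, in
  the span of \<open>V2\<close>.\<close>

lemma V3AV1: "u \<in> carrier_vec r \<Longrightarrow> transpose_mat V3 *\<^sub>v (A *\<^sub>v (V1 *\<^sub>v u)) = 0\<^sub>v m"
  unfolding V1_mult using AG_V2(1)[of "X *\<^sub>v u"] V_orthogonality(3) by auto

lemma QV1: "u \<in> carrier_vec r \<Longrightarrow> Q *\<^sub>v (V1 *\<^sub>v u) = 0\<^sub>v N"
  unfolding V1_mult by (rule QG) simp

text \<open>The block \<open>U1^T A V2\<close>, the only one left in the row of \<open>A\<close>
  tested with \<open>G\<close>.\<close>

definition "E = transpose_mat G * A * V2"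

lemma E_carrier: "E \<in> carrier_mat p p"
  unfolding E_def using carriers by simp

lemma E_mult: "v \<in> carrier_vec p \<Longrightarrow> E *\<^sub>v v = transpose_mat G *\<^sub>v (A *\<^sub>v (V2 *\<^sub>v v))"
  unfolding E_def by (rule mult_mat_vec_assoc3[OF _ A_carrier V2_carrier]) (use G_carrier in simp)

text \<open>Write \<open>V2 v = A G s\<close>. By symmetry of \<open>A\<close>, the squared length
  of \<open>V2 v\<close> is the product of \<open>s\<close> with \<open>E v\<close>, hence
  0.\<close>

lemma E_inj:
  assumes v: "v \<in> carrier_vec p" and E: "E *\<^sub>v v = 0\<^sub>v p"
  shows "v = 0\<^sub>v p"
proof -
  obtain s where s: "s \<in> carrier_vec p" "V2 *\<^sub>v v = A *\<^sub>v (G *\<^sub>v s)" using AG_V2(2)[OF v] by blast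
  have "(V2 *\<^sub>v v) \<bullet> (V2 *\<^sub>v v) = (G *\<^sub>v s) \<bullet> (A *\<^sub>v (V2 *\<^sub>v v))"
    by (simp add: A_adjoint) (simp add: s(2))
  also have "\<dots> = s \<bullet> (E *\<^sub>v v)" unfolding E_mult[OF v] by (simp add: adjoint_real[OF G_carrier s(1)])
  also have "\<dots> = 0" using E s by simp
  finally have "V2 *\<^sub>v v = 0\<^sub>v N" using scalar_prod_self_eq_0 by simp
  then show ?thesis using V_orthogonality(2)[OF v] mult_mat_vec_zero[of "transpose_mat V2" p N] V2_carrier by simp
qed

lemma A21_carrier: "A21 \<in> carrier_mat r r"
  unfolding A_blocks using carriers by simp

text \<open>Because \<open>U2 = A V1\<close>, the block \<open>A21\<close> is the Gram matrix of
  \<open>A V1\<close>. A kernel vector \<open>u\<close> gives \<open>A V1 u = 0\<close>, and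
  \<open>Q V1 u = 0\<close> holds anyway, so the trivial intersection of the null spaces
  applies.\<close>

lemma A21_inj:
  assumes u: "u \<in> carrier_vec r" and z: "A21 *\<^sub>v u = 0\<^sub>v r"
  shows "u = 0\<^sub>v r"
proof -
  have e: "A21 *\<^sub>v u = transpose_mat U2 *\<^sub>v (A *\<^sub>v (V1 *\<^sub>v u))"
    unfolding A_blocks by (rule mult_mat_vec_assoc3[OF _ A_carrier V1_carrier u]) (use U2_carrier in simp)
  have "(A *\<^sub>v (V1 *\<^sub>v u)) \<bullet> (A *\<^sub>v (V1 *\<^sub>v u)) = u \<bullet> (transpose_mat U2 *\<^sub>v (A *\<^sub>v (V1 *\<^sub>v u)))"
    by (simp add: adjoint_real[OF U2_carrier u] U2_mult u)
  also have "\<dots> = 0" unfolding e[symmetric] z using u by simp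
  finally have "A *\<^sub>v (V1 *\<^sub>v u) = 0\<^sub>v N" using scalar_prod_self_eq_0 by simp
  then have "V1 *\<^sub>v u \<in> mat_kernel A \<inter> mat_kernel Q"
    using mat_kernelI[OF A_carrier] mat_kernelI[OF Q_carrier] QV1[OF u] by simp
  then have "V1 *\<^sub>v u = 0\<^sub>v N" using null by auto
  then show ?thesis using V_orthogonality(1)[OF u] mult_mat_vec_zero[of "transpose_mat V1" r N] V1_carrier by simp
qed

text \<open>Orthogonality to \<open>V3\<close> leaves \<open>v = G x + A G s\<close> with
  \<open>x\<close> in the kernel of \<open>G^T A G\<close>. Testing with \<open>G\<close> gives
  \<open>x + G^T A G s = 0\<close>; kernel and range of the symmetric matrix \<open>G^T A G\<close>
  are orthogonal, so both terms vanish. Then \<open>s = X t\<close> and \<open>v = U2 t\<close>,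
  which is orthogonal to itself by the test with \<open>U2\<close>.\<close>

lemma U_inj:
  assumes v: "v \<in> carrier_vec N"
    and z: "transpose_mat G *\<^sub>v v = 0\<^sub>v p" "transpose_mat U2 *\<^sub>v v = 0\<^sub>v r" "transpose_mat V3 *\<^sub>v v = 0\<^sub>v m"
  shows "v = 0\<^sub>v N"
proof -
  define c1 where "c1 = transpose_mat V1 *\<^sub>v v"
  define c2 where "c2 = transpose_mat V2 *\<^sub>v v"
  have c: "c1 \<in> carrier_vec r" "c2 \<in> carrier_vec p" by (simp_all add: c1_def c2_def)
  obtain s where s: "s \<in> carrier_vec p" "V2 *\<^sub>v c2 = A *\<^sub>v (G *\<^sub>v s)" using AG_V2(2)[OF c(2)] by blast
  have "v = V1 *\<^sub>v c1 + V2 *\<^sub>v c2 + V3 *\<^sub>v 0\<^sub>v m"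
    using V_decomposition[OF v] unfolding z(3) c1_def[symmetric] c2_def[symmetric] .
  then have v': "v = G *\<^sub>v (X *\<^sub>v c1) + A *\<^sub>v (G *\<^sub>v s)"
    by (simp add: mult_zeros V1_mult[OF c(1)] s(2))
  have GG: "transpose_mat G *\<^sub>v (G *\<^sub>v u) = u" if "u \<in> carrier_vec p" for u
    by (rule mult_mat_vec_inverse[OF _ G_carrier G_orth that]) (use G_carrier in simp)
  let ?x = "X *\<^sub>v c1"
  have x0: "transpose_mat G *\<^sub>v (A *\<^sub>v (G *\<^sub>v ?x)) = 0\<^sub>v p" using ker_GAG[of ?x] c(1) by auto
  have Gv: "?x + transpose_mat G *\<^sub>v (A *\<^sub>v (G *\<^sub>v s)) = 0\<^sub>v p"
  proof -
    have "transpose_mat G *\<^sub>v v = transpose_mat G *\<^sub>v (G *\<^sub>v ?x) + transpose_mat G *\<^sub>v (A *\<^sub>v (G *\<^sub>v s))"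
      by (subst v', rule mult_add_distrib_mat_vec[of _ p N]) (use G_carrier in auto)
    then show ?thesis using z(1) by (simp add: GG)
  qed
  have "?x \<bullet> (transpose_mat G *\<^sub>v (A *\<^sub>v (G *\<^sub>v s))) = (transpose_mat G *\<^sub>v (A *\<^sub>v (G *\<^sub>v ?x))) \<bullet> s"
  proof -
    have "?x \<bullet> (transpose_mat G *\<^sub>v (A *\<^sub>v (G *\<^sub>v s))) = (A *\<^sub>v (G *\<^sub>v ?x)) \<bullet> (G *\<^sub>v s)"
      by (simp add: adjoint_real[OF G_carrier] A_adjoint)
    also have "\<dots> = s \<bullet> (transpose_mat G *\<^sub>v (A *\<^sub>v (G *\<^sub>v ?x)))"
      using comm_scalar_prod[of "A *\<^sub>v (G *\<^sub>v ?x)" N "G *\<^sub>v s"] by (simp add: adjoint_real[OF G_carrier s(1)])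
    also have "\<dots> = (transpose_mat G *\<^sub>v (A *\<^sub>v (G *\<^sub>v ?x))) \<bullet> s"
      by (rule comm_scalar_prod[OF s(1)]) simp
    finally show ?thesis .
  qed
  also have "\<dots> = 0" using x0 s by simp
  finally have "?x \<bullet> ?x = ?x \<bullet> (?x + transpose_mat G *\<^sub>v (A *\<^sub>v (G *\<^sub>v s)))"
    by (subst scalar_prod_add_distrib[of _ p]) auto
  then have "?x = 0\<^sub>v p" unfolding Gv by (intro scalar_prod_self_eq_0) auto
  then have GAs: "transpose_mat G *\<^sub>v (A *\<^sub>v (G *\<^sub>v s)) = 0\<^sub>v p" and Gx: "G *\<^sub>v ?x = 0\<^sub>v N"
    using Gv mult_mat_vec_zero[OF G_carrier] by simp_all
  obtain t where t: "t \<in> carrier_vec r" "X *\<^sub>v t = s" using ker_GAG[OF s(1)] GAs by blast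
  have "v = U2 *\<^sub>v t" using v' Gx t by (simp add: U2_mult V1_mult)
  then have "v \<bullet> v = t \<bullet> (transpose_mat U2 *\<^sub>v v)"
    by (simp add: adjoint_real[OF U2_carrier t(1)])
  also have "\<dots> = 0" using z(2) t by simp
  finally show ?thesis by (rule scalar_prod_self_eq_0[OF v])
qed

text \<open>The transpose of \<open>[G, U2, V3]\<close> is square because
  \<open>N = p + r + m\<close>, and injective by \<open>U_inj\<close>; its inverse is cut into
  column blocks.\<close>

lemma U_left_inverse:
  obtains K1 K2 K3 where "K1 \<in> carrier_mat N p" "K2 \<in> carrier_mat N r" "K3 \<in> carrier_mat N m"
    "\<And>w. w \<in> carrier_vec N \<Longrightarrow>
      w = K1 *\<^sub>v (transpose_mat G *\<^sub>v w) + K2 *\<^sub>v (transpose_mat U2 *\<^sub>v w) + K3 *\<^sub>v (transpose_mat V3 *\<^sub>v w)"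
proof -
  let ?U = "G @\<^sub>c U2 @\<^sub>c V3"
  have Neq: "N = p + (r + m)" using N_eq by linarith
  have Uc: "?U \<in> carrier_mat N N"
    using append_cols_carrier[OF G_carrier append_cols_carrier[OF U2_carrier V3]] unfolding Neq[symmetric] .
  have UT: "transpose_mat ?U *\<^sub>v w = transpose_mat G *\<^sub>v w @\<^sub>v transpose_mat U2 *\<^sub>v w @\<^sub>v transpose_mat V3 *\<^sub>v w"
    if w: "w \<in> carrier_vec N" for w
    unfolding append_cols_transpose_mult[OF G_carrier append_cols_carrier[OF U2_carrier V3] w]
      append_cols_transpose_mult[OF U2_carrier V3 w] ..
  have inj: "w = 0\<^sub>v N" if w: "w \<in> carrier_vec N" and z: "transpose_mat ?U *\<^sub>v w = 0\<^sub>v N" for w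
  proof -
    have "0\<^sub>v N = 0\<^sub>v p @\<^sub>v 0\<^sub>v r @\<^sub>v (0\<^sub>v m :: real Matrix.vec)"
      by (intro eq_vecI) (auto simp: Neq)
    then have "transpose_mat G *\<^sub>v w @\<^sub>v transpose_mat U2 *\<^sub>v w @\<^sub>v transpose_mat V3 *\<^sub>v w = 0\<^sub>v p @\<^sub>v 0\<^sub>v r @\<^sub>v 0\<^sub>v m"
      using z UT[OF w] by simp
    then have "transpose_mat G *\<^sub>v w = 0\<^sub>v p" "transpose_mat U2 *\<^sub>v w = 0\<^sub>v r" "transpose_mat V3 *\<^sub>v w = 0\<^sub>v m"
      using append_vec_eq[of "transpose_mat G *\<^sub>v w" p "0\<^sub>v p"] append_vec_eq[of "transpose_mat U2 *\<^sub>v w" r "0\<^sub>v r"] by auto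
    then show ?thesis by (rule U_inj[OF w])
  qed
  have UTc: "transpose_mat ?U \<in> carrier_mat N N" using Uc by simp
  from injective_imp_inverse[OF UTc inj] obtain K where K: "K \<in> carrier_mat N N" "K * transpose_mat ?U = 1\<^sub>m N"
    by blast
  have "K \<in> carrier_mat N (p + (r + m))" unfolding Neq[symmetric] by (rule K(1))
  then obtain K1 K' where K1: "K1 \<in> carrier_mat N p" "K' \<in> carrier_mat N (r + m)" "K = K1 @\<^sub>c K'"
    by (rule append_cols_split)
  obtain K2 K3 where K2: "K2 \<in> carrier_mat N r" "K3 \<in> carrier_mat N m" "K' = K2 @\<^sub>c K3"
    using K1(2) by (rule append_cols_split)
  show thesis
  proof (rule that[OF K1(1) K2(1,2)])
    fix w :: "real Matrix.vec" assume w: "w \<in> carrier_vec N"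
    have "w = K *\<^sub>v (transpose_mat ?U *\<^sub>v w)"
      by (rule mult_mat_vec_inverse[OF K(1) _ K(2) w, symmetric]) (use Uc in simp)
    also have "\<dots> = K1 *\<^sub>v (transpose_mat G *\<^sub>v w) + (K2 *\<^sub>v (transpose_mat U2 *\<^sub>v w) + K3 *\<^sub>v (transpose_mat V3 *\<^sub>v w))"
      unfolding UT[OF w] K1(3) K2(3)
      by (subst append_cols_mult[OF K1(1) append_cols_carrier[OF K2(1,2)]], simp, simp, subst append_cols_mult[OF K2(1,2)]) simp_all
    also have "\<dots> = K1 *\<^sub>v (transpose_mat G *\<^sub>v w) + K2 *\<^sub>v (transpose_mat U2 *\<^sub>v w) + K3 *\<^sub>v (transpose_mat V3 *\<^sub>v w)"
      by (rule assoc_add_vec[symmetric]) (rule mat_vec_closed, rule K1 K2)+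
    finally show "w = K1 *\<^sub>v (transpose_mat G *\<^sub>v w) + K2 *\<^sub>v (transpose_mat U2 *\<^sub>v w) + K3 *\<^sub>v (transpose_mat V3 *\<^sub>v w)" .
  qed
qed

end

lemma injective_mat_inv:
  fixes M :: "real mat"
  assumes M: "M \<in> carrier_mat n n"
    and inj: "\<And>x. x \<in> carrier_vec n \<Longrightarrow> M *\<^sub>v x = 0\<^sub>v n \<Longrightarrow> x = 0\<^sub>v n"
  shows "mat_inv M \<in> carrier_mat n n"
    and "x \<in> carrier_vec n \<Longrightarrow> mat_inv M *\<^sub>v (M *\<^sub>v x) = x"
    and "x \<in> carrier_vec n \<Longrightarrow> M *\<^sub>v (mat_inv M *\<^sub>v x) = x"
proof -
  from injective_imp_inverse[OF M inj] obtain Mi where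
    Mi: "Mi \<in> carrier_mat n n" "M * Mi = 1\<^sub>m n" "Mi * M = 1\<^sub>m n" by blast
  have e: "mat_inv M = Mi" by (rule mat_inv_eq(1)[OF M Mi(1,3)])
  show "mat_inv M \<in> carrier_mat n n" using e Mi by simp
  show "x \<in> carrier_vec n \<Longrightarrow> mat_inv M *\<^sub>v (M *\<^sub>v x) = x"
    unfolding e by (rule mult_mat_vec_inverse[OF Mi(1) M Mi(3)])
  show "x \<in> carrier_vec n \<Longrightarrow> M *\<^sub>v (mat_inv M *\<^sub>v x) = x"
    unfolding e by (rule mult_mat_vec_inverse[OF M Mi(1,2)])
qed

section \<open>Simultaneous diagonalisation of \<open>Q33\<close> and \<open>A33\<close>\<close>

context half_space_moment_system
begin

lemma L_carrier: "L \<in> carrier_mat m m" and Q33_eq: "Q33 = L * transpose_mat L"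
  using L by (auto simp: cholesky_def)

lemma Li: "mat_inv L \<in> carrier_mat m m" "mat_inv L * L = 1\<^sub>m m" "L * mat_inv L = 1\<^sub>m m"
  using lower_triangular_inverse[of L m] L by (auto simp: cholesky_def)

lemma R_carrier: "R \<in> carrier_mat m m" and R_orth: "transpose_mat R * R = 1\<^sub>m m"
  using R by (auto simp: orthonormal_mat_def)

lemma T_carrier: "T \<in> carrier_mat m m"
  unfolding T(1) using Li R_carrier by simp

lemma LT_carrier: "transpose_mat L \<in> carrier_mat m m" and TT_carrier: "transpose_mat T \<in> carrier_mat m m"
  and LiT_carrier: "transpose_mat (mat_inv L) \<in> carrier_mat m m"
  using L_carrier T_carrier Li by simp_all

lemma A33_carrier: "A33 \<in> carrier_mat m m" and Q33_carrier: "Q33 \<in> carrier_mat m m"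
  and A32_carrier: "A32 \<in> carrier_mat m p" and Q32_carrier: "Q32 \<in> carrier_mat m p"
  and A22_carrier: "A22 \<in> carrier_mat r p" and Q22_carrier: "Q22 \<in> carrier_mat r p"
  and A23_carrier: "A23 \<in> carrier_mat r m" and Q23_carrier: "Q23 \<in> carrier_mat r m"
  unfolding A_blocks Q_blocks using carriers by simp_all

definition "lam i = Lam $$ (i, i)"

lemma Lam_diag: "Lam = mat m m (\<lambda>(i, j). if i = j then lam i else 0)"
  and lam_eq: "i < m \<Longrightarrow> lam i = (if i < np then Lp $$ (i, i) else if i < np + n0 then 0 else Lm $$ (i - np - n0, i - np - n0))"
proof -
  note e = diag_block_mat_3[OF Lp(1,2) Lm(1,2), of n0, folded Lam]
  have l: "lam i = (if i < np then Lp $$ (i, i) else if i < np + n0 then 0 else Lm $$ (i - np - n0, i - np - n0))"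
    if "i < m" for i
    unfolding lam_def by (subst e) (use that in simp)
  then show "i < m \<Longrightarrow> lam i = (if i < np then Lp $$ (i, i) else if i < np + n0 then 0 else Lm $$ (i - np - n0, i - np - n0))" .
  show "Lam = mat m m (\<lambda>(i, j). if i = j then lam i else 0)"
    by (subst e) (auto intro!: cong_mat simp: l)
qed

lemma Lam_carrier: "Lam \<in> carrier_mat m m"
  by (subst Lam_diag) simp

lemma T_mult: "x \<in> carrier_vec m \<Longrightarrow> T *\<^sub>v x = transpose_mat (mat_inv L) *\<^sub>v (R *\<^sub>v x)"
  unfolding T(1) by (rule assoc_mult_mat_vec[OF _ R_carrier]) (use Li in simp)

lemma TT_mult: "x \<in> carrier_vec m \<Longrightarrow> transpose_mat T *\<^sub>v x = transpose_mat R *\<^sub>v (mat_inv L *\<^sub>v x)"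
proof -
  assume x: "x \<in> carrier_vec m"
  have "transpose_mat T = transpose_mat R * mat_inv L"
    unfolding T(1) using transpose_mult[of "transpose_mat (mat_inv L)" m m R m] Li R_carrier by simp
  then show ?thesis using assoc_mult_mat_vec[of "transpose_mat R" m m "mat_inv L" m x] R_carrier Li x by simp
qed

lemma RR: "x \<in> carrier_vec m \<Longrightarrow> transpose_mat R *\<^sub>v (R *\<^sub>v x) = x"
  by (rule mult_mat_vec_inverse[OF _ R_carrier R_orth]) (use R_carrier in simp_all)

lemma closed_m [simp]:
  "L *\<^sub>v x \<in> carrier_vec m" "mat_inv L *\<^sub>v x \<in> carrier_vec m" "R *\<^sub>v x \<in> carrier_vec m" "T *\<^sub>v x \<in> carrier_vec m"
  "A33 *\<^sub>v x \<in> carrier_vec m" "Q33 *\<^sub>v x \<in> carrier_vec m" "A32 *\<^sub>v x \<in> carrier_vec m" "Q32 *\<^sub>v x \<in> carrier_vec m"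
  "Lam *\<^sub>v x \<in> carrier_vec m" "A22 *\<^sub>v x \<in> carrier_vec r" "Q22 *\<^sub>v x \<in> carrier_vec r"
  "A23 *\<^sub>v x \<in> carrier_vec r" "Q23 *\<^sub>v x \<in> carrier_vec r"
  by (rule mat_vec_closed, rule L_carrier Li R_carrier T_carrier A33_carrier Q33_carrier A32_carrier Q32_carrier
      Lam_carrier A22_carrier Q22_carrier A23_carrier Q23_carrier)+

lemma closedT_m [simp]:
  "transpose_mat L *\<^sub>v x \<in> carrier_vec m" "transpose_mat (mat_inv L) *\<^sub>v x \<in> carrier_vec m"
  "transpose_mat R *\<^sub>v x \<in> carrier_vec m" "transpose_mat T *\<^sub>v x \<in> carrier_vec m"
  by (rule mat_vec_closed, rule transpose_carrier_mat[THEN iffD2], rule L_carrier Li R_carrier T_carrier)+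

text \<open>\<open>T\<close> is the inverse transpose of the Cholesky factor times an orthogonal
  matrix, so it normalises \<open>Q33\<close> to the identity.\<close>

lemma TQT: "x \<in> carrier_vec m \<Longrightarrow> transpose_mat T *\<^sub>v (Q33 *\<^sub>v (T *\<^sub>v x)) = x"
proof -
  assume x: "x \<in> carrier_vec m"
  have "transpose_mat L * transpose_mat (mat_inv L) = 1\<^sub>m m"
    using transpose_mult[OF Li(1) L_carrier] Li(2) by simp
  then have LL: "transpose_mat L *\<^sub>v (transpose_mat (mat_inv L) *\<^sub>v v) = v" if "v \<in> carrier_vec m" for v
    by (intro mult_mat_vec_inverse[of _ m m]) (use L_carrier Li that in auto)
  have "Q33 *\<^sub>v (T *\<^sub>v x) = L *\<^sub>v (transpose_mat L *\<^sub>v (T *\<^sub>v x))"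
    unfolding Q33_eq by (rule assoc_mult_mat_vec[OF L_carrier LT_carrier]) simp
  also have "\<dots> = L *\<^sub>v (R *\<^sub>v x)" unfolding T_mult[OF x] by (simp add: LL)
  finally show ?thesis
    by (simp add: TT_mult mult_mat_vec_inverse[OF Li(1) L_carrier Li(2)] RR x)
qed

lemma TAT: "x \<in> carrier_vec m \<Longrightarrow> transpose_mat T *\<^sub>v (A33 *\<^sub>v (T *\<^sub>v x)) = Lam *\<^sub>v x"
proof -
  assume x: "x \<in> carrier_vec m"
  have "mat_inv L *\<^sub>v (A33 *\<^sub>v (transpose_mat (mat_inv L) *\<^sub>v (R *\<^sub>v x))) =
      (mat_inv L * A33 * transpose_mat (mat_inv L)) *\<^sub>v (R *\<^sub>v x)"
    by (rule mult_mat_vec_assoc3[OF Li(1) A33_carrier LiT_carrier, symmetric]) simp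
  also have "\<dots> = (mat_inv L * A33 * transpose_mat (mat_inv L) * R) *\<^sub>v x"
    by (rule assoc_mult_mat_vec[OF _ R_carrier x, of _ m, symmetric])
      (rule mult_carrier_mat[OF mult_carrier_mat[OF Li(1) A33_carrier] LiT_carrier])
  also have "\<dots> = R *\<^sub>v (Lam *\<^sub>v x)"
    unfolding eig by (rule assoc_mult_mat_vec[OF R_carrier Lam_carrier x])
  finally show ?thesis by (simp add: TT_mult T_mult x RR)
qed

text \<open>The inverse of \<open>T\<close>, read off from \<open>T^T Q33 T = I\<close>.\<close>

definition "Ti = transpose_mat T * Q33"

lemma Ti_carrier: "Ti \<in> carrier_mat m m"
  unfolding Ti_def using T_carrier Q33_carrier by simp

lemma Ti_mult: "x \<in> carrier_vec m \<Longrightarrow> Ti *\<^sub>v x = transpose_mat T *\<^sub>v (Q33 *\<^sub>v x)"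
  unfolding Ti_def by (rule assoc_mult_mat_vec[OF _ Q33_carrier]) (use T_carrier in simp)

lemma Ti_T: "Ti * T = 1\<^sub>m m"
proof (rule mat_eq_vecI[of _ m m])
  fix v :: "real Matrix.vec" assume v: "v \<in> carrier_vec m"
  have "(Ti * T) *\<^sub>v v = Ti *\<^sub>v (T *\<^sub>v v)" by (rule assoc_mult_mat_vec[OF Ti_carrier T_carrier v])
  then show "(Ti * T) *\<^sub>v v = 1\<^sub>m m *\<^sub>v v" using v by (simp add: Ti_mult TQT)
qed (use Ti_carrier T_carrier in simp_all)

lemma mat_inv_T: "mat_inv T = Ti" and T_Ti: "T * Ti = 1\<^sub>m m"
  using mat_inv_eq[OF T_carrier Ti_carrier Ti_T] by auto

lemma T_Ti_mult: "x \<in> carrier_vec m \<Longrightarrow> T *\<^sub>v (Ti *\<^sub>v x) = x" "x \<in> carrier_vec m \<Longrightarrow> Ti *\<^sub>v (T *\<^sub>v x) = x"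
  by (rule mult_mat_vec_inverse[OF T_carrier Ti_carrier T_Ti], simp)
    (rule mult_mat_vec_inverse[OF Ti_carrier T_carrier Ti_T], simp)

lemma mat_inv_Q33: "mat_inv Q33 = T * transpose_mat T"
proof (rule mat_inv_eq(1)[OF Q33_carrier])
  have "T * transpose_mat T * Q33 = T * Ti"
    unfolding Ti_def by (rule assoc_mult_mat[OF T_carrier _ Q33_carrier]) (use T_carrier in simp)
  then show "T * transpose_mat T * Q33 = 1\<^sub>m m" using T_Ti by simp
qed (use T_carrier in simp)

text \<open>The bridge between \<open>T^(-1) h3\<close> and the test with \<open>T^T V3^T\<close>:
  the inverse of \<open>Q33\<close> is \<open>T T^T\<close>, so one factor \<open>T\<close>
  cancels.\<close>

lemma mat_inv_T_Q33: "x \<in> carrier_vec m \<Longrightarrow> mat_inv T *\<^sub>v (mat_inv Q33 *\<^sub>v x) = transpose_mat T *\<^sub>v x"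
proof -
  assume x: "x \<in> carrier_vec m"
  have "mat_inv Q33 *\<^sub>v x = T *\<^sub>v (transpose_mat T *\<^sub>v x)"
    unfolding mat_inv_Q33 by (rule assoc_mult_mat_vec[OF T_carrier _ x]) (use T_carrier in simp)
  then show ?thesis by (simp add: mat_inv_T T_Ti_mult)
qed

lemma lam_signs:
  shows "i < np \<Longrightarrow> 0 < lam i" "np \<le> i \<Longrightarrow> i < np + n0 \<Longrightarrow> lam i = 0" "np + n0 \<le> i \<Longrightarrow> i < m \<Longrightarrow> lam i < 0"
  using Lp(3) Lm(3) by (auto simp: lam_eq Lam(2))

text \<open>Column \<open>i\<close> of \<open>T\<close> is an eigenvector of
  \<open>Q33^(-1) A33\<close> with eigenvalue \<open>lam i\<close>, which is therefore at most
  \<open>lam_max\<close>; inverting positive numbers reverses the inequality.\<close>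

lemma a_less_lam:
  assumes i: "i < m" and l: "0 < lam i"
  shows "a < 1 / lam i"
proof -
  let ?e = "unit_vec m i :: real Matrix.vec" and ?M = "mat_inv Q33 * A33"
  have M: "?M \<in> carrier_mat m m" unfolding mat_inv_Q33 using T_carrier A33_carrier by simp
  have "?M *\<^sub>v (T *\<^sub>v ?e) = mat_inv Q33 *\<^sub>v (A33 *\<^sub>v (T *\<^sub>v ?e))"
    unfolding mat_inv_Q33 by (rule assoc_mult_mat_vec[OF mult_carrier_mat[OF T_carrier TT_carrier] A33_carrier]) simp
  also have "\<dots> = T *\<^sub>v (transpose_mat T *\<^sub>v (A33 *\<^sub>v (T *\<^sub>v ?e)))"
    unfolding mat_inv_Q33 by (rule assoc_mult_mat_vec[OF T_carrier TT_carrier]) simp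
  also have "\<dots> = T *\<^sub>v (Lam *\<^sub>v ?e)" by (simp add: TAT)
  also have "Lam *\<^sub>v ?e = lam i \<cdot>\<^sub>v ?e"
  proof (rule eq_vecI)
    fix j assume "j < dim_vec (lam i \<cdot>\<^sub>v ?e)"
    then have j: "j < m" by simp
    have "(Lam *\<^sub>v ?e) $ j = Lam $$ (j, i)" by (rule mult_unit_vec_index[OF Lam_carrier j i])
    also have "\<dots> = (lam i \<cdot>\<^sub>v ?e) $ j" using i j by (subst Lam_diag) simp
    finally show "(Lam *\<^sub>v ?e) $ j = (lam i \<cdot>\<^sub>v ?e) $ j" .
  qed (use Lam_carrier in simp)
  also have "T *\<^sub>v (lam i \<cdot>\<^sub>v ?e) = lam i \<cdot>\<^sub>v (T *\<^sub>v ?e)"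
    by (rule mult_mat_vec[OF T_carrier]) simp
  finally have ev: "?M *\<^sub>v (T *\<^sub>v ?e) = lam i \<cdot>\<^sub>v (T *\<^sub>v ?e)" .
  have "T *\<^sub>v ?e \<noteq> 0\<^sub>v m"
  proof
    assume "T *\<^sub>v ?e = 0\<^sub>v m"
    then have "?e = 0\<^sub>v m" using T_Ti_mult(2)[of ?e] mult_mat_vec_zero[OF Ti_carrier] by simp
    then have "?e $ i = (0\<^sub>v m :: real Matrix.vec) $ i" by simp
    then show False using i by simp
  qed
  then have "eigenvector ?M (T *\<^sub>v ?e) (lam i)"
    unfolding eigenvector_def using ev carrier_matD(1)[OF M] by simp
  then have "eigenvalue ?M (lam i)" unfolding eigenvalue_def by blast
  then have "lam i \<le> lam_max" using lam_max unfolding is_max_eigenvalue_def by blast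
  then have "1 / lam_max \<le> 1 / lam i" using l by (intro divide_left_mono) auto
  then show ?thesis using a(2) by linarith
qed

text \<open>The third block of the basis is rotated by \<open>T\<close>: the columns become
  \<open>V3 T\<close>, the dual rows \<open>T^(-1) V3^T\<close> and the test rows
  \<open>T^T V3^T\<close>. This makes the \<open>A\<close> block equal to \<open>Lam\<close> and the
  \<open>Q\<close> block equal to the identity.\<close>

lemma boundary_system_instance:
  assumes B: "B \<in> carrier_mat np m"
  obtains K1 K2 K3 where
    "boundary_system a N p r m A Q V1 V2 (V3 * T) (transpose_mat V1) (transpose_mat V2) (Ti * transpose_mat V3)
      (transpose_mat G) (transpose_mat U2) (transpose_mat T * transpose_mat V3) K1 K2 K3
      E (mat_inv E) A21 (mat_inv A21) A22 (A23 * T) Q22 (Q23 * T) (transpose_mat T * A32) (transpose_mat T * Q32)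
      Lam lam np n0 nm (B * T) (B * transpose_mat V3)"
proof -
  obtain K1 K2 K3 where K: "K1 \<in> carrier_mat N p" "K2 \<in> carrier_mat N r" "K3 \<in> carrier_mat N m"
    and KU: "\<And>w. w \<in> carrier_vec N \<Longrightarrow>
      w = K1 *\<^sub>v (transpose_mat G *\<^sub>v w) + K2 *\<^sub>v (transpose_mat U2 *\<^sub>v w) + K3 *\<^sub>v (transpose_mat V3 *\<^sub>v w)"
    by (rule U_left_inverse) blast
  have carr': "V3 * T \<in> carrier_mat N m" "transpose_mat V1 \<in> carrier_mat r N" "transpose_mat V2 \<in> carrier_mat p N"
    "transpose_mat V3 \<in> carrier_mat m N" "Ti * transpose_mat V3 \<in> carrier_mat m N" "transpose_mat G \<in> carrier_mat p N"
    "transpose_mat U2 \<in> carrier_mat r N" "transpose_mat T * transpose_mat V3 \<in> carrier_mat m N"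
    "A23 * T \<in> carrier_mat r m" "Q23 * T \<in> carrier_mat r m" "transpose_mat T * A32 \<in> carrier_mat m p"
    "transpose_mat T * Q32 \<in> carrier_mat m p" "transpose_mat T \<in> carrier_mat m m"
    using carriers T_carrier Ti_carrier A23_carrier Q23_carrier A32_carrier Q32_carrier by simp_all
  have V3T: "(V3 * T) *\<^sub>v x = V3 *\<^sub>v (T *\<^sub>v x)" if "x \<in> carrier_vec m" for x
    by (rule assoc_mult_mat_vec[OF V3 T_carrier that])
  have A23T: "(A23 * T) *\<^sub>v x = A23 *\<^sub>v (T *\<^sub>v x)" "(Q23 * T) *\<^sub>v x = Q23 *\<^sub>v (T *\<^sub>v x)" if "x \<in> carrier_vec m" for x
    by (rule assoc_mult_mat_vec[OF A23_carrier T_carrier that] assoc_mult_mat_vec[OF Q23_carrier T_carrier that])+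
  have P3: "(Ti * transpose_mat V3) *\<^sub>v w = Ti *\<^sub>v (transpose_mat V3 *\<^sub>v w)" if "w \<in> carrier_vec N" for w
    by (rule assoc_mult_mat_vec[OF Ti_carrier carr'(4) that])
  have R3: "(transpose_mat T * transpose_mat V3) *\<^sub>v w = transpose_mat T *\<^sub>v (transpose_mat V3 *\<^sub>v w)" if "w \<in> carrier_vec N" for w
    by (rule assoc_mult_mat_vec[OF carr'(13,4) that])
  have TA32: "(transpose_mat T * A32) *\<^sub>v x = transpose_mat T *\<^sub>v (A32 *\<^sub>v x)"
    "(transpose_mat T * Q32) *\<^sub>v x = transpose_mat T *\<^sub>v (Q32 *\<^sub>v x)" if "x \<in> carrier_vec p" for x
    by (rule assoc_mult_mat_vec[OF carr'(13) A32_carrier that] assoc_mult_mat_vec[OF carr'(13) Q32_carrier that])+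
  have TP3: "T *\<^sub>v ((Ti * transpose_mat V3) *\<^sub>v w) = transpose_mat V3 *\<^sub>v w" if "w \<in> carrier_vec N" for w
    unfolding P3[OF that] by (rule T_Ti_mult(1)) simp
  have block: "(transpose_mat M * S * M') *\<^sub>v x = transpose_mat M *\<^sub>v (S *\<^sub>v (M' *\<^sub>v x))"
    if "M \<in> carrier_mat N k" "S \<in> carrier_mat N N" "M' \<in> carrier_mat N l" "x \<in> carrier_vec l" for M S M' k l x
    by (rule mult_mat_vec_assoc3[OF _ that(2,3,4)]) (use that in simp)
  \<comment> \<open>Expansion of a tested row along \<open>V1\<close>, \<open>V2\<close>,
    \<open>V3\<close>; all row identities below follow by dropping the blocks that vanish.\<close>
  have row: "transpose_mat M *\<^sub>v (S *\<^sub>v w) = (transpose_mat M * S * V1) *\<^sub>v (transpose_mat V1 *\<^sub>v w)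
      + (transpose_mat M * S * V2) *\<^sub>v (transpose_mat V2 *\<^sub>v w) + (transpose_mat M * S * V3) *\<^sub>v (transpose_mat V3 *\<^sub>v w)"
    if M: "M \<in> carrier_mat N k" and S: "S \<in> carrier_mat N N" and w: "w \<in> carrier_vec N" for M S k w
  proof -
    have MT: "transpose_mat M \<in> carrier_mat k N" using M by simp
    have Sc: "S *\<^sub>v x \<in> carrier_vec N" for x by (rule mat_vec_closed[OF S])
    have "transpose_mat M *\<^sub>v (S *\<^sub>v w) = transpose_mat M *\<^sub>v (S *\<^sub>v (V1 *\<^sub>v (transpose_mat V1 *\<^sub>v w)
        + V2 *\<^sub>v (transpose_mat V2 *\<^sub>v w) + V3 *\<^sub>v (transpose_mat V3 *\<^sub>v w)))"
      using V_decomposition[OF w] by simp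
    also have "\<dots> = transpose_mat M *\<^sub>v (S *\<^sub>v (V1 *\<^sub>v (transpose_mat V1 *\<^sub>v w))) +
        transpose_mat M *\<^sub>v (S *\<^sub>v (V2 *\<^sub>v (transpose_mat V2 *\<^sub>v w))) +
        transpose_mat M *\<^sub>v (S *\<^sub>v (V3 *\<^sub>v (transpose_mat V3 *\<^sub>v w)))"
      by (simp add: mult_add_distrib_mat_vec[OF S] mult_add_distrib_mat_vec[OF MT] Sc)
    finally show ?thesis
      by (simp add: block[OF M S V1_carrier] block[OF M S V2_carrier] block[OF M S V3])
  qed
  have Einv: "mat_inv E \<in> carrier_mat p p" "\<And>x. x \<in> carrier_vec p \<Longrightarrow> mat_inv E *\<^sub>v (E *\<^sub>v x) = x"
    "\<And>x. x \<in> carrier_vec p \<Longrightarrow> E *\<^sub>v (mat_inv E *\<^sub>v x) = x"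
    by (rule injective_mat_inv[OF E_carrier E_inj]; assumption)+
  have Finv: "mat_inv A21 \<in> carrier_mat r r" "\<And>x. x \<in> carrier_vec r \<Longrightarrow> mat_inv A21 *\<^sub>v (A21 *\<^sub>v x) = x"
    "\<And>x. x \<in> carrier_vec r \<Longrightarrow> A21 *\<^sub>v (mat_inv A21 *\<^sub>v x) = x"
    by (rule injective_mat_inv[OF A21_carrier A21_inj]; assumption)+
  have zeroadd: "0\<^sub>v k + (x :: real Matrix.vec) = x" "x + 0\<^sub>v k = x" if "x \<in> carrier_vec k" for x k
    using that by simp_all
  have TTadd: "transpose_mat T *\<^sub>v (x + y) = transpose_mat T *\<^sub>v x + transpose_mat T *\<^sub>v y"
    if "x \<in> carrier_vec m" "y \<in> carrier_vec m" for x y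
    by (rule mult_add_distrib_mat_vec[OF carr'(13) that])
  show thesis
  \<comment> \<open>The factor \<open>Q33 T\<close> undoes the \<open>T^T\<close> in the third test
    row, being its inverse.\<close>
  proof (rule that[of K1 K2 "K3 * (Q33 * T)"], unfold_locales)
    fix w :: "real Matrix.vec" assume w: "w \<in> carrier_vec N"
    let ?P3 = "Ti * transpose_mat V3"
    have P3c: "?P3 *\<^sub>v w \<in> carrier_vec m" by (rule mat_vec_closed[OF carr'(5)])
    show "w = V1 *\<^sub>v (transpose_mat V1 *\<^sub>v w) + V2 *\<^sub>v (transpose_mat V2 *\<^sub>v w) + (V3 * T) *\<^sub>v (?P3 *\<^sub>v w)"
      unfolding V3T[OF P3c] TP3[OF w] by (rule V_decomposition[OF w])
    show "w = K1 *\<^sub>v (transpose_mat G *\<^sub>v w) + K2 *\<^sub>v (transpose_mat U2 *\<^sub>v w) +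
        (K3 * (Q33 * T)) *\<^sub>v ((transpose_mat T * transpose_mat V3) *\<^sub>v w)"
    proof -
      have QT: "Q33 * T \<in> carrier_mat m m" using Q33_carrier T_carrier by simp
      have "transpose_mat T * (Q33 * T) = 1\<^sub>m m"
        using assoc_mult_mat[OF carr'(13) Q33_carrier T_carrier] Ti_T by (simp add: Ti_def)
      from mat_mult_left_right_inverse[OF carr'(13) QT this] have "Q33 * T * transpose_mat T = 1\<^sub>m m" .
      from mult_mat_vec_inverse[OF QT carr'(13) this]
      have "(Q33 * T) *\<^sub>v (transpose_mat T *\<^sub>v x) = x" if "x \<in> carrier_vec m" for x using that by blast
      then have "(K3 * (Q33 * T)) *\<^sub>v ((transpose_mat T * transpose_mat V3) *\<^sub>v w) = K3 *\<^sub>v (transpose_mat V3 *\<^sub>v w)"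
        unfolding R3[OF w] by (subst assoc_mult_mat_vec[OF K(3) QT]) simp_all
      then show ?thesis using KU[OF w] by simp
    qed
    show "transpose_mat G *\<^sub>v (A *\<^sub>v w) = E *\<^sub>v (transpose_mat V2 *\<^sub>v w)"
      unfolding row[OF G_carrier A_carrier w]
      by (simp add: block[OF G_carrier A_carrier V1_carrier] block[OF G_carrier A_carrier V3] GAV1 GAV3
          E_def[symmetric] zeroadd[OF mat_vec_closed[OF E_carrier]])
    show "transpose_mat U2 *\<^sub>v (A *\<^sub>v w) =
        A21 *\<^sub>v (transpose_mat V1 *\<^sub>v w) + A22 *\<^sub>v (transpose_mat V2 *\<^sub>v w) + (A23 * T) *\<^sub>v (?P3 *\<^sub>v w)"
      unfolding row[OF U2_carrier A_carrier w] A23T(1)[OF P3c] TP3[OF w] by (simp add: A_blocks)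
    show "(transpose_mat T * transpose_mat V3) *\<^sub>v (A *\<^sub>v w) =
        (transpose_mat T * A32) *\<^sub>v (transpose_mat V2 *\<^sub>v w) + Lam *\<^sub>v (?P3 *\<^sub>v w)"
    proof -
      have "transpose_mat V3 *\<^sub>v (A *\<^sub>v w) = A32 *\<^sub>v (transpose_mat V2 *\<^sub>v w) + A33 *\<^sub>v (T *\<^sub>v (?P3 *\<^sub>v w))"
        unfolding row[OF V3 A_carrier w] TP3[OF w]
        by (simp add: block[OF V3 A_carrier V1_carrier] V3AV1 A_blocks(4,5)[symmetric])
      then show ?thesis by (simp add: R3 TTadd TA32 TAT[OF P3c])
    qed
    show "transpose_mat G *\<^sub>v (Q *\<^sub>v w) = 0\<^sub>v p" by (rule GQ[OF w])
    have z: "(transpose_mat M * Q * V1) *\<^sub>v (transpose_mat V1 *\<^sub>v w) = 0\<^sub>v k" if "M \<in> carrier_mat N k" for M k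
      using mult_mat_vec_zero[of "transpose_mat M" k N] that by (simp add: block[OF that Q_carrier V1_carrier] QV1)
    show "transpose_mat U2 *\<^sub>v (Q *\<^sub>v w) = Q22 *\<^sub>v (transpose_mat V2 *\<^sub>v w) + (Q23 * T) *\<^sub>v (?P3 *\<^sub>v w)"
      unfolding row[OF U2_carrier Q_carrier w] A23T(2)[OF P3c] TP3[OF w]
      by (simp add: z[OF U2_carrier] Q_blocks(1,2)[symmetric])
    show "(transpose_mat T * transpose_mat V3) *\<^sub>v (Q *\<^sub>v w) =
        (transpose_mat T * Q32) *\<^sub>v (transpose_mat V2 *\<^sub>v w) + ?P3 *\<^sub>v w"
    proof -
      have "transpose_mat V3 *\<^sub>v (Q *\<^sub>v w) = Q32 *\<^sub>v (transpose_mat V2 *\<^sub>v w) + Q33 *\<^sub>v (T *\<^sub>v (?P3 *\<^sub>v w))"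
        unfolding row[OF V3 Q_carrier w] TP3[OF w]
        by (simp add: z[OF V3] Q_blocks(3,4)[symmetric])
      then show ?thesis by (simp add: R3 TTadd TA32 TQT[OF P3c])
    qed
    show "(B * transpose_mat V3) *\<^sub>v w = (B * T) *\<^sub>v (?P3 *\<^sub>v w)"
      using assoc_mult_mat_vec[OF B carr'(4) w] assoc_mult_mat_vec[OF B T_carrier P3c] TP3[OF w] by simp
  next
    fix u v w :: "real Matrix.vec"
    assume uvw: "u \<in> carrier_vec r" "v \<in> carrier_vec p" "w \<in> carrier_vec m"
    have c: "V1 *\<^sub>v u + V2 *\<^sub>v v + V3 *\<^sub>v (T *\<^sub>v w) \<in> carrier_vec N" by simp
    show "transpose_mat V1 *\<^sub>v (V1 *\<^sub>v u + V2 *\<^sub>v v + (V3 * T) *\<^sub>v w) = u \<and>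
       transpose_mat V2 *\<^sub>v (V1 *\<^sub>v u + V2 *\<^sub>v v + (V3 * T) *\<^sub>v w) = v \<and>
       (Ti * transpose_mat V3) *\<^sub>v (V1 *\<^sub>v u + V2 *\<^sub>v v + (V3 * T) *\<^sub>v w) = w"
      unfolding V3T[OF uvw(3)] P3[OF c] using V_coords[OF uvw(1,2), of "T *\<^sub>v w"] T_Ti_mult(2)[OF uvw(3)] by simp
  qed (use carriers carr' K Einv Finv E_carrier A21_carrier A22_carrier Q22_carrier Q33_carrier T_carrier Lam_diag a lam_signs
      a_less_lam Lam(2) B in simp_all)
qed

end

section \<open>Return to the original blocks: the criterion and the formulas\<close>

lemma rank_eq_iff_injective:
  fixes M :: "real mat"
  assumes M: "M \<in> carrier_mat n n"
  shows "vec_space.rank n M = n \<longleftrightarrow> (\<forall>x\<in>carrier_vec n. M *\<^sub>v x = 0\<^sub>v n \<longrightarrow> x = 0\<^sub>v n)"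
  using vec_space.det_rank_iff[OF M] det_0_iff_vec_prod_zero_field[OF M] by blast

lemma mat_inv_diagonal_mult:
  fixes t :: real
  assumes A: "A \<in> carrier_mat n n" "diagonal_mat A" "\<forall>i<n. A $$ (i, i) \<noteq> (0 :: real)"
    and v: "v \<in> carrier_vec n" "i < n"
  shows "(mat_inv A *\<^sub>v v) $ i = 1 / A $$ (i, i) * v $ i"
    and "(mat_exp (t \<cdot>\<^sub>m mat_inv A) *\<^sub>v v) $ i = exp (t * (1 / A $$ (i, i))) * v $ i"
    and "mat_exp (t \<cdot>\<^sub>m mat_inv A) \<in> carrier_mat n n"
proof -
  have inv: "mat_inv A = mat n n (\<lambda>(i, j). if i = j then 1 / A $$ (i, i) else 0)"
    by (rule diagonal_mat_inv) (use A in auto)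
  show "(mat_inv A *\<^sub>v v) $ i = 1 / A $$ (i, i) * v $ i"
    unfolding inv by (rule diagonal_mult_vec[OF v])
  have "t \<cdot>\<^sub>m mat_inv A = mat n n (\<lambda>(i, j). if i = j then t * (1 / A $$ (i, i)) else 0)"
    unfolding inv by (intro eq_matI) auto
  then have e: "mat_exp (t \<cdot>\<^sub>m mat_inv A) = mat n n (\<lambda>(i, j). if i = j then exp (t * (1 / A $$ (i, i))) else 0)"
    by (simp only: mat_exp_diagonal)
  show "(mat_exp (t \<cdot>\<^sub>m mat_inv A) *\<^sub>v v) $ i = exp (t * (1 / A $$ (i, i))) * v $ i"
    unfolding e by (rule diagonal_mult_vec[OF v])
  show "mat_exp (t \<cdot>\<^sub>m mat_inv A) \<in> carrier_mat n n" unfolding e by simp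
qed

context half_space_moment_system
begin

definition part_pos :: "real Matrix.vec \<Rightarrow> real Matrix.vec" where
  "part_pos z = Matrix.vec np (\<lambda>i. z $ i)"

definition part_zero :: "real Matrix.vec \<Rightarrow> real Matrix.vec" where
  "part_zero z = Matrix.vec n0 (\<lambda>i. z $ (np + i))"

text \<open>Of length \<open>nm\<close>, to match \<open>Tm\<close> and \<open>Lm\<close>, unlike
  the padded \<open>neg_part\<close>.\<close>

definition part_neg :: "real Matrix.vec \<Rightarrow> real Matrix.vec" where
  "part_neg z = Matrix.vec nm (\<lambda>i. z $ (np + n0 + i))"

lemma part_carriers [simp]:
  "part_pos z \<in> carrier_vec np" "part_zero z \<in> carrier_vec n0" "part_neg z \<in> carrier_vec nm"
  by (simp_all add: part_pos_def part_zero_def part_neg_def)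

lemma parts_append:
  assumes "z \<in> carrier_vec m"
  shows "z = part_pos z @\<^sub>v part_zero z @\<^sub>v part_neg z"
proof (rule eq_vecI)
  have dz: "dim_vec z = np + n0 + nm" using assms Lam(2) by simp
  then show "dim_vec z = dim_vec (part_pos z @\<^sub>v part_zero z @\<^sub>v part_neg z)"
    by (simp add: part_pos_def part_zero_def part_neg_def)
  fix i assume "i < dim_vec (part_pos z @\<^sub>v part_zero z @\<^sub>v part_neg z)"
  then have "i < np + n0 + nm" by (simp add: part_pos_def part_zero_def part_neg_def)
  then show "z $ i = (part_pos z @\<^sub>v part_zero z @\<^sub>v part_neg z) $ i"
    using dz by (auto simp: part_pos_def part_zero_def part_neg_def)
qed

lemma T_parts:
  assumes "z \<in> carrier_vec m"
  shows "T *\<^sub>v z = Tp *\<^sub>v part_pos z + T0 *\<^sub>v part_zero z + Tm *\<^sub>v part_neg z"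
proof -
  have "T *\<^sub>v z = (Tp @\<^sub>c T0 @\<^sub>c Tm) *\<^sub>v (part_pos z @\<^sub>v part_zero z @\<^sub>v part_neg z)"
    using parts_append[OF assms] T(2) by simp
  also have "\<dots> = Tp *\<^sub>v part_pos z + (T0 *\<^sub>v part_zero z + Tm *\<^sub>v part_neg z)"
    using append_cols_mult[OF T_blocks(1) append_cols_carrier[OF T_blocks(2,3)], of "part_pos z" "part_zero z @\<^sub>v part_neg z"]
      append_cols_mult[OF T_blocks(2,3), of "part_zero z" "part_neg z"] by simp
  also have "\<dots> = Tp *\<^sub>v part_pos z + T0 *\<^sub>v part_zero z + Tm *\<^sub>v part_neg z"
    by (rule assoc_add_vec[symmetric]) (rule mat_vec_closed, rule T_blocks)+
  finally show ?thesis .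
qed

lemma BT_index:
  assumes B: "B \<in> carrier_mat np m" and i: "i < np"
  shows "j < np \<Longrightarrow> (B * T) $$ (i, j) = (B * Tp) $$ (i, j)"
    and "j < n0 \<Longrightarrow> (B * T) $$ (i, np + j) = (B * T0) $$ (i, j)"
proof -
  have col: "j < np \<Longrightarrow> col T j = col Tp j" "j < n0 \<Longrightarrow> col T (np + j) = col T0 j"
    using T_blocks T_carrier unfolding T(2) Lam(2) by (auto intro!: eq_vecI simp: append_cols_def)
  show "j < np \<Longrightarrow> (B * T) $$ (i, j) = (B * Tp) $$ (i, j)"
    using B i T_blocks T_carrier col(1) Lam(2) by simp
  show "j < n0 \<Longrightarrow> (B * T) $$ (i, np + j) = (B * T0) $$ (i, j)"
    using B i T_blocks T_carrier col(2) Lam(2) by simp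
qed

text \<open>In the columns of \<open>B * T\<close>, the leading block is \<open>B * Tp\<close> and
  the middle one \<open>B * T0\<close>; for a square matrix, full rank is injectivity.\<close>

lemma well_posed_iff:
  assumes B: "B \<in> carrier_mat np m"
  shows "well_posed a N np A Q (B * transpose_mat V3) \<longleftrightarrow>
    vec_space.rank np (B * Tp) = np \<and> B * T0 = 0\<^sub>m np n0"
proof -
  obtain K1 K2 K3 where "boundary_system a N p r m A Q V1 V2 (V3 * T) (transpose_mat V1) (transpose_mat V2) (Ti * transpose_mat V3)
      (transpose_mat G) (transpose_mat U2) (transpose_mat T * transpose_mat V3) K1 K2 K3
      E (mat_inv E) A21 (mat_inv A21) A22 (A23 * T) Q22 (Q23 * T) (transpose_mat T * A32) (transpose_mat T * Q32)
      Lam lam np n0 nm (B * T) (B * transpose_mat V3)"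
    by (rule boundary_system_instance[OF B])
  then interpret Z: boundary_system a N p r m A Q V1 V2 "V3 * T" "transpose_mat V1" "transpose_mat V2" "Ti * transpose_mat V3"
      "transpose_mat G" "transpose_mat U2" "transpose_mat T * transpose_mat V3" K1 K2 K3
      E "mat_inv E" A21 "mat_inv A21" A22 "A23 * T" Q22 "Q23 * T" "transpose_mat T * A32" "transpose_mat T * Q32"
      Lam lam np n0 nm "B * T" "B * transpose_mat V3" .
  have BTp: "B * Tp \<in> carrier_mat np np" using B T_blocks by simp
  have Bp: "Z.Bp = B * Tp"
    by (rule eq_matI) (use BT_index(1)[OF B] B T_blocks in \<open>auto simp: Z.Bp_def simp del: index_mult_mat(1)\<close>)
  have zero: "B * T0 = 0\<^sub>m np n0 \<longleftrightarrow> (\<forall>i<np. \<forall>j<n0. (B * T) $$ (i, np + j) = 0)"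
  proof -
    have "B * T0 = 0\<^sub>m np n0 \<longleftrightarrow> (\<forall>i<np. \<forall>j<n0. (B * T0) $$ (i, j) = 0)"
    proof
      assume "\<forall>i<np. \<forall>j<n0. (B * T0) $$ (i, j) = 0"
      then show "B * T0 = 0\<^sub>m np n0"
        using B T_blocks by (intro eq_matI) (auto simp del: index_mult_mat(1))
    qed simp
    then show ?thesis using BT_index(2)[OF B] by simp
  qed
  show ?thesis
  proof
    assume wp: "well_posed a N np A Q (B * transpose_mat V3)"
    have "vec_space.rank np (B * Tp) = np"
      unfolding rank_eq_iff_injective[OF BTp] using Z.well_posed_imp_inj[OF wp] Bp by auto
    moreover have "(B * T) $$ (i, np + j) = 0" if "i < np" "j < n0" for i j
    proof -
      have jm: "np + j < m" using that Lam(2) by simp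
      have "((B * T) *\<^sub>v unit_vec m (np + j)) $ i = 0"
        using Z.well_posed_imp_zero[OF wp, of "np + j"] that by simp
      then show ?thesis
        using mult_unit_vec_index[of "B * T" np m i "np + j"] B T_carrier that jm by simp
    qed
    ultimately show "vec_space.rank np (B * Tp) = np \<and> B * T0 = 0\<^sub>m np n0" using zero by blast
  next
    assume r: "vec_space.rank np (B * Tp) = np \<and> B * T0 = 0\<^sub>m np n0"
    show "well_posed a N np A Q (B * transpose_mat V3)"
    proof (rule Z.well_posed_if)
      show "x = 0\<^sub>v np" if "x \<in> carrier_vec np" "Z.Bp *\<^sub>v x = 0\<^sub>v np" for x
        using r that unfolding rank_eq_iff_injective[OF BTp] Bp by blast
      show "(B * T) $$ (i, j) = 0" if i: "i < np" and j: "np \<le> j" "j < np + n0" for i j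
      proof -
        have "\<forall>i<np. \<forall>j<n0. (B * T) $$ (i, np + j) = 0" using r zero by blast
        then have "(B * T) $$ (i, np + (j - np)) = 0" using i j(2) less_diff_conv2[OF j(1), of n0] by (metis add.commute)
        then show ?thesis using j(1) by simp
      qed
    qed
  qed
qed

text \<open>The coordinate formulas of the reduced system, translated back to the matrices of the
  statement. The rank condition makes \<open>zp 0\<close> the unique solution of the boundary
  equation.\<close>

lemma solution_formulas:
  assumes B: "B \<in> carrier_mat np m" and h: "weighted_L2 a N h"
    and rank: "vec_space.rank np (B * Tp) = np"
    and sol: "solves_bvp a N A Q (B * transpose_mat V3) h g W D"
  shows "(\<forall>y\<ge>0. vec_integrable p {y..} (\<lambda>s. transpose_mat G *\<^sub>v h s) \<and>
           transpose_mat G *\<^sub>v (A *\<^sub>v W y) =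
             - vec_integral p {y..} (\<lambda>s. transpose_mat G *\<^sub>v h s) \<and>
           (\<forall>w\<in>carrier_vec N. transpose_mat G *\<^sub>v (A *\<^sub>v w) =
               - vec_integral p {y..} (\<lambda>s. transpose_mat G *\<^sub>v h s) \<longrightarrow>
             transpose_mat V2 *\<^sub>v w = transpose_mat V2 *\<^sub>v W y))" (is ?thesis1)
    and "has_weak_derivative p (\<lambda>y. transpose_mat V2 *\<^sub>v W y) (\<lambda>y. transpose_mat V2 *\<^sub>v D y)"
    and "\<exists>h3 hp h0 hm zp z0 zm.
           (\<forall>y\<ge>0.
              h3 y = mat_inv Q33 *\<^sub>v
                (transpose_mat V3 *\<^sub>v h y - Q32 *\<^sub>v (transpose_mat V2 *\<^sub>v W y)
                   - A32 *\<^sub>v (transpose_mat V2 *\<^sub>v D y)) \<and>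
              hp y \<in> carrier_vec np \<and> h0 y \<in> carrier_vec n0 \<and> hm y \<in> carrier_vec nm \<and>
              mat_inv T *\<^sub>v h3 y = hp y @\<^sub>v h0 y @\<^sub>v hm y \<and>
              zp y \<in> carrier_vec np \<and> z0 y \<in> carrier_vec n0 \<and> zm y \<in> carrier_vec nm \<and>
              transpose_mat V3 *\<^sub>v W y = Tp *\<^sub>v zp y + T0 *\<^sub>v z0 y + Tm *\<^sub>v zm y \<and>
              z0 y = h0 y \<and>
              vec_integrable nm {y..} (\<lambda>s. mat_exp ((s - y) \<cdot>\<^sub>m mat_inv Lm) *\<^sub>v hm s) \<and>
              zm y = - (mat_inv Lm *\<^sub>v
                vec_integral nm {y..} (\<lambda>s. mat_exp ((s - y) \<cdot>\<^sub>m mat_inv Lm) *\<^sub>v hm s)) \<and>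
              vec_integrable np {0..y} (\<lambda>s. mat_exp ((s - y) \<cdot>\<^sub>m mat_inv Lp) *\<^sub>v hp s) \<and>
              zp y = mat_exp ((- y) \<cdot>\<^sub>m mat_inv Lp) *\<^sub>v zp 0 +
                mat_inv Lp *\<^sub>v
                  vec_integral np {0..y} (\<lambda>s. mat_exp ((s - y) \<cdot>\<^sub>m mat_inv Lp) *\<^sub>v hp s)) \<and>
           (\<forall>x\<in>carrier_vec np.
              (B * Tp) *\<^sub>v x = g - B *\<^sub>v (T0 *\<^sub>v z0 0 + Tm *\<^sub>v zm 0) \<longleftrightarrow> x = zp 0)" (is ?thesis3)
    and "\<forall>y\<ge>0.
           vec_integrable r {y..} (\<lambda>s. mat_inv A21 *\<^sub>v
             (Q22 *\<^sub>v (transpose_mat V2 *\<^sub>v W s) + Q23 *\<^sub>v (transpose_mat V3 *\<^sub>v W s)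
                - transpose_mat U2 *\<^sub>v h s)) \<and>
           transpose_mat V1 *\<^sub>v W y =
             - (mat_inv A21 *\<^sub>v
                 (A22 *\<^sub>v (transpose_mat V2 *\<^sub>v W y) + A23 *\<^sub>v (transpose_mat V3 *\<^sub>v W y))) +
             vec_integral r {y..} (\<lambda>s. mat_inv A21 *\<^sub>v
               (Q22 *\<^sub>v (transpose_mat V2 *\<^sub>v W s) + Q23 *\<^sub>v (transpose_mat V3 *\<^sub>v W s)
                  - transpose_mat U2 *\<^sub>v h s))" (is ?thesis4)
proof -
  obtain K1 K2 K3 where "boundary_system a N p r m A Q V1 V2 (V3 * T) (transpose_mat V1) (transpose_mat V2) (Ti * transpose_mat V3)
      (transpose_mat G) (transpose_mat U2) (transpose_mat T * transpose_mat V3) K1 K2 K3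
      E (mat_inv E) A21 (mat_inv A21) A22 (A23 * T) Q22 (Q23 * T) (transpose_mat T * A32) (transpose_mat T * Q32)
      Lam lam np n0 nm (B * T) (B * transpose_mat V3)"
    by (rule boundary_system_instance[OF B])
  then interpret Z: boundary_system a N p r m A Q V1 V2 "V3 * T" "transpose_mat V1" "transpose_mat V2" "Ti * transpose_mat V3"
      "transpose_mat G" "transpose_mat U2" "transpose_mat T * transpose_mat V3" K1 K2 K3
      E "mat_inv E" A21 "mat_inv A21" A22 "A23 * T" Q22 "Q23 * T" "transpose_mat T * A32" "transpose_mat T * Q32"
      Lam lam np n0 nm "B * T" "B * transpose_mat V3" .
  have W: "weighted_L2 a N W" and hs: "half_space_solution N A Q h W D"
    and bc: "(B * transpose_mat V3) *\<^sub>v W 0 = g"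
    using sol by (auto simp: solves_bvp_def)
  note c = Z.sol_carrier[OF h W hs]
  show ?thesis1
  proof (intro allI impI conjI ballI)
    fix y :: real assume y: "0 \<le> y"
    show "vec_integrable p {y..} (\<lambda>s. transpose_mat G *\<^sub>v h s)"
      by (rule weighted_L2_vec_integrable[OF Z.sol_R1h[OF h W hs] a(1) y])
    show e: "transpose_mat G *\<^sub>v (A *\<^sub>v W y) = - vec_integral p {y..} (\<lambda>s. transpose_mat G *\<^sub>v h s)"
      by (rule Z.sol_R1[OF h W hs y])
    fix w :: "real Matrix.vec" assume w: "w \<in> carrier_vec N"
      and ew: "transpose_mat G *\<^sub>v (A *\<^sub>v w) = - vec_integral p {y..} (\<lambda>s. transpose_mat G *\<^sub>v h s)"
    \<comment> \<open>Both vectors have the same image under \<open>G^T A\<close>, which is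
      \<open>E\<close> after \<open>V2^T\<close>; invertibility of \<open>E\<close> gives
      uniqueness.\<close>
    have "E *\<^sub>v (transpose_mat V2 *\<^sub>v w) = E *\<^sub>v (transpose_mat V2 *\<^sub>v W y)"
      by (rule trans[OF ew[unfolded Z.R1A[OF w]] e[unfolded Z.R1A[OF c(2)[OF y]], symmetric]])
    from arg_cong[OF this, of "\<lambda>v. mat_inv E *\<^sub>v v"]
    show "transpose_mat V2 *\<^sub>v w = transpose_mat V2 *\<^sub>v W y" by (simp only: Z.E(1) closedT)
  qed
  show "has_weak_derivative p (\<lambda>y. transpose_mat V2 *\<^sub>v W y) (\<lambda>y. transpose_mat V2 *\<^sub>v D y)"
    by (rule Z.sol_P2[OF h W hs])
  let ?P3 = "Ti * transpose_mat V3"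
  have P3: "?P3 *\<^sub>v w = Ti *\<^sub>v (transpose_mat V3 *\<^sub>v w)" if "w \<in> carrier_vec N" for w
    by (rule assoc_mult_mat_vec[OF Ti_carrier _ that]) (use V3 in simp)
  have TP3: "T *\<^sub>v (?P3 *\<^sub>v w) = transpose_mat V3 *\<^sub>v w" if "w \<in> carrier_vec N" for w
    unfolding P3[OF that] by (rule T_Ti_mult(1)) simp
  have P3c: "?P3 *\<^sub>v w \<in> carrier_vec m" for w by (rule mat_vec_closed[of _ m N]) (use Ti_carrier V3 in simp)
  show ?thesis4
  proof (intro allI impI)
    fix y :: real assume y: "0 \<le> y"
    have e: "(A23 * T) *\<^sub>v (?P3 *\<^sub>v w) = A23 *\<^sub>v (transpose_mat V3 *\<^sub>v w)"
      "(Q23 * T) *\<^sub>v (?P3 *\<^sub>v w) = Q23 *\<^sub>v (transpose_mat V3 *\<^sub>v w)" if "w \<in> carrier_vec N" for w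
      unfolding assoc_mult_mat_vec[OF A23_carrier T_carrier P3c] assoc_mult_mat_vec[OF Q23_carrier T_carrier P3c] TP3[OF that]
      by (rule refl)+
    have dr: "mat_inv A21 *\<^sub>v Z.drift h (\<lambda>y. transpose_mat V2 *\<^sub>v W y) (\<lambda>y. ?P3 *\<^sub>v W y) s =
        mat_inv A21 *\<^sub>v (Q22 *\<^sub>v (transpose_mat V2 *\<^sub>v W s) + Q23 *\<^sub>v (transpose_mat V3 *\<^sub>v W s) - transpose_mat U2 *\<^sub>v h s)"
      if "s \<in> {y..}" for s
      unfolding Z.drift_def using e(2)[OF c(2)[of s]] that y by simp
    show "vec_integrable r {y..} (\<lambda>s. mat_inv A21 *\<^sub>v
             (Q22 *\<^sub>v (transpose_mat V2 *\<^sub>v W s) + Q23 *\<^sub>v (transpose_mat V3 *\<^sub>v W s)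
                - transpose_mat U2 *\<^sub>v h s)) \<and>
           transpose_mat V1 *\<^sub>v W y =
             - (mat_inv A21 *\<^sub>v
                 (A22 *\<^sub>v (transpose_mat V2 *\<^sub>v W y) + A23 *\<^sub>v (transpose_mat V3 *\<^sub>v W y))) +
             vec_integral r {y..} (\<lambda>s. mat_inv A21 *\<^sub>v
               (Q22 *\<^sub>v (transpose_mat V2 *\<^sub>v W s) + Q23 *\<^sub>v (transpose_mat V3 *\<^sub>v W s)
                  - transpose_mat U2 *\<^sub>v h s))"
      using Z.sol_P1[OF h W hs y, unfolded e(1)[OF c(2)[OF y]]] vec_integral_cong(1)[of "{y..}", OF dr, where n = r]
        vec_integral_cong(2)[of "{y..}", OF dr, where n = r] by simp
  qed
  define h3 where "h3 y = mat_inv Q33 *\<^sub>v (transpose_mat V3 *\<^sub>v h y - Q32 *\<^sub>v (transpose_mat V2 *\<^sub>v W y)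
                   - A32 *\<^sub>v (transpose_mat V2 *\<^sub>v D y))" for y
  define f where "f y = mat_inv T *\<^sub>v h3 y" for y
  define z where "z y = ?P3 *\<^sub>v W y" for y
  let ?src = "Z.source h (\<lambda>y. transpose_mat V2 *\<^sub>v W y) (\<lambda>y. transpose_mat V2 *\<^sub>v D y)"
  have fc: "f y \<in> carrier_vec m" for y
    unfolding f_def mat_inv_T by (rule mat_vec_closed[OF Ti_carrier])
  have zc: "z y \<in> carrier_vec m" for y unfolding z_def by (rule P3c)
  \<comment> \<open>Identifies \<open>T^(-1) h3\<close> with the source term of the scalar
    equations, using \<open>T^(-1) Q33^(-1) = T^T\<close>.\<close>
  have fsrc: "f y = ?src y" if y: "0 \<le> y" for y
  proof -
    have "f y = transpose_mat T *\<^sub>v (transpose_mat V3 *\<^sub>v h y - Q32 *\<^sub>v (transpose_mat V2 *\<^sub>v W y)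
                   - A32 *\<^sub>v (transpose_mat V2 *\<^sub>v D y))"
      unfolding f_def h3_def by (rule mat_inv_T_Q33) simp
    also have "\<dots> = transpose_mat T *\<^sub>v (transpose_mat V3 *\<^sub>v h y) - transpose_mat T *\<^sub>v (Q32 *\<^sub>v (transpose_mat V2 *\<^sub>v W y))
        - transpose_mat T *\<^sub>v (A32 *\<^sub>v (transpose_mat V2 *\<^sub>v D y))"
      by (simp add: mult_minus_distrib_mat_vec[OF TT_carrier])
    also have "\<dots> = ?src y"
      unfolding Z.source_def
      using assoc_mult_mat_vec[OF TT_carrier _ c(1)[OF y], of "transpose_mat V3"] V3
        assoc_mult_mat_vec[OF TT_carrier A32_carrier, of "transpose_mat V2 *\<^sub>v D y"]
        assoc_mult_mat_vec[OF TT_carrier Q32_carrier, of "transpose_mat V2 *\<^sub>v W y"] by simp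
    finally show ?thesis .
  qed
  have fw: "wL2 a (\<lambda>y. f y $ i)" if i: "i < m" for i
  proof (rule wL2_congI)
    show "wL2 a (\<lambda>y. ?src y $ i)" using Z.sol_source[OF h W hs] i by (simp add: weighted_L2_iff)
  qed (simp add: fsrc)
  have zf: "z y $ i = Z.coord_sol i (z 0 $ i) (\<lambda>y. f y $ i) y" if i: "i < m" and y: "0 \<le> y" for i y
    unfolding z_def Z.sol_P3[OF h W hs i y] by (rule Z.coord_sol_cong[OF _ y]) (simp add: fsrc)
  have Lpn: "\<forall>i<np. Lp $$ (i, i) \<noteq> 0" and Lmn: "\<forall>i<nm. Lm $$ (i, i) \<noteq> 0"
    using Lp(3) Lm(3) by (metis less_irrefl)+
  \<comment> \<open>Inverses and exponentials of diagonal matrices act entrywise, so each component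
    of the matrix formulas is \<open>forward_sol\<close> or \<open>backward_sol\<close> with the
    inverse eigenvalue as parameter.\<close>
  note pos = mat_inv_diagonal_mult[OF Lp(1,2) Lpn] and neg = mat_inv_diagonal_mult[OF Lm(1,2) Lmn]
  have V3W: "transpose_mat V3 *\<^sub>v W y = Tp *\<^sub>v part_pos (z y) + T0 *\<^sub>v part_zero (z y) + Tm *\<^sub>v part_neg (z y)"
    if "0 \<le> y" for y
    using T_parts[OF zc] TP3[OF c(2)[OF that]] by (simp add: z_def)
  have zero: "part_zero (z y) = part_zero (f y)" if y: "0 \<le> y" for y
  proof -
    have "z y $ (np + i) = f y $ (np + i)" if "i < n0" for i
      using zf[OF _ y, of "np + i"] that lam_signs(2)[of "np + i"] Lam(2) by (simp add: Z.coord_sol_def)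
    then show ?thesis by (auto simp: part_zero_def)
  qed
  have neg_int: "vec_integrable nm {y..} (\<lambda>s. mat_exp ((s - y) \<cdot>\<^sub>m mat_inv Lm) *\<^sub>v part_neg (f s))" (is ?I)
    and neg_eq: "part_neg (z y) = - (mat_inv Lm *\<^sub>v
                vec_integral nm {y..} (\<lambda>s. mat_exp ((s - y) \<cdot>\<^sub>m mat_inv Lm) *\<^sub>v part_neg (f s)))" (is ?E)
    if y: "0 \<le> y" for y
  proof -
    let ?k = "\<lambda>i. np + n0 + i"
    have e: "(mat_exp ((s - y) \<cdot>\<^sub>m mat_inv Lm) *\<^sub>v part_neg (f s)) $ i = exp ((s - y) * (1 / Lm $$ (i, i))) * f s $ ?k i"
      if "i < nm" for i s
      using neg(2)[OF part_carriers(3) that] that by (simp add: part_neg_def del: index_mult_mat_vec)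
    have k: "?k i < m" "lam (?k i) = Lm $$ (i, i)" "lam (?k i) < 0" if "i < nm" for i
      using that lam_signs(3)[of "?k i"] lam_eq[of "?k i"] Lam(2) by auto
    have int: "integrable (lebesgue_on {y..}) (\<lambda>s. exp ((s - y) * (1 / Lm $$ (i, i))) * f s $ ?k i)" if i: "i < nm" for i
    proof (rule integrable_exp_backward)
      show "integrable (lebesgue_on {y..}) (\<lambda>s. f s $ ?k i)"
        by (rule integrable_lebesgue_on_subset[OF wL2_tail(1)[OF fw[OF k(1)[OF i]] a(1)]]) (use y in auto)
      show "1 / Lm $$ (i, i) \<le> 0" using Lm(3) i by (simp add: less_imp_le)
    qed
    show ?I unfolding vec_integrable_def
    proof (intro allI impI)
      fix i assume i: "i < nm"
      show "integrable (lebesgue_on {y..}) (\<lambda>s. (mat_exp ((s - y) \<cdot>\<^sub>m mat_inv Lm) *\<^sub>v part_neg (f s)) $ i)"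
        unfolding e[OF i] by (rule int[OF i])
    qed
    show ?E
    proof (rule eq_vecI)
      let ?J = "vec_integral nm {y..} (\<lambda>s. mat_exp ((s - y) \<cdot>\<^sub>m mat_inv Lm) *\<^sub>v part_neg (f s))"
      have dim: "dim_vec (mat_inv Lm *\<^sub>v ?J) = nm" using diagonal_mat_inv[OF Lm(1,2)] Lmn by simp
      then show "dim_vec (part_neg (z y)) = dim_vec (- (mat_inv Lm *\<^sub>v ?J))" by (simp add: part_neg_def del: dim_mult_mat_vec)
      fix i assume "i < dim_vec (- (mat_inv Lm *\<^sub>v ?J))"
      then have i: "i < nm" using dim by (simp del: dim_mult_mat_vec)
      have "part_neg (z y) $ i = z y $ ?k i" using i by (simp add: part_neg_def)
      also have "\<dots> = backward_sol (1 / Lm $$ (i, i)) (\<lambda>y. f y $ ?k i) y"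
        unfolding zf[OF k(1)[OF i] y] using k(2,3)[OF i] by (simp add: Z.coord_sol_def)
      also have "\<dots> = - (1 / Lm $$ (i, i) * ?J $ i)"
        using i by (simp add: backward_sol_def vec_integral_def e del: index_mult_mat_vec)
      also have "\<dots> = (- (mat_inv Lm *\<^sub>v ?J)) $ i"
        using neg(1)[OF vec_integral_carrier i] i dim by (simp del: index_mult_mat_vec dim_mult_mat_vec)
      finally show "part_neg (z y) $ i = (- (mat_inv Lm *\<^sub>v ?J)) $ i" .
    qed
  qed
  have pos_int: "vec_integrable np {0..y} (\<lambda>s. mat_exp ((s - y) \<cdot>\<^sub>m mat_inv Lp) *\<^sub>v part_pos (f s))" (is ?I)
    and pos_eq: "part_pos (z y) = mat_exp ((- y) \<cdot>\<^sub>m mat_inv Lp) *\<^sub>v part_pos (z 0) +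
                mat_inv Lp *\<^sub>v vec_integral np {0..y} (\<lambda>s. mat_exp ((s - y) \<cdot>\<^sub>m mat_inv Lp) *\<^sub>v part_pos (f s))" (is ?E)
    if y: "0 \<le> y" for y
  proof -
    have e: "(mat_exp ((s - y) \<cdot>\<^sub>m mat_inv Lp) *\<^sub>v part_pos (f s)) $ i = exp ((s - y) * (1 / Lp $$ (i, i))) * f s $ i"
      if "i < np" for i s
      using pos(2)[OF part_carriers(1) that] that by (simp add: part_pos_def del: index_mult_mat_vec)
    have k: "i < m" "lam i = Lp $$ (i, i)" "0 < lam i" if "i < np" for i
      using that lam_signs(1)[of i] lam_eq[of i] Lam(2) by auto
    have int: "integrable (lebesgue_on {0..y}) (\<lambda>s. exp ((s - y) * (1 / Lp $$ (i, i))) * f s $ i)" if i: "i < np" for i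
      by (rule integrable_exp_forward, rule integrable_lebesgue_on_subset[OF wL2_tail(1)[OF fw[OF k(1)[OF i]] a(1)]]) auto
    show ?I unfolding vec_integrable_def
    proof (intro allI impI)
      fix i assume i: "i < np"
      show "integrable (lebesgue_on {0..y}) (\<lambda>s. (mat_exp ((s - y) \<cdot>\<^sub>m mat_inv Lp) *\<^sub>v part_pos (f s)) $ i)"
        unfolding e[OF i] by (rule int[OF i])
    qed
    show ?E
    proof (rule eq_vecI)
      let ?J = "vec_integral np {0..y} (\<lambda>s. mat_exp ((s - y) \<cdot>\<^sub>m mat_inv Lp) *\<^sub>v part_pos (f s))"
      let ?M = "mat_exp ((- y) \<cdot>\<^sub>m mat_inv Lp)"
      have dim: "dim_vec (mat_inv Lp *\<^sub>v ?J) = np" using diagonal_mat_inv[OF Lp(1,2)] Lpn by simp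
      then show "dim_vec (part_pos (z y)) = dim_vec (?M *\<^sub>v part_pos (z 0) + mat_inv Lp *\<^sub>v ?J)"
        by (simp add: part_pos_def del: dim_mult_mat_vec)
      fix i assume "i < dim_vec (?M *\<^sub>v part_pos (z 0) + mat_inv Lp *\<^sub>v ?J)"
      then have i: "i < np" using dim by (simp del: dim_mult_mat_vec)
      have "part_pos (z y) $ i = z y $ i" using i by (simp add: part_pos_def)
      also have "\<dots> = forward_sol (1 / Lp $$ (i, i)) (z 0 $ i) (\<lambda>y. f y $ i) y"
        unfolding zf[OF k(1)[OF i] y] using k(2,3)[OF i] by (simp add: Z.coord_sol_def)
      also have "\<dots> = exp (- y * (1 / Lp $$ (i, i))) * part_pos (z 0) $ i + 1 / Lp $$ (i, i) * ?J $ i"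
      proof -
        have "part_pos (z 0) $ i = z 0 $ i" using i by (simp add: part_pos_def)
        then show ?thesis using i by (simp add: forward_sol_def vec_integral_def e del: index_mult_mat_vec)
      qed
      also have "\<dots> = (?M *\<^sub>v part_pos (z 0)) $ i + (mat_inv Lp *\<^sub>v ?J) $ i"
        using pos(1)[OF vec_integral_carrier i] pos(2)[OF part_carriers(1) i, where t = "- y"] by (simp only: part_carriers)
      also have "\<dots> = (?M *\<^sub>v part_pos (z 0) + mat_inv Lp *\<^sub>v ?J) $ i"
        using i dim by (simp del: index_mult_mat_vec dim_mult_mat_vec)
      finally show "part_pos (z y) $ i = (?M *\<^sub>v part_pos (z 0) + mat_inv Lp *\<^sub>v ?J) $ i" .
    qed
  qed
  \<comment> \<open>Expanding \<open>V3^T W 0\<close> along the blocks of \<open>T\<close> turns the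
    boundary condition into the stated equation with \<open>zp 0\<close> as a solution; injectivity
    of \<open>B * Tp\<close> excludes any other.\<close>
  have bc_iff: "(B * Tp) *\<^sub>v x = g - B *\<^sub>v (T0 *\<^sub>v part_zero (z 0) + Tm *\<^sub>v part_neg (z 0)) \<longleftrightarrow> x = part_pos (z 0)"
    if x: "x \<in> carrier_vec np" for x
  proof -
    let ?u = "T0 *\<^sub>v part_zero (z 0) + Tm *\<^sub>v part_neg (z 0)"
    have cl: "Tp *\<^sub>v v \<in> carrier_vec m" "T0 *\<^sub>v v \<in> carrier_vec m" "Tm *\<^sub>v v \<in> carrier_vec m" "B *\<^sub>v v \<in> carrier_vec np" for v
      by (rule mat_vec_closed, rule T_blocks B)+
    have BTp: "B * Tp \<in> carrier_mat np np" using B T_blocks by simp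
    have BTpc: "(B * Tp) *\<^sub>v v \<in> carrier_vec np" for v by (rule mat_vec_closed[OF BTp])
    have "g = B *\<^sub>v (transpose_mat V3 *\<^sub>v W 0)"
      using bc assoc_mult_mat_vec[OF B _ c(2)[OF order_refl], of "transpose_mat V3"] V3 by simp
    also have "transpose_mat V3 *\<^sub>v W 0 = Tp *\<^sub>v part_pos (z 0) + ?u"
      unfolding V3W[OF order_refl] by (rule assoc_add_vec) (rule cl)+
    also have "B *\<^sub>v (Tp *\<^sub>v part_pos (z 0) + ?u) = B *\<^sub>v (Tp *\<^sub>v part_pos (z 0)) + B *\<^sub>v ?u"
      by (rule mult_add_distrib_mat_vec[OF B]) (simp_all add: cl)
    also have "B *\<^sub>v (Tp *\<^sub>v part_pos (z 0)) = (B * Tp) *\<^sub>v part_pos (z 0)"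
      by (rule assoc_mult_mat_vec[OF B T_blocks(1), symmetric]) simp
    finally have gz: "g = (B * Tp) *\<^sub>v part_pos (z 0) + B *\<^sub>v ?u" .
    have "v + w - w = v" if "v \<in> carrier_vec np" "w \<in> carrier_vec np" for v w :: "real Matrix.vec"
      using that by (intro eq_vecI) auto
    from this[OF BTpc cl(4)] have gu: "g - B *\<^sub>v ?u = (B * Tp) *\<^sub>v part_pos (z 0)"
      unfolding gz .
    have "x = part_pos (z 0)" if e: "(B * Tp) *\<^sub>v x = (B * Tp) *\<^sub>v part_pos (z 0)"
    proof -
      have "(B * Tp) *\<^sub>v (x - part_pos (z 0)) = (B * Tp) *\<^sub>v x - (B * Tp) *\<^sub>v part_pos (z 0)"
        by (rule mult_minus_distrib_mat_vec[OF BTp x]) simp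
      also have "\<dots> = 0\<^sub>v np" unfolding e using BTpc by simp
      finally have "x - part_pos (z 0) = 0\<^sub>v np"
        using rank x unfolding rank_eq_iff_injective[OF BTp] by simp
      then have d: "(x - part_pos (z 0)) $ i = 0" if "i < np" for i using that by simp
      show ?thesis
      proof (rule eq_vecI)
        fix i assume "i < dim_vec (part_pos (z 0))"
        then have "i < np" by (simp add: part_pos_def)
        then show "x $ i = part_pos (z 0) $ i" using d[of i] by (simp add: part_pos_def)
      qed (use x in \<open>simp add: part_pos_def\<close>)
    qed
    then show ?thesis unfolding gu by blast
  qed
  have fparts: "mat_inv T *\<^sub>v h3 y = part_pos (f y) @\<^sub>v part_zero (f y) @\<^sub>v part_neg (f y)" for y
    unfolding f_def[symmetric] by (rule parts_append[OF fc])
  show ?thesis3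
    by (rule exI[of _ h3], rule exI[of _ "\<lambda>y. part_pos (f y)"], rule exI[of _ "\<lambda>y. part_zero (f y)"],
        rule exI[of _ "\<lambda>y. part_neg (f y)"], rule exI[of _ "\<lambda>y. part_pos (z y)"], rule exI[of _ "\<lambda>y. part_zero (z y)"],
        rule exI[of _ "\<lambda>y. part_neg (z y)"], intro conjI allI impI ballI h3_def part_carriers
        fparts V3W zero neg_int neg_eq pos_int pos_eq bc_iff)
qed

end

theorem theorem2p1:
  fixes M N p r m np n0 nm :: nat
    and A Q G X V1 V2 V3 U1 U2 U3 A21 A22 A23 A32 A33 Q22 Q23 Q32 Q33
        L R Lam Lp Lm T Tp T0 Tm B :: "real mat"
    and a lam_max :: real
  assumes M: "2 \<le> M"
    and N: "N = card {(i, j, k). i + j + k \<le> M}"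
    and A: "symmetric_real_mat N A"
    and Q: "pos_semidef_mat N Q"
    and null: "mat_kernel A \<inter> mat_kernel Q = {0\<^sub>v N}"
    and p: "p = kernel_dim Q"
    and G: "orthonormal_basis_mat N p (mat_kernel Q) G"
    and r: "r = kernel_dim (transpose_mat G * A * G)"
    and X: "orthonormal_basis_mat p r (mat_kernel (transpose_mat G * A * G)) X"
    and V1: "V1 = G * X"
    and V2: "orthonormal_basis_mat N p (vec_space.col_space N (A * G)) V2"
    and m: "m = N - p - r"
    and V3: "V3 \<in> carrier_mat N m"
    and V: "orthonormal_mat N (V1 @\<^sub>c V2 @\<^sub>c V3)"
    and U: "U1 = G" "U2 = A * G * X" "U3 = V3"
    and A_blocks:
      "A21 = transpose_mat U2 * A * V1" "A22 = transpose_mat U2 * A * V2"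
      "A23 = transpose_mat U2 * A * V3" "A32 = transpose_mat U3 * A * V2"
      "A33 = transpose_mat U3 * A * V3"
    and Q_blocks:
      "Q22 = transpose_mat U2 * Q * V2" "Q23 = transpose_mat U2 * Q * V3"
      "Q32 = transpose_mat U3 * Q * V2" "Q33 = transpose_mat U3 * Q * V3"
    and L: "cholesky m Q33 L"
    and R: "orthonormal_mat m R"
    and eig: "mat_inv L * A33 * transpose_mat (mat_inv L) * R = R * Lam"
    and Lam: "Lam = diag_block_mat [Lp, 0\<^sub>m n0 n0, Lm]" "m = np + n0 + nm"
    and Lp: "Lp \<in> carrier_mat np np" "diagonal_mat Lp" "\<forall>i<np. 0 < Lp $$ (i, i)"
    and Lm: "Lm \<in> carrier_mat nm nm" "diagonal_mat Lm" "\<forall>i<nm. Lm $$ (i, i) < 0"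
    and T: "T = transpose_mat (mat_inv L) * R" "T = Tp @\<^sub>c T0 @\<^sub>c Tm"
    and T_blocks: "Tp \<in> carrier_mat m np" "T0 \<in> carrier_mat m n0" "Tm \<in> carrier_mat m nm"
    and lam_max: "is_max_eigenvalue (mat_inv Q33 * A33) lam_max"
    and a: "0 < a" "a < 1 / lam_max"
    and B: "B \<in> carrier_mat np (np + n0 + nm)"
  shows
    "(well_posed a N np A Q (B * transpose_mat V3) \<longleftrightarrow>
       vec_space.rank np (B * Tp) = np \<and> B * T0 = 0\<^sub>m np n0) \<and>
     (vec_space.rank np (B * Tp) = np \<and> B * T0 = 0\<^sub>m np n0 \<longrightarrow>
     (\<forall>h g W D. weighted_L2 a N h \<longrightarrow> g \<in> carrier_vec np \<longrightarrow>
        solves_bvp a N A Q (B * transpose_mat V3) h g W D \<longrightarrow>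
        (\<forall>y\<ge>0. vec_integrable p {y..} (\<lambda>s. transpose_mat G *\<^sub>v h s) \<and>
           transpose_mat G *\<^sub>v (A *\<^sub>v W y) =
             - vec_integral p {y..} (\<lambda>s. transpose_mat G *\<^sub>v h s) \<and>
           (\<forall>w\<in>carrier_vec N. transpose_mat G *\<^sub>v (A *\<^sub>v w) =
               - vec_integral p {y..} (\<lambda>s. transpose_mat G *\<^sub>v h s) \<longrightarrow>
             transpose_mat V2 *\<^sub>v w = transpose_mat V2 *\<^sub>v W y)) \<and>
        has_weak_derivative p (\<lambda>y. transpose_mat V2 *\<^sub>v W y) (\<lambda>y. transpose_mat V2 *\<^sub>v D y) \<and>
        (\<exists>h3 hp h0 hm zp z0 zm.
           (\<forall>y\<ge>0.
              h3 y = mat_inv Q33 *\<^sub>v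
                (transpose_mat V3 *\<^sub>v h y - Q32 *\<^sub>v (transpose_mat V2 *\<^sub>v W y)
                   - A32 *\<^sub>v (transpose_mat V2 *\<^sub>v D y)) \<and>
              hp y \<in> carrier_vec np \<and> h0 y \<in> carrier_vec n0 \<and> hm y \<in> carrier_vec nm \<and>
              mat_inv T *\<^sub>v h3 y = hp y @\<^sub>v h0 y @\<^sub>v hm y \<and>
              zp y \<in> carrier_vec np \<and> z0 y \<in> carrier_vec n0 \<and> zm y \<in> carrier_vec nm \<and>
              transpose_mat V3 *\<^sub>v W y = Tp *\<^sub>v zp y + T0 *\<^sub>v z0 y + Tm *\<^sub>v zm y \<and>
              z0 y = h0 y \<and>
              vec_integrable nm {y..} (\<lambda>s. mat_exp ((s - y) \<cdot>\<^sub>m mat_inv Lm) *\<^sub>v hm s) \<and>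
              zm y = - (mat_inv Lm *\<^sub>v
                vec_integral nm {y..} (\<lambda>s. mat_exp ((s - y) \<cdot>\<^sub>m mat_inv Lm) *\<^sub>v hm s)) \<and>
              vec_integrable np {0..y} (\<lambda>s. mat_exp ((s - y) \<cdot>\<^sub>m mat_inv Lp) *\<^sub>v hp s) \<and>
              zp y = mat_exp ((- y) \<cdot>\<^sub>m mat_inv Lp) *\<^sub>v zp 0 +
                mat_inv Lp *\<^sub>v
                  vec_integral np {0..y} (\<lambda>s. mat_exp ((s - y) \<cdot>\<^sub>m mat_inv Lp) *\<^sub>v hp s)) \<and>
           (\<forall>x\<in>carrier_vec np.
              (B * Tp) *\<^sub>v x = g - B *\<^sub>v (T0 *\<^sub>v z0 0 + Tm *\<^sub>v zm 0) \<longleftrightarrow> x = zp 0)) \<and>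
        (\<forall>y\<ge>0.
           vec_integrable r {y..} (\<lambda>s. mat_inv A21 *\<^sub>v
             (Q22 *\<^sub>v (transpose_mat V2 *\<^sub>v W s) + Q23 *\<^sub>v (transpose_mat V3 *\<^sub>v W s)
                - transpose_mat U2 *\<^sub>v h s)) \<and>
           transpose_mat V1 *\<^sub>v W y =
             - (mat_inv A21 *\<^sub>v
                 (A22 *\<^sub>v (transpose_mat V2 *\<^sub>v W y) + A23 *\<^sub>v (transpose_mat V3 *\<^sub>v W y))) +
             vec_integral r {y..} (\<lambda>s. mat_inv A21 *\<^sub>v
               (Q22 *\<^sub>v (transpose_mat V2 *\<^sub>v W s) + Q23 *\<^sub>v (transpose_mat V3 *\<^sub>v W s)
                  - transpose_mat U2 *\<^sub>v h s)))))"
proof -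
  interpret S: half_space_moment_system N p r m np n0 nm A Q G X V1 V2 V3 U2
      A21 A22 A23 A32 A33 Q22 Q23 Q32 Q33 L R Lam Lp Lm T Tp T0 Tm a lam_max
    by unfold_locales
      (fact A Q null G X V1 V2 V3 V U(2) A_blocks[unfolded U(3)] Q_blocks[unfolded U(3)]
        L R eig Lam Lp Lm T T_blocks lam_max a)+
  have B': "B \<in> carrier_mat np m" using B Lam(2) by simp
  note formulas = S.solution_formulas[OF B']
  show ?thesis
    \<comment> \<open>The rank condition required by the formulas is the first conjunct of the
      premise.\<close>
    by (intro conjI[OF S.well_posed_iff[OF B']] impI allI
        conjI[OF formulas(1) conjI[OF formulas(2) conjI[OF formulas(3) formulas(4)]]])
      (assumption | erule conjunct1)+
qed

end
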